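(* Let $n\ge 1$, $d\ge n+1$, let $M^d$ be Euclidean, spherical or hyperbolic $d$-space, let $\mathbf{A}=\{A_1,\dots,A_{n+2}\}$ be the vertex set of a degenerate $(n+1)$-simplex lying in a totally geodesic $M^n\subset M^d$ all of whose $n$-faces are non-degenerate, let $\alpha=\{\alpha_1,\dots,\alpha_{n+2}\}$ be a $1$-stress on $\mathbf{A}$, and let $1\le k\le n$. Let $\mathbf{A}(t)$, $t\ge 0$, be a smooth motion of $\mathbf{A}$ in $M^d$ with $\mathbf{A}(0)=\mathbf{A}$. Suppose that either $c_{k-1}(\alpha^{k-1})>0$ and the motion satisfies the volume constraints of $G_{n,k}$, or $c_{k-1}(\alpha^{k-1})<0$ and the motion satisfies the volume constraints of $G'_{n,k}$. Then for small $t\ge 0$ (that is, for all $t\in[0,\varepsilon)$ for some $\varepsilon>0$) the motion preserves the volumes of all $k$-faces of $\mathbf{A}(t)$, and the vertices of $\mathbf{A}(t)$ are confined in a lower dimensional (totally geodesic) $M^n$.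
   Context: Spaces: $M^d$ is $\mathbb{R}^d$ (curvature $\kappa=0$), the unit sphere $\mathbb{S}^d\subset\mathbb{R}^{d+1}$ ($\kappa=1$), or $\mathbb{H}^d=\{x\in\mathbb{R}^{d,1}: x\cdot x=-1,\ x_0>0\}$ ($\kappa=-1$), where $\mathbb{R}^{d,1}$ is $\mathbb{R}^{d+1}$ with $x\cdot y=-x_0y_0+x_1y_1+\cdots+x_dy_d$. Points of $\mathbb{S}^d$, $\mathbb{H}^d$ are regarded as vectors of the ambient space. Setting: all $n$-faces of $\mathbf{A}$ non-degenerate means any $n+1$ of the points are affinely independent (Euclidean case), resp. linearly independent (non-Euclidean case). A $1$-stress $\alpha$ on $\mathbf{A}$ is the sequence of non-zero real coefficients, unique up to a constant factor, with $\sum\alpha_iA_i=0$ and $\sum\alpha_i=0$ (Euclidean case), or $\sum\alpha_iA_i=0$ (non-Euclidean case). A $k$-face $F$ of $\mathbf{A}$ is the $k$-simplex spanned by $k+1$ of the vertices; $V_k$ denotes $k$-dimensional volume ($V_0$ of a point is $1$). Constraints: $G_{n,k}$ requires that along the motion the volume of a $k$-face $F$ only decrease (non-increasing in $t$) if $\prod_{A_s\in F}\alpha_s<0$, and only increase (non-decreasing in $t$) if $\prod_{A_s\in F}\alpha_s>0$. $G'_{n,k}$ is obtained by interchanging "decrease" and "increase". The invariants $c_j(\alpha^j)$: set $c_0(\alpha^0)=1$. For $j\ge1$ in the non-Euclidean case, $$c_j(\alpha^j)=\kappa\,(j+1)\,(j-1)!\sum_{F\subset\mathbf{A},\ \dim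 F=j-1}\Big(\prod_{A_s\in F}\alpha_s\Big)\|F\|\,V_{j-1}(F),$$ where for a simplex $F$ with vertices $B_1,\dots,B_{j}$, $\|F\|=|\det(B_p\cdot B_q)_{1\le p,q\le j}|^{1/2}$. For $j\ge 1$ in the Euclidean case, $$c_j(\alpha^j)=\sum_{F\subset\mathbf{A},\ \dim F=j-1}\Big(\prod_{A_s\in F}\alpha_s\Big)\big((j-1)!\,V_{j-1}(F)\big)^2\, w_P^F\cdot w_Q^F,$$ where $w_P^F$, $w_Q^F$ are the altitude vectors of points $P,Q\in M^d$ with respect to the affine span of $F$ (the vectors to $P$, $Q$ from their orthogonal projections onto that span); the value does not depend on the choice of $P,Q$. *)

theory Defs
  imports "HOL-Analysis.Analysis" "Jordan_Normal_Form.Determinant"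
begin

no_notation Matrix.scalar_prod (infix \<open>\<bullet>\<close> 70)

text \<open>
  The space forms are subsets of an ambient Euclidean space \<open>'v\<close>, which is \<open>\<real>\<^sup>d\<close> in the
  Euclidean case and \<open>\<real>\<^sup>d\<^sup>+\<^sup>1\<close> (carrying the Lorentz form in the hyperbolic case) otherwise.
\<close>

datatype geometry = Euclidean | Spherical | Hyperbolic

primrec curvature :: "geometry \<Rightarrow> real" where
  "curvature Euclidean = 0"
| "curvature Spherical = 1"
| "curvature Hyperbolic = -1"

primrec ambient_dim :: "geometry \<Rightarrow> nat \<Rightarrow> nat" where
  "ambient_dim Euclidean d = d"
| "ambient_dim Spherical d = d + 1"
| "ambient_dim Hyperbolic d = d + 1"

text \<open>The coordinate \<open>x\<^sub>0\<close> of \<open>x\<close> is \<open>x \<bullet> e0\<close>; which basis vector is singled out is immaterial.\<close>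

definition e0 :: "'v::euclidean_space" where
  "e0 = (SOME b. b \<in> Basis)"

primrec form :: "geometry \<Rightarrow> 'v::euclidean_space \<Rightarrow> 'v \<Rightarrow> real" where
  "form Euclidean x y = x \<bullet> y"
| "form Spherical x y = x \<bullet> y"
| "form Hyperbolic x y = - (x \<bullet> e0) * (y \<bullet> e0) + (\<Sum>b\<in>Basis - {e0}. (x \<bullet> b) * (y \<bullet> b))"

primrec space_form :: "geometry \<Rightarrow> 'v::euclidean_space set" where
  "space_form Euclidean = UNIV"
| "space_form Spherical = sphere 0 1"
| "space_form Hyperbolic = {x. form Hyperbolic x x = -1 \<and> x \<bullet> e0 > 0}"

primrec totally_geodesic :: "geometry \<Rightarrow> nat \<Rightarrow> 'v::euclidean_space set \<Rightarrow> bool" where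
  "totally_geodesic Euclidean n S \<longleftrightarrow> affine S \<and> aff_dim S = int n"
| "totally_geodesic Spherical n S \<longleftrightarrow>
     (\<exists>L. subspace L \<and> dim L = n + 1 \<and> S = space_form Spherical \<inter> L)"
| "totally_geodesic Hyperbolic n S \<longleftrightarrow>
     (\<exists>L. subspace L \<and> dim L = n + 1 \<and> S = space_form Hyperbolic \<inter> L) \<and> S \<noteq> {}"

text \<open>
  Independence of the family \<open>A i\<close>, \<open>i \<in> I\<close>: injectivity rules out repeated points, which the
  image \<open>A ` I\<close> would not show.
\<close>

primrec nondegenerate :: "geometry \<Rightarrow> (nat \<Rightarrow> 'v::euclidean_space) \<Rightarrow> nat set \<Rightarrow> bool" where
  "nondegenerate Euclidean A I \<longleftrightarrow> inj_on A I \<and> \<not> affine_dependent (A ` I)"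
| "nondegenerate Spherical A I \<longleftrightarrow> inj_on A I \<and> independent (A ` I)"
| "nondegenerate Hyperbolic A I \<longleftrightarrow> inj_on A I \<and> independent (A ` I)"

text \<open>
  A \<open>k\<close>-face of the simplex with vertices \<open>A 1, \<dots>, A (n + 2)\<close> is given by its set of \<open>k + 1\<close>
  indices; simplices are given by the list of their vertices.
\<close>

definition faces :: "nat \<Rightarrow> nat \<Rightarrow> nat set set" where
  "faces n k = {I. I \<subseteq> {1..n + 2} \<and> card I = k + 1}"

definition verts :: "(nat \<Rightarrow> 'v) \<Rightarrow> nat set \<Rightarrow> 'v list" where
  "verts A I = map A (sorted_list_of_set I)"

definition gram_det :: "geometry \<Rightarrow> 'v::euclidean_space list \<Rightarrow> real" where
  "gram_det G Bs = Determinant.det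
     (Matrix.mat (length Bs) (length Bs) (\<lambda>(p, q). form G (Bs ! p) (Bs ! q)))"

definition simplex_norm :: "geometry \<Rightarrow> 'v::euclidean_space list \<Rightarrow> real" where
  "simplex_norm G Bs = sqrt \<bar>gram_det G Bs\<bar>"

text \<open>
  Volume of a geodesic \<open>k\<close>-simplex with vertices \<open>B\<^sub>0, \<dots>, B\<^sub>k\<close>: the Riemannian volume
  \<open>\<integral> sqrt (det (\<partial>\<^sub>i\<phi> \<cdot> \<partial>\<^sub>j\<phi>)) ds\<close> over \<open>{s. s\<^sub>i \<ge> 0, \<Sum> s\<^sub>i \<le> 1}\<close> in the parametrization \<open>\<phi>\<close> that
  projects the affine simplex \<open>B\<^sub>0 + \<Sum> s\<^sub>i (B\<^sub>i - B\<^sub>0)\<close> radially onto the space form (no projection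
  in the Euclidean case). For \<open>k = 0\<close> this is the integral of the empty determinant over a
  one-point space, i.e. 1.
\<close>

primrec radial :: "geometry \<Rightarrow> 'v::euclidean_space \<Rightarrow> 'v" where
  "radial Euclidean x = x"
| "radial Spherical x = x /\<^sub>R sqrt (form Spherical x x)"
| "radial Hyperbolic x = x /\<^sub>R sqrt (- form Hyperbolic x x)"

definition std_simplex :: "nat \<Rightarrow> (nat \<Rightarrow> real) set" where
  "std_simplex k = {s \<in> extensional {..<k}. (\<forall>i<k. 0 \<le> s i) \<and> (\<Sum>i<k. s i) \<le> 1}"

definition simplex_param :: "geometry \<Rightarrow> 'v::euclidean_space list \<Rightarrow> (nat \<Rightarrow> real) \<Rightarrow> 'v" where
  "simplex_param G Bs s =
     radial G (Bs ! 0 + (\<Sum>i<length Bs - 1. s i *\<^sub>R (Bs ! Suc i - Bs ! 0)))"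

definition simplex_partial ::
  "geometry \<Rightarrow> 'v::euclidean_space list \<Rightarrow> (nat \<Rightarrow> real) \<Rightarrow> nat \<Rightarrow> 'v" where
  "simplex_partial G Bs s i =
     vector_derivative (\<lambda>u. simplex_param G Bs (s(i := u))) (at (s i))"

definition simplex_volume :: "geometry \<Rightarrow> 'v::euclidean_space list \<Rightarrow> real" where
  "simplex_volume G Bs = (let k = length Bs - 1 in
     LINT s : std_simplex k | PiM {..<k} (\<lambda>_. lborel).
       sqrt (gram_det G (map (simplex_partial G Bs s) [0..<k])))"

definition is_1_stress ::
  "geometry \<Rightarrow> nat \<Rightarrow> (nat \<Rightarrow> 'v::euclidean_space) \<Rightarrow> (nat \<Rightarrow> real) \<Rightarrow> bool" where
  "is_1_stress G n A \<alpha> \<longleftrightarrow>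
     (\<forall>i\<in>{1..n + 2}. \<alpha> i \<noteq> 0) \<and>
     (\<Sum>i\<in>{1..n + 2}. \<alpha> i *\<^sub>R A i) = 0 \<and>
     (G = Euclidean \<longrightarrow> (\<Sum>i\<in>{1..n + 2}. \<alpha> i) = 0)"

definition altitude :: "'v::euclidean_space list \<Rightarrow> 'v \<Rightarrow> 'v" where
  "altitude Bs P = P - closest_point (affine hull set Bs) P"

text \<open>
  \<open>c\<^sub>j(\<alpha>\<^sup>j)\<close>. The auxiliary points \<open>P\<close>, \<open>Q\<close> enter only in the Euclidean case, where the value does
  not depend on them.
\<close>

definition stress_invariant ::
  "geometry \<Rightarrow> nat \<Rightarrow> (nat \<Rightarrow> 'v::euclidean_space) \<Rightarrow> (nat \<Rightarrow> real) \<Rightarrow> 'v \<Rightarrow> 'v \<Rightarrow> nat \<Rightarrow> real" where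
  "stress_invariant G n A \<alpha> P Q j =
     (if j = 0 then 1
      else if G = Euclidean then
        (\<Sum>I\<in>faces n (j - 1). (\<Prod>i\<in>I. \<alpha> i) * (fact (j - 1) * simplex_volume G (verts A I))\<^sup>2 *
           (altitude (verts A I) P \<bullet> altitude (verts A I) Q))
      else
        curvature G * real (j + 1) * fact (j - 1) *
        (\<Sum>I\<in>faces n (j - 1). (\<Prod>i\<in>I. \<alpha> i) * simplex_norm G (verts A I) *
           simplex_volume G (verts A I)))"

text \<open>\<open>C\<^sup>\<infinity>\<close> on \<open>[0, \<infinity>)\<close>, with one-sided derivatives at \<open>0\<close>; \<open>D m\<close> is the \<open>m\<close>-th derivative.\<close>

definition smooth_on_nonneg :: "(real \<Rightarrow> 'v::real_normed_vector) \<Rightarrow> bool" where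
  "smooth_on_nonneg f \<longleftrightarrow>
     (\<exists>D. D 0 = f \<and>
       (\<forall>m::nat. \<forall>t\<ge>0. (D m has_vector_derivative D (Suc m) t) (at t within {0..})))"

definition smooth_motion ::
  "geometry \<Rightarrow> nat \<Rightarrow> (nat \<Rightarrow> 'v::euclidean_space) \<Rightarrow> (real \<Rightarrow> nat \<Rightarrow> 'v) \<Rightarrow> bool" where
  "smooth_motion G n A At \<longleftrightarrow>
     (\<forall>i\<in>{1..n + 2}. At 0 i = A i \<and> smooth_on_nonneg (\<lambda>t. At t i) \<and>
        (\<forall>t\<ge>0. At t i \<in> space_form G))"

definition volume_constraints ::
  "geometry \<Rightarrow> nat \<Rightarrow> nat \<Rightarrow> (nat \<Rightarrow> real) \<Rightarrow> (real \<Rightarrow> nat \<Rightarrow> 'v::euclidean_space) \<Rightarrow> bool" where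
  "volume_constraints G n k \<alpha> At \<longleftrightarrow>
     (\<forall>I\<in>faces n k.
        ((\<Prod>i\<in>I. \<alpha> i) < 0 \<longrightarrow> antimono_on {0..} (\<lambda>t. simplex_volume G (verts (At t) I))) \<and>
        ((\<Prod>i\<in>I. \<alpha> i) > 0 \<longrightarrow> mono_on {0..} (\<lambda>t. simplex_volume G (verts (At t) I))))"

definition volume_constraints' ::
  "geometry \<Rightarrow> nat \<Rightarrow> nat \<Rightarrow> (nat \<Rightarrow> real) \<Rightarrow> (real \<Rightarrow> nat \<Rightarrow> 'v::euclidean_space) \<Rightarrow> bool" where
  "volume_constraints' G n k \<alpha> At \<longleftrightarrow>
     (\<forall>I\<in>faces n k.
        ((\<Prod>i\<in>I. \<alpha> i) < 0 \<longrightarrow> mono_on {0..} (\<lambda>t. simplex_volume G (verts (At t) I))) \<and>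
        ((\<Prod>i\<in>I. \<alpha> i) > 0 \<longrightarrow> antimono_on {0..} (\<lambda>t. simplex_volume G (verts (At t) I))))"

end

theory Submission
  imports Defs "HOL-Real_Asymp.Real_Asymp"
begin

text \<open>
  In the spherical and hyperbolic cases let \<open>H\<close> be \<open>\<kappa>\<close> times the Gram matrix of the vertices. In
  polar coordinates the volume of a face \<open>F\<close> becomes, up to a constant, the square root of
  \<open>\<bar>det H\<^sub>F\<bar>\<close> times the integral of \<open>exp (- x \<cdot> H x / 2)\<close> over the orthant \<open>x \<ge> 0\<close>, and integration by
  parts yields a Schlaefli formula for its derivative. The stress is continued to \<open>\<alpha>(t)\<close>, constant
  at one vertex \<open>o\<close>, such that \<open>H \<alpha>\<close> is supported at \<open>o\<close>. Put \<open>\<lambda> = \<alpha> \<cdot> H \<alpha>\<close>. Summing the Schlaefli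
  formulas of all \<open>k\<close>-faces, weighted by \<open>\<Prod>\<^sub>F \<alpha>\<close>, the result is \<open>- C \<lambda>' + O(\<lambda>)\<close> where \<open>C\<close> has, up to
  the factor \<open>\<kappa>\<close>, the sign of \<open>c\<^sub>k\<^sub>-\<^sub>1\<close>. The constraints give this sum a sign, so that
  \<open>(\<kappa> \<lambda>)' \<le> K \<kappa> \<lambda>\<close>. On the other hand \<open>\<kappa> \<lambda>\<close> is the form evaluated at \<open>y = \<Sum> \<alpha>\<^sub>i A\<^sub>i\<close>, a vector
  orthogonal to a point of the space form, hence \<open>\<kappa> \<lambda> \<ge> 0\<close> with equality only for \<open>y = 0\<close>. Since
  \<open>\<lambda>(0) = 0\<close>, Gronwall's inequality gives \<open>\<lambda> = 0\<close>: the vertices stay linearly dependent, and as all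
  summands have the same sign, every volume is constant.

  In the Euclidean case the squared volumes are bordered Gram determinants, so the same argument
  with \<open>\<lambda> = \<bar>\<Sum> \<alpha>\<^sub>i A\<^sub>i\<bar>\<^sup>2\<close> needs no integrals.
\<close>

section \<open>Determinants over finite index sets\<close>

text \<open>Time 0 itself gives no information: \<open>\<kappa> \<lambda>\<close> is minimal there,
  so \<lambda>'(0) = 0 and the weighted sum of the volume derivatives vanishes at t = 0 whatever the
  motion. Rigidity has to come from a differential inequality for t > 0, and there the order of the
  error decides. With the stress frozen at its initial value, \<open>H \<alpha>\<close> would in
  general only be of order |y|, like the square root of \<lambda>, and an inequality f' \<le> K sqrt
  f has nonzero solutions starting at 0. If instead \<open>H \<alpha>\<close> has a single entry
  \<mu>, at \<open>o\<close>, then \<lambda> is \<mu> times the constant entry of the stress at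
  \<open>o\<close>; all errors are linear in \<open>H \<alpha>\<close>, hence bounded multiples of
  \<lambda>. The index k - 1 of the invariant arises because a vertex is dropped twice: once from a
  k-face to its facets, and once more when the first moments of a facet are expressed through its
  own facets. What is left is a sum over faces with k - 1 vertices. The Gaussian form of the volume
  turns both descents into linear algebra with cofactors, so that dihedral angles never
  occur.\<close>

definition ldet :: "'a set \<Rightarrow> ('a \<Rightarrow> 'a \<Rightarrow> real) \<Rightarrow> real" where
  "ldet I M = (\<Sum>p | p permutes I. of_int (sign p) * (\<Prod>i\<in>I. M i (p i)))"

text \<open>Signed minors are kept as Leibniz sums over an arbitrary finite set, so that minors
  belonging to vertex sets need no renumbering. The sign is carried by the permutations with p i =
  j.\<close>

definition cofac :: "'a set \<Rightarrow> ('a \<Rightarrow> 'a \<Rightarrow> real) \<Rightarrow> 'a \<Rightarrow> 'a \<Rightarrow> real" where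
  "cofac I M i j =
     (\<Sum>p | p permutes I \<and> p i = j. of_int (sign p) * (\<Prod>l\<in>I - {i}. M l (p l)))"

lemma ldet_empty [simp]: "ldet {} M = 1"
  by (simp add: ldet_def permutes_empty cong: conj_cong)

lemma ldet_cong:
  assumes "\<And>i j. i \<in> I \<Longrightarrow> j \<in> I \<Longrightarrow> M i j = N i j"
  shows "ldet I M = ldet I N"
  unfolding ldet_def using assms
  by (intro sum.cong refl arg_cong2[where f="(*)"] prod.cong) (auto simp: permutes_in_image)

lemma tendsto_ldet:
  assumes "finite I" "\<And>i j. i \<in> I \<Longrightarrow> j \<in> I \<Longrightarrow> ((\<lambda>t. M t i j) \<longlongrightarrow> N i j) F"
  shows "((\<lambda>t. ldet I (M t)) \<longlongrightarrow> ldet I N) F"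
  unfolding ldet_def by (intro tendsto_sum tendsto_mult tendsto_const tendsto_prod assms) (auto simp: permutes_in_image)

lemma cofac_cong:
  assumes "\<And>i j. i \<in> I \<Longrightarrow> j \<in> I \<Longrightarrow> M i j = N i j"
  shows "cofac I M a b = cofac I N a b"
  unfolding cofac_def using assms
  by (intro sum.cong refl arg_cong2[where f="(*)"] prod.cong) (auto simp: permutes_in_image)

lemma ldet_reindex:
  assumes "bij_betw f J I" "finite J"
  shows "ldet J (\<lambda>i j. M (f i) (f j)) = ldet I M"
proof -
  have inj: "inj_on f J" and img: "f ` J = I" using assms by (auto simp: bij_betw_def)
  have finI: "finite I" using img assms(2) by auto
  have "ldet J (\<lambda>i j. M (f i) (f j)) =
    (\<Sum>p | p permutes J. of_int (sign (map_permutation J f p)) * (\<Prod>i\<in>I. M i (map_permutation J f p i)))"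
    unfolding ldet_def
  proof (intro sum.cong refl)
    fix p assume "p \<in> {p. p permutes J}"
    then have p: "p permutes J" by simp
    have "(\<Prod>i\<in>I. M i (map_permutation J f p i)) = (\<Prod>i\<in>J. M (f i) (map_permutation J f p (f i)))"
      using inj img by (simp add: prod.reindex flip: img)
    also have "\<dots> = (\<Prod>i\<in>J. M (f i) (f (p i)))"
      using map_permutation_apply[OF inj] by (intro prod.cong) auto
    finally show "of_int (sign p) * (\<Prod>i\<in>J. M (f i) (f (p i))) =
       real_of_int (sign (map_permutation J f p)) * (\<Prod>i\<in>I. M i (map_permutation J f p i))"
      using sign_map_permutation[OF inj p assms(2)] by simp
  qed
  also have "\<dots> = ldet I M" unfolding ldet_def
    using sum.reindex_bij_betw[OF bij_betw_permutations[OF assms(1)],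
        of "\<lambda>p. of_int (sign p) * (\<Prod>i\<in>I. M i (p i))"] img
    by (simp add: map_permutation_def restrict_id_def comp_def fun_eq_iff)
  finally show ?thesis .
qed

lemma ldet_transpose: "finite I \<Longrightarrow> ldet I (\<lambda>i j. M j i) = ldet I M"
proof -
  assume fin: "finite I"
  have "ldet I (\<lambda>i j. M j i) = (\<Sum>p | p permutes I. of_int (sign (Hilbert_Choice.inv p)) * (\<Prod>i\<in>I. M (Hilbert_Choice.inv p i) i))"
    unfolding ldet_def
    by (rule sum.reindex_bij_witness[where i=Hilbert_Choice.inv and j=Hilbert_Choice.inv])
       (auto simp: permutes_inv permutes_inv_inv)
  also have "\<dots> = ldet I M" unfolding ldet_def
  proof (intro sum.cong refl)
    fix p assume "p \<in> {p. p permutes I}"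
    then have p: "p permutes I" by simp
    have "(\<Prod>i\<in>I. M (Hilbert_Choice.inv p i) i) = (\<Prod>i\<in>I. M (Hilbert_Choice.inv p (p i)) (p i))"
      using prod.reindex_bij_betw[OF permutes_imp_bij[OF p], of "\<lambda>i. M (Hilbert_Choice.inv p i) i"] by simp
    then show "real_of_int (sign (Hilbert_Choice.inv p)) * (\<Prod>i\<in>I. M (Hilbert_Choice.inv p i) i) =
        real_of_int (sign p) * (\<Prod>i\<in>I. M i (p i))"
      using p fin by (simp add: permutes_inverses sign_inverse permutes_imp_permutation)
  qed
  finally show ?thesis .
qed

text \<open>Inverting permutations exchanges the conditions p i = j and p j = i.\<close>

lemma cofac_sym:
  assumes fin: "finite I" and ij: "i \<in> I" "j \<in> I" and sym: "\<And>a b. a \<in> I \<Longrightarrow> b \<in> I \<Longrightarrow> M a b = M b a"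
  shows "cofac I M i j = cofac I M j i"
proof -
  have "cofac I M i j = (\<Sum>p | p permutes I \<and> p j = i. of_int (sign (Hilbert_Choice.inv p)) * (\<Prod>l\<in>I - {i}. M l (Hilbert_Choice.inv p l)))"
    unfolding cofac_def
    by (rule sum.reindex_bij_witness[where i=Hilbert_Choice.inv and j=Hilbert_Choice.inv])
       (auto simp: permutes_inv permutes_inv_inv permutes_inverses)
  also have "\<dots> = cofac I M j i" unfolding cofac_def
  proof (intro sum.cong refl)
    fix p assume "p \<in> {p. p permutes I \<and> p j = i}"
    then have p: "p permutes I" and pj: "p j = i" by auto
    have bij: "bij_betw p (I - {j}) (I - {i})"
      using permutes_imp_bij[OF p] pj ij
      by (intro bij_betw_DiffI) auto
    have "(\<Prod>l\<in>I - {i}. M l (Hilbert_Choice.inv p l)) = (\<Prod>l\<in>I - {j}. M (p l) (Hilbert_Choice.inv p (p l)))"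
      using prod.reindex_bij_betw[OF bij, of "\<lambda>l. M l (Hilbert_Choice.inv p l)"] by simp
    also have "\<dots> = (\<Prod>l\<in>I - {j}. M l (p l))"
      using p sym by (intro prod.cong refl) (auto simp: permutes_inverses permutes_in_image)
    finally show "real_of_int (sign (Hilbert_Choice.inv p)) * (\<Prod>l\<in>I - {i}. M l (Hilbert_Choice.inv p l)) =
        real_of_int (sign p) * (\<Prod>l\<in>I - {j}. M l (p l))"
      using p fin by (simp add: sign_inverse permutes_imp_permutation)
  qed
  finally show ?thesis .
qed

lemma ldet_expand_row:
  assumes fin: "finite I" and i: "i \<in> I"
  shows "ldet I M = (\<Sum>j\<in>I. M i j * cofac I M i j)"
proof -
  have "(\<Sum>j\<in>I. M i j * cofac I M i j) = (\<Sum>j\<in>I. \<Sum>p | p \<in> {p. p permutes I} \<and> p i = j. of_int (sign p) * (\<Prod>l\<in>I. M l (p l)))"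
    unfolding cofac_def sum_distrib_left
    by (intro sum.cong refl) (auto simp: algebra_simps prod.remove[OF fin i])
  also have "\<dots> = ldet I M" unfolding ldet_def
    using fin i by (intro sum.group) (auto simp: finite_permutations permutes_in_image)
  finally show ?thesis by simp
qed

lemma cofac_row_indep: "cofac I (M(i := r)) i j = cofac I M i j"
  unfolding cofac_def by (intro sum.cong refl arg_cong2[where f="(*)"] prod.cong) auto

lemma ldet_row_linear:
  assumes fin: "finite I" and i: "i \<in> I"
  shows "ldet I (M(i := (\<lambda>j. \<Sum>a\<in>S. c a * R a j))) = (\<Sum>a\<in>S. c a * ldet I (M(i := R a)))"
  unfolding ldet_expand_row[OF assms] cofac_row_indep
  by (simp add: sum_distrib_left sum_distrib_right algebra_simps sum.swap[of _ _ I])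

lemma ldet_identical_rows:
  assumes fin: "finite I" and ab: "a \<in> I" "b \<in> I" "a \<noteq> b" and eq: "\<And>j. j \<in> I \<Longrightarrow> M a j = M b j"
  shows "ldet I M = 0"
proof -
  let ?t = "Transposition.transpose a b"
  have t: "?t permutes I" using ab by (simp add: permutes_swap_id)
  have "ldet I M = (\<Sum>p | p permutes I. of_int (sign (p \<circ> ?t)) * (\<Prod>i\<in>I. M i ((p \<circ> ?t) i)))"
    unfolding ldet_def
    by (rule sum.reindex_bij_witness[where i="\<lambda>p. p \<circ> ?t" and j="\<lambda>p. p \<circ> ?t"])
       (auto simp: permutes_compose t o_assoc[symmetric])
  also have "\<dots> = - ldet I M" unfolding ldet_def sum_negf[symmetric]
  proof (intro sum.cong refl)
    fix p assume "p \<in> {p. p permutes I}"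
    then have p: "p permutes I" by simp
    have "(\<Prod>i\<in>I. M i (p (?t i))) = (\<Prod>i\<in>I. M (?t i) (p (?t (?t i))))"
      using prod.reindex_bij_betw[OF permutes_imp_bij[OF t], of "\<lambda>i. M i (p (?t i))"] by simp
    also have "\<dots> = (\<Prod>i\<in>I. M i (p i))"
      using eq p by (intro prod.cong refl) (auto simp: Transposition.transpose_def permutes_in_image)
    finally show "real_of_int (sign (p \<circ> ?t)) * (\<Prod>i\<in>I. M i ((p \<circ> ?t) i)) =
       - (real_of_int (sign p) * (\<Prod>i\<in>I. M i (p i)))"
      using p t fin ab by (simp add: sign_compose permutes_imp_permutation sign_swap_id)
  qed
  finally show ?thesis by simp
qed

text \<open>For \<open>a \<noteq> i\<close> the sum expands the determinant whose row
  \<open>i\<close> has been overwritten by row \<open>a\<close>, which has two equal rows.\<close>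

lemma cofac_orth:
  assumes fin: "finite I" and ab: "a \<in> I" "i \<in> I"
  shows "(\<Sum>j\<in>I. M a j * cofac I M i j) = (if a = i then ldet I M else 0)"
proof (cases "a = i")
  case True then show ?thesis using ldet_expand_row[OF fin, of i M] ab by simp
next
  case False
  have "(\<Sum>j\<in>I. M a j * cofac I M i j) = ldet I (M(i := M a))"
    unfolding ldet_expand_row[OF fin ab(2)] cofac_row_indep by simp
  also have "\<dots> = 0" using False ab by (intro ldet_identical_rows[OF fin, of a i]) auto
  finally show ?thesis using False by simp
qed

lemma cofac_diag:
  assumes fin: "finite E" and m: "m \<notin> E"
  shows "cofac (insert m E) M m m = ldet E M"
proof -
  have "{p. p permutes insert m E \<and> p m = m} = {p. p permutes E}"
    using m by (auto intro: permutes_subset[of _ E] permutes_superset[of _ "insert m E"] permutes_not_in)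
  then show ?thesis unfolding cofac_def ldet_def using m by (simp add: Diff_insert_absorb)
qed

lemma ldet_row_add:
  assumes fin: "finite I" and o: "o' \<in> I"
  shows "ldet I (M(o' := (\<lambda>j. M o' j + (\<Sum>a\<in>I - {o'}. c a * M a j)))) = ldet I M"
proof -
  let ?c = "\<lambda>a. if a = o' then 1 else c a"
  have "(\<lambda>j. M o' j + (\<Sum>a\<in>I - {o'}. c a * M a j)) = (\<lambda>j. \<Sum>a\<in>I. ?c a * M a j)"
    using sum.remove[OF fin o, of "\<lambda>a. ?c a * M a _"] by (intro ext) (simp)
  then have "ldet I (M(o' := (\<lambda>j. M o' j + (\<Sum>a\<in>I - {o'}. c a * M a j)))) = (\<Sum>a\<in>I. ?c a * ldet I (M(o' := M a)))"
    using ldet_row_linear[OF fin o, of M ?c M I] by simp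
  also have "\<dots> = ldet I M + (\<Sum>a\<in>I-{o'}. ?c a * ldet I (M(o' := M a)))"
    using sum.remove[OF fin o, of "\<lambda>a. ?c a * ldet I (M(o' := M a))"] by simp
  also have "(\<Sum>a\<in>I-{o'}. ?c a * ldet I (M(o' := M a))) = 0"
  proof (intro sum.neutral ballI)
    fix a assume "a \<in> I - {o'}"
    then have "ldet I (M(o' := M a)) = 0" using o by (intro ldet_identical_rows[OF fin, of a o']) auto
    then show "?c a * ldet I (M(o' := M a)) = 0" by simp
  qed
  finally show ?thesis by (simp del: fun_upd_apply)
qed

lemma ldet_scale: "ldet I (\<lambda>i j. a i * b j * M i j) = (\<Prod>i\<in>I. a i) * (\<Prod>i\<in>I. b i) * ldet I M"
proof -
  have "(\<Prod>i\<in>I. b (p i)) = (\<Prod>i\<in>I. b i)" if "p permutes I" for p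
    using prod.reindex_bij_betw[OF permutes_imp_bij[OF that], of b] by simp
  then show ?thesis unfolding ldet_def sum_distrib_left
    by (intro sum.cong refl) (auto simp: prod.distrib)
qed

text \<open>Cramer's rule without division, from multiplying the system by the adjugate. With
  \<open>y = 0\<close> it expresses that a nonsingular matrix has trivial kernel.\<close>

lemma cofac_kernel:
  assumes fin: "finite I" and sym: "\<And>a b. a \<in> I \<Longrightarrow> b \<in> I \<Longrightarrow> M a b = M b a" and b: "b \<in> I"
    and eq: "\<And>a. a \<in> I \<Longrightarrow> (\<Sum>j\<in>I. M a j * x j) = y a"
  shows "ldet I M * x b = (\<Sum>a\<in>I. cofac I M b a * y a)"
proof -
  have "(\<Sum>a\<in>I. cofac I M b a * y a) = (\<Sum>j\<in>I. x j * (\<Sum>a\<in>I. M a j * cofac I M b a))"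
    unfolding sum_distrib_left by (subst sum.swap) (simp add: eq[symmetric] sum_distrib_left mult_ac)
  also have "\<dots> = (\<Sum>j\<in>I. x j * (\<Sum>a\<in>I. M j a * cofac I M b a))"
    using sym by (intro sum.cong refl arg_cong2[where f="(*)"]) auto
  also have "\<dots> = (\<Sum>j\<in>I. x j * (if j = b then ldet I M else 0))"
    using cofac_orth[OF fin] b by (intro sum.cong refl) auto
  also have "\<dots> = ldet I M * x b"
    using fin b by (simp add: if_distrib[of "\<lambda>y. _ * y"] cong: if_cong)
  finally show ?thesis by simp
qed

lemma ldet_rows_add:
  assumes fin: "finite I" and o: "o' \<in> I" and S: "S \<subseteq> I - {o'}"
  shows "ldet I (\<lambda>i j. M i j + (if i \<in> S then c i * M o' j else 0)) = ldet I M"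
proof -
  have "finite S" using S fin finite_subset by blast
  then show ?thesis using S
  proof (induction S)
    case empty show ?case by simp
  next
    case (insert s S)
    let ?M = "\<lambda>i j. M i j + (if i \<in> S then c i * M o' j else 0)"
    have s: "s \<in> I" "s \<noteq> o'" "o' \<notin> S" using insert by auto
    have "(\<Sum>a\<in>I - {s}. (if a = o' then c s else 0) * ?M a j) = c s * M o' j" for j
      using fin o s by (simp add: if_distrib[of "\<lambda>x. x * _"] cong: if_cong)
    then have eq: "(\<lambda>i j. M i j + (if i \<in> insert s S then c i * M o' j else 0)) =
       ?M(s := (\<lambda>j. ?M s j + (\<Sum>a\<in>I - {s}. (if a = o' then c s else 0) * ?M a j)))"
      using insert by (auto simp: fun_eq_iff)
    show ?case unfolding eq
      by (subst ldet_row_add[OF fin s(1), of ?M]) (use insert in auto)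
  qed
qed

text \<open>Gaussian elimination of column \<open>o'\<close>. For a Gram matrix the Schur complement
  is the Gram matrix of the projections orthogonal to the vector at \<open>o'\<close>; this serves
  later for tangent vectors and for the signs of Gram determinants.\<close>

lemma ldet_schur:
  assumes fin: "finite I" and o: "o' \<notin> I" and nz: "M o' o' \<noteq> 0"
  shows "ldet (insert o' I) M = M o' o' * ldet I (\<lambda>i j. M i j - M i o' * M o' j / M o' o')"
proof -
  let ?c = "\<lambda>i. - M i o' / M o' o'"
  define M' where "M' = (\<lambda>i j. M i j + (if i \<in> I then ?c i * M o' j else 0))"
  have "ldet (insert o' I) M = ldet (insert o' I) M'"
    unfolding M'_def using o fin by (subst ldet_rows_add) auto
  also have "\<dots> = ldet (insert o' I) (\<lambda>i j. M' j i)" by (rule ldet_transpose[symmetric]) (use fin in simp)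
  also have "\<dots> = (\<Sum>j\<in>insert o' I. M' j o' * cofac (insert o' I) (\<lambda>i j. M' j i) o' j)"
    by (rule ldet_expand_row) (use fin in auto)
  also have "\<dots> = M' o' o' * cofac (insert o' I) (\<lambda>i j. M' j i) o' o'"
    using fin o nz by (subst sum.insert) (auto simp: M'_def)
  also have "\<dots> = M' o' o' * ldet I (\<lambda>i j. M' j i)"
    using o fin by (simp add: cofac_diag)
  also have "\<dots> = M o' o' * ldet I M'"
    using o ldet_transpose[OF fin, of M'] by (simp add: M'_def)
  also have "ldet I M' = ldet I (\<lambda>i j. M i j - M i o' * M o' j / M o' o')"
    by (rule ldet_cong) (simp add: M'_def)
  finally show ?thesis .
qed

lemma ldet_pos_def:
  assumes "finite I" and "\<And>i j. i \<in> I \<Longrightarrow> j \<in> I \<Longrightarrow> M i j = M j i"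
    and "\<And>x. \<exists>i\<in>I. x i \<noteq> 0 \<Longrightarrow> (\<Sum>i\<in>I. \<Sum>j\<in>I. x i * x j * M i j) > 0"
  shows "ldet I M > 0"
  using assms
proof (induction I arbitrary: M)
  case (insert o' I)
  \<comment> \<open>This value at \<open>o'\<close> minimizes the form over that coordinate; what
    remains is the form of the Schur complement.\<close>
  let ?x = "\<lambda>x i. if i = o' then - (\<Sum>j\<in>I. x j * M o' j) / M o' o' else x i"
  have quad: "(\<Sum>i\<in>insert o' I. \<Sum>j\<in>insert o' I. x i * x j * M i j)
      = x o' * x o' * M o' o' + 2 * x o' * (\<Sum>j\<in>I. x j * M o' j) + (\<Sum>i\<in>I. \<Sum>j\<in>I. x i * x j * M i j)" for x
    using insert by (simp add: sum.distrib sum_distrib_left mult_ac)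
  have pos: "M o' o' > 0"
  proof -
    let ?e = "\<lambda>i. if i = o' then 1 else 0 :: real"
    have "(\<Sum>i\<in>I. \<Sum>j\<in>I. ?e i * ?e j * M i j) = 0"
      using insert.hyps by (intro sum.neutral ballI) auto
    then have "(\<Sum>i\<in>insert o' I. \<Sum>j\<in>insert o' I. ?e i * ?e j * M i j) = M o' o'"
      unfolding quad using insert.hyps by (simp add: if_distrib[of "\<lambda>x. x * _"] cong: if_cong)
    then show ?thesis using insert.prems(2)[of ?e] by simp
  qed
  have "ldet I (\<lambda>i j. M i j - M i o' * M o' j / M o' o') > 0"
  proof (rule insert.IH)
    fix x :: "'a \<Rightarrow> real" assume ex: "\<exists>i\<in>I. x i \<noteq> 0"
    let ?s = "\<Sum>j\<in>I. x j * M o' j"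
    have same: "(\<Sum>i\<in>I. \<Sum>j\<in>I. ?x x i * ?x x j * M i j) = (\<Sum>i\<in>I. \<Sum>j\<in>I. x i * x j * M i j)"
       "(\<Sum>j\<in>I. ?x x j * M o' j) = ?s"
      using insert.hyps by (auto intro!: sum.cong)
    have "0 < (\<Sum>i\<in>insert o' I. \<Sum>j\<in>insert o' I. ?x x i * ?x x j * M i j)"
      using ex insert.hyps by (intro insert.prems(2)) force
    also have "\<dots> = (\<Sum>i\<in>I. \<Sum>j\<in>I. x i * x j * M i j) - ?s * ?s / M o' o'"
      unfolding quad same using pos by (simp add: field_simps)
    also have "?s * ?s = (\<Sum>i\<in>I. \<Sum>j\<in>I. x i * x j * (M i o' * M o' j))"
      using insert.prems(1) by (simp add: sum_product mult_ac)
    also have "(\<Sum>i\<in>I. \<Sum>j\<in>I. x i * x j * M i j) - (\<Sum>i\<in>I. \<Sum>j\<in>I. x i * x j * (M i o' * M o' j)) / M o' o'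
       = (\<Sum>i\<in>I. \<Sum>j\<in>I. x i * x j * (M i j - M i o' * M o' j / M o' o'))"
      by (simp add: sum_divide_distrib sum_subtractf algebra_simps)
    finally show "0 < (\<Sum>i\<in>I. \<Sum>j\<in>I. x i * x j * (M i j - M i o' * M o' j / M o' o'))" .
  qed (use insert.prems(1) in \<open>auto simp: mult.commute\<close>)
  then show ?case using insert.hyps pos by (simp add: ldet_schur)
qed simp

text \<open>Multilinearity in the rows: \<open>C\<close> is the set of rows taken from the diagonal
  part, and only permutations fixing \<open>C\<close> pointwise survive. One determinant thus
  generates the minors of all faces at once.\<close>

lemma ldet_diag_add:
  assumes fin: "finite I"
  shows "ldet I (\<lambda>i j. (if i = j then d i else 0) + M i j) = (\<Sum>C\<in>Pow I. (\<Prod>i\<in>C. d i) * ldet (I - C) M)"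
proof -
  have perm: "{p. p permutes I - C} = {p. p permutes I \<and> (\<forall>i\<in>C. p i = i)}" if "C \<subseteq> I" for C
  proof (intro equalityI subsetI CollectI conjI ballI)
    fix p assume "p \<in> {p. p permutes I - C}"
    then have p: "p permutes I - C" by simp
    show "p permutes I" by (rule permutes_subset[OF p]) auto
    show "p i = i" if "i \<in> C" for i using that permutes_not_in[OF p, of i] by auto
  next
    fix p assume "p \<in> {p. p permutes I \<and> (\<forall>i\<in>C. p i = i)}"
    then show "p permutes I - C" by (auto intro: permutes_superset)
  qed
  have "ldet I (\<lambda>i j. (if i = j then d i else 0) + M i j) =
     (\<Sum>p | p permutes I. \<Sum>C\<in>Pow I. of_int (sign p) *
        ((\<Prod>i\<in>C. if i = p i then d i else 0) * (\<Prod>i\<in>I-C. M i (p i))))"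
    unfolding ldet_def by (simp add: prod_add[OF fin] sum_distrib_left)
  also have "\<dots> = (\<Sum>C\<in>Pow I. \<Sum>p | p permutes I. of_int (sign p) *
        ((\<Prod>i\<in>C. if i = p i then d i else 0) * (\<Prod>i\<in>I-C. M i (p i))))"
    by (rule sum.swap)
  also have "\<dots> = (\<Sum>C\<in>Pow I. \<Sum>p | p permutes I - C. (\<Prod>i\<in>C. d i) * (of_int (sign p) * (\<Prod>i\<in>I-C. M i (p i))))"
  proof (rule sum.cong[OF refl])
    fix C assume "C \<in> Pow I"
    then have C: "C \<subseteq> I" "finite C" using fin finite_subset by auto
    show "(\<Sum>p | p permutes I. real_of_int (sign p) * ((\<Prod>i\<in>C. if i = p i then d i else 0) * (\<Prod>i\<in>I-C. M i (p i))))
      = (\<Sum>p | p permutes I - C. (\<Prod>i\<in>C. d i) * (of_int (sign p) * (\<Prod>i\<in>I-C. M i (p i))))"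
      unfolding perm[OF C(1)]
    proof (rule sum.mono_neutral_cong_right)
      show "finite {p. p permutes I}" using fin by (rule finite_permutations)
      show "\<forall>p\<in>{p. p permutes I} - {p. p permutes I \<and> (\<forall>i\<in>C. p i = i)}.
        real_of_int (sign p) * ((\<Prod>i\<in>C. if i = p i then d i else 0) * (\<Prod>i\<in>I-C. M i (p i))) = 0"
        using C by (force intro!: prod_zero simp: mult_eq_0_iff)
    qed (auto intro!: prod.cong)
  qed
  also have "\<dots> = (\<Sum>C\<in>Pow I. (\<Prod>i\<in>C. d i) * ldet (I - C) M)"
    by (simp add: ldet_def sum_distrib_left)
  finally show ?thesis .
qed

section \<open>Weighted sums along a stress\<close>

text \<open>Double counting: pairs (F, l) with l in F correspond to pairs (E, l) with l outside E
  through E = F - {l}. A sum over the facets of faces becomes a sum over all ways of adding a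
  vertex, and that is where the stress equation can be applied.\<close>

lemma sum_facets_swap:
  assumes fin: "finite U"
  shows "(\<Sum>F | F \<subseteq> U \<and> card F = Suc k. \<Sum>l\<in>F. \<phi> (F - {l}) l) =
         (\<Sum>E | E \<subseteq> U \<and> card E = k. \<Sum>l\<in>U - E. \<phi> E l)"
proof -
  have fins: "finite F" if "F \<subseteq> U" for F using that fin finite_subset by blast
  have fin2: "finite {F. F \<subseteq> U \<and> P F}" for P
    by (rule finite_subset[of _ "Pow U"]) (use fin in auto)
  show ?thesis
  proof -
    have "(\<Sum>F | F \<subseteq> U \<and> card F = Suc k. \<Sum>l\<in>F. \<phi> (F - {l}) l) =
       (\<Sum>(F,l)\<in>(SIGMA F:{F. F \<subseteq> U \<and> card F = Suc k}. F). \<phi> (F - {l}) l)"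
      by (rule sum.Sigma) (use fins fin2 in auto)
    also have "\<dots> = (\<Sum>(E,l)\<in>(SIGMA E:{E. E \<subseteq> U \<and> card E = k}. U - E). \<phi> E l)"
      by (rule sum.reindex_bij_witness[where i="\<lambda>(E,l). (insert l E, l)" and j="\<lambda>(F,l). (F - {l}, l)"])
        (use fins in \<open>force simp: insert_absorb\<close>)+
    also have "\<dots> = (\<Sum>E | E \<subseteq> U \<and> card E = k. \<Sum>l\<in>U - E. \<phi> E l)"
      by (rule sum.Sigma[symmetric]) (use fin fin2 in auto)
    finally show ?thesis .
  qed
qed

text \<open>Add up, with weights \<open>\<alpha> m\<close>, the rows at \<open>m\<close> of the
  adjugates of \<open>insert m E\<close>. The result has entry \<open>ldet E H * \<alpha> m\<close>
  at each \<open>m\<close> outside \<open>E\<close> and is annihilated by the rows of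
  \<open>H\<close> in \<open>E\<close>. If \<open>H \<alpha> = 0\<close>, the vector
  \<open>ldet E H * \<alpha>\<close> has both properties too, and the two agree because
  \<open>H\<close> is nonsingular on \<open>E\<close>. A nonzero \<open>g\<close> adds a correction
  linear in \<open>g\<close>.\<close>

lemma stress_facet_cofactors:
  assumes fin: "finite U" and EU: "E \<subseteq> U" and sym: "\<And>a b. a \<in> U \<Longrightarrow> b \<in> U \<Longrightarrow> H a b = H b a"
    and nz: "ldet E H \<noteq> 0" and g: "\<And>a. a \<in> U \<Longrightarrow> g a = (\<Sum>i\<in>U. H a i * \<alpha> i)"
  shows "(\<Sum>m\<in>U - E. \<alpha> m * (\<Sum>i\<in>insert m E. cofac (insert m E) H m i * h i)) =
     ldet E H * (\<Sum>i\<in>U. \<alpha> i * h i) - (\<Sum>i\<in>E. \<Sum>p\<in>E. cofac E H i p * g p * h i)"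
proof -
  have finE: "finite E" using EU fin finite_subset by blast
  define z where "z i = (\<Sum>m\<in>U - E. \<alpha> m * cofac (insert m E) H m i)" for i
  have symE: "H a b = H b a" if "a \<in> E" "b \<in> E" for a b using that EU sym by blast
  have Hz: "(\<Sum>i\<in>E. H a i * (z i - ldet E H * \<alpha> i)) = - ldet E H * g a" if a: "a \<in> E" for a
  proof -
    have "(\<Sum>i\<in>E. H a i * z i) = (\<Sum>m\<in>U - E. \<alpha> m * (\<Sum>i\<in>E. H a i * cofac (insert m E) H m i))"
      unfolding z_def sum_distrib_left by (subst sum.swap) (simp add: mult_ac)
    also have "\<dots> = (\<Sum>m\<in>U - E. \<alpha> m * (- H a m * ldet E H))"
    proof (intro sum.cong refl arg_cong2[where f="(*)"])
      fix m assume m: "m \<in> U - E"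
      have "(\<Sum>i\<in>insert m E. H a i * cofac (insert m E) H m i) = 0"
        using cofac_orth[of "insert m E" a m H] a m finE by auto
      then show "(\<Sum>i\<in>E. H a i * cofac (insert m E) H m i) = - H a m * ldet E H"
        using m finE by (simp add: cofac_diag)
    qed
    also have "\<dots> = - ldet E H * (\<Sum>m\<in>U - E. H a m * \<alpha> m)"
      by (simp add: sum_distrib_left sum_negf mult_ac)
    also have "(\<Sum>m\<in>U - E. H a m * \<alpha> m) = g a - (\<Sum>i\<in>E. H a i * \<alpha> i)"
      using g[of a] a EU sum_diff[OF fin EU, of "\<lambda>m. H a m * \<alpha> m"] by (simp add: subset_iff)
    finally have "(\<Sum>i\<in>E. H a i * z i) - ldet E H * (\<Sum>i\<in>E. H a i * \<alpha> i) = - ldet E H * g a"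
      by (simp add: algebra_simps)
    then show ?thesis by (simp add: right_diff_distrib sum_subtractf sum_distrib_left mult_ac)
  qed
  have z: "z i = ldet E H * \<alpha> i - (\<Sum>p\<in>E. cofac E H i p * g p)" if i: "i \<in> E" for i
  proof -
    have "ldet E H * (z i - ldet E H * \<alpha> i) = (\<Sum>a\<in>E. cofac E H i a * (- ldet E H * g a))"
      by (rule cofac_kernel[OF finE symE i Hz])
    also have "\<dots> = ldet E H * (- (\<Sum>p\<in>E. cofac E H i p * g p))"
      by (simp add: sum_distrib_left sum_negf mult_ac)
    finally have "z i - ldet E H * \<alpha> i = - (\<Sum>p\<in>E. cofac E H i p * g p)" using nz
      by (simp only: mult_cancel_left) simp
    then show ?thesis by simp
  qed
  have "(\<Sum>m\<in>U - E. \<alpha> m * (\<Sum>i\<in>insert m E. cofac (insert m E) H m i * h i)) =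
     (\<Sum>m\<in>U - E. \<alpha> m * (ldet E H * h m)) + (\<Sum>m\<in>U - E. \<Sum>i\<in>E. \<alpha> m * cofac (insert m E) H m i * h i)"
    using finE by (simp add: cofac_diag algebra_simps sum.distrib sum_distrib_left)
  also have "(\<Sum>m\<in>U - E. \<Sum>i\<in>E. \<alpha> m * cofac (insert m E) H m i * h i) = (\<Sum>i\<in>E. z i * h i)"
    unfolding z_def sum_distrib_right by (rule sum.swap)
  also have "\<dots> = (\<Sum>i\<in>E. ldet E H * (\<alpha> i * h i)) - (\<Sum>i\<in>E. \<Sum>p\<in>E. cofac E H i p * g p * h i)"
    by (simp add: z sum_subtractf algebra_simps sum_distrib_left)
  also have "(\<Sum>m\<in>U - E. \<alpha> m * (ldet E H * h m)) + \<dots> =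
     ldet E H * ((\<Sum>m\<in>U - E. \<alpha> m * h m) + (\<Sum>i\<in>E. \<alpha> i * h i)) - (\<Sum>i\<in>E. \<Sum>p\<in>E. cofac E H i p * g p * h i)"
    by (simp add: sum_distrib_left distrib_left mult_ac)
  also have "(\<Sum>m\<in>U - E. \<alpha> m * h m) + (\<Sum>i\<in>E. \<alpha> i * h i) = (\<Sum>i\<in>U. \<alpha> i * h i)"
    using sum.subset_diff[OF EU fin, of "\<lambda>i. \<alpha> i * h i"] by simp
  finally show ?thesis .
qed

text \<open>\<open>J\<close> and \<open>x1\<close> stand for the zeroth and first Gaussian moments,
  \<open>X\<close> for the volume derivative cleared of its square root. By hypothesis
  \<open>X F\<close> lives on the facets of \<open>F\<close>. Summing over the vertices that can be
  added to a facet \<open>E\<close> collapses the cofactors to \<open>ldet E H * h i\<close>; the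
  rule for \<open>x1\<close> then descends to the facets of \<open>E\<close>, where the same
  summation produces the product of \<alpha> and \<open>h\<close>. Both summations leave errors
  linear in \<open>g\<close>.\<close>

lemma schlaefli_stress_sum:
  fixes J :: "'a set \<Rightarrow> real"
  assumes fin: "finite U"
    and sym: "\<And>a b. a \<in> U \<Longrightarrow> b \<in> U \<Longrightarrow> H a b = H b a"
    and symd: "\<And>a b. a \<in> U \<Longrightarrow> b \<in> U \<Longrightarrow> dH a b = dH b a"
    and nz: "\<And>E. E \<subseteq> U \<Longrightarrow> card E \<le> Suc k \<Longrightarrow> ldet E H \<noteq> 0"
    and g: "\<And>a. a \<in> U \<Longrightarrow> g a = (\<Sum>i\<in>U. H a i * \<alpha> i)"
    and h: "\<And>a. a \<in> U \<Longrightarrow> h a = (\<Sum>i\<in>U. dH a i * \<alpha> i)"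
    and X: "\<And>F. F \<subseteq> U \<Longrightarrow> card F = Suc (Suc k) \<Longrightarrow>
       2 * X F = - (\<Sum>l\<in>F. \<Sum>i\<in>F - {l}. x1 (F - {l}) i * (\<Sum>j\<in>F. cofac F H l j * dH j i))"
    and x1: "\<And>F i. F \<subseteq> U \<Longrightarrow> card F = Suc k \<Longrightarrow> i \<in> F \<Longrightarrow>
       ldet F H * x1 F i = (\<Sum>m\<in>F. cofac F H i m * J (F - {m}))"
  shows "2 * (\<Sum>F | F \<subseteq> U \<and> card F = Suc (Suc k). (\<Prod>i\<in>F. \<alpha> i) * X F) =
     - (\<Sum>i\<in>U. \<alpha> i * h i) * (\<Sum>E | E \<subseteq> U \<and> card E = k. (\<Prod>i\<in>E. \<alpha> i) * (ldet E H * J E))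
     + (\<Sum>E | E \<subseteq> U \<and> card E = Suc k. (\<Prod>i\<in>E. \<alpha> i) *
          (\<Sum>i\<in>E. x1 E i * (\<Sum>j\<in>E. \<Sum>p\<in>E. cofac E H j p * g p * dH j i)))
     + (\<Sum>E | E \<subseteq> U \<and> card E = k. (\<Prod>i\<in>E. \<alpha> i) * (J E * (\<Sum>i\<in>E. \<Sum>p\<in>E. cofac E H i p * g p * h i)))"
proof -
  have fins: "finite F" if "F \<subseteq> U" for F using that fin finite_subset by blast
  let ?A = "\<lambda>F. \<Prod>i\<in>F. \<alpha> i"
  let ?C1 = "\<lambda>E i. \<Sum>j\<in>E. \<Sum>p\<in>E. cofac E H j p * g p * dH j i"
  let ?C2 = "\<lambda>E. \<Sum>i\<in>E. \<Sum>p\<in>E. cofac E H i p * g p * h i"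
  have rem: "?A F = ?A (F - {l}) * \<alpha> l" if "F \<subseteq> U" "l \<in> F" for F l
    using prod.remove[of F l \<alpha>] fins that by (simp add: mult.commute)
  have "2 * (\<Sum>F | F \<subseteq> U \<and> card F = Suc (Suc k). ?A F * X F) =
     (\<Sum>F | F \<subseteq> U \<and> card F = Suc (Suc k). \<Sum>l\<in>F. - (?A (F - {l}) * \<alpha> l *
        (\<Sum>i\<in>F - {l}. x1 (F - {l}) i * (\<Sum>j\<in>insert l (F - {l}). cofac (insert l (F - {l})) H l j * dH j i))))"
  proof (subst sum_distrib_left, rule sum.cong[OF refl])
    fix F assume F: "F \<in> {F. F \<subseteq> U \<and> card F = Suc (Suc k)}"
    have "2 * (?A F * X F) = ?A F * (2 * X F)" by simp
    also have "\<dots> = (\<Sum>l\<in>F. - (?A F * (\<Sum>i\<in>F - {l}. x1 (F - {l}) i * (\<Sum>j\<in>F. cofac F H l j * dH j i))))"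
      using X[of F] F by (simp add: sum_distrib_left sum_negf)
    also have "\<dots> = (\<Sum>l\<in>F. - (?A (F - {l}) * \<alpha> l *
        (\<Sum>i\<in>F - {l}. x1 (F - {l}) i * (\<Sum>j\<in>insert l (F - {l}). cofac (insert l (F - {l})) H l j * dH j i))))"
      using F by (intro sum.cong refl) (simp add: rem[of F] insert_absorb)
    finally show "2 * (?A F * X F) = (\<Sum>l\<in>F. - (?A (F - {l}) * \<alpha> l *
        (\<Sum>i\<in>F - {l}. x1 (F - {l}) i * (\<Sum>j\<in>insert l (F - {l}). cofac (insert l (F - {l})) H l j * dH j i))))" .
  qed
  also have "\<dots> = (\<Sum>E | E \<subseteq> U \<and> card E = Suc k. \<Sum>l\<in>U - E. - (?A E * \<alpha> l *
        (\<Sum>i\<in>E. x1 E i * (\<Sum>j\<in>insert l E. cofac (insert l E) H l j * dH j i))))"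
    by (rule sum_facets_swap[OF fin])
  also have "\<dots> = (\<Sum>E | E \<subseteq> U \<and> card E = Suc k. ?A E * (\<Sum>i\<in>E. x1 E i * ?C1 E i) -
      (\<Sum>l\<in>E. ?A (E - {l}) * \<alpha> l * (J (E - {l}) * (\<Sum>i\<in>insert l (E - {l}). cofac (insert l (E - {l})) H l i * h i))))"
  proof (rule sum.cong[OF refl])
    fix E assume "E \<in> {E. E \<subseteq> U \<and> card E = Suc k}"
    then have E: "E \<subseteq> U" "card E = Suc k" by auto
    have "(\<Sum>l\<in>U - E. - (?A E * \<alpha> l * (\<Sum>i\<in>E. x1 E i * (\<Sum>j\<in>insert l E. cofac (insert l E) H l j * dH j i)))) =
      - ?A E * (\<Sum>i\<in>E. x1 E i * (\<Sum>l\<in>U - E. \<alpha> l * (\<Sum>j\<in>insert l E. cofac (insert l E) H l j * dH j i)))"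
      unfolding sum_distrib_left sum_negf[symmetric] by (subst sum.swap) (simp add: mult_ac)
    also have "\<dots> = - ?A E * (\<Sum>i\<in>E. x1 E i * (ldet E H * h i - ?C1 E i))"
    proof (intro arg_cong2[where f="(*)"] sum.cong refl)
      fix i assume i: "i \<in> E"
      \<comment> \<open>The test vector of the cofactor lemma is column \<open>i\<close> of
        \<open>dH\<close>, which the stress pairs to \<open>h i\<close>.\<close>
      have "(\<Sum>j\<in>U. \<alpha> j * dH j i) = h i" 
        using h[of i] i E symd[of _ i] by (auto simp: mult.commute intro!: sum.cong)
      then show "(\<Sum>l\<in>U - E. \<alpha> l * (\<Sum>j\<in>insert l E. cofac (insert l E) H l j * dH j i)) = ldet E H * h i - ?C1 E i"
        using stress_facet_cofactors[where h="\<lambda>j. dH j i", OF fin E(1) sym nz[OF E(1)] g] E by simp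
    qed
    also have "\<dots> = ?A E * (\<Sum>i\<in>E. x1 E i * ?C1 E i) - ?A E * (\<Sum>i\<in>E. h i * (ldet E H * x1 E i))"
      by (simp add: algebra_simps sum_subtractf)
    \<comment> \<open>The factor \<open>ldet E H\<close> left by the first summation is exactly what
      the first moments need in order to descend to facets.\<close>
    also have "(\<Sum>i\<in>E. h i * (ldet E H * x1 E i)) = (\<Sum>l\<in>E. \<Sum>i\<in>E. h i * cofac E H l i * J (E - {l}))"
      using E x1[OF E] cofac_sym[OF fins[OF E(1)], of _ _ H] sym
      by (subst sum.swap) (auto simp: sum_distrib_left mult_ac subset_iff intro!: sum.cong)
    also have "?A E * \<dots> = (\<Sum>l\<in>E. ?A (E - {l}) * \<alpha> l * (J (E - {l}) * (\<Sum>i\<in>insert l (E - {l}). cofac (insert l (E - {l})) H l i * h i)))"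
      using E unfolding sum_distrib_left by (intro sum.cong refl) (auto simp: rem[of E] insert_absorb mult_ac)
    finally show "(\<Sum>l\<in>U - E. - (?A E * \<alpha> l * (\<Sum>i\<in>E. x1 E i * (\<Sum>j\<in>insert l E. cofac (insert l E) H l j * dH j i)))) =
       ?A E * (\<Sum>i\<in>E. x1 E i * ?C1 E i) -
      (\<Sum>l\<in>E. ?A (E - {l}) * \<alpha> l * (J (E - {l}) * (\<Sum>i\<in>insert l (E - {l}). cofac (insert l (E - {l})) H l i * h i)))" .
  qed
  also have "\<dots> = (\<Sum>E | E \<subseteq> U \<and> card E = Suc k. ?A E * (\<Sum>i\<in>E. x1 E i * ?C1 E i)) -
      (\<Sum>E | E \<subseteq> U \<and> card E = k. \<Sum>l\<in>U - E. ?A E * \<alpha> l * (J E * (\<Sum>i\<in>insert l E. cofac (insert l E) H l i * h i)))"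
    unfolding sum_subtractf by (subst sum_facets_swap[OF fin]) simp
  also have "(\<Sum>E | E \<subseteq> U \<and> card E = k. \<Sum>l\<in>U - E. ?A E * \<alpha> l * (J E * (\<Sum>i\<in>insert l E. cofac (insert l E) H l i * h i))) =
      (\<Sum>E | E \<subseteq> U \<and> card E = k. (\<Sum>i\<in>U. \<alpha> i * h i) * (?A E * (ldet E H * J E)) - ?A E * (J E * ?C2 E))"
  proof (rule sum.cong[OF refl])
    fix E assume "E \<in> {E. E \<subseteq> U \<and> card E = k}"
    then have E: "E \<subseteq> U" "card E = k" by auto
    have "(\<Sum>l\<in>U - E. ?A E * \<alpha> l * (J E * (\<Sum>i\<in>insert l E. cofac (insert l E) H l i * h i))) =
      ?A E * J E * (\<Sum>l\<in>U - E. \<alpha> l * (\<Sum>i\<in>insert l E. cofac (insert l E) H l i * h i))"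
      by (simp add: sum_distrib_left mult_ac)
    also have "(\<Sum>l\<in>U - E. \<alpha> l * (\<Sum>i\<in>insert l E. cofac (insert l E) H l i * h i)) =
       ldet E H * (\<Sum>i\<in>U. \<alpha> i * h i) - ?C2 E"
      by (rule stress_facet_cofactors[OF fin E(1) sym nz[OF E(1)] g]) (use E in auto)
    finally show "(\<Sum>l\<in>U - E. ?A E * \<alpha> l * (J E * (\<Sum>i\<in>insert l E. cofac (insert l E) H l i * h i))) =
      (\<Sum>i\<in>U. \<alpha> i * h i) * (?A E * (ldet E H * J E)) - ?A E * (J E * ?C2 E)"
      by (simp add: algebra_simps)
  qed
  finally show ?thesis by (simp add: sum_subtractf sum_distrib_left sum_negf)
qed

section \<open>Bordered determinants and generating polynomials of minors\<close>

lemma ldet_unit_row: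
  assumes "finite E" "e \<notin> E" "\<And>j. j \<in> E \<Longrightarrow> M e j = 0"
  shows "ldet (insert e E) M = M e e * ldet E M"
  using assms by (subst ldet_expand_row[of _ e]) (auto simp: cofac_diag)

text \<open>\<open>o'\<close> and \<open>e\<close> split off as a block with zero corner and
  off-diagonal ones, whose determinant is -1.\<close>

lemma ldet_hook:
  assumes fin: "finite E" and o: "o' \<notin> E" "e \<notin> E" "o' \<noteq> e"
    and row: "\<And>j. j \<in> insert o' E \<Longrightarrow> M o' j = 0" "M o' e = 1"
    and col: "\<And>j. j \<in> E \<Longrightarrow> M j o' = 0" "M e o' = 1"
  shows "ldet (insert o' (insert e E)) M = - ldet E M"
proof -
  let ?I = "insert o' (insert e E)"
  let ?N = "M(e := (\<lambda>j. if j = o' then 1 else 0))"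
  have finI: "finite ?I" using fin by simp
  let ?c = "\<lambda>a. if a = o' then 1 else - M e a"
  let ?b = "\<lambda>a j. if j = a then 1 else 0 :: real"
  txt \<open>Row \<open>o'\<close> clears the entry \<open>M e e\<close>; the other entries of row \<open>e\<close> are cleared by column \<open>o'\<close>.\<close>
  have "ldet ?I M = ldet ?I (\<lambda>i j. M j i)" by (rule ldet_transpose[symmetric]) (fact finI)
  also have "\<dots> = ldet ?I (\<lambda>i j. M j i + (if i \<in> insert e E then (- M e i) * M j o' else 0))"
    by (rule ldet_rows_add[symmetric]) (use fin o in auto)
  also have "\<dots> = ldet ?I (\<lambda>i j. ?N j i)"
    using o row col by (intro ldet_cong) auto
  also have "\<dots> = ldet ?I ?N" by (rule ldet_transpose) (fact finI)
  also have "\<dots> = - ldet ?I (?N \<circ> Transposition.transpose o' e)"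
  proof -
    let ?t = "Transposition.transpose o' e"
    have t: "?t permutes ?I" by (simp add: permutes_swap_id)
    have "ldet ?I ?N = (\<Sum>p | p permutes ?I. of_int (sign (p \<circ> ?t)) * (\<Prod>i\<in>?I. ?N i ((p \<circ> ?t) i)))"
      unfolding ldet_def
      by (rule sum.reindex_bij_witness[where i="\<lambda>p. p \<circ> ?t" and j="\<lambda>p. p \<circ> ?t"])
         (auto simp: permutes_compose t o_assoc[symmetric])
    also have "\<dots> = - ldet ?I (?N \<circ> ?t)" unfolding ldet_def sum_negf[symmetric]
    proof (rule sum.cong[OF refl])
      fix p assume "p \<in> {p. p permutes ?I}"
      then have p: "p permutes ?I" by simp
      have "(\<Prod>i\<in>?I. ?N i (p (?t i))) = (\<Prod>i\<in>?I. ?N (?t i) (p (?t (?t i))))"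
        using prod.reindex_bij_betw[OF permutes_imp_bij[OF t], of "\<lambda>i. ?N i (p (?t i))"] by simp
      moreover have "sign (p \<circ> ?t) = - sign p"
        using p t finI o(3) by (simp add: sign_compose permutes_imp_permutation[OF finI] sign_swap_id)
      ultimately show "real_of_int (sign (p \<circ> ?t)) * (\<Prod>i\<in>?I. ?N i ((p \<circ> ?t) i)) =
         - (real_of_int (sign p) * (\<Prod>i\<in>?I. (?N \<circ> ?t) i (p i)))"
        by (simp del: fun_upd_apply)
    qed
    finally show ?thesis .
  qed
  also have "ldet ?I (?N \<circ> Transposition.transpose o' e) = ldet E M"
  proof -
    have "ldet ?I (?N \<circ> Transposition.transpose o' e) = ldet (insert e E) (?N \<circ> Transposition.transpose o' e)"
      using fin o by (subst ldet_unit_row) auto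
    also have "\<dots> = ldet E (?N \<circ> Transposition.transpose o' e)"
      using fin o row by (subst ldet_unit_row) auto
    also have "\<dots> = ldet E M" using o by (intro ldet_cong) (auto simp: Transposition.transpose_def)
    finally show ?thesis .
  qed
  finally show ?thesis .
qed

text \<open>Identities between generating polynomials in \<open>x\<close> are proved for all faces
  together and separated here by face size; the shift \<open>s\<close> is the number of vertices
  lost from one side to the other.\<close>

lemma coefficient_comparison:
  fixes \<phi> \<psi> :: "'a set \<Rightarrow> real"
  assumes fin: "finite U"
    and eq: "\<And>x. (\<Sum>E\<in>Pow U. x ^ card E * \<phi> E) = (\<Sum>E\<in>Pow U. x ^ (card E + s) * \<psi> E)"
  shows "(\<Sum>F | F \<subseteq> U \<and> card F = k + s. \<phi> F) = (\<Sum>E | E \<subseteq> U \<and> card E = k. \<psi> E)"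
proof -
  let ?N = "card U + s + k"
  have group: "(\<Sum>E\<in>Pow U. x ^ (card E + r) * \<theta> E) =
      (\<Sum>m\<le>?N. (\<Sum>E | E \<in> Pow U \<and> card E + r = m. \<theta> E) * x ^ m)"
    if r: "r \<le> s" for r x and \<theta> :: "'a set \<Rightarrow> real"
  proof -
    have "(\<Sum>m\<le>?N. (\<Sum>E | E \<in> Pow U \<and> card E + r = m. \<theta> E) * x ^ m) =
       (\<Sum>m\<le>?N. (\<Sum>E | E \<in> Pow U \<and> card E + r = m. x ^ (card E + r) * \<theta> E))"
      unfolding sum_distrib_right by (intro sum.cong refl) (auto simp: mult.commute)
    also have "\<dots> = (\<Sum>E\<in>Pow U. x ^ (card E + r) * \<theta> E)"
    proof (rule sum.group)
      show "(\<lambda>E. card E + r) ` Pow U \<subseteq> {..?N}"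
        using card_mono[OF fin] r by (auto simp: trans_le_add1 add_mono)
    qed (use fin in auto)
    finally show ?thesis by simp
  qed
  have "(\<Sum>m\<le>?N. (\<Sum>E | E \<in> Pow U \<and> card E + 0 = m. \<phi> E) * x ^ m) =
      (\<Sum>m\<le>?N. (\<Sum>E | E \<in> Pow U \<and> card E + s = m. \<psi> E) * x ^ m)" for x
    using group[of 0 x \<phi>] group[of s x \<psi>] eq[of x] by simp
  then have "\<forall>m\<le>?N. (\<Sum>E | E \<in> Pow U \<and> card E + 0 = m. \<phi> E) = (\<Sum>E | E \<in> Pow U \<and> card E + s = m. \<psi> E)"
    by (intro polyfun_eq_coeffs[THEN iffD1] allI)
  from this[rule_format, of "k + s"] show ?thesis by simp
qed

text \<open>Generating polynomial of the weighted minors bordered by \<open>B\<close>. The diagonal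
  part vanishes on the border rows, so only sets \<open>C\<close> inside \<open>U\<close>
  contribute, each leaving the minor on \<open>(U - C) \<union> B\<close>.\<close>

lemma ldet_border_expand:
  assumes fin: "finite U" "finite B" and disj: "U \<inter> B = {}"
  shows "ldet (U \<union> B) (\<lambda>i j. (if i = j \<and> i \<in> U then 1 else 0) + (if i \<in> U then x * \<alpha> i else 1) * M i j) =
    (\<Sum>E\<in>Pow U. x ^ card E * ((\<Prod>i\<in>E. \<alpha> i) * ldet (E \<union> B) M))"
proof -
  let ?d = "\<lambda>i. if i \<in> U then 1 else 0 :: real"
  let ?r = "\<lambda>i. if i \<in> U then x * \<alpha> i else 1 :: real"
  have "ldet (U \<union> B) (\<lambda>i j. (if i = j \<and> i \<in> U then 1 else 0) + ?r i * M i j) =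
    ldet (U \<union> B) (\<lambda>i j. (if i = j then ?d i else 0) + ?r i * 1 * M i j)"
    by (rule ldet_cong) auto
  also have "\<dots> = (\<Sum>C\<in>Pow (U \<union> B). (\<Prod>i\<in>C. ?d i) * ldet (U \<union> B - C) (\<lambda>i j. ?r i * 1 * M i j))"
    using fin by (subst ldet_diag_add) auto
  also have "\<dots> = (\<Sum>C\<in>Pow U. ldet (U \<union> B - C) (\<lambda>i j. ?r i * 1 * M i j))"
  proof (rule sum.mono_neutral_cong_right)
    show "\<forall>C\<in>Pow (U \<union> B) - Pow U. (\<Prod>i\<in>C. ?d i) * ldet (U \<union> B - C) (\<lambda>i j. ?r i * 1 * M i j) = 0"
    proof
      fix C assume C: "C \<in> Pow (U \<union> B) - Pow U"
      then have "finite C" using fin by (meson Diff_iff PowD finite_UnI finite_subset)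
      then have "(\<Prod>i\<in>C. ?d i) = 0" using C by (intro prod_zero) auto
      then show "(\<Prod>i\<in>C. ?d i) * ldet (U \<union> B - C) (\<lambda>i j. ?r i * 1 * M i j) = 0" by simp
    qed
  qed (use fin in \<open>auto simp: subset_iff\<close>)
  also have "\<dots> = (\<Sum>E\<in>Pow U. ldet (E \<union> B) (\<lambda>i j. ?r i * 1 * M i j))"
    by (rule sum.reindex_bij_witness[where i="\<lambda>E. U - E" and j="\<lambda>E. U - E"])
       (use disj in \<open>auto intro!: arg_cong2[where f=ldet]\<close>)
  also have "\<dots> = (\<Sum>E\<in>Pow U. x ^ card E * ((\<Prod>i\<in>E. \<alpha> i) * ldet (E \<union> B) M))"
  proof (rule sum.cong[OF refl])
    fix E assume E: "E \<in> Pow U"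
    have "(\<Prod>i\<in>E \<union> B. ?r i) = (\<Prod>i\<in>E. ?r i) * (\<Prod>i\<in>B. ?r i)"
      using E disj fin finite_subset by (intro prod.union_disjoint) auto
    also have "(\<Prod>i\<in>B. ?r i) = 1" using disj by (intro prod.neutral) auto
    also have "(\<Prod>i\<in>E. ?r i) = (\<Prod>i\<in>E. x * \<alpha> i)" using E by (intro prod.cong) auto
    finally show "ldet (E \<union> B) (\<lambda>i j. ?r i * 1 * M i j) = x ^ card E * ((\<Prod>i\<in>E. \<alpha> i) * ldet (E \<union> B) M)"
      by (subst ldet_scale) (simp add: prod.distrib)
  qed
  finally show ?thesis .
qed

text \<open>With g = 1 and l = 0 this is a Cayley-Menger matrix written with inner products. With g
  = G \<alpha> and l the value of the form \<open>G\<close> at \<alpha>, it is the Gram matrix of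
  the vertices together with their combination with coefficients \<alpha>.\<close>

definition bordered :: "'a \<Rightarrow> ('a \<Rightarrow> 'a \<Rightarrow> real) \<Rightarrow> ('a \<Rightarrow> real) \<Rightarrow> real \<Rightarrow> 'a \<Rightarrow> 'a \<Rightarrow> real" where
  "bordered o' G g l i j =
     (if i = o' then if j = o' then l else g j else if j = o' then g i else G i j)"

text \<open>Flat counterpart of the double Schlaefli step. In the generating determinant the border
  of ones cancels against the unit diagonal: the row and then the column of \<open>o'\<close> turn
  into -x times the border \<open>g\<close>, and the corner into x^2 times the new corner. Pulling
  out x^2 means that two vertices are lost.\<close>

lemma stress_second_order:
  fixes \<alpha> :: "'a \<Rightarrow> real"
  assumes fin: "finite U" and o: "o' \<notin> U"
    and sym: "\<And>a b. a \<in> U \<Longrightarrow> b \<in> U \<Longrightarrow> G a b = G b a"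
    and \<sigma>: "(\<Sum>i\<in>U. \<alpha> i) = 0" and g: "\<And>a. a \<in> U \<Longrightarrow> g a = (\<Sum>i\<in>U. G a i * \<alpha> i)"
  shows "(\<Sum>F | F \<subseteq> U \<and> card F = k + 2. (\<Prod>i\<in>F. \<alpha> i) * ldet (insert o' F) (bordered o' G (\<lambda>_. 1) 0)) =
    (\<Sum>E | E \<subseteq> U \<and> card E = k. (\<Prod>i\<in>E. \<alpha> i) * ldet (insert o' E) (bordered o' G g (\<Sum>i\<in>U. \<alpha> i * g i)))"
proof (rule coefficient_comparison[OF fin])
  fix x :: real
  let ?M = "bordered o' G (\<lambda>_. 1) 0" and ?N = "bordered o' G g (\<Sum>i\<in>U. \<alpha> i * g i)"
  let ?I = "U \<union> {o'}"
  let ?A = "\<lambda>i j. (if i = j \<and> i \<in> U then 1 else 0) + (if i \<in> U then x * \<alpha> i else 1) * ?M i j"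
  have finI: "finite ?I" and disj: "U \<inter> {o'} = {}" and IU: "?I - {o'} = U" and oI: "o' \<in> ?I" using fin o by auto
  define B where "B = ?A(o' := (\<lambda>j. ?A o' j + (\<Sum>i\<in>?I - {o'}. (-1) * ?A i j)))"
  \<comment> \<open>\<open>C\<close> modifies the transpose of the row-reduced \<open>B\<close>, so
    that the column operation can be treated as a row operation.\<close>
  define C where "C = (\<lambda>j i. B i j)(o' := (\<lambda>i. B i o' + (\<Sum>j\<in>?I - {o'}. (- x * \<alpha> j) * B i j)))"
  have B1: "B i j = ?A i j" if "i \<in> U" for i j using that o unfolding B_def by auto
  have B2: "B o' j = - x * g j" if "j \<in> U" for j
  proof -
    have "(\<Sum>i\<in>U. (-1) * ?A i j) = (\<Sum>i\<in>U. - (if i = j then 1 else 0) - x * (\<alpha> i * G i j))"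
      using that o by (intro sum.cong refl) (auto simp: bordered_def)
    also have "\<dots> = - 1 - x * (\<Sum>i\<in>U. \<alpha> i * G i j)"
      using that fin by (simp add: sum_subtractf sum_negf sum_distrib_left)
    also have "(\<Sum>i\<in>U. \<alpha> i * G i j) = g j" using g[OF that] sym[OF that] by (simp add: mult.commute)
    finally have "B o' j = ?A o' j + (- 1 - x * g j)" unfolding B_def IU by simp
    then show ?thesis using that o by (auto simp: bordered_def)
  qed
  have B3: "B o' o' = 0"
  proof -
    have "(\<Sum>i\<in>U. (-1) * ?A i o') = - (x * (\<Sum>i\<in>U. \<alpha> i))"
      unfolding sum_distrib_left sum_negf[symmetric] using o by (intro sum.cong refl) (auto simp: bordered_def)
    then show ?thesis using o \<sigma> unfolding B_def IU by (simp add: bordered_def)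
  qed
  have C1: "C j i = B i j" if "j \<in> U" for i j using that o unfolding C_def by auto
  have C2: "C o' i = - x * (x * \<alpha> i * g i)" if "i \<in> U" for i
  proof -
    have "(\<Sum>j\<in>U. (- x * \<alpha> j) * B i j) = (\<Sum>j\<in>U. - (x * (if j = i then \<alpha> j else 0)) - x * (x * \<alpha> i) * (G i j * \<alpha> j))"
      using that o by (intro sum.cong refl) (auto simp: B1 bordered_def algebra_simps)
    also have "\<dots> = - (x * \<alpha> i) - x * (x * \<alpha> i) * g i"
      using that fin g[OF that] by (simp add: sum_subtractf sum_negf sum_distrib_left[symmetric])
    finally show ?thesis using that o unfolding C_def IU by (auto simp: B1 bordered_def)
  qed
  have C3: "C o' o' = - x * (- x * (\<Sum>i\<in>U. \<alpha> i * g i))"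
    unfolding C_def IU using B2 B3 by (simp add: sum_distrib_left mult_ac)
  have "(\<Sum>E\<in>Pow U. x ^ card E * ((\<Prod>i\<in>E. \<alpha> i) * ldet (insert o' E) ?M)) = ldet ?I ?A"
    using ldet_border_expand[OF fin finite.insertI[OF finite.emptyI] disj, of x \<alpha> ?M] by simp
  also have "\<dots> = ldet ?I B" unfolding B_def by (rule ldet_row_add[OF finI oI, symmetric])
  also have "\<dots> = ldet ?I C"
    unfolding C_def by (subst ldet_row_add[OF finI oI]) (rule ldet_transpose[symmetric], fact finI)
  also have "\<dots> = ldet ?I (\<lambda>j i. (if j = o' then - x else 1) * (if i = o' then - x else 1) *
       ((if i = j \<and> i \<in> U then 1 else 0) + (if i \<in> U then x * \<alpha> i else 1) * ?N i j))"
    using o by (intro ldet_cong) (auto simp: C1 C2 C3 B1 B2 bordered_def)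
  also have "\<dots> = x\<^sup>2 * ldet ?I (\<lambda>j i. (if i = j \<and> i \<in> U then 1 else 0) + (if i \<in> U then x * \<alpha> i else 1) * ?N i j)"
  proof -
    have "(\<Prod>i\<in>?I. if i = o' then - x else 1) = - x" using fin o by simp
    then show ?thesis by (subst ldet_scale) (simp add: power2_eq_square)
  qed
  also have "ldet ?I (\<lambda>j i. (if i = j \<and> i \<in> U then 1 else 0) + (if i \<in> U then x * \<alpha> i else 1) * ?N i j) =
     ldet ?I (\<lambda>i j. (if i = j \<and> i \<in> U then 1 else 0) + (if i \<in> U then x * \<alpha> i else 1) * ?N i j)"
    by (rule ldet_transpose) (fact finI)
  also have "\<dots> = (\<Sum>E\<in>Pow U. x ^ card E * ((\<Prod>i\<in>E. \<alpha> i) * ldet (insert o' E) ?N))"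
    using ldet_border_expand[OF fin finite.insertI[OF finite.emptyI] disj, of x \<alpha> ?N] by simp
  finally show "(\<Sum>E\<in>Pow U. x ^ card E * ((\<Prod>i\<in>E. \<alpha> i) * ldet (insert o' E) ?M)) =
     (\<Sum>E\<in>Pow U. x ^ (card E + 2) * ((\<Prod>i\<in>E. \<alpha> i) * ldet (insert o' E) ?N))"
    by (simp add: sum_distrib_left power_add power2_eq_square mult_ac)
qed

text \<open>The parameters \<open>p\<close>, \<open>q\<close>, \<open>r\<close> are the inner products of two auxiliary points with the vertices
  and with each other; the right hand side does not contain them.\<close>

lemma stress_invariant_gram:
  fixes \<alpha> :: "'a \<Rightarrow> real"
  assumes fin: "finite U" and o: "o' \<notin> U" "e \<notin> U" "o' \<noteq> e"
    and sym: "\<And>a b. a \<in> U \<Longrightarrow> b \<in> U \<Longrightarrow> G a b = G b a"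
    and \<sigma>: "(\<Sum>i\<in>U. \<alpha> i) = 0" and g: "\<And>a. a \<in> U \<Longrightarrow> (\<Sum>i\<in>U. G a i * \<alpha> i) = 0"
    and p: "(\<Sum>i\<in>U. \<alpha> i * p i) = 0" and q: "(\<Sum>i\<in>U. \<alpha> i * q i) = 0"
    and R: "\<And>i j. R i j = (if i = o' then if j = o' then 0 else 1 else if j = o' then 1
        else if i = e then if j = e then r else p j else if j = e then q i else G i j)"
  shows "(\<Sum>E | E \<subseteq> U \<and> card E = k. (\<Prod>i\<in>E. \<alpha> i) * ldet (insert o' (insert e E)) R) =
    - (\<Sum>E | E \<subseteq> U \<and> card E = k. (\<Prod>i\<in>E. \<alpha> i) * ldet E G)"
proof -
  let ?B = "{o', e}"
  let ?I = "U \<union> ?B"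
  \<comment> \<open>The border of ones is eliminated as in \<open>stress_second_order\<close>, now
    with vanishing \<open>g\<close> and corner. The relations for \<open>p\<close> and
    \<open>q\<close> keep the entries pairing \<open>o'\<close> with \<open>e\<close> equal to 1, so
    that these two indices end up as a hook.\<close>
  define R' where "R' i j = (if i = o' then if j = e then 1 else 0 else if j = o' then if i = e then 1 else 0 else R i j)" for i j
  have finB: "finite ?B" by simp
  have finI: "finite ?I" and disj: "U \<inter> ?B = {}" and oI: "o' \<in> ?I" using fin o by auto
  have "(\<Sum>F | F \<subseteq> U \<and> card F = k + 0. (\<Prod>i\<in>F. \<alpha> i) * ldet (F \<union> ?B) R) =
    (\<Sum>F | F \<subseteq> U \<and> card F = k. (\<Prod>i\<in>F. \<alpha> i) * ldet (F \<union> ?B) R')"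
  proof (rule coefficient_comparison[OF fin])
    fix x :: real
    let ?A = "\<lambda>R i j. (if i = j \<and> i \<in> U then 1 else 0) + (if i \<in> U then x * \<alpha> i else 1) * R i j"
    let ?c = "\<lambda>i. if i \<in> U then -1 else 0 :: real" and ?d = "\<lambda>i. if i \<in> U then - x * \<alpha> i else 0"
    define B where "B = (?A R)(o' := (\<lambda>j. ?A R o' j + (\<Sum>i\<in>?I - {o'}. ?c i * ?A R i j)))"
    define C where "C = (\<lambda>j i. B i j)(o' := (\<lambda>i. B i o' + (\<Sum>j\<in>?I - {o'}. ?d j * B i j)))"
    have sumI: "(\<Sum>i\<in>?I - {o'}. f i) = (\<Sum>i\<in>U. f i)" if "f e = 0" for f :: "'a \<Rightarrow> real"
      using that o fin by (intro sum.mono_neutral_right) auto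
    have B1: "B i j = ?A R i j" if "i \<noteq> o'" for i j using that unfolding B_def by auto
    have B1U: "B i j = ?A R i j" if "i \<in> U" for i j using that o by (intro B1) auto
    have Bo: "B o' j = ?A R o' j + (\<Sum>i\<in>U. ?c i * ?A R i j)" for j
      unfolding B_def by (subst fun_upd_same, subst sumI) (use o in simp_all)
    have B2: "B o' j = 0" if "j \<in> U" for j
    proof -
      have "(\<Sum>i\<in>U. ?c i * ?A R i j) = (\<Sum>i\<in>U. - (if i = j then 1 else 0) - x * (\<alpha> i * G i j))"
        using that o by (intro sum.cong refl) (auto simp: R)
      also have "\<dots> = - 1 - x * (\<Sum>i\<in>U. \<alpha> i * G i j)"
        using that fin by (simp add: sum_subtractf sum_negf sum_distrib_left)
      also have "(\<Sum>i\<in>U. \<alpha> i * G i j) = 0" using g[OF that] sym[OF that] by (simp add: mult.commute)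
      finally have "B o' j = ?A R o' j - 1" unfolding Bo by simp
      then show ?thesis using that o by (auto simp: R)
    qed
    have B3: "B o' o' = 0"
    proof -
      have "(\<Sum>i\<in>U. ?c i * ?A R i o') = - (x * (\<Sum>i\<in>U. \<alpha> i))"
        unfolding sum_distrib_left sum_negf[symmetric] using o by (intro sum.cong refl) (auto simp: R)
      then have "B o' o' = ?A R o' o'" unfolding Bo using \<sigma> by simp
      then show ?thesis using o by (simp add: R)
    qed
    have B4: "B o' e = 1"
    proof -
      have "(\<Sum>i\<in>U. ?c i * ?A R i e) = - (x * (\<Sum>i\<in>U. \<alpha> i * q i))"
        unfolding sum_distrib_left sum_negf[symmetric] using o by (intro sum.cong refl) (auto simp: R)
      then have "B o' e = ?A R o' e" unfolding Bo using q by simp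
      then show ?thesis using o by (simp add: R)
    qed
    have C1: "C j i = B i j" if "j \<noteq> o'" for i j using that unfolding C_def by auto
    have Co: "C o' i = B i o' + (\<Sum>j\<in>U. ?d j * B i j)" for i
      unfolding C_def by (subst fun_upd_same, subst sumI) (use o in simp_all)
    have C2: "C o' i = 0" if "i \<in> U" for i
    proof -
      have "(\<Sum>j\<in>U. ?d j * B i j) = (\<Sum>j\<in>U. - (x * (if j = i then \<alpha> j else 0)) - x * (x * \<alpha> i) * (G i j * \<alpha> j))"
        using that o by (intro sum.cong refl) (auto simp: B1U R algebra_simps)
      also have "\<dots> = - (x * \<alpha> i)"
        using that fin g[OF that] by (simp add: sum_subtractf sum_negf sum_distrib_left[symmetric])
      finally have "C o' i = B i o' - x * \<alpha> i" unfolding Co by simp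
      then show ?thesis using that o by (auto simp: B1U R)
    qed
    have C3: "C o' o' = 0" unfolding Co using B2 B3 by simp
    have C4: "C o' e = 1"
    proof -
      have "(\<Sum>j\<in>U. ?d j * B e j) = - (x * (\<Sum>j\<in>U. \<alpha> j * p j))"
        unfolding sum_distrib_left sum_negf[symmetric] using o by (intro sum.cong refl) (auto simp: B1 R)
      then have "C o' e = B e o'" unfolding Co using p by simp
      then show ?thesis using o by (simp add: B1 R)
    qed
    have "(\<Sum>E\<in>Pow U. x ^ card E * ((\<Prod>i\<in>E. \<alpha> i) * ldet (E \<union> ?B) R)) = ldet ?I (?A R)"
      by (rule ldet_border_expand[OF fin finB disj, symmetric])
    also have "\<dots> = ldet ?I B" unfolding B_def by (rule ldet_row_add[OF finI oI, symmetric])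
    also have "\<dots> = ldet ?I C"
      unfolding C_def by (subst ldet_row_add[OF finI oI]) (rule ldet_transpose[symmetric], fact finI)
    also have "\<dots> = ldet ?I (\<lambda>j i. ?A R' i j)"
      using o by (intro ldet_cong) (auto simp: C1 C2 C3 C4 B1 B2 B4 R'_def)
    also have "\<dots> = ldet ?I (?A R')" by (rule ldet_transpose) (fact finI)
    also have "\<dots> = (\<Sum>E\<in>Pow U. x ^ (card E + 0) * ((\<Prod>i\<in>E. \<alpha> i) * ldet (E \<union> ?B) R'))"
      unfolding add_0_right by (rule ldet_border_expand[OF fin finB disj])
    finally show "(\<Sum>E\<in>Pow U. x ^ card E * ((\<Prod>i\<in>E. \<alpha> i) * ldet (E \<union> ?B) R)) =
       (\<Sum>E\<in>Pow U. x ^ (card E + 0) * ((\<Prod>i\<in>E. \<alpha> i) * ldet (E \<union> ?B) R'))" .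
  qed
  also have "\<dots> = (\<Sum>F | F \<subseteq> U \<and> card F = k. - ((\<Prod>i\<in>F. \<alpha> i) * ldet F G))"
  proof (rule sum.cong[OF refl])
    fix F assume "F \<in> {F. F \<subseteq> U \<and> card F = k}"
    then have F: "F \<subseteq> U" "finite F" using fin finite_subset by auto
    have "ldet (insert o' (insert e F)) R' = - ldet F R'"
      using F o by (intro ldet_hook) (auto simp: R'_def)
    also have "ldet F R' = ldet F G" using F o by (intro ldet_cong) (auto simp: R'_def R)
    finally show "(\<Prod>i\<in>F. \<alpha> i) * ldet (F \<union> ?B) R' = - ((\<Prod>i\<in>F. \<alpha> i) * ldet F G)" by simp
  qed
  finally show ?thesis by (simp add: sum_negf)
qed

section \<open>Gaussian integrals over orthants\<close>

definition halfline :: "real measure" where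
  "halfline = restrict_space lborel {0..}"

definition orthant :: "'a set \<Rightarrow> ('a \<Rightarrow> real) measure" where
  "orthant I = PiM I (\<lambda>_. halfline)"

definition quad :: "('a \<Rightarrow> 'a \<Rightarrow> real) \<Rightarrow> 'a set \<Rightarrow> ('a \<Rightarrow> real) \<Rightarrow> real" where
  "quad H I x = (\<Sum>i\<in>I. \<Sum>j\<in>I. H i j * x i * x j)"

definition gauss :: "('a \<Rightarrow> 'a \<Rightarrow> real) \<Rightarrow> 'a set \<Rightarrow> (('a \<Rightarrow> real) \<Rightarrow> real) \<Rightarrow> real" where
  "gauss H I f = (\<integral>x. f x * exp (- quad H I x / 2) \<partial>orthant I)"

text \<open>Only nonnegative vectors are tested: \<kappa> times a hyperbolic Gram matrix is in
  general indefinite, yet coercive on the orthant.\<close>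

definition coercive :: "real \<Rightarrow> ('a \<Rightarrow> 'a \<Rightarrow> real) \<Rightarrow> 'a set \<Rightarrow> bool" where
  "coercive c H I \<longleftrightarrow> c > 0 \<and> (\<forall>x. (\<forall>i\<in>I. 0 \<le> x i) \<longrightarrow> c * (\<Sum>i\<in>I. (x i)\<^sup>2) \<le> quad H I x)"

text \<open>One integrable majorant for every form with coercivity constant \<open>c\<close>. The
  polynomial factors dominate all monomials up to degree two, hence all moments that occur.\<close>

definition gauss_dom :: "real \<Rightarrow> 'a set \<Rightarrow> ('a \<Rightarrow> real) \<Rightarrow> real" where
  "gauss_dom c I x = (\<Prod>i\<in>I. (1 + x i)\<^sup>2 * exp (- (c * (x i)\<^sup>2 / 2)))"

lemma space_halfline [simp]: "space halfline = {0..}"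
  by (simp add: halfline_def space_restrict_space)

lemma product_sigma_finite_halfline: "product_sigma_finite (\<lambda>_::'a. halfline)"
  unfolding halfline_def product_sigma_finite_def
  by (auto intro!: sigma_finite_measure_restrict_space sigma_finite_lborel)

lemma measurable_halfline [measurable (raw)]: "f \<in> measurable borel M \<Longrightarrow> f \<in> measurable halfline M"
  unfolding halfline_def by (intro measurable_restrict_space1) simp

lemma measurable_orthant [measurable (raw)]: "i \<in> I \<Longrightarrow> (\<lambda>x. x i) \<in> borel_measurable (orthant I)"
  unfolding orthant_def
  by (rule measurable_compose[OF measurable_component_singleton[of i I "\<lambda>_. halfline"]]) auto

lemma orthant_nonneg: "x \<in> space (orthant I) \<Longrightarrow> i \<in> I \<Longrightarrow> 0 \<le> x i"
  by (auto simp: orthant_def space_PiM PiE_def Pi_def)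

lemma measurable_quad [measurable]: "quad H I \<in> borel_measurable (orthant I)"
  unfolding quad_def by measurable

lemma integrable_halfline: "integrable halfline f \<longleftrightarrow> set_integrable lborel {0..} f" for f :: "real \<Rightarrow> real"
  unfolding halfline_def set_integrable_def by (rule integrable_restrict_space) simp

lemma integral_halfline: "integral\<^sup>L halfline f = (LINT x:{0..}|lborel. f x)" for f :: "real \<Rightarrow> real"
  unfolding halfline_def set_lebesgue_integral_def by (rule integral_restrict_space) simp

lemma integrable_halfline_exp: "integrable halfline (\<lambda>x::real. exp (- 1 * x))"
  unfolding integrable_halfline
  using absolutely_integrable_on_iff_nonneg[of "{0..}" "\<lambda>x. exp (-1 * x)"]
    integrable_on_exp_minus_to_infinity[of 1 0]
  by (auto simp: integrable_completion set_integrable_def)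

lemma integrable_halfline_dom:
  fixes c :: real
  assumes "c > 0"
  shows "integrable halfline (\<lambda>x. (1 + x)\<^sup>2 * exp (- (c * x\<^sup>2 / 2)))"
proof -
  \<comment> \<open>The constant comes from (c x - 3)^2 \<ge> 0: together with (1 + x)^2 \<le> exp
    (2 x) it leaves the decay exp (- x).\<close>
  have "integrable halfline (\<lambda>x::real. exp (9 / (2 * c)) * exp (- 1 * x))"
    by (rule integrable_mult_right) (rule integrable_halfline_exp)
  then show ?thesis
  proof (rule Bochner_Integration.integrable_bound)
    show "AE x in halfline. norm ((1 + x)\<^sup>2 * exp (- (c * x\<^sup>2 / 2))) \<le> norm (exp (9 / (2 * c)) * exp (- 1 * x))"
    proof (rule AE_I2)
      fix x :: real assume "x \<in> space halfline"
      then have x: "x \<ge> 0" by simp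
      have "(1 + x)\<^sup>2 \<le> (exp x)\<^sup>2" using x exp_ge_add_one_self[of x] by (intro power_mono) auto
      also have "\<dots> = exp (2 * x)" by (simp add: exp_double)
      finally have "(1 + x)\<^sup>2 * exp (- (c * x\<^sup>2 / 2)) \<le> exp (2 * x) * exp (- (c * x\<^sup>2 / 2))" by simp
      also have "\<dots> = exp (2 * x - c * x\<^sup>2 / 2)" by (simp add: exp_add[symmetric])
      also have "\<dots> \<le> exp (9 / (2 * c) - x)"
      proof -
        have "0 \<le> (c * x - 3)\<^sup>2 / (2 * c)" using assms by simp
        also have "\<dots> = c * x\<^sup>2 / 2 - 3 * x + 9 / (2 * c)"
          using assms by (simp add: power2_eq_square field_simps)
        finally show ?thesis by simp
      qed
      finally show "norm ((1 + x)\<^sup>2 * exp (- (c * x\<^sup>2 / 2))) \<le> norm (exp (9 / (2 * c)) * exp (- 1 * x))"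
        by (simp add: exp_add[symmetric] exp_diff exp_minus field_simps)
    qed
  qed measurable
qed

lemma integrable_gauss_dom: "finite I \<Longrightarrow> c > 0 \<Longrightarrow> integrable (orthant I) (gauss_dom c I)"
proof -
  assume fin: "finite I" and c: "c > 0"
  interpret product_sigma_finite "\<lambda>_::'a. halfline" by (rule product_sigma_finite_halfline)
  show ?thesis unfolding orthant_def gauss_dom_def
    by (rule product_integrable_prod) (use fin c integrable_halfline_dom in auto)
qed

lemma gauss_dom_bound:
  assumes "finite I" "coercive c H I" "x \<in> space (orthant I)" "\<bar>f\<bar> \<le> B * (\<Prod>i\<in>I. (1 + x i)\<^sup>2)"
  shows "\<bar>f * exp (- quad H I x / 2)\<bar> \<le> B * gauss_dom c I x"
proof -
  have "c * (\<Sum>i\<in>I. (x i)\<^sup>2) \<le> quad H I x"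
    using assms orthant_nonneg[OF assms(3)] unfolding coercive_def by auto
  then have "exp (- quad H I x / 2) \<le> exp (\<Sum>i\<in>I. - (c * (x i)\<^sup>2 / 2))"
    by (simp add: sum_negf sum_divide_distrib[symmetric] sum_distrib_left)
  also have "\<dots> = (\<Prod>i\<in>I. exp (- (c * (x i)\<^sup>2 / 2)))" using assms(1) by (rule exp_sum)
  finally have e: "exp (- quad H I x / 2) \<le> (\<Prod>i\<in>I. exp (- (c * (x i)\<^sup>2 / 2)))" .
  have "\<bar>f * exp (- quad H I x / 2)\<bar> = \<bar>f\<bar> * exp (- quad H I x / 2)" by (simp add: abs_mult)
  also have "\<dots> \<le> (B * (\<Prod>i\<in>I. (1 + x i)\<^sup>2)) * (\<Prod>i\<in>I. exp (- (c * (x i)\<^sup>2 / 2)))"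
    using assms(4) e by (intro mult_mono) auto
  finally show ?thesis by (simp add: gauss_dom_def prod.distrib mult.assoc)
qed

lemma moment_bounds:
  fixes x :: "'a \<Rightarrow> real"
  assumes fin: "finite I" and nn: "\<And>i. i \<in> I \<Longrightarrow> 0 \<le> x i"
  shows "1 \<le> (\<Prod>i\<in>I. (1 + x i)\<^sup>2)"
    and "i \<in> I \<Longrightarrow> x i \<le> (\<Prod>i\<in>I. (1 + x i)\<^sup>2)"
    and "i \<in> I \<Longrightarrow> j \<in> I \<Longrightarrow> x i * x j \<le> (\<Prod>i\<in>I. (1 + x i)\<^sup>2)"
proof -
  let ?P = "\<Prod>i\<in>I. (1 + x i)"
  have P1: "1 \<le> ?P" using nn by (intro prod_ge_1) auto
  have Pi: "x i \<le> ?P" if i: "i \<in> I" for i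
  proof -
    have "x i \<le> (1 + x i) * 1" by simp
    also have "\<dots> \<le> (1 + x i) * (\<Prod>i\<in>I - {i}. (1 + x i))"
      using nn i by (intro mult_left_mono prod_ge_1) (auto simp: add_nonneg_nonneg)
    also have "\<dots> = ?P" using prod.remove[OF fin i, of "\<lambda>i. 1 + x i"] by simp
    finally show ?thesis .
  qed
  have sq: "(\<Prod>i\<in>I. (1 + x i)\<^sup>2) = ?P * ?P" by (simp add: prod.distrib power2_eq_square)
  show "1 \<le> (\<Prod>i\<in>I. (1 + x i)\<^sup>2)" unfolding sq using mult_mono[OF P1 P1] P1 by simp
  show "x i \<le> (\<Prod>i\<in>I. (1 + x i)\<^sup>2)" if "i \<in> I" unfolding sq using mult_mono[OF Pi P1] that P1 by simp
  show "x i * x j \<le> (\<Prod>i\<in>I. (1 + x i)\<^sup>2)" if "i \<in> I" "j \<in> I"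
    unfolding sq using that nn P1 by (intro mult_mono Pi) auto
qed

text \<open>The second bound depends on \<open>H\<close> only through \<open>c\<close>, so it is
  uniform along a motion on which \<open>c\<close> can be kept fixed.\<close>

lemma gauss_integrable:
  assumes "finite I" "coercive c H I" and f: "f \<in> borel_measurable (orthant I)"
    and b: "\<And>x. x \<in> space (orthant I) \<Longrightarrow> \<bar>f x\<bar> \<le> B * (\<Prod>i\<in>I. (1 + x i)\<^sup>2)"
  shows "integrable (orthant I) (\<lambda>x. f x * exp (- quad H I x / 2))"
    and "\<bar>gauss H I f\<bar> \<le> B * (\<integral>x. gauss_dom c I x \<partial>orthant I)"
proof -
  have c: "c > 0" using assms(2) by (simp add: coercive_def)
  have dom: "integrable (orthant I) (\<lambda>x. B * gauss_dom c I x)"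
    by (rule integrable_mult_right) (use integrable_gauss_dom assms(1) c in auto)
  note [measurable] = f
  have le: "\<bar>f x * exp (- quad H I x / 2)\<bar> \<le> B * gauss_dom c I x" if "x \<in> space (orthant I)" for x
    by (rule gauss_dom_bound[OF assms(1,2) that b[OF that]])
  show int: "integrable (orthant I) (\<lambda>x. f x * exp (- quad H I x / 2))"
    by (rule Bochner_Integration.integrable_bound[OF dom])
      (measurable, use order_trans[OF le abs_ge_self] in \<open>auto intro!: AE_I2\<close>)
  have "\<bar>gauss H I f\<bar> \<le> (\<integral>x. \<bar>f x * exp (- quad H I x / 2)\<bar> \<partial>orthant I)"
    unfolding gauss_def by (rule integral_abs_bound)
  also have "\<dots> \<le> (\<integral>x. B * gauss_dom c I x \<partial>orthant I)"
    using le int dom by (intro integral_mono integrable_abs) auto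
  finally show "\<bar>gauss H I f\<bar> \<le> B * (\<integral>x. gauss_dom c I x \<partial>orthant I)" by simp
qed

lemma gauss_moments_integrable:
  assumes "finite I" "coercive c H I"
  shows "integrable (orthant I) (\<lambda>x. exp (- quad H I x / 2))"
    and "i \<in> I \<Longrightarrow> integrable (orthant I) (\<lambda>x. x i * exp (- quad H I x / 2))"
    and "i \<in> I \<Longrightarrow> j \<in> I \<Longrightarrow> integrable (orthant I) (\<lambda>x. x i * x j * exp (- quad H I x / 2))"
proof -
  note mb = moment_bounds[OF assms(1)]
  show "integrable (orthant I) (\<lambda>x. exp (- quad H I x / 2))"
    using gauss_integrable(1)[OF assms, of "\<lambda>_. 1" 1] mb(1) orthant_nonneg by fastforce
  show "integrable (orthant I) (\<lambda>x. x i * exp (- quad H I x / 2))" if i: "i \<in> I"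
  proof (rule gauss_integrable(1)[OF assms, of _ 1])
    fix x assume x: "x \<in> space (orthant I)"
    show "\<bar>x i\<bar> \<le> 1 * (\<Prod>i\<in>I. (1 + x i)\<^sup>2)"
      using mb(2)[of x, OF orthant_nonneg[OF x] i] orthant_nonneg[OF x i] by simp
  qed (use i in measurable)
  show "integrable (orthant I) (\<lambda>x. x i * x j * exp (- quad H I x / 2))" if i: "i \<in> I" and j: "j \<in> I"
  proof (rule gauss_integrable(1)[OF assms, of _ 1])
    fix x assume x: "x \<in> space (orthant I)"
    show "\<bar>x i * x j\<bar> \<le> 1 * (\<Prod>i\<in>I. (1 + x i)\<^sup>2)"
      using mb(3)[of x, OF orthant_nonneg[OF x] i j] orthant_nonneg[OF x i] orthant_nonneg[OF x j]
      by (simp add: abs_mult)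
  qed (use i j in measurable)
qed

section \<open>Integration by parts on the half-line and on the orthant\<close>

lemma halfline_FTC:
  fixes f F :: "real \<Rightarrow> real"
  assumes int: "integrable halfline f"
    and F: "\<And>x. (F has_real_derivative f x) (at x)" and cont: "continuous_on UNIV f"
    and lim: "(F \<longlongrightarrow> 0) at_top"
  shows "integral\<^sup>L halfline f = - F 0"
proof -
  have "((\<lambda>b. LINT x:{0..b}|lborel. f x) \<longlongrightarrow> (LINT x:{0..}|lborel. f x)) at_top"
    by (rule tendsto_set_lebesgue_integral_at_top) (use int in \<open>auto simp: integrable_halfline\<close>)
  moreover have "((\<lambda>b. LINT x:{0..b}|lborel. f x) \<longlongrightarrow> 0 - F 0) at_top"
  proof (rule Lim_transform_eventually)
    show "((\<lambda>b. F b - F 0) \<longlongrightarrow> 0 - F 0) at_top" by (intro tendsto_intros lim)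
    show "\<forall>\<^sub>F b in at_top. F b - F 0 = (LINT x:{0..b}|lborel. f x)"
      using eventually_ge_at_top[of 0]
    proof eventually_elim
      case (elim b)
      have "(LINT x:{0..b}|lborel. f x) = F b - F 0"
        unfolding set_lebesgue_integral_def
        using elim F continuous_on_subset[OF cont]
        by (intro integral_FTC_atLeastAtMost)
          (auto simp: has_real_derivative_iff_has_vector_derivative[symmetric] intro: has_field_derivative_at_within)
      then show ?case by simp
    qed
  qed
  ultimately show ?thesis unfolding integral_halfline by (auto dest: tendsto_unique[rotated])
qed

lemma quad_insert:
  assumes fin: "finite I" "l \<notin> I" and sym: "\<And>j. j \<in> I \<Longrightarrow> H j l = H l j"
  shows "quad H (insert l I) (x(l := y)) = H l l * y\<^sup>2 + 2 * (\<Sum>j\<in>I. H l j * x j) * y + quad H I x"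
proof -
  have eq: "(x(l := y)) i = x i" if "i \<in> I" for i using that fin by auto
  have "quad H (insert l I) (x(l := y)) = H l l * y * y + (\<Sum>j\<in>I. H l j * y * (x(l := y)) j) +
      ((\<Sum>i\<in>I. H i l * (x(l := y)) i * y) + (\<Sum>i\<in>I. \<Sum>j\<in>I. H i j * (x(l := y)) i * (x(l := y)) j))"
    unfolding quad_def using fin by (simp add: sum.distrib del: fun_upd_apply) simp
  also have "(\<Sum>i\<in>I. \<Sum>j\<in>I. H i j * (x(l := y)) i * (x(l := y)) j) = (\<Sum>i\<in>I. \<Sum>j\<in>I. H i j * x i * x j)"
    using eq by (intro sum.cong refl) simp
  also have "(\<Sum>i\<in>I. H i l * (x(l := y)) i * y) = (\<Sum>j\<in>I. H l j * x j) * y"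
    unfolding sum_distrib_right using eq sym by (intro sum.cong refl) simp
  also have "(\<Sum>j\<in>I. H l j * y * (x(l := y)) j) = (\<Sum>j\<in>I. H l j * x j) * y"
    unfolding sum_distrib_right using eq by (intro sum.cong refl) simp
  finally show ?thesis by (simp add: quad_def power2_eq_square algebra_simps)
qed

lemma coercive_subset:
  assumes "coercive c H F" "I \<subseteq> F" "finite F"
  shows "coercive c H I"
  unfolding coercive_def
proof (intro conjI allI impI)
  show "c > 0" using assms(1) by (simp add: coercive_def)
  fix x :: "'a \<Rightarrow> real" assume x: "\<forall>i\<in>I. 0 \<le> x i"
  define y where "y i = (if i \<in> I then x i else 0)" for i
  have finI: "finite I" using assms finite_subset by blast
  have "c * (\<Sum>i\<in>F. (y i)\<^sup>2) \<le> quad H F y"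
    using assms(1) x unfolding coercive_def by (elim conjE allE[of _ y]) (auto simp: y_def)
  moreover have "(\<Sum>i\<in>F. (y i)\<^sup>2) = (\<Sum>i\<in>I. (x i)\<^sup>2)"
    using assms finI by (intro sum.mono_neutral_cong_right) (auto simp: y_def)
  moreover have "quad H F y = quad H I x"
  proof -
    have "(\<Sum>j\<in>F. H i j * y i * y j) = (\<Sum>j\<in>I. H i j * y i * x j)" for i
      using assms finI by (intro sum.mono_neutral_cong_right) (auto simp: y_def)
    moreover have "(\<Sum>i\<in>F. \<Sum>j\<in>I. H i j * y i * x j) = (\<Sum>i\<in>I. \<Sum>j\<in>I. H i j * x i * x j)"
      using assms finI by (intro sum.mono_neutral_cong_right) (auto simp: y_def)
    ultimately show ?thesis by (simp add: quad_def)
  qed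
  ultimately show "c * (\<Sum>i\<in>I. (x i)\<^sup>2) \<le> quad H I x" by simp
qed

lemma coercive_diag:
  assumes "coercive c H F" "l \<in> F" "finite F"
  shows "H l l > 0"
proof -
  have "coercive c H {l}" using coercive_subset[OF assms(1)] assms by auto
  then have "c * (\<Sum>i\<in>{l}. 1\<^sup>2) \<le> quad H {l} (\<lambda>_. 1)" and "c > 0"
    unfolding coercive_def by (auto dest: spec[of _ "\<lambda>_. 1"])
  then show ?thesis by (simp add: quad_def)
qed

lemma integrable_halfline_gauss:
  fixes a b r :: real and p :: "real \<Rightarrow> real"
  assumes a: "a > 0" and p: "p \<in> borel_measurable borel" "\<And>y. y \<ge> 0 \<Longrightarrow> \<bar>p y\<bar> \<le> B * (1 + y)\<^sup>2"
  shows "integrable halfline (\<lambda>y. p y * exp (- (a * y\<^sup>2 + 2 * b * y + r) / 2))"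
proof -
  \<comment> \<open>Half of the quadratic decay is kept for the majorant. Completing the square in
    the other half absorbs the linear term and produces b^2 / a.\<close>
  let ?K = "exp (b\<^sup>2 / a - r / 2)"
  have "integrable halfline (\<lambda>y. B * ?K * ((1 + y)\<^sup>2 * exp (- (a / 2 * y\<^sup>2 / 2))))"
    using a by (intro integrable_mult_right integrable_halfline_dom) auto
  then show ?thesis
  proof (rule Bochner_Integration.integrable_bound)
    show "AE y in halfline. norm (p y * exp (- (a * y\<^sup>2 + 2 * b * y + r) / 2))
        \<le> norm (B * ?K * ((1 + y)\<^sup>2 * exp (- (a / 2 * y\<^sup>2 / 2))))"
    proof (rule AE_I2)
      fix y assume "y \<in> space halfline"
      then have y: "y \<ge> 0" by simp
      have "0 \<le> (a * y + 2 * b)\<^sup>2 / (4 * a)" using a by simp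
      also have "\<dots> = a * y\<^sup>2 / 4 + b * y + b\<^sup>2 / a"
        using a by (simp add: power2_eq_square field_simps)
      finally have "exp (- (a * y\<^sup>2 + 2 * b * y + r) / 2) \<le> exp ((b\<^sup>2 / a - r / 2) + (- (a / 2 * y\<^sup>2 / 2)))"
        unfolding exp_le_cancel_iff by (simp add: add_divide_distrib diff_divide_distrib)
      also have "\<dots> = ?K * exp (- (a / 2 * y\<^sup>2 / 2))" by (rule exp_add)
      finally have "\<bar>p y\<bar> * exp (- (a * y\<^sup>2 + 2 * b * y + r) / 2) \<le> (B * (1 + y)\<^sup>2) * (?K * exp (- (a / 2 * y\<^sup>2 / 2)))"
        using p(2)[OF y] by (intro mult_mono) auto
      also have "\<dots> \<le> norm (B * ?K * ((1 + y)\<^sup>2 * exp (- (a / 2 * y\<^sup>2 / 2))))"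
        by (simp add: mult_ac)
      finally show "norm (p y * exp (- (a * y\<^sup>2 + 2 * b * y + r) / 2)) \<le> norm (B * ?K * ((1 + y)\<^sup>2 * exp (- (a / 2 * y\<^sup>2 / 2))))"
        by (simp add: abs_mult)
    qed
  qed (use p(1) in measurable)
qed

text \<open>(a y + b) u has the antiderivative - u, and y (a y + b) u - u has - y u. The boundary
  value exp (- r / 2) of the first becomes, after integration over the other variables, the Gaussian
  of a facet; the second is zero at y = 0.\<close>

lemma halfline_gauss_ibp:
  fixes a b r :: real
  assumes a: "a > 0"
  defines "u \<equiv> \<lambda>y. exp (- (a * y\<^sup>2 + 2 * b * y + r) / 2)"
  shows "(\<integral>y. (a * y + b) * u y \<partial>halfline) = exp (- r / 2)"
    and "(\<integral>y. y * (a * y + b) * u y \<partial>halfline) = (\<integral>y. u y \<partial>halfline)"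
proof -
  have du: "((\<lambda>y. - u y) has_real_derivative (a * y + b) * u y) (at y)" for y
    unfolding u_def by (auto intro!: derivative_eq_intros simp: field_simps)
  have dyu: "((\<lambda>y. - y * u y) has_real_derivative y * (a * y + b) * u y - u y) (at y)" for y
    unfolding u_def by (auto intro!: derivative_eq_intros simp: field_simps)
  have cont: "continuous_on UNIV u" unfolding u_def by (intro continuous_intros) auto
  have quadb: "\<bar>p + q * y + s * y\<^sup>2\<bar> \<le> (\<bar>p\<bar> + \<bar>q\<bar> + \<bar>s\<bar>) * (1 + y)\<^sup>2" if "y \<ge> 0" for p q s y :: real
  proof -
    have "\<bar>p + q * y + s * y\<^sup>2\<bar> \<le> \<bar>p\<bar> * 1 + \<bar>q\<bar> * y + \<bar>s\<bar> * y\<^sup>2"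
      using that by (simp add: abs_mult order_trans[OF abs_triangle_ineq] order_trans[OF abs_triangle_ineq add_right_mono])
    also have "\<dots> \<le> \<bar>p\<bar> * (1 + y)\<^sup>2 + \<bar>q\<bar> * (1 + y)\<^sup>2 + \<bar>s\<bar> * (1 + y)\<^sup>2"
      using that by (intro add_mono mult_left_mono) (auto simp: power2_eq_square algebra_simps)
    finally show ?thesis by (simp add: algebra_simps)
  qed
  have int1: "integrable halfline (\<lambda>y. (a * y + b) * u y)"
    unfolding u_def by (rule integrable_halfline_gauss[OF a, of _ "\<bar>b\<bar> + \<bar>a\<bar> + \<bar>0\<bar>"])
      (measurable, use quadb[of _ b a 0] in \<open>simp add: add.commute\<close>)
  have int2: "integrable halfline (\<lambda>y. y * (a * y + b) * u y)"
    unfolding u_def by (rule integrable_halfline_gauss[OF a, of _ "\<bar>0\<bar> + \<bar>b\<bar> + \<bar>a\<bar>"])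
      (measurable, use quadb[of _ 0 b a] in \<open>simp add: power2_eq_square algebra_simps\<close>)
  have int0: "integrable halfline u"
    using integrable_halfline_gauss[OF a, of "\<lambda>_. 1" 1 b r] unfolding u_def by (simp add: power2_eq_square algebra_simps)
  have lim1: "((\<lambda>y. - u y) \<longlongrightarrow> 0) at_top" and lim2: "((\<lambda>y. - y * u y) \<longlongrightarrow> 0) at_top"
    unfolding u_def using a by real_asymp+
  show "(\<integral>y. (a * y + b) * u y \<partial>halfline) = exp (- r / 2)"
    by (subst halfline_FTC[OF int1 du _ lim1]) (auto intro!: continuous_intros cont simp: u_def)
  have "(\<integral>y. y * (a * y + b) * u y - u y \<partial>halfline) = 0"
    by (subst halfline_FTC[OF _ dyu _ lim2]) (auto intro!: continuous_intros cont int2 int0)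
  then show "(\<integral>y. y * (a * y + b) * u y \<partial>halfline) = (\<integral>y. u y \<partial>halfline)"
    using int2 int0 by (simp add: Bochner_Integration.integral_diff)
qed

lemma gauss_insert:
  assumes "finite I" "l \<notin> I" "integrable (orthant (insert l I)) (\<lambda>x. f x * exp (- quad H (insert l I) x / 2))"
  shows "gauss H (insert l I) f =
     (\<integral>x. (\<integral>y. f (x(l := y)) * exp (- quad H (insert l I) (x(l := y)) / 2) \<partial>halfline) \<partial>orthant I)"
proof -
  interpret product_sigma_finite "\<lambda>_::'a. halfline" by (rule product_sigma_finite_halfline)
  show ?thesis using product_integral_insert[OF assms(1,2)] assms(3) unfolding gauss_def orthant_def by simp
qed

context
  fixes c :: real and H :: "'a \<Rightarrow> 'a \<Rightarrow> real" and F :: "'a set"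
  assumes fin: "finite F" and co: "coercive c H F" and sym: "\<And>i j. i \<in> F \<Longrightarrow> j \<in> F \<Longrightarrow> H i j = H j i"
begin

lemma quad_slice:
  assumes l: "l \<in> F"
  shows "(\<Sum>b\<in>F. H l b * (x(l := y)) b) = H l l * y + (\<Sum>j\<in>F - {l}. H l j * x j)"
    and "quad H F (x(l := y)) = H l l * y\<^sup>2 + 2 * (\<Sum>j\<in>F - {l}. H l j * x j) * y + quad H (F - {l}) x"
proof -
  have "(\<Sum>b\<in>F - {l}. H l b * (x(l := y)) b) = (\<Sum>j\<in>F - {l}. H l j * x j)"
    by (intro sum.cong) auto
  then show "(\<Sum>b\<in>F. H l b * (x(l := y)) b) = H l l * y + (\<Sum>j\<in>F - {l}. H l j * x j)"
    using sum.remove[OF fin l, of "\<lambda>b. H l b * (x(l := y)) b"] by simp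
  show "quad H F (x(l := y)) = H l l * y\<^sup>2 + 2 * (\<Sum>j\<in>F - {l}. H l j * x j) * y + quad H (F - {l}) x"
    using quad_insert[of "F - {l}" l H x y] fin l sym by (simp add: insert_absorb)
qed

text \<open>The derivative of the Gaussian in direction \<open>l\<close> integrates to its boundary
  value on x l = 0, that is on the facet \<open>F - {l}\<close>.\<close>

lemma gauss_ibp_one:
  assumes l: "l \<in> F"
  shows "(\<Sum>b\<in>F. H l b * gauss H F (\<lambda>x. x b)) = gauss H (F - {l}) (\<lambda>_. 1)"
proof -
  let ?I = "F - {l}"
  have ins: "insert l ?I = F" and I: "finite ?I" "l \<notin> ?I" using l fin by auto
  have int: "integrable (orthant F) (\<lambda>x. (\<Sum>b\<in>F. H l b * x b) * exp (- quad H F x / 2))"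
    unfolding sum_distrib_right mult.assoc
    by (intro Bochner_Integration.integrable_sum integrable_mult_right gauss_moments_integrable(2)[OF fin co])
  have "(\<Sum>b\<in>F. H l b * gauss H F (\<lambda>x. x b)) = gauss H F (\<lambda>x. \<Sum>b\<in>F. H l b * x b)"
    unfolding gauss_def sum_distrib_right mult.assoc
    by (subst Bochner_Integration.integral_sum, intro integrable_mult_right gauss_moments_integrable(2)[OF fin co], assumption)
       (simp only: integral_mult_right_zero)
  also have "\<dots> = (\<integral>x. (\<integral>y. (\<Sum>b\<in>F. H l b * (x(l := y)) b) * exp (- quad H F (x(l := y)) / 2) \<partial>halfline) \<partial>orthant ?I)"
    using gauss_insert[OF I, of "\<lambda>x. \<Sum>b\<in>F. H l b * x b" H] int unfolding ins by simp
  also have "\<dots> = (\<integral>x. exp (- quad H ?I x / 2) \<partial>orthant ?I)"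
    unfolding quad_slice[OF l] by (intro Bochner_Integration.integral_cong refl halfline_gauss_ibp(1) coercive_diag[OF co l fin])
  finally show ?thesis by (simp add: gauss_def)
qed

text \<open>For \<open>l = i\<close> the extra factor \<open>x i\<close> vanishes on the boundary
  while its derivative contributes the total mass; for other \<open>l\<close> it survives on the
  facet.\<close>

lemma gauss_ibp_coord:
  assumes l: "l \<in> F" and i: "i \<in> F"
  shows "(\<Sum>b\<in>F. H l b * gauss H F (\<lambda>x. x i * x b)) =
     (if l = i then gauss H F (\<lambda>_. 1) else gauss H (F - {l}) (\<lambda>x. x i))"
proof -
  let ?I = "F - {l}"
  have ins: "insert l ?I = F" and I: "finite ?I" "l \<notin> ?I" using l fin by auto
  have mu: "(\<Sum>b\<in>F. H l b * (x i * x b)) = x i * (\<Sum>b\<in>F. H l b * x b)" for x :: "'a \<Rightarrow> real"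
    by (simp add: sum_distrib_left mult_ac)
  have int: "integrable (orthant F) (\<lambda>x. (\<Sum>b\<in>F. H l b * (x i * x b)) * exp (- quad H F x / 2))"
    unfolding sum_distrib_right mult.assoc[of "H l _"]
    by (intro Bochner_Integration.integrable_sum integrable_mult_right gauss_moments_integrable(3)[OF fin co] i)
  have "(\<Sum>b\<in>F. H l b * gauss H F (\<lambda>x. x i * x b)) = gauss H F (\<lambda>x. \<Sum>b\<in>F. H l b * (x i * x b))"
    unfolding gauss_def sum_distrib_right mult.assoc[of "H l _"]
    by (subst Bochner_Integration.integral_sum, intro integrable_mult_right gauss_moments_integrable(3)[OF fin co] i, assumption)
       (simp only: integral_mult_right_zero)
  also have "\<dots> = (\<integral>x. (\<integral>y. (x(l := y)) i * (\<Sum>b\<in>F. H l b * (x(l := y)) b) * exp (- quad H F (x(l := y)) / 2) \<partial>halfline) \<partial>orthant ?I)"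
    using gauss_insert[OF I, of "\<lambda>x. x i * (\<Sum>b\<in>F. H l b * x b)" H] int unfolding ins mu by simp
  also have "\<dots> = (if l = i then gauss H F (\<lambda>_. 1) else gauss H (F - {l}) (\<lambda>x. x i))"
  proof (cases "l = i")
    case True
    have "(\<integral>x. (\<integral>y. (x(l := y)) i * (\<Sum>b\<in>F. H l b * (x(l := y)) b) * exp (- quad H F (x(l := y)) / 2) \<partial>halfline) \<partial>orthant ?I)
       = (\<integral>x. (\<integral>y. 1 * exp (- quad H F (x(l := y)) / 2) \<partial>halfline) \<partial>orthant ?I)"
      unfolding quad_slice[OF l]
    proof (rule Bochner_Integration.integral_cong[OF refl])
      fix x
      show "(\<integral>y. (x(l := y)) i * (H l l * y + (\<Sum>j\<in>?I. H l j * x j)) *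
          exp (- (H l l * y\<^sup>2 + 2 * (\<Sum>j\<in>?I. H l j * x j) * y + quad H ?I x) / 2) \<partial>halfline) =
        (\<integral>y. 1 * exp (- (H l l * y\<^sup>2 + 2 * (\<Sum>j\<in>?I. H l j * x j) * y + quad H ?I x) / 2) \<partial>halfline)"
        using halfline_gauss_ibp(2)[OF coercive_diag[OF co l fin]] True by (simp only: fun_upd_same mult_1)
    qed
    also have "\<dots> = gauss H F (\<lambda>_. 1)"
      using gauss_insert[OF I, of "\<lambda>_. 1" H] gauss_moments_integrable(1)[OF fin co] unfolding ins by simp
    finally show ?thesis using True by simp
  next
    case False
    have "(\<integral>x. (\<integral>y. (x(l := y)) i * (\<Sum>b\<in>F. H l b * (x(l := y)) b) * exp (- quad H F (x(l := y)) / 2) \<partial>halfline) \<partial>orthant ?I)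
       = (\<integral>x. x i * exp (- quad H ?I x / 2) \<partial>orthant ?I)"
      unfolding quad_slice[OF l]
      by (intro Bochner_Integration.integral_cong refl)
         (simp only: fun_upd_other[OF False[symmetric]] mult.assoc[of "_ i"] integral_mult_right_zero halfline_gauss_ibp(1)[OF coercive_diag[OF co l fin]])
    then show ?thesis using False by (simp add: gauss_def)
  qed
  finally show ?thesis .
qed

end

section \<open>Differentiation of a Gaussian integral with respect to its form\<close>

lemma abs_exp_diff_le:
  fixes a b m :: real
  assumes "m \<le> a" "m \<le> b"
  shows "\<bar>exp (- a) - exp (- b)\<bar> \<le> \<bar>a - b\<bar> * exp (- m)"
proof -
  have *: "\<bar>exp (- a) - exp (- b)\<bar> \<le> \<bar>a - b\<bar> * exp (- m)" if "a \<le> b" "m \<le> a" for a b :: real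
  proof -
    have "exp (- b) = exp (- a) * exp (- (b - a))" by (simp add: exp_add[symmetric])
    then have "exp (- a) - exp (- b) = exp (- a) * (1 - exp (- (b - a)))" by (simp add: algebra_simps)
    moreover have "1 - exp (- (b - a)) \<le> b - a" using exp_ge_add_one_self[of "- (b - a)"] by linarith
    moreover have "0 \<le> 1 - exp (- (b - a))" using that by simp
    ultimately have "\<bar>exp (- a) - exp (- b)\<bar> \<le> exp (- a) * (b - a)"
      by (simp add: abs_mult mult_left_mono)
    also have "\<dots> \<le> exp (- m) * (b - a)" using that by (intro mult_right_mono) auto
    finally show ?thesis using that by (simp add: mult.commute)
  qed
  show ?thesis using *[of a b] *[of b a] assms by (cases "a \<le> b") (auto simp: abs_minus_commute)
qed

text \<open>Dominated convergence for the difference quotients, for which a common coercivity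
  constant supplies a common majorant. The derivative is taken within \<open>S\<close> to admit
  one-sided derivatives at time 0.\<close>

lemma gauss_has_derivative:
  fixes H :: "real \<Rightarrow> 'a \<Rightarrow> 'a \<Rightarrow> real"
  assumes fin: "finite I" and t: "coercive c (H t) I"
    and co: "\<forall>\<^sub>F s in at t within S. coercive c (H s) I"
    and H: "\<And>i j. i \<in> I \<Longrightarrow> j \<in> I \<Longrightarrow> ((\<lambda>s. H s i j) has_real_derivative H' i j) (at t within S)"
  shows "((\<lambda>s. gauss (H s) I (\<lambda>_. 1)) has_real_derivative
     - (\<Sum>i\<in>I. \<Sum>j\<in>I. H' i j * gauss (H t) I (\<lambda>x. x i * x j)) / 2) (at t within S)"
proof -
  \<comment> \<open>\<bar>H' i j\<bar> + 1 bounds the difference quotients of the entries near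
    \<open>t\<close>; the 2 is the one in the exponent.\<close>
  define K where "K = (\<Sum>i\<in>I. \<Sum>j\<in>I. (\<bar>H' i j\<bar> + 1) / 2)"
  define D where "D x = - (\<Sum>i\<in>I. \<Sum>j\<in>I. H' i j * (x i * x j)) / 2 * exp (- quad (H t) I x / 2)" for x
  define q where "q s x = (exp (- quad (H s) I x / 2) - exp (- quad (H t) I x / 2)) / (s - t)" for s x
  have Heq: "((\<lambda>s. (H s i j - H t i j) / (s - t)) \<longlongrightarrow> H' i j) (at t within S)" if "i \<in> I" "j \<in> I" for i j
    using H[OF that] by (simp add: has_field_derivative_iff)
  have lip: "\<forall>\<^sub>F s in at t within S. \<bar>H s i j - H t i j\<bar> \<le> (\<bar>H' i j\<bar> + 1) * \<bar>s - t\<bar>" if "i \<in> I" "j \<in> I" for i j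
  proof -
    have "\<forall>\<^sub>F s in at t within S. \<bar>(H s i j - H t i j) / (s - t)\<bar> < \<bar>H' i j\<bar> + 1"
      using tendsto_rabs[OF Heq[OF that]] by (rule order_tendstoD) simp
    moreover have "\<forall>\<^sub>F s in at t within S. s \<noteq> t" by (simp add: eventually_at_filter)
    ultimately show ?thesis
      by eventually_elim (auto simp: abs_divide divide_less_eq split: if_splits)
  qed
  have bound: "\<bar>q s x\<bar> \<le> K * gauss_dom c I x"
    if s: "s \<noteq> t" "coercive c (H s) I" "\<And>i j. i \<in> I \<Longrightarrow> j \<in> I \<Longrightarrow> \<bar>H s i j - H t i j\<bar> \<le> (\<bar>H' i j\<bar> + 1) * \<bar>s - t\<bar>"
      and x: "x \<in> space (orthant I)" for s x
  proof -
    let ?m = "\<Sum>i\<in>I. c * (x i)\<^sup>2 / 2" and ?P = "\<Prod>i\<in>I. (1 + x i)\<^sup>2"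
    note nn = orthant_nonneg[OF x]
    have m: "?m \<le> quad (H s) I x / 2" "?m \<le> quad (H t) I x / 2"
      using s(2) t nn unfolding coercive_def by (auto simp: sum_divide_distrib[symmetric] sum_distrib_left[symmetric])
    have dq: "\<bar>quad (H s) I x / 2 - quad (H t) I x / 2\<bar> \<le> K * ?P * \<bar>s - t\<bar>"
    proof -
      have "quad (H s) I x / 2 - quad (H t) I x / 2 = (\<Sum>i\<in>I. \<Sum>j\<in>I. (H s i j - H t i j) * (x i * x j) / 2)"
        unfolding quad_def sum_divide_distrib sum_subtractf[symmetric]
        by (intro sum.cong refl) (simp add: algebra_simps diff_divide_distrib)
      also have "\<bar>\<dots>\<bar> \<le> (\<Sum>i\<in>I. \<Sum>j\<in>I. (\<bar>H' i j\<bar> + 1) / 2 * ?P * \<bar>s - t\<bar>)"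
      proof (intro order_trans[OF sum_abs] sum_mono order_trans[OF sum_abs])
        fix i j assume ij: "i \<in> I" "j \<in> I"
        have "\<bar>(H s i j - H t i j) * (x i * x j) / 2\<bar> = \<bar>H s i j - H t i j\<bar> * (x i * x j) / 2"
          using nn ij by (simp add: abs_mult)
        also have "\<dots> \<le> ((\<bar>H' i j\<bar> + 1) * \<bar>s - t\<bar>) * ?P / 2"
          using s(3)[OF ij] moment_bounds(3)[OF fin nn ij] nn ij by (intro divide_right_mono mult_mono) auto
        finally show "\<bar>(H s i j - H t i j) * (x i * x j) / 2\<bar> \<le> (\<bar>H' i j\<bar> + 1) / 2 * ?P * \<bar>s - t\<bar>"
          by (simp add: mult_ac)
      qed
      also have "\<dots> = K * ?P * \<bar>s - t\<bar>" by (simp add: K_def sum_distrib_right)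
      finally show ?thesis .
    qed
    have "\<bar>exp (- quad (H s) I x / 2) - exp (- quad (H t) I x / 2)\<bar> \<le> K * ?P * \<bar>s - t\<bar> * exp (- ?m)"
      using order_trans[OF abs_exp_diff_le[OF m] mult_right_mono[OF dq, of "exp (- ?m)"]] by simp
    then have "\<bar>q s x\<bar> \<le> K * ?P * exp (- ?m)"
      using s(1) by (simp add: q_def abs_divide divide_le_eq mult_ac)
    also have "K * ?P * exp (- ?m) = K * gauss_dom c I x"
      using fin by (simp add: gauss_dom_def prod.distrib exp_sum sum_negf[symmetric])
    finally show ?thesis .
  qed
  have pt: "((\<lambda>s. q s x) \<longlongrightarrow> D x) (at t within S)" for x
  proof -
    have "((\<lambda>s. exp (- quad (H s) I x / 2)) has_real_derivative
        exp (- quad (H t) I x / 2) * (- (\<Sum>i\<in>I. \<Sum>j\<in>I. H' i j * x i * x j) / 2)) (at t within S)"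
      unfolding quad_def
      by (rule derivative_eq_intros H refl | simp)+
    then show ?thesis unfolding q_def D_def has_field_derivative_iff by (simp add: mult_ac)
  qed
  have intD: "integral\<^sup>L (orthant I) D = - (\<Sum>i\<in>I. \<Sum>j\<in>I. H' i j * gauss (H t) I (\<lambda>x. x i * x j)) / 2"
  proof -
    let ?e = "\<lambda>x. exp (- quad (H t) I x / 2)"
    have "D x = - (1/2) * (\<Sum>i\<in>I. \<Sum>j\<in>I. H' i j * (x i * x j * ?e x))" for x
    proof -
      have "(\<Sum>i\<in>I. \<Sum>j\<in>I. H' i j * (x i * x j * ?e x)) = (\<Sum>i\<in>I. \<Sum>j\<in>I. H' i j * (x i * x j)) * ?e x"
        by (simp add: sum_distrib_right mult.assoc)
      then show ?thesis by (simp add: D_def)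
    qed
    then have "D = (\<lambda>x. - (1/2) * (\<Sum>i\<in>I. \<Sum>j\<in>I. H' i j * (x i * x j * ?e x)))" by (rule ext)
    then have "integral\<^sup>L (orthant I) D = - (1/2) * (\<integral>x. (\<Sum>i\<in>I. \<Sum>j\<in>I. H' i j * (x i * x j * ?e x)) \<partial>orthant I)"
      by (simp only: integral_mult_right_zero)
    also have "(\<integral>x. (\<Sum>i\<in>I. \<Sum>j\<in>I. H' i j * (x i * x j * ?e x)) \<partial>orthant I) =
       (\<Sum>i\<in>I. \<Sum>j\<in>I. H' i j * gauss (H t) I (\<lambda>x. x i * x j))"
      unfolding gauss_def
      apply (subst Bochner_Integration.integral_sum)
       apply (intro Bochner_Integration.integrable_sum integrable_mult_right gauss_moments_integrable(3)[OF fin t], assumption+)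
      apply (rule sum.cong[OF refl])
      apply (subst Bochner_Integration.integral_sum)
       apply (intro integrable_mult_right gauss_moments_integrable(3)[OF fin t], assumption+)
      apply (simp only: integral_mult_right_zero)
      done
    finally show ?thesis by simp
  qed
  have "((\<lambda>s. integral\<^sup>L (orthant I) (q s)) \<longlongrightarrow> integral\<^sup>L (orthant I) D) (at t within S)"
    \<comment> \<open>Dominated convergence concerns sequences. The eventual bounds hold from some
      index \<open>N\<close> on, and the sequence is shifted by \<open>N\<close>.\<close>
    unfolding tendsto_at_iff_sequentially
  proof (intro allI impI)
    fix X assume X: "\<forall>i. X i \<in> S - {t}" "X \<longlonglongrightarrow> t"
    have flim: "filterlim X (at t within S) sequentially"
      using X by (auto simp: filterlim_at)
    have ev: "\<forall>\<^sub>F s in at t within S. \<forall>i\<in>I. \<forall>j\<in>I. \<bar>H s i j - H t i j\<bar> \<le> (\<bar>H' i j\<bar> + 1) * \<bar>s - t\<bar>"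
      using lip by (intro eventually_ball_finite ballI fin) auto
    have "\<forall>\<^sub>F n in sequentially. coercive c (H (X n)) I \<and> (\<forall>i\<in>I. \<forall>j\<in>I. \<bar>H (X n) i j - H t i j\<bar> \<le> (\<bar>H' i j\<bar> + 1) * \<bar>X n - t\<bar>)"
      using eventually_compose_filterlim[OF eventually_conj[OF co ev] flim] .
    then obtain N where N: "\<And>n. n \<ge> N \<Longrightarrow> coercive c (H (X n)) I \<and> (\<forall>i\<in>I. \<forall>j\<in>I. \<bar>H (X n) i j - H t i j\<bar> \<le> (\<bar>H' i j\<bar> + 1) * \<bar>X n - t\<bar>)"
      by (auto simp: eventually_sequentially)
    have "(\<lambda>n. integral\<^sup>L (orthant I) (q (X (n + N)))) \<longlonglongrightarrow> integral\<^sup>L (orthant I) D"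
    proof (rule integral_dominated_convergence)
      show "integrable (orthant I) (\<lambda>x. K * gauss_dom c I x)"
        using integrable_gauss_dom[OF fin, of c] t by (simp add: coercive_def)
      show "D \<in> borel_measurable (orthant I)" unfolding D_def by measurable
      show "q (X (n + N)) \<in> borel_measurable (orthant I)" for n unfolding q_def by measurable
      show "AE x in orthant I. (\<lambda>n. q (X (n + N)) x) \<longlonglongrightarrow> D x"
        using filterlim_compose[OF pt flim] by (intro AE_I2 LIMSEQ_ignore_initial_segment)
      show "AE x in orthant I. norm (q (X (n + N)) x) \<le> K * gauss_dom c I x" for n
        using bound[of "X (n + N)"] N[of "n + N"] X(1) by (intro AE_I2) auto
    qed
    then show "((\<lambda>s. integral\<^sup>L (orthant I) (q s)) \<circ> X) \<longlonglongrightarrow> integral\<^sup>L (orthant I) D"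
      unfolding comp_def by (rule LIMSEQ_offset)
  qed
  moreover have "\<forall>\<^sub>F s in at t within S. integral\<^sup>L (orthant I) (q s) =
     (gauss (H s) I (\<lambda>_. 1) - gauss (H t) I (\<lambda>_. 1)) / (s - t)"
    using co
  proof eventually_elim
    case (elim s)
    show ?case unfolding q_def gauss_def
      using gauss_moments_integrable(1)[OF fin elim] gauss_moments_integrable(1)[OF fin t]
      by (simp add: integral_divide_zero Bochner_Integration.integral_diff)
  qed
  ultimately have "((\<lambda>s. (gauss (H s) I (\<lambda>_. 1) - gauss (H t) I (\<lambda>_. 1)) / (s - t)) \<longlongrightarrow> integral\<^sup>L (orthant I) D) (at t within S)"
    by (rule Lim_transform_eventually)
  then show ?thesis unfolding intD has_field_derivative_iff .
qed

section \<open>From orthants to simplices\<close>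

lemma product_sigma_finite_lborel: "product_sigma_finite (\<lambda>_::'a. lborel :: real measure)"
  by standard

lemma measurable_PiM_lborel_orthant [measurable (raw)]:
  "f \<in> borel_measurable (PiM I (\<lambda>_. lborel)) \<Longrightarrow> f \<in> borel_measurable (orthant I)" for f :: "('a \<Rightarrow> real) \<Rightarrow> ennreal"
proof -
  assume f: "f \<in> borel_measurable (PiM I (\<lambda>_. lborel))"
  have "(\<lambda>x. x) \<in> measurable (orthant I) (PiM I (\<lambda>_. lborel))"
  proof (rule measurable_PiM_single')
    show "(\<lambda>x. x) \<in> space (orthant I) \<rightarrow> (\<Pi>\<^sub>E i\<in>I. space lborel)"
      by (auto simp: orthant_def space_PiM)
  qed auto
  from measurable_compose[OF this f] show ?thesis by simp
qed

lemma measurable_indicator_nonneg: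
  assumes "finite J" "J \<subseteq> I"
  shows "(\<lambda>x. indicator {x. \<forall>i\<in>J. 0 \<le> x i} x :: ennreal) \<in> borel_measurable (PiM I (\<lambda>_. lborel :: real measure))"
proof -
  have "(\<lambda>x. indicator {x. \<forall>i\<in>J. 0 \<le> x i} x :: ennreal) = (\<lambda>x. \<Prod>i\<in>J. indicator {0::real..} (x i))"
    using assms(1) by (induction J) (auto simp: fun_eq_iff indicator_def)
  also have "\<dots> \<in> borel_measurable (PiM I (\<lambda>_. lborel))"
  proof (rule borel_measurable_prod_ennreal)
    fix i assume "i \<in> J"
    then have "i \<in> I" using assms by auto
    show "(\<lambda>x. indicator {0::real..} (x i) :: ennreal) \<in> borel_measurable (PiM I (\<lambda>_. lborel :: real measure))"
      by (rule measurable_compose[OF measurable_component_singleton[OF \<open>i \<in> I\<close>]]) simp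
  qed
  finally show ?thesis .
qed

lemma nn_integral_halfline:
  "(\<integral>\<^sup>+y. f y \<partial>halfline) = (\<integral>\<^sup>+y. f y * indicator {0..} y \<partial>lborel)"
  unfolding halfline_def by (rule nn_integral_restrict_space) simp

lemma nn_integral_orthant:
  fixes f :: "('a \<Rightarrow> real) \<Rightarrow> ennreal"
  assumes "finite I" "f \<in> borel_measurable (PiM I (\<lambda>_. lborel))"
  shows "(\<integral>\<^sup>+x. f x \<partial>orthant I) = (\<integral>\<^sup>+x. f x * indicator {x. \<forall>i\<in>I. 0 \<le> x i} x \<partial>PiM I (\<lambda>_. lborel))"
  using assms
proof (induction I arbitrary: f)
  case empty
  show ?case by (simp add: orthant_def PiM_empty)
next
  case (insert i I)
  interpret L: product_sigma_finite "\<lambda>_::'a. lborel :: real measure" by (rule product_sigma_finite_lborel)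
  interpret P: product_sigma_finite "\<lambda>_::'a. halfline" by (rule product_sigma_finite_halfline)
  note [measurable] = insert.prems
  have "(\<integral>\<^sup>+x. f x \<partial>orthant (insert i I)) = (\<integral>\<^sup>+x. (\<integral>\<^sup>+y. f (x(i := y)) \<partial>halfline) \<partial>orthant I)"
    using P.product_nn_integral_insert[OF insert.hyps, of f] measurable_PiM_lborel_orthant[OF insert.prems]
    unfolding orthant_def by simp
  also have "\<dots> = (\<integral>\<^sup>+x. (\<integral>\<^sup>+y. f (x(i := y)) * indicator {0..} y \<partial>lborel) * indicator {x. \<forall>i\<in>I. 0 \<le> x i} x \<partial>PiM I (\<lambda>_. lborel))"
    unfolding nn_integral_halfline by (rule insert.IH) measurable
  also have "\<dots> = (\<integral>\<^sup>+x. (\<integral>\<^sup>+y. f (x(i := y)) * indicator {x. \<forall>i\<in>insert i I. 0 \<le> x i} (x(i := y)) \<partial>lborel) \<partial>PiM I (\<lambda>_. lborel))"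
  proof (rule nn_integral_cong)
    fix x :: "'a \<Rightarrow> real"
    show "(\<integral>\<^sup>+y. f (x(i := y)) * indicator {0..} y \<partial>lborel) * indicator {x. \<forall>i\<in>I. 0 \<le> x i} x =
      (\<integral>\<^sup>+y. f (x(i := y)) * indicator {x. \<forall>i\<in>insert i I. 0 \<le> x i} (x(i := y)) \<partial>lborel)"
    proof (cases "\<forall>i\<in>I. 0 \<le> x i")
      case True
      then have "indicator {x. \<forall>i\<in>insert i I. 0 \<le> x i} (x(i := y)) = (indicator {0..} y :: ennreal)" for y
        using insert.hyps by (auto simp: indicator_def)
      then show ?thesis using True by simp
    next
      case False
      then have "indicator {x. \<forall>i\<in>insert i I. 0 \<le> x i} (x(i := y)) = (0 :: ennreal)" for y
        using insert.hyps by (auto simp: indicator_def)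
      then show ?thesis using False by simp
    qed
  qed
  also have "\<dots> = (\<integral>\<^sup>+x. f x * indicator {x. \<forall>i\<in>insert i I. 0 \<le> x i} x \<partial>PiM (insert i I) (\<lambda>_. lborel))"
  proof (rule L.product_nn_integral_insert[symmetric, OF insert.hyps])
    have "(\<lambda>x. indicator {x. \<forall>i\<in>insert i I. 0 \<le> x i} x :: ennreal) \<in> borel_measurable (PiM (insert i I) (\<lambda>_. lborel :: real measure))"
      by (rule measurable_indicator_nonneg) (use insert.hyps in auto)
    then show "(\<lambda>x. f x * indicator {x. \<forall>i\<in>insert i I. 0 \<le> x i} x) \<in> borel_measurable (PiM (insert i I) (\<lambda>_. lborel))"
      by measurable
  qed
  finally show ?case .
qed

lemma nn_integral_PiM_scale:
  fixes f :: "('a \<Rightarrow> real) \<Rightarrow> ennreal"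
  assumes "finite I" "r > 0" "f \<in> borel_measurable (PiM I (\<lambda>_. lborel))"
  shows "(\<integral>\<^sup>+x. f x \<partial>PiM I (\<lambda>_. lborel)) = ennreal (r ^ card I) * (\<integral>\<^sup>+x. f (\<lambda>i\<in>I. r * x i) \<partial>PiM I (\<lambda>_. lborel))"
  using assms(1,3)
proof (induction I arbitrary: f)
  case empty
  show ?case by (simp add: PiM_empty restrict_def nn_integral_count_space_finite)
next
  case (insert i I)
  interpret L: product_sigma_finite "\<lambda>_::'a. lborel :: real measure" by (rule product_sigma_finite_lborel)
  note [measurable] = insert.prems
  have m: "(\<lambda>y. f (x(i := y))) \<in> borel_measurable lborel" if "x \<in> space (PiM I (\<lambda>_. lborel))" for x
    using measurable_comp[OF measurable_component_update insert.prems, OF that insert.hyps(2)] unfolding comp_def .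
  have "(\<integral>\<^sup>+x. f x \<partial>PiM (insert i I) (\<lambda>_. lborel)) = (\<integral>\<^sup>+x. (\<integral>\<^sup>+y. f (x(i := y)) \<partial>lborel) \<partial>PiM I (\<lambda>_. lborel))"
    by (rule L.product_nn_integral_insert[OF insert.hyps]) measurable
  also have "\<dots> = ennreal (r ^ card I) * (\<integral>\<^sup>+x. (\<integral>\<^sup>+y. f ((\<lambda>i\<in>I. r * x i)(i := y)) \<partial>lborel) \<partial>PiM I (\<lambda>_. lborel))"
    by (rule insert.IH) measurable
  also have "(\<integral>\<^sup>+x. (\<integral>\<^sup>+y. f ((\<lambda>i\<in>I. r * x i)(i := y)) \<partial>lborel) \<partial>PiM I (\<lambda>_. lborel)) =
     (\<integral>\<^sup>+x. ennreal r * (\<integral>\<^sup>+y. f (\<lambda>j\<in>insert i I. r * (x(i := y)) j) \<partial>lborel) \<partial>PiM I (\<lambda>_. lborel))"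
  proof (rule nn_integral_cong)
    fix x :: "'a \<Rightarrow> real" assume "x \<in> space (PiM I (\<lambda>_. lborel))"
    have eq: "(\<lambda>i\<in>I. r * x i)(i := 0 + r * y) = (\<lambda>j\<in>insert i I. r * (x(i := y)) j)" for y
      using insert.hyps by (auto simp: fun_eq_iff restrict_def)
    have "(\<lambda>i\<in>I. r * x i) \<in> space (PiM I (\<lambda>_. lborel))" by (simp add: space_PiM)
    then have "(\<integral>\<^sup>+y. f ((\<lambda>i\<in>I. r * x i)(i := y)) \<partial>lborel) = ennreal \<bar>r\<bar> * (\<integral>\<^sup>+y. f ((\<lambda>i\<in>I. r * x i)(i := 0 + r * y)) \<partial>lborel)"
      using m[of "\<lambda>i\<in>I. r * x i"] assms(2) by (intro nn_integral_real_affine) auto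
    then show "(\<integral>\<^sup>+y. f ((\<lambda>i\<in>I. r * x i)(i := y)) \<partial>lborel) =
       ennreal r * (\<integral>\<^sup>+y. f (\<lambda>j\<in>insert i I. r * (x(i := y)) j) \<partial>lborel)"
      using assms(2) unfolding eq by (simp only: abs_of_pos)
  qed
  also have "\<dots> = ennreal r * (\<integral>\<^sup>+x. (\<integral>\<^sup>+y. f (\<lambda>j\<in>insert i I. r * (x(i := y)) j) \<partial>lborel) \<partial>PiM I (\<lambda>_. lborel))"
    by (rule nn_integral_cmult) measurable
  also have "(\<integral>\<^sup>+x. (\<integral>\<^sup>+y. f (\<lambda>j\<in>insert i I. r * (x(i := y)) j) \<partial>lborel) \<partial>PiM I (\<lambda>_. lborel)) =
      (\<integral>\<^sup>+x. f (\<lambda>j\<in>insert i I. r * x j) \<partial>PiM (insert i I) (\<lambda>_. lborel))"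
    by (rule L.product_nn_integral_insert[symmetric, OF insert.hyps]) measurable
  also have "ennreal (r ^ card I) * (ennreal r * (\<integral>\<^sup>+x. f (\<lambda>j\<in>insert i I. r * x j) \<partial>PiM (insert i I) (\<lambda>_. lborel))) =
     ennreal (r ^ card (insert i I)) * (\<integral>\<^sup>+x. f (\<lambda>j\<in>insert i I. r * x j) \<partial>PiM (insert i I) (\<lambda>_. lborel))"
    unfolding mult.assoc[symmetric] using insert.hyps assms(2)
    by (intro arg_cong2[where f="(*)"] refl) (simp add: ennreal_mult mult.commute)
  finally show ?case .
qed

lemma nn_integral_orthant_reindex:
  fixes f :: "('b \<Rightarrow> real) \<Rightarrow> ennreal"
  assumes fin: "finite J" and inj: "inj_on h J" and f: "f \<in> borel_measurable (orthant (h ` J))"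
  shows "(\<integral>\<^sup>+x. f x \<partial>orthant (h ` J)) = (\<integral>\<^sup>+x. f (\<lambda>i\<in>h ` J. x (the_inv_into J h i)) \<partial>orthant J)"
proof -
  interpret P: product_sigma_finite "\<lambda>_::'a. halfline" by (rule product_sigma_finite_halfline)
  interpret Q: product_sigma_finite "\<lambda>_::'b. halfline" by (rule product_sigma_finite_halfline)
  let ?T = "\<lambda>x. \<lambda>i\<in>h ` J. x (the_inv_into J h i)"
  have inv: "the_inv_into J h i \<in> J" if "i \<in> h ` J" for i using that inj by (metis subset_refl the_inv_into_into)
  have T: "?T \<in> measurable (orthant J) (orthant (h ` J))"
    unfolding orthant_def using inv by (intro measurable_restrict measurable_component_singleton) auto
  have "distr (orthant J) (orthant (h ` J)) ?T = orthant (h ` J)"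
    unfolding orthant_def[of "h ` J"]
  proof (rule Q.PiM_eqI)
    fix A assume A: "\<And>i. i \<in> h ` J \<Longrightarrow> A i \<in> sets halfline"
    have "?T -` (Pi\<^sub>E (h ` J) A) \<inter> space (orthant J) = Pi\<^sub>E J (\<lambda>j. A (h j))"
    proof -
      have "A i \<subseteq> {0..}" if "i \<in> h ` J" for i using sets.sets_into_space[OF A[OF that]] by simp
      then show ?thesis using inj
        by (auto simp: orthant_def space_PiM PiE_iff the_inv_into_f_f) 
    qed
    then have "emeasure (distr (orthant J) (PiM (h ` J) (\<lambda>_. halfline)) ?T) (Pi\<^sub>E (h ` J) A) = emeasure (orthant J) (Pi\<^sub>E J (\<lambda>j. A (h j)))"
      using T A fin unfolding orthant_def[of "h ` J"] by (subst emeasure_distr) (auto intro!: sets_PiM_I_finite)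
    also have "\<dots> = (\<Prod>j\<in>J. emeasure halfline (A (h j)))"
      unfolding orthant_def using A by (intro P.emeasure_PiM fin) auto
    also have "\<dots> = (\<Prod>i\<in>h ` J. emeasure halfline (A i))" using inj by (simp add: prod.reindex)
    finally show "emeasure (distr (orthant J) (PiM (h ` J) (\<lambda>_. halfline)) ?T) (Pi\<^sub>E (h ` J) A) = (\<Prod>i\<in>h ` J. emeasure halfline (A i))" .
  qed (use fin in auto)
  then have "(\<integral>\<^sup>+x. f x \<partial>orthant (h ` J)) = (\<integral>\<^sup>+x. f x \<partial>distr (orthant J) (orthant (h ` J)) ?T)" by simp
  also have "\<dots> = (\<integral>\<^sup>+x. f (?T x) \<partial>orthant J)" by (rule nn_integral_distr) (use T f in auto)
  finally show ?thesis .
qed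

text \<open>Nonnegative integrals make the substitutions and exchanges of integration below free of
  integrability conditions.\<close>

lemma gauss_eq_nn_integral:
  "gauss H I (\<lambda>_. 1) = enn2real (\<integral>\<^sup>+x. ennreal (exp (- quad H I x / 2)) \<partial>orthant I)"
  unfolding gauss_def by (subst integral_eq_nn_integral) auto

lemma gauss_reindex:
  assumes fin: "finite J" and bij: "bij_betw h J I"
  shows "gauss (\<lambda>i j. H (h i) (h j)) J (\<lambda>_. 1) = gauss H I (\<lambda>_. 1)"
proof -
  have inj: "inj_on h J" and I: "I = h ` J" using bij by (auto simp: bij_betw_def)
  have "quad H (h ` J) (\<lambda>i\<in>h ` J. x (the_inv_into J h i)) = quad (\<lambda>i j. H (h i) (h j)) J x" for x
    unfolding quad_def using inj by (simp add: sum.reindex the_inv_into_f_f)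
  then show ?thesis unfolding gauss_eq_nn_integral I
    by (subst nn_integral_orthant_reindex[OF fin inj]) auto
qed

lemma coercive_reindex:
  fixes h :: "'a \<Rightarrow> 'b"
  assumes bij: "bij_betw h J I" and co: "coercive c H I"
  shows "coercive c (\<lambda>i j. H (h i) (h j)) J"
  unfolding coercive_def
proof (intro conjI allI impI)
  show "c > 0" using co by (simp add: coercive_def)
  fix x :: "'a \<Rightarrow> real" assume x: "\<forall>i\<in>J. 0 \<le> x i"
  define y where "y i = x (the_inv_into J h i)" for i
  have inj: "inj_on h J" and I: "I = h ` J" using bij unfolding bij_betw_def by blast+
  have y: "y (h j) = x j" if "j \<in> J" for j using that inj by (simp add: y_def the_inv_into_f_f)
  have "\<forall>i\<in>I. 0 \<le> y i"
  proof
    fix i assume "i \<in> I"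
    then obtain j where "j \<in> J" "i = h j" using I by blast
    then show "0 \<le> y i" using x y by simp
  qed
  then have "c * (\<Sum>i\<in>I. (y i)\<^sup>2) \<le> quad H I y"
    by (rule co[unfolded coercive_def, THEN conjunct2, THEN spec, THEN mp])
  moreover have "(\<Sum>i\<in>I. (y i)\<^sup>2) = (\<Sum>i\<in>J. (x i)\<^sup>2)"
    unfolding I sum.reindex[OF inj] o_def by (rule sum.cong[OF refl]) (simp only: y)
  moreover have "quad H I y = quad (\<lambda>i j. H (h i) (h j)) J x"
    unfolding I quad_def sum.reindex[OF inj] o_def by (intro sum.cong[OF refl]) (simp only: y)
  ultimately show "c * (\<Sum>i\<in>J. (x i)\<^sup>2) \<le> quad (\<lambda>i j. H (h i) (h j)) J x" by simp
qed

section \<open>Polar coordinates on the orthant\<close>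

definition radial_moment :: "nat \<Rightarrow> ennreal" where
  "radial_moment k = (\<integral>\<^sup>+r. ennreal (r ^ k * exp (- r\<^sup>2 / 2)) \<partial>halfline)"

lemma radial_moment_finite: "radial_moment k < \<infinity>"
proof -
  \<comment> \<open>r / k \<le> exp (r / k) gives r^k \<le> k^k exp r, and (r - 2)^2 \<ge> 0 bounds
    exp (r - r^2 / 2) by exp (2 - r).\<close>
  have "integrable halfline (\<lambda>r::real. (real k ^ k * exp 2) * exp (- 1 * r))"
    by (intro integrable_mult_right integrable_halfline_exp)
  then have "integrable halfline (\<lambda>r::real. r ^ k * exp (- r\<^sup>2 / 2))"
  proof (rule Bochner_Integration.integrable_bound)
    show "AE r in halfline. norm (r ^ k * exp (- r\<^sup>2 / 2)) \<le> norm ((real k ^ k * exp 2) * exp (- 1 * r))"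
    proof (rule AE_I2)
      fix r :: real assume "r \<in> space halfline"
      then have r: "r \<ge> 0" by simp
      have "r ^ k \<le> real k ^ k * exp r"
      proof (cases "k = 0")
        case False
        have "r / k \<le> exp (r / k)" using exp_ge_add_one_self[of "r / k"] by linarith
        then have "(r / k) ^ k \<le> exp (r / k) ^ k" using r by (intro power_mono) auto
        also have "\<dots> = exp r" using False by (simp add: exp_of_nat_mult[symmetric])
        finally show ?thesis using False by (simp add: power_divide divide_le_eq mult.commute)
      qed (use r in simp)
      then have "r ^ k * exp (- r\<^sup>2 / 2) \<le> (real k ^ k * exp r) * exp (- r\<^sup>2 / 2)" by (intro mult_right_mono) auto
      also have "\<dots> = real k ^ k * exp (r - r\<^sup>2 / 2)" by (simp add: exp_add[symmetric])
      also have "\<dots> \<le> real k ^ k * exp (2 - r)"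
      proof -
        have "0 \<le> (r - 2)\<^sup>2 / 2" by simp
        also have "\<dots> = r\<^sup>2 / 2 - 2 * r + 2" by (simp add: power2_eq_square field_simps)
        finally show ?thesis by (intro mult_left_mono) auto
      qed
      finally show "norm (r ^ k * exp (- r\<^sup>2 / 2)) \<le> norm ((real k ^ k * exp 2) * exp (- 1 * r))"
        using r by (simp add: exp_diff exp_minus field_simps)
    qed
  qed measurable
  moreover have "(\<integral>\<^sup>+r. ennreal (norm (r ^ k * exp (- r\<^sup>2 / 2))) \<partial>halfline) = radial_moment k"
    unfolding radial_moment_def by (intro nn_integral_cong) auto
  ultimately show ?thesis by (simp add: integrable_iff_bounded)
qed

lemma radial_moment_pos: "radial_moment k > 0"
proof -
  \<comment> \<open>On the interval from 1 to 2 the integrand is at least exp (- 2).\<close>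
  have "0 < ennreal (exp (- 2))" by simp
  also have "\<dots> = (\<integral>\<^sup>+r. ennreal (exp (- 2)) * indicator {1..2::real} r \<partial>lborel)"
    by (subst nn_integral_cmult_indicator) auto
  also have "\<dots> \<le> (\<integral>\<^sup>+r. ennreal (r ^ k * exp (- r\<^sup>2 / 2)) * indicator {0..} r \<partial>lborel)"
  proof (rule nn_integral_mono)
    fix r :: real
    show "ennreal (exp (- 2)) * indicator {1..2} r \<le> ennreal (r ^ k * exp (- r\<^sup>2 / 2)) * indicator {0..} r"
    proof (cases "r \<in> {1..2}")
      case True
      then have "r\<^sup>2 \<le> 2\<^sup>2" by (intro power_mono) auto
      then have "1 * exp (- 2) \<le> r ^ k * exp (- r\<^sup>2 / 2)"
        using True by (intro mult_mono one_le_power) auto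
      then show ?thesis using True by (simp add: ennreal_leI)
    qed simp
  qed
  finally show ?thesis by (simp add: radial_moment_def nn_integral_halfline)
qed

lemma nn_integral_gauss_radial:
  assumes "q > 0"
  shows "(\<integral>\<^sup>+r. ennreal (r ^ k * exp (- (r\<^sup>2 * q) / 2)) * indicator {0..} r \<partial>lborel) =
    radial_moment k * ennreal ((1 / sqrt q) ^ Suc k)"
proof -
  define a where "a = 1 / sqrt q"
  have a: "a > 0" "a\<^sup>2 * q = 1" using assms by (auto simp: a_def power_divide)
  have "(\<integral>\<^sup>+r. ennreal (r ^ k * exp (- (r\<^sup>2 * q) / 2)) * indicator {0..} r \<partial>lborel) =
    ennreal \<bar>a\<bar> * (\<integral>\<^sup>+r. ennreal ((0 + a * r) ^ k * exp (- ((0 + a * r)\<^sup>2 * q) / 2)) * indicator {0..} (0 + a * r) \<partial>lborel)"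
    using a by (intro nn_integral_real_affine) auto
  also have "\<dots> = ennreal a * (\<integral>\<^sup>+r. ennreal (a ^ k) * (ennreal (r ^ k * exp (- r\<^sup>2 / 2)) * indicator {0..} r) \<partial>lborel)"
  proof -
    have "ennreal ((0 + a * r) ^ k * exp (- ((0 + a * r)\<^sup>2 * q) / 2)) * indicator {0..} (0 + a * r) =
      ennreal (a ^ k) * (ennreal (r ^ k * exp (- r\<^sup>2 / 2)) * indicator {0..} r)" for r
    proof (cases "r \<ge> 0")
      case True
      have "(0 + a * r)\<^sup>2 * q = (a\<^sup>2 * q) * r\<^sup>2" by (simp add: power_mult_distrib)
      then have e: "(0 + a * r)\<^sup>2 * q = r\<^sup>2" unfolding a(2) by simp
      show ?thesis unfolding e using True a(1) by (simp add: ennreal_mult power_mult_distrib mult_ac)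
    next
      case False
      then have "a * r < 0" using a(1) by (simp add: mult_pos_neg)
      then show ?thesis using False by simp
    qed
    then show ?thesis using a(1) by simp
  qed
  also have "\<dots> = ennreal a * (ennreal (a ^ k) * radial_moment k)"
    unfolding radial_moment_def nn_integral_halfline by (subst nn_integral_cmult) auto
  also have "\<dots> = radial_moment k * ennreal (a ^ Suc k)"
    using a(1) by (simp add: ennreal_mult mult_ac)
  finally show ?thesis by (simp add: a_def)
qed

text \<open>Polar coordinates on the orthant with radius \<open>\<Sum>\<^sub>i x\<^sub>i\<close>; the coordinate \<open>x\<^sub>k\<close> is
  \<open>r (1 - \<Sum>\<^sub>i s\<^sub>i)\<close>.\<close>

lemma nn_integral_orthant_simplex:
  fixes g :: "(nat \<Rightarrow> real) \<Rightarrow> ennreal"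
  assumes g: "g \<in> borel_measurable (PiM {..k} (\<lambda>_. lborel))"
  shows "(\<integral>\<^sup>+x. g x \<partial>orthant {..k}) =
    (\<integral>\<^sup>+s. (\<integral>\<^sup>+r. ennreal (r ^ k) * g ((\<lambda>i\<in>{..<k}. r * s i)(k := r * (1 - (\<Sum>i<k. s i)))) * indicator {0..} r \<partial>lborel)
        * indicator (std_simplex k) s \<partial>PiM {..<k} (\<lambda>_. lborel))"
proof -
  interpret L: product_sigma_finite "\<lambda>_::nat. lborel :: real measure" by (rule product_sigma_finite_lborel)
  interpret LI: sigma_finite_measure "PiM {..<k} (\<lambda>_. lborel :: real measure)" by (rule L.sigma_finite) simp
  let ?L = "PiM {..<k} (\<lambda>_. lborel :: real measure)"
  have ins: "insert k {..<k} = {..k}" by auto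
  have g' [measurable]: "g \<in> borel_measurable (PiM (insert k {..<k}) (\<lambda>_. lborel))" unfolding ins by (rule g)
  have ind[measurable]: "(\<lambda>x. indicator {x. \<forall>i<k. 0 \<le> x i} x :: ennreal) \<in> borel_measurable ?L"
    using measurable_indicator_nonneg[of "{..<k}" "{..<k}"] by simp
  have sm[measurable]: "(\<lambda>x. \<Sum>i<k. x i) \<in> borel_measurable ?L"
    by (intro borel_measurable_sum) (auto intro: measurable_compose[OF measurable_component_singleton])
  let ?nn = "\<lambda>x. indicator {x. \<forall>i<k. 0 \<le> x i} x :: ennreal"
  \<comment> \<open>The last coordinate has been replaced by the radius r, the sum of all
    coordinates; for fixed remaining coordinates this is a translation.\<close>
  let ?h = "\<lambda>x r. g (x(k := r - (\<Sum>i<k. x i))) * ?nn x * indicator {0..} (r - (\<Sum>i<k. x i))"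
  let ?F = "\<lambda>r s. ennreal (r ^ k) * g ((\<lambda>i\<in>{..<k}. r * s i)(k := r * (1 - (\<Sum>i<k. s i)))) * indicator {0..} r"
  \<comment> \<open>\<open>std_simplex\<close> also demands extensionality; on the product space it
    is replaced by an indicator whose measurability is evident.\<close>
  let ?D = "\<lambda>s. ?nn s * indicator {..1} (\<Sum>i<k. s i)"
  have D: "?D s = indicator (std_simplex k) s" if "s \<in> space ?L" for s
    using that by (auto simp: indicator_def std_simplex_def space_PiM PiE_def)
  have F[measurable]: "(\<lambda>(r, s). ?F r s) \<in> borel_measurable (lborel \<Otimes>\<^sub>M ?L)" by measurable
  have F2: "(\<lambda>(s, r). ?F r s * ?D s) \<in> borel_measurable (?L \<Otimes>\<^sub>M lborel)" by measurable
  have "(\<integral>\<^sup>+x. g x \<partial>orthant {..k}) =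
    (\<integral>\<^sup>+x. g x * indicator {x. \<forall>i\<in>insert k {..<k}. 0 \<le> x i} x \<partial>PiM (insert k {..<k}) (\<lambda>_. lborel))"
    unfolding ins by (rule nn_integral_orthant[OF _ g]) simp
  also have "\<dots> = (\<integral>\<^sup>+x. (\<integral>\<^sup>+y. g (x(k := y)) * indicator {x. \<forall>i\<in>insert k {..<k}. 0 \<le> x i} (x(k := y)) \<partial>lborel) \<partial>?L)"
    using measurable_indicator_nonneg[of "insert k {..<k}" "insert k {..<k}"]
    by (intro L.product_nn_integral_insert borel_measurable_times g') auto
  also have "\<dots> = (\<integral>\<^sup>+x. (\<integral>\<^sup>+r. ?h x r \<partial>lborel) \<partial>?L)"
  proof (rule nn_integral_cong)
    fix x assume x: "x \<in> space ?L"
    have m: "(\<lambda>y. g (x(k := y))) \<in> borel_measurable lborel"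
      using measurable_comp[OF measurable_component_update g', OF x] unfolding comp_def by simp
    have eq: "indicator {x. \<forall>i\<in>insert k {..<k}. 0 \<le> x i} (x(k := y)) = ?nn x * indicator {0..} y" for y
      by (auto simp: indicator_def)
    have "(\<integral>\<^sup>+y. g (x(k := y)) * ?nn x * indicator {0..} y \<partial>lborel) =
       ennreal \<bar>1\<bar> * (\<integral>\<^sup>+r. g (x(k := - (\<Sum>i<k. x i) + 1 * r)) * ?nn x * indicator {0..} (- (\<Sum>i<k. x i) + 1 * r) \<partial>lborel)"
      using m by (intro nn_integral_real_affine) auto
    then show "(\<integral>\<^sup>+y. g (x(k := y)) * indicator {x. \<forall>i\<in>insert k {..<k}. 0 \<le> x i} (x(k := y)) \<partial>lborel) = (\<integral>\<^sup>+r. ?h x r \<partial>lborel)"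
      unfolding eq by (simp add: mult.assoc)
  qed
  also have "\<dots> = (\<integral>\<^sup>+r. (\<integral>\<^sup>+x. ?h x r \<partial>?L) \<partial>lborel)"
    by (rule pair_sigma_finite.Fubini') (auto intro!: pair_sigma_finite.intro sigma_finite_lborel LI.sigma_finite_measure_axioms)
  also have "\<dots> = (\<integral>\<^sup>+r. (\<integral>\<^sup>+s. ennreal (r ^ k) * g ((\<lambda>i\<in>{..<k}. r * s i)(k := r * (1 - (\<Sum>i<k. s i)))) * indicator {0..} r
        * indicator (std_simplex k) s \<partial>?L) \<partial>lborel)"
  proof (rule nn_integral_cong_AE)
    show "AE r in lborel. (\<integral>\<^sup>+x. ?h x r \<partial>?L) = (\<integral>\<^sup>+s. ennreal (r ^ k) * g ((\<lambda>i\<in>{..<k}. r * s i)(k := r * (1 - (\<Sum>i<k. s i)))) * indicator {0..} r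
        * indicator (std_simplex k) s \<partial>?L)"
      \<comment> \<open>Rescaling by r needs r > 0. For r < 0 both sides vanish, and r = 0 is
        discarded as a null set.\<close>
      using AE_lborel_singleton[of 0]
    proof eventually_elim
      case (elim r)
      show ?case
      proof (cases "r > 0")
        case True
        have hm: "(\<lambda>x. ?h x r) \<in> borel_measurable ?L" by measurable
        have "(\<integral>\<^sup>+x. ?h x r \<partial>?L) = ennreal (r ^ k) * (\<integral>\<^sup>+s. ?h (\<lambda>i\<in>{..<k}. r * s i) r \<partial>?L)"
          using nn_integral_PiM_scale[OF _ True hm] by simp
        also have "\<dots> = (\<integral>\<^sup>+s. ennreal (r ^ k) * ?h (\<lambda>i\<in>{..<k}. r * s i) r \<partial>?L)"
        proof (rule nn_integral_cmult[symmetric])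
          have "(\<lambda>s. \<lambda>i\<in>{..<k}. r * s i) \<in> measurable ?L ?L" by measurable
          from measurable_compose[OF this hm] show "(\<lambda>s. ?h (\<lambda>i\<in>{..<k}. r * s i) r) \<in> borel_measurable ?L" .
        qed
        also have "\<dots> = (\<integral>\<^sup>+s. ennreal (r ^ k) * g ((\<lambda>i\<in>{..<k}. r * s i)(k := r * (1 - (\<Sum>i<k. s i)))) * indicator {0..} r
        * indicator (std_simplex k) s \<partial>?L)"
        proof (rule nn_integral_cong)
          fix s assume s: "s \<in> space ?L"
          have e: "(\<Sum>i<k. (\<lambda>i\<in>{..<k}. r * s i) i) = r * (\<Sum>i<k. s i)"
            by (simp add: sum_distrib_left)
          have "?nn (\<lambda>i\<in>{..<k}. r * s i) * indicator {0..} (r - r * (\<Sum>i<k. s i)) = (indicator (std_simplex k) s :: ennreal)"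
          proof -
            have "(\<forall>i<k. 0 \<le> (\<lambda>i\<in>{..<k}. r * s i) i) \<longleftrightarrow> (\<forall>i<k. 0 \<le> s i)" using True by (simp add: zero_le_mult_iff)
            moreover have "0 \<le> r - r * (\<Sum>i<k. s i) \<longleftrightarrow> (\<Sum>i<k. s i) \<le> 1" using True by simp
            ultimately show ?thesis using s by (simp add: indicator_def std_simplex_def space_PiM PiE_def)
          qed
          then show "ennreal (r ^ k) * ?h (\<lambda>i\<in>{..<k}. r * s i) r = ennreal (r ^ k) * g ((\<lambda>i\<in>{..<k}. r * s i)(k := r * (1 - (\<Sum>i<k. s i)))) * indicator {0..} r
        * indicator (std_simplex k) s"
            unfolding e using True by (simp add: mult.assoc right_diff_distrib)
        qed
        finally show ?thesis .
      next
        case False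
        then have r: "r < 0" using elim by simp
        have "?h x r = 0" for x
          using r sum_nonneg[of "{..<k}" x] by (auto simp: indicator_def)
        then have "(\<integral>\<^sup>+x. ?h x r \<partial>?L) = (\<integral>\<^sup>+x. 0 \<partial>?L)" by (intro nn_integral_cong)
        then show ?thesis using r by simp
      qed
    qed
  qed
  also have "\<dots> = (\<integral>\<^sup>+r. (\<integral>\<^sup>+s. ?F r s * ?D s \<partial>?L) \<partial>lborel)"
    by (intro nn_integral_cong) (simp add: D)
  also have "\<dots> = (\<integral>\<^sup>+s. (\<integral>\<^sup>+r. ?F r s * ?D s \<partial>lborel) \<partial>?L)"
    by (rule pair_sigma_finite.Fubini'[OF _ F2]) (auto intro!: pair_sigma_finite.intro sigma_finite_lborel LI.sigma_finite_measure_axioms)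
  also have "\<dots> = (\<integral>\<^sup>+s. (\<integral>\<^sup>+r. ?F r s \<partial>lborel) * indicator (std_simplex k) s \<partial>?L)"
  proof (rule nn_integral_cong)
    fix s assume s: "s \<in> space ?L"
    have "(\<lambda>r. ?F r s) \<in> borel_measurable lborel"
      using measurable_Pair1[OF F s] by simp
    then show "(\<integral>\<^sup>+r. ?F r s * ?D s \<partial>lborel) = (\<integral>\<^sup>+r. ?F r s \<partial>lborel) * indicator (std_simplex k) s"
      unfolding D[OF s] by (rule nn_integral_multc)
  qed
  finally show ?thesis .
qed

section \<open>Volumes of geodesic simplices\<close>

text \<open>The working rule in place of the defining sum over the basis: bilinearity and estimates
  reduce to those of the inner product.\<close>

lemma form_Hyperbolic: "form Hyperbolic x y = x \<bullet> y - 2 * (x \<bullet> e0) * (y \<bullet> e0)"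
proof -
  have e: "(e0 :: 'a) \<in> Basis" unfolding e0_def using some_in_eq[of "Basis :: 'a set"] by auto
  have "x \<bullet> y = (\<Sum>b\<in>Basis. (x \<bullet> b) * (y \<bullet> b))" by (rule euclidean_inner)
  also have "\<dots> = (x \<bullet> e0) * (y \<bullet> e0) + (\<Sum>b\<in>Basis - {e0}. (x \<bullet> b) * (y \<bullet> b))"
    using e by (subst sum.remove[of _ e0]) auto
  finally show ?thesis by simp
qed

declare form.simps(3) [simp del]

lemma form_sym: "form G x y = form G y x"
  by (cases G) (simp_all add: form_Hyperbolic inner_commute mult_ac)

lemma bounded_bilinear_form: "bounded_bilinear (form G :: 'v::euclidean_space \<Rightarrow> 'v \<Rightarrow> real)"
proof (cases G)
  case Hyperbolic
  have e: "norm (e0 :: 'v) = 1"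
    unfolding e0_def using some_in_eq[of "Basis :: 'v set"] by auto
  show ?thesis unfolding Hyperbolic
  proof
    show "\<exists>K. \<forall>a b. norm (form Hyperbolic a (b::'v)) \<le> norm a * norm b * K"
    proof (intro exI[of _ 3] allI)
      fix a b :: 'v
      have "\<bar>form Hyperbolic a b\<bar> \<le> \<bar>a \<bullet> b\<bar> + 2 * (\<bar>a \<bullet> e0\<bar> * \<bar>b \<bullet> e0\<bar>)"
        unfolding form_Hyperbolic using abs_triangle_ineq4[of "a \<bullet> b" "2 * (a \<bullet> e0) * (b \<bullet> e0)"] by (simp add: abs_mult)
      also have "\<dots> \<le> norm a * norm b + 2 * (norm a * norm b)"
        using Cauchy_Schwarz_ineq2[of a b] Cauchy_Schwarz_ineq2[of a e0] Cauchy_Schwarz_ineq2[of b e0] e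
        by (intro add_mono mult_left_mono mult_mono) auto
      finally show "norm (form Hyperbolic a b) \<le> norm a * norm b * 3" by simp
    qed
  qed (simp_all add: form_Hyperbolic inner_add_left inner_add_right algebra_simps)
next
  case Euclidean
  then have "(form G :: 'v \<Rightarrow> 'v \<Rightarrow> real) = (\<bullet>)" by (intro ext) simp
  then show ?thesis using bounded_bilinear_inner by simp
next
  case Spherical
  then have "(form G :: 'v \<Rightarrow> 'v \<Rightarrow> real) = (\<bullet>)" by (intro ext) simp
  then show ?thesis using bounded_bilinear_inner by simp
qed

lemmas form_simps =
  bounded_bilinear.add_left[OF bounded_bilinear_form] bounded_bilinear.add_right[OF bounded_bilinear_form]
  bounded_bilinear.diff_left[OF bounded_bilinear_form] bounded_bilinear.diff_right[OF bounded_bilinear_form]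
  bounded_bilinear.scaleR_left[OF bounded_bilinear_form] bounded_bilinear.scaleR_right[OF bounded_bilinear_form]
  bounded_bilinear.zero_left[OF bounded_bilinear_form] bounded_bilinear.zero_right[OF bounded_bilinear_form]
  bounded_bilinear.minus_left[OF bounded_bilinear_form] bounded_bilinear.minus_right[OF bounded_bilinear_form]
  bounded_bilinear.sum_left[OF bounded_bilinear_form] bounded_bilinear.sum_right[OF bounded_bilinear_form]

lemma det_eq_ldet: "Determinant.det (Matrix.mat n n (\<lambda>(i, j). M i j)) = ldet {..<n} M"
  by (subst det_def'[of _ n]) (auto simp: ldet_def lessThan_atLeast0 permutes_in_image intro!: sum.cong prod.cong)

lemma gram_det_eq_ldet: "gram_det G Bs = ldet {..<length Bs} (\<lambda>p q. form G (Bs ! p) (Bs ! q))"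
  unfolding gram_det_def by (rule det_eq_ldet)

lemma gram_add_one:
  fixes v :: "'a \<Rightarrow> 'v::euclidean_space"
  assumes fin: "finite I" and o: "o' \<in> I"
  shows "ldet I (\<lambda>i j. form G ((v(o' := v o' + (\<Sum>a\<in>I - {o'}. c a *\<^sub>R v a))) i) ((v(o' := v o' + (\<Sum>a\<in>I - {o'}. c a *\<^sub>R v a))) j)) =
    ldet I (\<lambda>i j. form G (v i) (v j))" (is "ldet I (\<lambda>i j. form G (?v i) (?v j)) = _")
proof -
  let ?M = "\<lambda>i j. form G (v i) (?v j)"
  have "ldet I (\<lambda>i j. form G (?v i) (?v j)) = ldet I (?M(o' := (\<lambda>j. ?M o' j + (\<Sum>a\<in>I - {o'}. c a * ?M a j))))"
    by (rule ldet_cong) (simp add: form_simps)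
  also have "\<dots> = ldet I ?M" by (rule ldet_row_add[OF fin o])
  also have "\<dots> = ldet I (\<lambda>j i. ?M i j)" by (rule ldet_transpose[symmetric]) (fact fin)
  also have "\<dots> = ldet I ((\<lambda>j i. form G (v i) (v j))(o' := (\<lambda>i. form G (v i) (v o') + (\<Sum>a\<in>I - {o'}. c a * form G (v i) (v a)))))"
    by (rule ldet_cong) (simp add: form_simps)
  also have "\<dots> = ldet I (\<lambda>j i. form G (v i) (v j))"
    by (rule ldet_row_add[OF fin o, of "\<lambda>j i. form G (v i) (v j)"])
  also have "\<dots> = ldet I (\<lambda>i j. form G (v i) (v j))" by (rule ldet_transpose) (fact fin)
  finally show ?thesis .
qed

lemma gram_add_all:
  fixes v :: "'a \<Rightarrow> 'v::euclidean_space"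
  assumes fin: "finite I" and o: "o' \<in> I"
  shows "ldet I (\<lambda>i j. form G (if i = o' then v i else v i + c i *\<^sub>R v o') (if j = o' then v j else v j + c j *\<^sub>R v o')) =
    ldet I (\<lambda>i j. form G (v i) (v j))" (is "ldet I (\<lambda>i j. form G (?v i) (?v j)) = _")
proof -
  let ?M = "\<lambda>i j. form G (v i) (?v j)"
  have "ldet I (\<lambda>i j. form G (?v i) (?v j)) = ldet I (\<lambda>i j. ?M i j + (if i \<in> I - {o'} then c i * ?M o' j else 0))"
    by (rule ldet_cong) (simp add: form_simps)
  also have "\<dots> = ldet I ?M" by (rule ldet_rows_add[OF fin o]) auto
  also have "\<dots> = ldet I (\<lambda>j i. ?M i j)" by (rule ldet_transpose[symmetric]) (fact fin)
  also have "\<dots> = ldet I (\<lambda>j i. form G (v i) (v j) + (if j \<in> I - {o'} then c j * form G (v i) (v o') else 0))"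
    by (rule ldet_cong) (simp add: form_simps)
  also have "\<dots> = ldet I (\<lambda>j i. form G (v i) (v j))"
    by (rule ldet_rows_add[OF fin o, of _ "\<lambda>j i. form G (v i) (v j)"]) auto
  also have "\<dots> = ldet I (\<lambda>i j. form G (v i) (v j))" by (rule ldet_transpose) (fact fin)
  finally show ?thesis .
qed

lemma measurable_quad_lborel [measurable]: "quad H I \<in> borel_measurable (PiM I (\<lambda>_. lborel))"
  unfolding quad_def
  by (intro borel_measurable_sum borel_measurable_times)
     (auto intro: measurable_compose[OF measurable_component_singleton])

lemma measurable_std_simplex: "std_simplex k \<inter> space (PiM {..<k} (\<lambda>_. lborel)) \<in> sets (PiM {..<k} (\<lambda>_. lborel :: real measure))"
proof -
  let ?L = "PiM {..<k} (\<lambda>_. lborel :: real measure)"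
  have sm: "(\<lambda>x. \<Sum>i<k. x i) \<in> borel_measurable ?L"
    by (intro borel_measurable_sum) (auto intro: measurable_compose[OF measurable_component_singleton])
  have "std_simplex k \<inter> space ?L = (\<Pi>\<^sub>E i\<in>{..<k}. {0..}) \<inter> ((\<lambda>x. \<Sum>i<k. x i) -` {..1} \<inter> space ?L)"
    by (auto simp: std_simplex_def space_PiM PiE_def Pi_def)
  also have "\<dots> \<in> sets ?L"
    by (intro sets.Int sets_PiM_I_finite measurable_sets[OF sm]) auto
  finally show ?thesis .
qed

lemma std_simplex_subset_space: "std_simplex k \<subseteq> space (PiM {..<k} (\<lambda>_. lborel :: real measure))"
  by (auto simp: std_simplex_def space_PiM PiE_def)

lemma simplex_quad_pos:
  assumes co: "coercive c H {..k}" and s: "s \<in> std_simplex k"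
  shows "quad H {..k} (s(k := 1 - (\<Sum>i<k. s i))) > 0"
proof -
  let ?b = "\<lambda>s :: nat \<Rightarrow> real. s(k := 1 - (\<Sum>i<k. s i))"
  have nn: "\<forall>i\<in>{..k}. 0 \<le> ?b s i" using s by (auto simp: std_simplex_def)
  then have le: "c * (\<Sum>i\<le>k. (?b s i)\<^sup>2) \<le> quad H {..k} (?b s)" using co unfolding coercive_def by blast
  have s1: "(\<Sum>i\<le>k. ?b s i) = 1"
  proof -
    have "{..k} = insert k {..<k}" by auto
    moreover have "(\<Sum>i<k. ?b s i) = (\<Sum>i<k. s i)" by (intro sum.cong) auto
    ultimately show ?thesis by simp
  qed
  obtain i where "i \<in> {..k}" "?b s i \<noteq> 0" using s1 sum.neutral[of "{..k}" "?b s"] by (metis zero_neq_one)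
  then have "(\<Sum>i\<le>k. (?b s i)\<^sup>2) > 0" by (intro sum_pos2[of _ i]) (simp_all del: fun_upd_apply)
  then have "0 < c * (\<Sum>i\<le>k. (?b s i)\<^sup>2)" using co by (simp add: coercive_def)
  with le show ?thesis by linarith
qed

text \<open>The form is homogeneous of degree two, so integration along the ray through a
  barycentric point leaves the form to the power -(k + 1) / 2, times a constant.\<close>

lemma gauss_eq_simplex_integral:
  assumes co: "coercive c H {..k}"
  shows "gauss H {..k} (\<lambda>_. 1) = enn2real (radial_moment k) *
    (LINT s:std_simplex k|PiM {..<k} (\<lambda>_. lborel). (1 / sqrt (quad H {..k} (s(k := 1 - (\<Sum>i<k. s i))))) ^ Suc k)"
proof -
  let ?L = "PiM {..<k} (\<lambda>_. lborel :: real measure)"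
  let ?b = "\<lambda>s :: nat \<Rightarrow> real. s(k := 1 - (\<Sum>i<k. s i))"
  let ?w = "\<lambda>s. (1 / sqrt (quad H {..k} (?b s))) ^ Suc k"
  note pos = simplex_quad_pos[OF co]
  have quadr: "quad H {..k} ((\<lambda>i\<in>{..<k}. r * s i)(k := r * (1 - (\<Sum>i<k. s i)))) = r\<^sup>2 * quad H {..k} (?b s)" for r s
  proof -
    have e: "((\<lambda>i\<in>{..<k}. r * s i)(k := r * (1 - (\<Sum>i<k. s i)))) i = r * ?b s i" if "i \<le> k" for i
      using that by (cases "i = k") auto
    show ?thesis unfolding quad_def sum_distrib_left
      by (intro sum.cong refl) (simp only: atMost_iff e, simp add: power2_eq_square mult_ac)
  qed
  have mw: "?b \<in> measurable ?L (PiM {..k} (\<lambda>_. lborel))"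
  proof -
    have "{..k} = insert k {..<k}" by auto
    moreover have "(\<lambda>s. 1 - (\<Sum>i<k. s i)) \<in> measurable ?L lborel"
      unfolding measurable_cong_sets[OF refl sets_lborel]
      by (intro borel_measurable_diff borel_measurable_sum) (auto intro: measurable_compose[OF measurable_component_singleton])
    ultimately show ?thesis by (auto intro!: measurable_fun_upd[where J="{..<k}"])
  qed
  have q[measurable]: "(\<lambda>s. quad H {..k} (?b s)) \<in> borel_measurable ?L"
    by (rule measurable_compose[OF mw measurable_quad_lborel])
  have "(\<integral>\<^sup>+x. ennreal (exp (- quad H {..k} x / 2)) \<partial>orthant {..k}) =
     (\<integral>\<^sup>+s. (\<integral>\<^sup>+r. ennreal (r ^ k) * ennreal (exp (- (r\<^sup>2 * quad H {..k} (?b s)) / 2)) * indicator {0..} r \<partial>lborel)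
        * indicator (std_simplex k) s \<partial>?L)"
    by (subst nn_integral_orthant_simplex) (measurable, simp only: quadr)
  also have "\<dots> = (\<integral>\<^sup>+s. radial_moment k * (ennreal (?w s) * indicator (std_simplex k) s) \<partial>?L)"
  proof (rule nn_integral_cong)
    fix s
    show "(\<integral>\<^sup>+r. ennreal (r ^ k) * ennreal (exp (- (r\<^sup>2 * quad H {..k} (?b s)) / 2)) * indicator {0..} r \<partial>lborel)
        * indicator (std_simplex k) s = radial_moment k * (ennreal (?w s) * indicator (std_simplex k) s)"
    proof (cases "s \<in> std_simplex k")
      case True
      have "(\<integral>\<^sup>+r. ennreal (r ^ k) * ennreal (exp (- (r\<^sup>2 * quad H {..k} (?b s)) / 2)) * indicator {0..} r \<partial>lborel) =
        (\<integral>\<^sup>+r. ennreal (r ^ k * exp (- (r\<^sup>2 * quad H {..k} (?b s)) / 2)) * indicator {0..} r \<partial>lborel)"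
        by (intro nn_integral_cong) (auto simp: indicator_def ennreal_mult)
      then show ?thesis using nn_integral_gauss_radial[OF pos[OF True], of k] True by simp
    qed simp
  qed
  also have "\<dots> = radial_moment k * (\<integral>\<^sup>+s. ennreal (indicator (std_simplex k) s * ?w s) \<partial>?L)"
  proof -
    have "(\<integral>\<^sup>+s. radial_moment k * (ennreal (?w s) * indicator (std_simplex k) s) \<partial>?L) =
       radial_moment k * (\<integral>\<^sup>+s. ennreal (?w s) * indicator (std_simplex k \<inter> space ?L) s \<partial>?L)"
    proof (subst nn_integral_cmult[symmetric])
      have [measurable]: "std_simplex k \<inter> space ?L \<in> sets ?L" by (rule measurable_std_simplex)
      show "(\<lambda>s. ennreal (?w s) * indicator (std_simplex k \<inter> space ?L) s) \<in> borel_measurable ?L" by measurable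
    qed (auto intro!: nn_integral_cong simp: indicator_def)
    also have "(\<integral>\<^sup>+s. ennreal (?w s) * indicator (std_simplex k \<inter> space ?L) s \<partial>?L) =
       (\<integral>\<^sup>+s. ennreal (indicator (std_simplex k) s * ?w s) \<partial>?L)"
      by (intro nn_integral_cong) (auto simp: indicator_def)
    finally show ?thesis .
  qed
  finally have "gauss H {..k} (\<lambda>_. 1) = enn2real (radial_moment k) * enn2real (\<integral>\<^sup>+s. ennreal (indicator (std_simplex k) s * ?w s) \<partial>?L)"
    unfolding gauss_eq_nn_integral by (simp add: enn2real_mult)
  also have "enn2real (\<integral>\<^sup>+s. ennreal (indicator (std_simplex k) s * ?w s) \<partial>?L) = (LINT s:std_simplex k|?L. ?w s)"
    unfolding set_lebesgue_integral_def real_scaleR_def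
  proof (rule integral_eq_nn_integral[symmetric])
    have "(\<lambda>s. indicator (std_simplex k \<inter> space ?L) s * ?w s) \<in> borel_measurable ?L"
      using measurable_std_simplex[of k] by measurable
    moreover have "(indicator (std_simplex k \<inter> space ?L) :: _ \<Rightarrow> real) = indicator (std_simplex k)"
      using std_simplex_subset_space[of k] by (simp add: Int_absorb2)
    ultimately show "(\<lambda>s. indicator (std_simplex k) s * ?w s) \<in> borel_measurable ?L" by simp
    show "AE s in ?L. 0 \<le> indicator (std_simplex k) s * ?w s"
      using pos by (intro AE_I2) (auto simp: indicator_def less_imp_le)
  qed
  finally show ?thesis .
qed

section \<open>The metric density of a radially projected simplex\<close>

lemma radial_eq:
  assumes "G \<noteq> Euclidean"
  shows "radial G x = x /\<^sub>R sqrt (curvature G * form G x x)"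
  using assms by (cases G) auto

lemma curvature_sq:
  assumes "G \<noteq> Euclidean"
  shows "curvature G * curvature G = 1"
  using assms by (cases G) auto

definition affine_point :: "'v::euclidean_space list \<Rightarrow> (nat \<Rightarrow> real) \<Rightarrow> 'v" where
  "affine_point Bs s = Bs ! 0 + (\<Sum>i<length Bs - 1. s i *\<^sub>R (Bs ! Suc i - Bs ! 0))"

lemma affine_point_upd:
  assumes "i < length Bs - 1"
  shows "affine_point Bs (s(i := u)) = affine_point Bs s + (u - s i) *\<^sub>R (Bs ! Suc i - Bs ! 0)"
proof -
  let ?e = "\<lambda>i. Bs ! Suc i - Bs ! 0" and ?I = "{..<length Bs - 1}"
  have "(\<Sum>j\<in>?I - {i}. (s(i := u)) j *\<^sub>R ?e j) = (\<Sum>j\<in>?I - {i}. s j *\<^sub>R ?e j)"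
    by (intro sum.cong) auto
  then show ?thesis
    using assms sum.remove[of ?I i "\<lambda>j. (s(i := u)) j *\<^sub>R ?e j"] sum.remove[of ?I i "\<lambda>j. s j *\<^sub>R ?e j"]
    by (simp add: affine_point_def algebra_simps)
qed

lemma simplex_partial_Euclidean:
  assumes "i < length Bs - 1"
  shows "simplex_partial Euclidean Bs s i = Bs ! Suc i - Bs ! 0"
proof -
  have "((\<lambda>u. affine_point Bs (s(i := u))) has_vector_derivative Bs ! Suc i - Bs ! 0) (at (s i))"
    unfolding affine_point_upd[OF assms] by (auto intro!: derivative_eq_intros)
  then show ?thesis unfolding simplex_partial_def simplex_param_def radial.simps affine_point_def
    by (rule vector_derivative_at)
qed

lemma has_real_derivative_inverse_sqrt:
  fixes f :: "real \<Rightarrow> real"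
  assumes "(f has_real_derivative c * (2 * d)) (at u)" "f u > 0"
  shows "((\<lambda>u. inverse (sqrt (f u))) has_real_derivative - (c * d) / (f u * sqrt (f u))) (at u)"
proof -
  have "((\<lambda>u. inverse (sqrt (f u))) has_real_derivative
     - (inverse (sqrt (f u)) * (inverse (sqrt (f u)) / 2 * (c * (2 * d))) * inverse (sqrt (f u)))) (at u)"
    by (intro DERIV_inverse' DERIV_chain2[OF DERIV_real_sqrt assms(1)] assms(2)) (use assms(2) in auto)
  moreover have "- (inverse (sqrt (f u)) * (inverse (sqrt (f u)) / 2 * (c * (2 * d))) * inverse (sqrt (f u))) =
     - (c * d) / (f u * sqrt (f u))"
    using assms(2) by (simp add: field_simps)
  ultimately show ?thesis by simp
qed

text \<open>Differentiating the radial projection removes from the edge \<open>e\<close> its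
  component along \<open>x\<close> and divides by the length of \<open>x\<close>; the result is
  tangent to the space form.\<close>

lemma simplex_partial_radial:
  fixes Bs :: "'v::euclidean_space list"
  assumes G: "G \<noteq> Euclidean" and i: "i < length Bs - 1"
    and q: "curvature G * form G (affine_point Bs s) (affine_point Bs s) > 0"
  defines "x \<equiv> affine_point Bs s" and "e \<equiv> Bs ! Suc i - Bs ! 0"
  shows "simplex_partial G Bs s i = (1 / sqrt (curvature G * form G x x)) *\<^sub>R
     (e - (form G x e / form G x x) *\<^sub>R x)"
proof -
  let ?k = "curvature G" and ?q = "curvature G * form G x x"
  have f0: "form G x x \<noteq> 0" and q0: "?q > 0" using q unfolding x_def by auto
  have dx: "((\<lambda>u. x + (u - s i) *\<^sub>R e) has_vector_derivative e) (at (s i))"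
    by (auto intro!: derivative_eq_intros)
  have dq: "((\<lambda>u. ?k * form G (x + (u - s i) *\<^sub>R e) (x + (u - s i) *\<^sub>R e)) has_real_derivative ?k * (2 * form G x e)) (at (s i))"
  proof -
    have "(\<lambda>u. ?k * form G (x + (u - s i) *\<^sub>R e) (x + (u - s i) *\<^sub>R e)) =
      (\<lambda>u. ?k * (form G x x + (u - s i) * (2 * form G x e) + (u - s i)\<^sup>2 * form G e e))"
      by (simp add: form_simps form_sym[of G e x] power2_eq_square algebra_simps)
    then show ?thesis by (auto intro!: derivative_eq_intros)
  qed
  have dr: "((\<lambda>u. inverse (sqrt (?k * form G (x + (u - s i) *\<^sub>R e) (x + (u - s i) *\<^sub>R e)))) has_real_derivative
      - (?k * form G x e) / (?q * sqrt ?q)) (at (s i))"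
    using has_real_derivative_inverse_sqrt[OF dq] q0 by simp
  have "((\<lambda>u. inverse (sqrt (?k * form G (x + (u - s i) *\<^sub>R e) (x + (u - s i) *\<^sub>R e))) *\<^sub>R (x + (u - s i) *\<^sub>R e))
     has_vector_derivative (inverse (sqrt ?q)) *\<^sub>R e + (- (?k * form G x e) / (?q * sqrt ?q)) *\<^sub>R x) (at (s i))"
    using has_vector_derivative_scaleR[OF dr dx] by simp
  moreover have "(\<lambda>u. simplex_param G Bs (s(i := u))) =
     (\<lambda>u. inverse (sqrt (?k * form G (x + (u - s i) *\<^sub>R e) (x + (u - s i) *\<^sub>R e))) *\<^sub>R (x + (u - s i) *\<^sub>R e))"
    unfolding simplex_param_def affine_point_def[symmetric] affine_point_upd[OF i] radial_eq[OF G] x_def e_def ..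
  ultimately have "simplex_partial G Bs s i = (inverse (sqrt ?q)) *\<^sub>R e + (- (?k * form G x e) / (?q * sqrt ?q)) *\<^sub>R x"
    unfolding simplex_partial_def by (simp add: vector_derivative_at)
  also have "- (?k * form G x e) / (?q * sqrt ?q) = - ((1 / sqrt ?q) * (form G x e / form G x x))"
    using f0 q0 by (simp add: field_simps)
  finally show ?thesis by (simp add: inverse_eq_divide scaleR_diff_right)
qed

text \<open>Simplex coordinates 0, ..., k - 1 belong to vertices 1, ..., k, and the remaining
  barycentric coordinate k belongs to vertex 0.\<close>

lemma ldet_lessThan_Suc_gram:
  fixes B :: "'v::euclidean_space list"
  assumes len: "length B = Suc k"
  shows "ldet {..k} (\<lambda>i j. form G (if i = k then B ! 0 else B ! Suc i) (if j = k then B ! 0 else B ! Suc j)) = gram_det G B"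
proof -
  let ?h = "\<lambda>i. if i = k then 0 else Suc i"
  have "bij_betw ?h {..k} {..<Suc k}"
    by (rule bij_betw_byWitness[where f'="\<lambda>j. if j = 0 then k else j - 1"]) auto
  from ldet_reindex[OF this, of "\<lambda>i j. form G (B ! i) (B ! j)"]
  show ?thesis unfolding gram_det_eq_ldet len by (simp add: if_distrib[of "(!) B"])
qed

text \<open>The Gram matrix of the projected edges is a Schur complement: its determinant is that of
  the edges and \<open>x\<close> together, divided by \<open>form G x x\<close>. Row and column
  operations then replace \<open>x\<close> by the first vertex and the edges by the other vertices.
  The k rescalings and this one division add up to the power \<open>Suc k\<close>.\<close>

lemma gram_det_partials:
  fixes Bs :: "'v::euclidean_space list"
  assumes G: "G \<noteq> Euclidean" and len: "length Bs = Suc k"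
  defines "q \<equiv> \<lambda>s. curvature G * form G (affine_point Bs s) (affine_point Bs s)"
  assumes qpos: "q s > 0"
  shows "gram_det G (map (simplex_partial G Bs s) [0..<k]) = curvature G * gram_det G Bs / q s ^ Suc k"
proof -
  define x where "x = affine_point Bs s"
  define e where "e i = Bs ! Suc i - Bs ! 0" for i
  have qx: "q s = curvature G * form G x x" by (simp add: q_def x_def)
  have f0: "form G x x \<noteq> 0" using qpos unfolding qx by auto
  let ?a = "1 / sqrt (q s)"
  define v where "v i = (if i = k then x else e i)" for i
  define w where "w i = (if i = k then Bs ! 0 else e i)" for i
  define B where "B i = (if i = k then Bs ! 0 else Bs ! Suc i)" for i
  have ins: "{..k} = insert k {..<k}" by auto
  have "gram_det G (map (simplex_partial G Bs s) [0..<k]) =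
     ldet {..<k} (\<lambda>i j. form G (map (simplex_partial G Bs s) [0..<k] ! i) (map (simplex_partial G Bs s) [0..<k] ! j))"
    by (simp add: gram_det_eq_ldet)
  also have "\<dots> = ldet {..<k} (\<lambda>i j. ?a * ?a * (form G (e i) (e j) - form G (e i) x * form G x (e j) / form G x x))"
  proof (rule ldet_cong)
    fix i j assume ij: "i \<in> {..<k}" "j \<in> {..<k}"
    have p: "map (simplex_partial G Bs s) [0..<k] ! i = ?a *\<^sub>R (e i - (form G x (e i) / form G x x) *\<^sub>R x)" if "i \<in> {..<k}" for i
      using simplex_partial_radial[OF G, of i Bs s] that len qpos unfolding q_def x_def e_def by simp
    have "form G (e i - (form G x (e i) / form G x x) *\<^sub>R x) (e j - (form G x (e j) / form G x x) *\<^sub>R x) =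
       form G (e i) (e j) - form G (e i) x * form G x (e j) / form G x x"
      using f0 by (simp add: form_simps form_sym[of G x "e i"] field_simps)
    then show "form G (map (simplex_partial G Bs s) [0..<k] ! i) (map (simplex_partial G Bs s) [0..<k] ! j) =
      ?a * ?a * (form G (e i) (e j) - form G (e i) x * form G x (e j) / form G x x)"
      unfolding p[OF ij(1)] p[OF ij(2)] form_simps(5,6) by simp
  qed
  also have "\<dots> = (?a * ?a) ^ k * ldet {..<k} (\<lambda>i j. form G (e i) (e j) - form G (e i) x * form G x (e j) / form G x x)"
    using ldet_scale[of "{..<k}" "\<lambda>_. ?a" "\<lambda>_. ?a"] by (simp only: prod_constant card_lessThan power_mult_distrib)
  also have "?a * ?a = 1 / q s" using qpos by simp
  also have "ldet {..<k} (\<lambda>i j. form G (e i) (e j) - form G (e i) x * form G x (e j) / form G x x) =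
     ldet {..k} (\<lambda>i j. form G (v i) (v j)) / form G x x"
  proof -
    have "ldet (insert k {..<k}) (\<lambda>i j. form G (v i) (v j)) = form G x x *
       ldet {..<k} (\<lambda>i j. form G (v i) (v j) - form G (v i) (v k) * form G (v k) (v j) / form G (v k) (v k))"
      by (subst ldet_schur) (use f0 in \<open>auto simp: v_def\<close>)
    also have "ldet {..<k} (\<lambda>i j. form G (v i) (v j) - form G (v i) (v k) * form G (v k) (v j) / form G (v k) (v k)) =
      ldet {..<k} (\<lambda>i j. form G (e i) (e j) - form G (e i) x * form G x (e j) / form G x x)"
      by (rule ldet_cong) (auto simp: v_def)
    finally show ?thesis using f0 unfolding ins by simp
  qed
  also have "ldet {..k} (\<lambda>i j. form G (v i) (v j)) = ldet {..k} (\<lambda>i j. form G (w i) (w j))"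
  proof -
    have "(\<Sum>a\<in>{..k} - {k}. s a *\<^sub>R w a) = (\<Sum>a<k. s a *\<^sub>R e a)" by (intro sum.cong) (auto simp: w_def)
    then have "v = w(k := w k + (\<Sum>a\<in>{..k} - {k}. s a *\<^sub>R w a))"
      unfolding x_def affine_point_def e_def using len by (auto simp: fun_eq_iff v_def w_def x_def affine_point_def e_def)
    then show ?thesis using gram_add_one[of "{..k}" k G w s] by simp
  qed
  also have "\<dots> = ldet {..k} (\<lambda>i j. form G (B i) (B j))"
  proof -
    have "w = (\<lambda>i. if i = k then B i else B i + (-1) *\<^sub>R B k)" by (auto simp: fun_eq_iff e_def w_def B_def)
    then show ?thesis using gram_add_all[of "{..k}" k G B "\<lambda>_. -1"] by simp
  qed
  also have "\<dots> = gram_det G Bs" unfolding B_def by (rule ldet_lessThan_Suc_gram[OF len])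
  also have "(1 / q s) ^ k * (gram_det G Bs / form G x x) = curvature G * gram_det G Bs / q s ^ Suc k"
  proof -
    have "curvature G \<noteq> 0" using G by (cases G) auto
    then have "1 / form G x x = curvature G / q s" using f0 curvature_sq[OF G] unfolding qx by (simp add: field_simps)
    then have "gram_det G Bs / form G x x = gram_det G Bs * (curvature G / q s)" by (metis times_divide_eq_right mult.right_neutral)
    then show ?thesis by (simp add: power_divide mult_ac)
  qed
  finally show ?thesis .
qed

text \<open>The metric density is the norm of the simplex times q to the power -(k + 1) / 2. That
  power of q is also what radial integration of the Gaussian leaves, up to the radial moment, so the
  two integrands agree pointwise on the parameter simplex.\<close>

lemma simplex_volume_gauss:
  fixes Bs :: "'v::euclidean_space list"
  assumes G: "G \<noteq> Euclidean" and len: "length Bs = Suc k"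
    and det: "curvature G * gram_det G Bs > 0"
    and co: "coercive c (\<lambda>i j. curvature G * form G (Bs ! i) (Bs ! j)) {..k}"
  shows "simplex_volume G Bs * enn2real (radial_moment k) =
    simplex_norm G Bs * gauss (\<lambda>i j. curvature G * form G (Bs ! i) (Bs ! j)) {..k} (\<lambda>_. 1)"
proof -
  let ?h = "\<lambda>i. if i = k then 0 else Suc i"
  let ?H = "\<lambda>i j. curvature G * form G (Bs ! i) (Bs ! j)"
  let ?B = "\<lambda>i. Bs ! ?h i"
  let ?H' = "\<lambda>i j. curvature G * form G (?B i) (?B j)"
  let ?L = "PiM {..<k} (\<lambda>_. lborel :: real measure)"
  have bij: "bij_betw ?h {..k} {..k}"
    by (rule bij_betw_byWitness[where f'="\<lambda>j. if j = 0 then k else j - 1"]) auto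
  have co': "coercive c ?H' {..k}" by (rule coercive_reindex[OF bij co])
  have q: "quad ?H' {..k} (s(k := 1 - (\<Sum>i<k. s i))) = curvature G * form G (affine_point Bs s) (affine_point Bs s)" for s
  proof -
    let ?b = "s(k := 1 - (\<Sum>i<k. s i))"
    have "(\<Sum>i\<le>k. ?b i *\<^sub>R ?B i) = (\<Sum>i<k. s i *\<^sub>R Bs ! Suc i) + (1 - (\<Sum>i<k. s i)) *\<^sub>R Bs ! 0"
      unfolding lessThan_Suc_atMost[symmetric] sum.lessThan_Suc by (intro arg_cong2[where f="(+)"] sum.cong) auto
    also have "\<dots> = affine_point Bs s"
      unfolding affine_point_def using len
      by (simp add: scaleR_diff_left scaleR_diff_right sum_subtractf scaleR_sum_left)
    finally have "affine_point Bs s = (\<Sum>i\<le>k. ?b i *\<^sub>R ?B i)" ..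
    then have "curvature G * form G (affine_point Bs s) (affine_point Bs s) =
       curvature G * (\<Sum>i\<le>k. \<Sum>j\<le>k. ?b i * (?b j * form G (?B i) (?B j)))"
      by (simp only: form_simps) (subst sum.swap, simp add: sum_distrib_left mult_ac del: fun_upd_apply)
    then show ?thesis unfolding quad_def sum_distrib_left by (simp add: mult_ac del: fun_upd_apply)
  qed
  have "simplex_volume G Bs = (LINT s:std_simplex k|?L. simplex_norm G Bs * (1 / sqrt (quad ?H' {..k} (s(k := 1 - (\<Sum>i<k. s i))))) ^ Suc k)"
    unfolding simplex_volume_def Let_def len diff_Suc_1 set_lebesgue_integral_def
  proof (rule Bochner_Integration.integral_cong[OF refl])
    fix s
    show "indicator (std_simplex k) s *\<^sub>R sqrt (gram_det G (map (simplex_partial G Bs s) [0..<k])) =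
      indicator (std_simplex k) s *\<^sub>R (simplex_norm G Bs * (1 / sqrt (quad ?H' {..k} (s(k := 1 - (\<Sum>i<k. s i))))) ^ Suc k)"
    proof (cases "s \<in> std_simplex k")
      case True
      let ?q = "curvature G * form G (affine_point Bs s) (affine_point Bs s)"
      have qpos: "?q > 0" unfolding q[symmetric] by (rule simplex_quad_pos[OF co' True])
      have abs: "curvature G * gram_det G Bs = \<bar>gram_det G Bs\<bar>"
        using det G by (cases G) auto
      have "sqrt (gram_det G (map (simplex_partial G Bs s) [0..<k])) = sqrt (\<bar>gram_det G Bs\<bar> / ?q ^ Suc k)"
        unfolding gram_det_partials[OF G len qpos] abs ..
      also have "\<dots> = simplex_norm G Bs * (1 / sqrt ?q) ^ Suc k"
        unfolding simplex_norm_def real_sqrt_divide real_sqrt_power power_divide by simp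
      finally show ?thesis unfolding q by simp
    qed simp
  qed
  also have "\<dots> = simplex_norm G Bs * (LINT s:std_simplex k|?L. (1 / sqrt (quad ?H' {..k} (s(k := 1 - (\<Sum>i<k. s i))))) ^ Suc k)"
    by (rule set_integral_mult_right)
  finally show ?thesis
    using gauss_eq_simplex_integral[OF co'] gauss_reindex[OF _ bij, of ?H] by (simp only: finite_atMost mult_ac)
qed

section \<open>Continuation of the stress along a motion\<close>

text \<open>exp (- K t) \<nu> is nonincreasing and tends to 0 at time 0, so it is at most 0
  afterwards.\<close>

lemma gronwall_zero:
  fixes \<nu> \<nu>' :: "real \<Rightarrow> real"
  assumes der: "\<And>t. 0 < t \<Longrightarrow> t < \<delta> \<Longrightarrow> (\<nu> has_real_derivative \<nu>' t) (at t)"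
    and nn: "\<And>t. 0 < t \<Longrightarrow> t < \<delta> \<Longrightarrow> 0 \<le> \<nu> t" and lim: "(\<nu> \<longlongrightarrow> 0) (at_right 0)"
    and le: "\<And>t. 0 < t \<Longrightarrow> t < \<delta> \<Longrightarrow> \<nu>' t \<le> K * \<nu> t" and t: "0 < t" "t < \<delta>"
  shows "\<nu> t = 0"
proof -
  define \<phi> where "\<phi> t = \<nu> t * exp (- K * t)" for t
  have "\<phi> t \<le> \<phi> s" if s: "0 < s" "s < t" for s
  proof (rule DERIV_nonpos_imp_nonincreasing[of s t \<phi>])
    fix x assume x: "s \<le> x" "x \<le> t"
    have "(\<phi> has_real_derivative (\<nu>' x - K * \<nu> x) * exp (- K * x)) (at x)"
      unfolding \<phi>_def using der[of x] x s t by (auto intro!: derivative_eq_intros simp: algebra_simps)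
    moreover have "(\<nu>' x - K * \<nu> x) * exp (- K * x) \<le> 0"
      using le[of x] x s t by (intro mult_nonpos_nonneg) auto
    ultimately show "\<exists>y. (\<phi> has_real_derivative y) (at x) \<and> y \<le> 0" by blast
  qed (use s in simp)
  then have ev: "\<forall>\<^sub>F s in at_right 0. \<phi> t \<le> \<phi> s"
    using t(1) by (auto simp: eventually_at_right_field)
  have "(\<phi> \<longlongrightarrow> 0 * exp (- K * 0)) (at_right 0)"
    unfolding \<phi>_def by (intro tendsto_intros lim)
  then have "\<phi> t \<le> 0" using tendsto_lowerbound[OF _ ev] by simp
  then show ?thesis using nn[OF t] by (simp add: \<phi>_def mult_le_0_iff)
qed

text \<open>The engine shared by all geometries: \<nu> plays the role of \<kappa> \<lambda>, and
  \<open>w F\<close> carries the sign which the constraints impose on the volume derivative.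
  Nonnegative summands bound \<nu>' by a multiple of \<nu>, so \<nu> vanishes. Then the right side
  of the identity is zero, and with it every summand.\<close>

lemma constrained_motion_rigid:
  fixes \<nu> \<nu>' C r :: "real \<Rightarrow> real" and V V' w :: "'f \<Rightarrow> real \<Rightarrow> real"
  assumes fin: "finite Fs" and c0: "c0 > 0"
    and der: "\<And>t. 0 < t \<Longrightarrow> t < \<delta> \<Longrightarrow> (\<nu> has_real_derivative \<nu>' t) (at t)"
    and nn: "\<And>t. 0 < t \<Longrightarrow> t < \<delta> \<Longrightarrow> 0 \<le> \<nu> t" and lim: "(\<nu> \<longlongrightarrow> 0) (at_right 0)"
    and V: "\<And>F t. F \<in> Fs \<Longrightarrow> 0 < t \<Longrightarrow> t < \<delta> \<Longrightarrow> (V F has_real_derivative V' F t) (at t)"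
    and Vlim: "\<And>F. F \<in> Fs \<Longrightarrow> (V F \<longlongrightarrow> V F 0) (at_right 0)"
    and w: "\<And>F t. F \<in> Fs \<Longrightarrow> 0 < t \<Longrightarrow> t < \<delta> \<Longrightarrow> w F t \<noteq> 0"
    and wV: "\<And>F t. F \<in> Fs \<Longrightarrow> 0 < t \<Longrightarrow> t < \<delta> \<Longrightarrow> 0 \<le> w F t * V' F t"
    and C: "\<And>t. 0 < t \<Longrightarrow> t < \<delta> \<Longrightarrow> c0 \<le> C t"
    and r: "\<And>t. 0 < t \<Longrightarrow> t < \<delta> \<Longrightarrow> \<bar>r t\<bar> \<le> K * \<nu> t"
    and eq: "\<And>t. 0 < t \<Longrightarrow> t < \<delta> \<Longrightarrow> (\<Sum>F\<in>Fs. w F t * V' F t) = - C t * \<nu>' t + r t"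
    and t: "0 < t" "t < \<delta>"
  shows "\<nu> t = 0 \<and> (\<forall>F\<in>Fs. V F t = V F 0)"
proof -
  have le: "\<nu>' t \<le> K / c0 * \<nu> t" if t: "0 < t" "t < \<delta>" for t
  proof -
    have "0 \<le> (\<Sum>F\<in>Fs. w F t * V' F t)" using wV t by (intro sum_nonneg) auto
    then have CK: "C t * \<nu>' t \<le> K * \<nu> t" using eq[OF t] r[OF t] by linarith
    have K\<nu>: "0 \<le> K * \<nu> t" using r[OF t] by linarith
    show ?thesis
    \<comment> \<open>\<open>C\<close> is bounded from below only, so it may be replaced by
      \<open>c0\<close> just when \<nu>' is positive.\<close>
    proof (cases "\<nu>' t \<le> 0")
      case True
      then show ?thesis using K\<nu> c0 by (simp add: order_trans[of _ 0])
    next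
      case False
      then have "c0 * \<nu>' t \<le> C t * \<nu>' t" using C[OF t] by (intro mult_right_mono) auto
      then have "c0 * \<nu>' t \<le> K * \<nu> t" using CK by linarith
      then show ?thesis using c0 by (simp add: field_simps)
    qed
  qed
  have z: "\<nu> t = 0" if t: "0 < t" "t < \<delta>" for t by (rule gronwall_zero[OF der nn lim le t])
  have V0: "V' F t = 0" if F: "F \<in> Fs" and t: "0 < t" "t < \<delta>" for F t
  proof -
    have "(\<nu> has_real_derivative 0) (at t)"
    proof (rule has_field_derivative_transform_within_open[of "\<lambda>_. 0"])
      show "open {0<..<\<delta>}" "t \<in> {0<..<\<delta>}" using t by auto
      show "0 = \<nu> x" if "x \<in> {0<..<\<delta>}" for x using z that by auto
    qed simp
    then have "\<nu>' t = 0" using der[OF t] DERIV_unique by blast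
    moreover have "r t = 0" using r[OF t] z[OF t] by simp
    ultimately have "(\<Sum>F\<in>Fs. w F t * V' F t) = 0" using eq[OF t] by simp
    then have "w F t * V' F t = 0" using sum_nonneg_eq_0_iff[OF fin, of "\<lambda>F. w F t * V' F t"] wV t F by auto
    then show ?thesis using w[OF F t] by simp
  qed
  have "V F t = V F 0" if F: "F \<in> Fs" for F
  proof -
    have const: "V F s = V F t" if s: "0 < s" "s < t" for s
    proof (rule DERIV_isconst3[of 0 \<delta> s t "V F"])
      show "(V F has_real_derivative 0) (at x)" if "x \<in> {0<..<\<delta>}" for x
        using V[OF F, of x] V0[OF F, of x] that by simp
    qed (use s t in auto)
    then have "\<forall>\<^sub>F s in at_right 0. V F s = V F t"
      using t(1) by (auto simp: eventually_at_right_field)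
    then have "(V F \<longlongrightarrow> V F t) (at_right 0)" by (rule tendsto_eventually)
    then show ?thesis using Vlim[OF F] tendsto_unique[OF trivial_limit_at_right_real] by blast
  qed
  then show ?thesis using z[OF t] by auto
qed

text \<open>C^1 up to 0 from the right, with the derivative left existential, so that determinants,
  cofactors and quotients are covered by closure rules instead of explicit derivative
  formulas.\<close>

definition c1_right :: "(real \<Rightarrow> real) \<Rightarrow> bool" where
  "c1_right f \<longleftrightarrow> (f \<longlongrightarrow> f 0) (at_right 0) \<and>
     (\<exists>f' l. (\<forall>\<^sub>F t in at_right 0. (f has_real_derivative f' t) (at t)) \<and> (f' \<longlongrightarrow> l) (at_right 0))"

lemma c1_rightI:
  assumes "(f \<longlongrightarrow> f 0) (at_right 0)" "\<forall>\<^sub>F t in at_right 0. (f has_real_derivative f' t) (at t)" "(f' \<longlongrightarrow> l) (at_right 0)"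
  shows "c1_right f"
  using assms unfolding c1_right_def by blast

lemma c1_right_const [simp]: "c1_right (\<lambda>_. c)"
  by (rule c1_rightI[of _ "\<lambda>_. 0" 0]) auto

lemma c1_right_add:
  assumes "c1_right f" "c1_right g"
  shows "c1_right (\<lambda>t. f t + g t)"
proof -
  from assms obtain f' g' l m where
    f: "(f \<longlongrightarrow> f 0) (at_right 0)" "\<forall>\<^sub>F t in at_right 0. (f has_real_derivative f' t) (at t)" "(f' \<longlongrightarrow> l) (at_right 0)" and
    g: "(g \<longlongrightarrow> g 0) (at_right 0)" "\<forall>\<^sub>F t in at_right 0. (g has_real_derivative g' t) (at t)" "(g' \<longlongrightarrow> m) (at_right 0)"
    unfolding c1_right_def by blast
  show ?thesis
  proof (rule c1_rightI[of _ "\<lambda>t. f' t + g' t" "l + m"])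
    show "\<forall>\<^sub>F t in at_right 0. ((\<lambda>t. f t + g t) has_real_derivative f' t + g' t) (at t)"
      using f(2) g(2) by eventually_elim (rule DERIV_add)
  qed (intro tendsto_intros f g)+
qed

lemma c1_right_mult:
  assumes "c1_right f" "c1_right g"
  shows "c1_right (\<lambda>t. f t * g t)"
proof -
  from assms obtain f' g' l m where
    f: "(f \<longlongrightarrow> f 0) (at_right 0)" "\<forall>\<^sub>F t in at_right 0. (f has_real_derivative f' t) (at t)" "(f' \<longlongrightarrow> l) (at_right 0)" and
    g: "(g \<longlongrightarrow> g 0) (at_right 0)" "\<forall>\<^sub>F t in at_right 0. (g has_real_derivative g' t) (at t)" "(g' \<longlongrightarrow> m) (at_right 0)"
    unfolding c1_right_def by blast
  show ?thesis
  proof (rule c1_rightI[of _ "\<lambda>t. f' t * g t + g' t * f t" "l * g 0 + m * f 0"])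
    show "\<forall>\<^sub>F t in at_right 0. ((\<lambda>t. f t * g t) has_real_derivative f' t * g t + g' t * f t) (at t)"
      using f(2) g(2) by eventually_elim (rule DERIV_mult)
  qed (intro tendsto_intros f g)+
qed

lemma c1_right_divide:
  assumes "c1_right f" "c1_right g" "g 0 \<noteq> 0"
  shows "c1_right (\<lambda>t. f t / g t)"
proof -
  from assms obtain f' g' l m where
    f: "(f \<longlongrightarrow> f 0) (at_right 0)" "\<forall>\<^sub>F t in at_right 0. (f has_real_derivative f' t) (at t)" "(f' \<longlongrightarrow> l) (at_right 0)" and
    g: "(g \<longlongrightarrow> g 0) (at_right 0)" "\<forall>\<^sub>F t in at_right 0. (g has_real_derivative g' t) (at t)" "(g' \<longlongrightarrow> m) (at_right 0)"
    unfolding c1_right_def by blast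
  have nz: "\<forall>\<^sub>F t in at_right 0. g t \<noteq> 0" using g(1) assms(3) by (rule tendsto_imp_eventually_ne)
  show ?thesis
  proof (rule c1_rightI[of _ "\<lambda>t. (f' t * g t - f t * g' t) / (g t * g t)" "(l * g 0 - f 0 * m) / (g 0 * g 0)"])
    show "\<forall>\<^sub>F t in at_right 0. ((\<lambda>t. f t / g t) has_real_derivative (f' t * g t - f t * g' t) / (g t * g t)) (at t)"
      using f(2) g(2) nz by eventually_elim (rule DERIV_divide)
  qed (use assms(3) in \<open>auto intro!: tendsto_intros f g\<close>)
qed

lemma c1_right_sum: "(\<And>i. i \<in> I \<Longrightarrow> c1_right (\<lambda>t. f t i)) \<Longrightarrow> c1_right (\<lambda>t. \<Sum>i\<in>I. f t i)"
  by (induction I rule: infinite_finite_induct) (auto intro: c1_right_add)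

lemma c1_right_prod: "(\<And>i. i \<in> I \<Longrightarrow> c1_right (\<lambda>t. f t i)) \<Longrightarrow> c1_right (\<lambda>t. \<Prod>i\<in>I. f t i)"
  by (induction I rule: infinite_finite_induct) (auto intro: c1_right_mult)

lemma c1_right_ldet:
  assumes "\<And>i j. i \<in> I \<Longrightarrow> j \<in> I \<Longrightarrow> c1_right (\<lambda>t. M t i j)"
  shows "c1_right (\<lambda>t. ldet I (M t))"
  unfolding ldet_def using assms
  by (intro c1_right_sum c1_right_mult c1_right_prod c1_right_const) (auto simp: permutes_in_image)

lemma c1_right_cofac:
  assumes "\<And>i j. i \<in> I \<Longrightarrow> j \<in> I \<Longrightarrow> c1_right (\<lambda>t. M t i j)"
  shows "c1_right (\<lambda>t. cofac I (M t) a b)"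
  unfolding cofac_def using assms
  by (intro c1_right_sum c1_right_mult c1_right_prod c1_right_const) (auto simp: permutes_in_image)

lemma c1_right_tendsto: "c1_right f \<Longrightarrow> (f \<longlongrightarrow> f 0) (at_right 0)"
  by (simp add: c1_right_def)

text \<open>Normalizing the stress to be constant at the vertex \<open>o'\<close> makes the derivative of \<open>\<lambda>\<close> free of
  the derivatives of the stress.\<close>

lemma stress_continuation:
  fixes H H' :: "real \<Rightarrow> 'a \<Rightarrow> 'a \<Rightarrow> real"
  assumes fin: "finite W" and o: "o' \<in> W"
    and sym: "\<And>t i j. i \<in> W \<Longrightarrow> j \<in> W \<Longrightarrow> H t i j = H t j i"
    and H0: "\<And>i j. i \<in> W \<Longrightarrow> j \<in> W \<Longrightarrow> ((\<lambda>t. H t i j) \<longlongrightarrow> H 0 i j) (at_right 0)"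
    and dH: "\<And>i j t. i \<in> W \<Longrightarrow> j \<in> W \<Longrightarrow> t > 0 \<Longrightarrow> ((\<lambda>t. H t i j) has_real_derivative H' t i j) (at t)"
    and H'0: "\<And>i j. i \<in> W \<Longrightarrow> j \<in> W \<Longrightarrow> ((\<lambda>t. H' t i j) \<longlongrightarrow> H' 0 i j) (at_right 0)"
    and nz: "ldet (W - {o'}) (H 0) \<noteq> 0"
    and ker: "\<And>i. i \<in> W \<Longrightarrow> (\<Sum>j\<in>W. H 0 i j * \<alpha> j) = 0"
  obtains a \<mu> where
    "\<And>i. i \<in> W \<Longrightarrow> ((\<lambda>t. a t i) \<longlongrightarrow> \<alpha> i) (at_right 0)" "(\<mu> \<longlongrightarrow> 0) (at_right 0)"
    "\<forall>\<^sub>F t in at_right 0. a t o' = \<alpha> o' \<and> (\<forall>i\<in>W. (\<Sum>j\<in>W. H t i j * a t j) = (if i = o' then \<mu> t else 0))"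
    "\<forall>\<^sub>F t in at_right 0. ((\<lambda>t. \<alpha> o' * \<mu> t) has_real_derivative (\<Sum>i\<in>W. \<Sum>j\<in>W. a t i * a t j * H' t i j)) (at t)"
proof -
  \<comment> \<open>Row \<open>o'\<close> of the adjugate solves the equations outside
    \<open>o'\<close>. Division by the complementary minor gives it the entry
    \<open>\<alpha> o'\<close> at \<open>o'\<close>, and \<mu> is the residual in the remaining
    equation.\<close>
  define a where "a t i = \<alpha> o' * cofac W (H t) o' i / ldet (W - {o'}) (H t)" for t i
  define \<mu> where "\<mu> t = \<alpha> o' * ldet W (H t) / ldet (W - {o'}) (H t)" for t
  have ins: "insert o' (W - {o'}) = W" using o by auto
  have c1H: "c1_right (\<lambda>t. H t i j)" if "i \<in> W" "j \<in> W" for i j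
    by (rule c1_rightI[OF H0[OF that] _ H'0[OF that]])
       (use dH[OF that] in \<open>auto simp: eventually_at_right_field intro!: exI[of _ 1]\<close>)
  have c1a: "c1_right (\<lambda>t. a t i)" for i
    unfolding a_def using nz c1H by (intro c1_right_divide c1_right_mult c1_right_const c1_right_cofac c1_right_ldet) auto
  have c1\<mu>: "c1_right \<mu>"
    unfolding \<mu>_def using nz c1H by (intro c1_right_divide c1_right_mult c1_right_const c1_right_ldet) auto
  have diag: "cofac W (H t) o' o' = ldet (W - {o'}) (H t)" for t
    using cofac_diag[of "W - {o'}" o' "H t"] fin ins by simp
  have eqs: "a t o' = \<alpha> o'" "i \<in> W \<Longrightarrow> (\<Sum>j\<in>W. H t i j * a t j) = (if i = o' then \<mu> t else 0)"
    if t: "ldet (W - {o'}) (H t) \<noteq> 0" for t i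
  proof -
    show "a t o' = \<alpha> o'" using t unfolding a_def diag by simp
    assume i: "i \<in> W"
    have "(\<Sum>j\<in>W. H t i j * a t j) = \<alpha> o' / ldet (W - {o'}) (H t) * (\<Sum>j\<in>W. H t i j * cofac W (H t) o' j)"
      unfolding a_def sum_distrib_left by (intro sum.cong refl) simp
    then show "(\<Sum>j\<in>W. H t i j * a t j) = (if i = o' then \<mu> t else 0)"
      unfolding cofac_orth[OF fin i o] by (simp add: \<mu>_def)
  qed
  have "ldet W (H 0) * \<alpha> o' = (\<Sum>a\<in>W. cofac W (H 0) o' a * 0)"
    by (rule cofac_kernel[OF fin sym o ker])
  then have \<mu>0: "\<mu> 0 = 0" by (auto simp: \<mu>_def)
  have a0: "a 0 i = \<alpha> i" if i: "i \<in> W" for i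
  proof (cases "i = o'")
    case True then show ?thesis using eqs(1)[OF nz] by simp
  next
    case False
    \<comment> \<open>The difference from \<alpha> vanishes at \<open>o'\<close> and lies in the
      kernel, so the nonsingular minor without \<open>o'\<close> forces it to be zero.\<close>
    have k: "(\<Sum>j\<in>W - {o'}. H 0 b j * (a 0 j - \<alpha> j)) = 0" if b: "b \<in> W - {o'}" for b
    proof -
      have "(\<Sum>j\<in>W. H 0 b j * (a 0 j - \<alpha> j)) = 0"
        using eqs(2)[OF nz, of b] ker[of b] b by (simp add: right_diff_distrib sum_subtractf)
      then show ?thesis using eqs(1)[OF nz] sum.remove[OF fin o, of "\<lambda>j. H 0 b j * (a 0 j - \<alpha> j)"] by simp
    qed
    have "ldet (W - {o'}) (H 0) * (a 0 i - \<alpha> i) = (\<Sum>b\<in>W - {o'}. cofac (W - {o'}) (H 0) i b * 0)"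
      by (rule cofac_kernel[of "W - {o'}" "H 0"]) (use fin sym i False k in auto)
    then show ?thesis using nz by simp
  qed
  have ev_nz: "\<forall>\<^sub>F t in at_right 0. ldet (W - {o'}) (H t) \<noteq> 0"
  proof (rule tendsto_imp_eventually_ne[OF c1_right_tendsto[of "\<lambda>t. ldet (W - {o'}) (H t)"] nz])
    show "c1_right (\<lambda>t. ldet (W - {o'}) (H t))" using c1H by (intro c1_right_ldet) auto
  qed
  show ?thesis
  proof (rule that[of a \<mu>])
    show "((\<lambda>t. a t i) \<longlongrightarrow> \<alpha> i) (at_right 0)" if "i \<in> W" for i
      using c1_right_tendsto[OF c1a, of i] a0[OF that] by simp
    show "(\<mu> \<longlongrightarrow> 0) (at_right 0)" using c1_right_tendsto[OF c1\<mu>] \<mu>0 by simp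
    show "\<forall>\<^sub>F t in at_right 0. a t o' = \<alpha> o' \<and> (\<forall>i\<in>W. (\<Sum>j\<in>W. H t i j * a t j) = (if i = o' then \<mu> t else 0))"
      using ev_nz by eventually_elim (use eqs in auto)
    have "\<forall>\<^sub>F t in at_right 0. \<forall>i\<in>W. \<exists>d. ((\<lambda>t. a t i) has_real_derivative d) (at t)"
    proof (rule eventually_ball_finite[OF fin], rule ballI)
      fix i
      obtain f' where "\<forall>\<^sub>F t in at_right 0. ((\<lambda>t. a t i) has_real_derivative f' t) (at t)"
        using c1a[of i] unfolding c1_right_def by blast
      then show "\<forall>\<^sub>F t in at_right 0. \<exists>d. ((\<lambda>t. a t i) has_real_derivative d) (at t)"
        by eventually_elim blast
    qed
    from eventually_conj[OF this ev_nz] obtain b where b: "b > 0"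
      and B: "\<And>t. 0 < t \<Longrightarrow> t < b \<Longrightarrow> (\<forall>i\<in>W. \<exists>d. ((\<lambda>t. a t i) has_real_derivative d) (at t)) \<and> ldet (W - {o'}) (H t) \<noteq> 0"
      unfolding eventually_at_right_field by auto
    have "((\<lambda>t. \<alpha> o' * \<mu> t) has_real_derivative (\<Sum>i\<in>W. \<Sum>j\<in>W. a t i * a t j * H' t i j)) (at t)" if t: "0 < t" "t < b" for t
    proof -
      obtain d where d: "\<And>i. i \<in> W \<Longrightarrow> ((\<lambda>t. a t i) has_real_derivative d i) (at t)"
        using B[OF t] by metis
      have op: "open {0<..<b}" "t \<in> {0<..<b}" using t by auto
      have g: "(\<Sum>j\<in>W. H s i j * a s j) = (if i = o' then \<mu> s else 0)" "a s o' = \<alpha> o'" if "s \<in> {0<..<b}" "i \<in> W" for s i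
        using eqs(1)[of s] eqs(2)[of s i] B[of s] that by simp_all
      have "((\<lambda>t. a t o') has_real_derivative 0) (at t)"
        by (rule has_field_derivative_transform_within_open[OF DERIV_const op]) (use g(2) o in auto)
      then have d0: "d o' = 0" using d[OF o] DERIV_unique by blast
      \<comment> \<open>Differentiating the quadratic form pairs the derivative \<open>d\<close> of
        the stress with \<open>H a\<close>, which lives at \<open>o'\<close>, where \<open>d\<close>
        vanishes.\<close>
      have sum1: "(\<Sum>i\<in>W. d i * (\<Sum>j\<in>W. H t i j * a t j)) = 0"
      proof -
        have "(\<Sum>i\<in>W. d i * (\<Sum>j\<in>W. H t i j * a t j)) = (\<Sum>i\<in>W. d i * (if i = o' then \<mu> t else 0))"
          using g(1)[OF op(2)] by (intro sum.cong refl) simp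
        also have "\<dots> = 0" using d0 by (intro sum.neutral) auto
        finally show ?thesis .
      qed
      have "((\<lambda>s. \<Sum>i\<in>W. \<Sum>j\<in>W. a s i * a s j * H s i j) has_real_derivative
         (\<Sum>i\<in>W. \<Sum>j\<in>W. (d i * a t j + d j * a t i) * H t i j + H' t i j * (a t i * a t j))) (at t)"
        using t by (intro DERIV_sum DERIV_mult d dH) auto
      also have "(\<Sum>i\<in>W. \<Sum>j\<in>W. (d i * a t j + d j * a t i) * H t i j + H' t i j * (a t i * a t j)) =
         (\<Sum>i\<in>W. \<Sum>j\<in>W. d i * (H t i j * a t j)) + (\<Sum>i\<in>W. \<Sum>j\<in>W. d j * (H t i j * a t i)) + (\<Sum>i\<in>W. \<Sum>j\<in>W. a t i * a t j * H' t i j)"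
        by (simp add: sum.distrib algebra_simps)
      also have "(\<Sum>i\<in>W. \<Sum>j\<in>W. d j * (H t i j * a t i)) = (\<Sum>j\<in>W. \<Sum>i\<in>W. d j * (H t j i * a t i))"
        using sym by (subst sum.swap) (intro sum.cong refl, auto)
      also have "(\<Sum>i\<in>W. \<Sum>j\<in>W. d i * (H t i j * a t j)) = 0" using sum1 by (simp add: sum_distrib_left)
      finally have "((\<lambda>s. \<Sum>i\<in>W. \<Sum>j\<in>W. a s i * a s j * H s i j) has_real_derivative
         (\<Sum>i\<in>W. \<Sum>j\<in>W. a t i * a t j * H' t i j)) (at t)" by simp
      then show ?thesis
      proof (rule has_field_derivative_transform_within_open[OF _ op])
        fix s assume s: "s \<in> {0<..<b}"
        have "(\<Sum>i\<in>W. \<Sum>j\<in>W. a s i * a s j * H s i j) = (\<Sum>i\<in>W. a s i * (\<Sum>j\<in>W. H s i j * a s j))"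
          by (simp add: sum_distrib_left mult_ac)
        also have "\<dots> = (\<Sum>i\<in>W. a s i * (if i = o' then \<mu> s else 0))"
          using g(1)[OF s] by (intro sum.cong refl) simp
        also have "\<dots> = (\<Sum>i\<in>W. if i = o' then \<alpha> o' * \<mu> s else 0)"
          using g(2)[OF s o] by (intro sum.cong refl) simp
        also have "\<dots> = \<alpha> o' * \<mu> s" using fin o by simp
        finally show "(\<Sum>i\<in>W. \<Sum>j\<in>W. a s i * a s j * H s i j) = \<alpha> o' * \<mu> s" .
      qed
    qed
    then show "\<forall>\<^sub>F t in at_right 0. ((\<lambda>t. \<alpha> o' * \<mu> t) has_real_derivative (\<Sum>i\<in>W. \<Sum>j\<in>W. a t i * a t j * H' t i j)) (at t)"
      using b by (auto simp: eventually_at_right_field)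
  qed
qed

section \<open>Estimates near time 0\<close>

lemma coercive_eventually:
  fixes H :: "'t \<Rightarrow> 'a \<Rightarrow> 'a \<Rightarrow> real"
  assumes fin: "finite I" and co: "coercive c H0 I"
    and lim: "\<And>i j. i \<in> I \<Longrightarrow> j \<in> I \<Longrightarrow> ((\<lambda>s. H s i j) \<longlongrightarrow> H0 i j) F"
  shows "\<forall>\<^sub>F s in F. coercive (c / 2) (H s) I"
proof -
  have c: "c > 0" using co by (simp add: coercive_def)
  \<comment> \<open>An entrywise error \<eta> changes the form by at most \<eta> * card I times the
    sum of squares, which must not exceed half of the coercivity. The added 1 covers an empty
    \<open>I\<close>.\<close>
  define \<eta> where "\<eta> = c / (2 * (real (card I) + 1))"
  have \<eta>: "\<eta> > 0" using c by (simp add: \<eta>_def add_pos_nonneg)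
  have \<eta>c: "\<eta> * card I \<le> c / 2" using c by (simp add: \<eta>_def field_simps)
  have "\<forall>\<^sub>F s in F. \<forall>i\<in>I. \<forall>j\<in>I. dist (H s i j) (H0 i j) < \<eta>"
    using lim \<eta> by (intro eventually_ball_finite ballI fin tendstoD) auto
  then show ?thesis
  proof eventually_elim
    case (elim s)
    show ?case unfolding coercive_def
    proof (intro conjI allI impI)
      show "c / 2 > 0" using c by simp
      fix x :: "'a \<Rightarrow> real" assume x: "\<forall>i\<in>I. 0 \<le> x i"
      have "quad H0 I x - quad (H s) I x = (\<Sum>i\<in>I. \<Sum>j\<in>I. (H0 i j - H s i j) * (x i * x j))"
        unfolding quad_def sum_subtractf[symmetric] by (intro sum.cong refl) (simp add: algebra_simps)
      also have "\<dots> \<le> (\<Sum>i\<in>I. \<Sum>j\<in>I. \<eta> * (x i * x j))"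
        using elim x by (intro sum_mono mult_right_mono) (force simp: dist_real_def abs_less_iff)+
      also have "\<dots> = \<eta> * (\<Sum>i\<in>I. x i)\<^sup>2" by (subst power2_eq_square, subst sum_product) (simp add: sum_distrib_left)
      also have "\<dots> \<le> \<eta> * (card I * (\<Sum>i\<in>I. (x i)\<^sup>2))"
        using \<eta> sum_squared_le_sum_of_squares[of x I] fin by (intro mult_left_mono) (auto simp: mult.commute)
      also have "\<dots> = (\<eta> * card I) * (\<Sum>i\<in>I. (x i)\<^sup>2)" by simp
      also have "\<dots> \<le> c / 2 * (\<Sum>i\<in>I. (x i)\<^sup>2)" by (rule mult_right_mono[OF \<eta>c]) (simp add: sum_nonneg)
      finally have "quad H0 I x - c / 2 * (\<Sum>i\<in>I. (x i)\<^sup>2) \<le> quad (H s) I x" by linarith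
      moreover have "c * (\<Sum>i\<in>I. (x i)\<^sup>2) \<le> quad H0 I x" using co x by (auto simp: coercive_def)
      ultimately show "c / 2 * (\<Sum>i\<in>I. (x i)\<^sup>2) \<le> quad (H s) I x" by simp
    qed
  qed
qed

lemma ldet_has_derivative:
  assumes fin: "finite I" and M: "\<And>i j. i \<in> I \<Longrightarrow> j \<in> I \<Longrightarrow> ((\<lambda>t. M t i j) has_real_derivative M' i j) (at t)"
  shows "((\<lambda>t. ldet I (M t)) has_real_derivative (\<Sum>i\<in>I. \<Sum>j\<in>I. M' i j * cofac I (M t) i j)) (at t)"
proof -
  have "((\<lambda>t. ldet I (M t)) has_real_derivative
     (\<Sum>p | p permutes I. of_int (sign p) * (\<Sum>i\<in>I. M' i (p i) * (\<Prod>l\<in>I - {i}. M t l (p l))))) (at t)"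
    unfolding ldet_def
    by (intro DERIV_sum DERIV_cmult has_field_derivative_prod M) (auto simp: permutes_in_image)
  also have "(\<Sum>p | p permutes I. of_int (sign p) * (\<Sum>i\<in>I. M' i (p i) * (\<Prod>l\<in>I - {i}. M t l (p l)))) =
     (\<Sum>i\<in>I. \<Sum>p | p permutes I. M' i (p i) * (of_int (sign p) * (\<Prod>l\<in>I - {i}. M t l (p l))))"
    unfolding sum_distrib_left by (subst sum.swap) (simp add: mult_ac)
  also have "\<dots> = (\<Sum>i\<in>I. \<Sum>j\<in>I. M' i j * cofac I (M t) i j)"
  proof (rule sum.cong[OF refl])
    fix i assume i: "i \<in> I"
    have "(\<Sum>j\<in>I. M' i j * cofac I (M t) i j) =
       (\<Sum>j\<in>I. \<Sum>p | p \<in> {p. p permutes I} \<and> p i = j. M' i (p i) * (of_int (sign p) * (\<Prod>l\<in>I - {i}. M t l (p l))))"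
      unfolding cofac_def sum_distrib_left by (intro sum.cong refl) auto
    also have "\<dots> = (\<Sum>p | p permutes I. M' i (p i) * (of_int (sign p) * (\<Prod>l\<in>I - {i}. M t l (p l))))"
      using fin i by (intro sum.group) (auto simp: finite_permutations permutes_in_image)
    finally show "(\<Sum>p | p permutes I. M' i (p i) * (of_int (sign p) * (\<Prod>l\<in>I - {i}. M t l (p l)))) = (\<Sum>j\<in>I. M' i j * cofac I (M t) i j)" ..
  qed
  finally show ?thesis .
qed

text \<open>First moments are controlled through a uniform majorant, so remainders are shown to be
  bounded rather than convergent.\<close>

definition bounded_right :: "(real \<Rightarrow> real) \<Rightarrow> bool" where
  "bounded_right f \<longleftrightarrow> (\<exists>K. \<forall>\<^sub>F t in at_right 0. \<bar>f t\<bar> \<le> K)"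

lemma bounded_right_tendsto: "(f \<longlongrightarrow> l) (at_right 0) \<Longrightarrow> bounded_right f"
proof -
  assume "(f \<longlongrightarrow> l) (at_right 0)"
  then have "\<forall>\<^sub>F t in at_right 0. \<bar>f t\<bar> < \<bar>l\<bar> + 1" by (intro order_tendstoD[OF tendsto_rabs]) auto
  then show ?thesis unfolding bounded_right_def by (intro exI[of _ "\<bar>l\<bar> + 1"]) (auto elim: eventually_mono)
qed

lemma bounded_right_const [simp]: "bounded_right (\<lambda>_. c)"
  by (rule bounded_right_tendsto[of _ c]) simp

lemma bounded_right_add: "bounded_right f \<Longrightarrow> bounded_right g \<Longrightarrow> bounded_right (\<lambda>t. f t + g t)"
proof -
  assume "bounded_right f" "bounded_right g"
  then obtain K L where "\<forall>\<^sub>F t in at_right 0. \<bar>f t\<bar> \<le> K" "\<forall>\<^sub>F t in at_right 0. \<bar>g t\<bar> \<le> L" unfolding bounded_right_def by blast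
  then have "\<forall>\<^sub>F t in at_right 0. \<bar>f t + g t\<bar> \<le> K + L" by eventually_elim linarith
  then show ?thesis unfolding bounded_right_def by blast
qed

lemma bounded_right_mult: "bounded_right f \<Longrightarrow> bounded_right g \<Longrightarrow> bounded_right (\<lambda>t. f t * g t)"
proof -
  assume "bounded_right f" "bounded_right g"
  then obtain K L where "\<forall>\<^sub>F t in at_right 0. \<bar>f t\<bar> \<le> K" "\<forall>\<^sub>F t in at_right 0. \<bar>g t\<bar> \<le> L" unfolding bounded_right_def by blast
  then have "\<forall>\<^sub>F t in at_right 0. \<bar>f t * g t\<bar> \<le> K * L" by eventually_elim (auto simp: abs_mult intro!: mult_mono)
  then show ?thesis unfolding bounded_right_def by blast
qed

lemma bounded_right_sum: "(\<And>i. i \<in> I \<Longrightarrow> bounded_right (\<lambda>t. f t i)) \<Longrightarrow> bounded_right (\<lambda>t. \<Sum>i\<in>I. f t i)"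
  by (induction I rule: infinite_finite_induct) (auto intro: bounded_right_add)

lemma bounded_right_prod: "(\<And>i. i \<in> I \<Longrightarrow> bounded_right (\<lambda>t. f t i)) \<Longrightarrow> bounded_right (\<lambda>t. \<Prod>i\<in>I. f t i)"
  by (induction I rule: infinite_finite_induct) (auto intro: bounded_right_mult)

lemma coercive_mono: "coercive c H I \<Longrightarrow> 0 < c' \<Longrightarrow> c' \<le> c \<Longrightarrow> coercive c' H I"
proof -
  assume a: "coercive c H I" "0 < c'" "c' \<le> c"
  then have "c' * (\<Sum>i\<in>I. (x i)\<^sup>2) \<le> c * (\<Sum>i\<in>I. (x i)\<^sup>2)" for x :: "'a \<Rightarrow> real"
    by (intro mult_right_mono) (auto simp: sum_nonneg)
  then show ?thesis using a unfolding coercive_def by (meson order_trans)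
qed

lemma eventually_at_right_0_withinI:
  "(\<And>t. 0 < t \<Longrightarrow> t < b \<Longrightarrow> P t) \<Longrightarrow> b > 0 \<Longrightarrow> eventually P (at_right (0::real))"
  by (auto simp: eventually_at_right_field)

lemma at_within_nonneg: "0 < (t::real) \<Longrightarrow> at t within {0..} = at t"
  by (rule at_within_interior) (simp add: interior_Ici[of "-1"])

lemma tendsto_at_right_of_derivative:
  assumes "(f has_real_derivative D) (at 0 within {0..})"
  shows "(f \<longlongrightarrow> f 0) (at_right 0)"
proof -
  have "(f \<longlongrightarrow> f 0) (at 0 within {0..})" using DERIV_continuous[OF assms] by (simp add: continuous_within)
  then show ?thesis by (rule tendsto_within_subset) auto
qed

text \<open>Halving \<open>c\<close> buys an interval with one coercivity constant, which serves
  both the differentiation and the uniform moment bounds.\<close>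

lemma gauss_derivative_near:
  fixes H H' :: "real \<Rightarrow> 'a \<Rightarrow> 'a \<Rightarrow> real"
  assumes fin: "finite I" and co: "coercive c (H 0) I"
    and dH: "\<And>i j t. i \<in> I \<Longrightarrow> j \<in> I \<Longrightarrow> t \<ge> 0 \<Longrightarrow> ((\<lambda>t. H t i j) has_real_derivative H' t i j) (at t within {0..})"
  obtains b where "b > 0" "\<And>t. 0 \<le> t \<Longrightarrow> t < b \<Longrightarrow> coercive (c / 2) (H t) I"
    "\<And>t. 0 \<le> t \<Longrightarrow> t < b \<Longrightarrow> ((\<lambda>s. gauss (H s) I (\<lambda>_. 1)) has_real_derivative
       - (\<Sum>i\<in>I. \<Sum>j\<in>I. H' t i j * gauss (H t) I (\<lambda>x. x i * x j)) / 2) (at t within {0..})"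
proof -
  have c: "c > 0" using co by (simp add: coercive_def)
  have "((\<lambda>t. H t i j) \<longlongrightarrow> H 0 i j) (at_right 0)" if "i \<in> I" "j \<in> I" for i j
    by (rule tendsto_at_right_of_derivative[OF dH[OF that]]) simp
  then have "\<forall>\<^sub>F t in at_right 0. coercive (c / 2) (H t) I" by (rule coercive_eventually[OF fin co])
  then obtain b where b: "b > 0" "\<And>t. 0 < t \<Longrightarrow> t < b \<Longrightarrow> coercive (c / 2) (H t) I"
    unfolding eventually_at_right_field by auto
  have cob: "coercive (c / 2) (H t) I" if "0 \<le> t" "t < b" for t
    using b(2)[of t] coercive_mono[OF co, of "c / 2"] c that by (cases "t = 0") auto
  show ?thesis
  proof (rule that[OF b(1) cob])
    fix t assume t: "0 \<le> t" "t < b"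
    have "\<forall>\<^sub>F s in at t within {0..}. s < b" by (rule order_tendstoD(2)[OF tendsto_ident_at t(2)])
    moreover have "\<forall>\<^sub>F s in at t within {0..}. s \<in> {0..}" by (simp add: eventually_at_filter)
    ultimately have "\<forall>\<^sub>F s in at t within {0..}. coercive (c / 2) (H s) I"
      by eventually_elim (simp add: cob)
    then show "((\<lambda>s. gauss (H s) I (\<lambda>_. 1)) has_real_derivative
       - (\<Sum>i\<in>I. \<Sum>j\<in>I. H' t i j * gauss (H t) I (\<lambda>x. x i * x j)) / 2) (at t within {0..})"
      using gauss_has_derivative[OF fin cob[OF t] _ dH] t by simp
  qed
qed

text \<open>The left side of the first claim is 2 sqrt det times the derivative of sqrt det * J. By
  integration by parts and Cramer's rule the second moments are combinations of \<open>J\<close> and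
  of first moments on facets. The terms with \<open>J\<close> cancel against the derivative of the
  determinant and only facets remain.\<close>

lemma schlaefli_gauss:
  fixes dH :: "'a \<Rightarrow> 'a \<Rightarrow> real"
  assumes fin: "finite F" and co: "coercive c H F" and sym: "\<And>i j. H i j = H j i" and symd: "\<And>i j. dH i j = dH j i"
  shows "2 * (ldet F H * (- (\<Sum>i\<in>F. \<Sum>j\<in>F. dH i j * gauss H F (\<lambda>x. x i * x j)) / 2) +
       (\<Sum>i\<in>F. \<Sum>j\<in>F. dH i j * cofac F H i j) * gauss H F (\<lambda>_. 1) / 2) =
    - (\<Sum>l\<in>F. \<Sum>i\<in>F - {l}. gauss H (F - {l}) (\<lambda>x. x i) * (\<Sum>j\<in>F. cofac F H l j * dH j i))"
    and "i \<in> F \<Longrightarrow> ldet F H * gauss H F (\<lambda>x. x i) = (\<Sum>m\<in>F. cofac F H i m * gauss H (F - {m}) (\<lambda>_. 1))"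
proof -
  let ?J = "gauss H F (\<lambda>_. 1)" and ?x = "\<lambda>l i. gauss H (F - {l}) (\<lambda>x. x i)"
  show "i \<in> F \<Longrightarrow> ldet F H * gauss H F (\<lambda>x. x i) = (\<Sum>m\<in>F. cofac F H i m * gauss H (F - {m}) (\<lambda>_. 1))"
    by (rule cofac_kernel[OF fin sym]) (use gauss_ibp_one[OF fin co sym] in auto)
  have xx: "ldet F H * gauss H F (\<lambda>x. x i * x j) = cofac F H j i * ?J + (\<Sum>l\<in>F - {i}. cofac F H l j * ?x l i)"
    if i: "i \<in> F" and j: "j \<in> F" for i j
  proof -
    have "ldet F H * gauss H F (\<lambda>x. x i * x j) = (\<Sum>l\<in>F. cofac F H j l * (if l = i then ?J else ?x l i))"
      by (rule cofac_kernel[OF fin sym j]) (use gauss_ibp_coord[OF fin co sym] i in auto)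
    also have "\<dots> = cofac F H j i * ?J + (\<Sum>l\<in>F - {i}. cofac F H j l * ?x l i)"
      using sum.remove[OF fin i, of "\<lambda>l. cofac F H j l * (if l = i then ?J else ?x l i)"] by simp
    also have "(\<Sum>l\<in>F - {i}. cofac F H j l * ?x l i) = (\<Sum>l\<in>F - {i}. cofac F H l j * ?x l i)"
      using cofac_sym[OF fin j _ sym] by (intro sum.cong) auto
    finally show ?thesis .
  qed
  have "(\<Sum>i\<in>F. \<Sum>j\<in>F. dH i j * (ldet F H * gauss H F (\<lambda>x. x i * x j))) =
    (\<Sum>i\<in>F. \<Sum>j\<in>F. dH i j * (cofac F H j i * ?J)) + (\<Sum>i\<in>F. \<Sum>j\<in>F. \<Sum>l\<in>F - {i}. dH i j * (cofac F H l j * ?x l i))"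
    unfolding sum.distrib[symmetric] by (intro sum.cong refl) (simp add: xx distrib_left sum_distrib_left)
  also have "(\<Sum>i\<in>F. \<Sum>j\<in>F. dH i j * (cofac F H j i * ?J)) = (\<Sum>i\<in>F. \<Sum>j\<in>F. dH i j * cofac F H i j) * ?J"
    unfolding sum_distrib_right using cofac_sym[OF fin _ _ sym] by (intro sum.cong refl) auto
  also have "(\<Sum>i\<in>F. \<Sum>j\<in>F. \<Sum>l\<in>F - {i}. dH i j * (cofac F H l j * ?x l i)) =
     (\<Sum>i\<in>F. \<Sum>l\<in>F - {i}. \<Sum>j\<in>F. dH i j * (cofac F H l j * ?x l i))"
    by (intro sum.cong refl sum.swap)
  also have "\<dots> = (\<Sum>i\<in>F. \<Sum>l\<in>F. if l \<noteq> i then \<Sum>j\<in>F. dH i j * (cofac F H l j * ?x l i) else 0)"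
    using fin by (intro sum.cong refl sum.mono_neutral_cong_left) auto
  also have "\<dots> = (\<Sum>l\<in>F. \<Sum>i\<in>F. if l \<noteq> i then \<Sum>j\<in>F. dH i j * (cofac F H l j * ?x l i) else 0)"
    by (rule sum.swap)
  also have "\<dots> = (\<Sum>l\<in>F. \<Sum>i\<in>F - {l}. \<Sum>j\<in>F. dH i j * (cofac F H l j * ?x l i))"
    using fin by (intro sum.cong refl sum.mono_neutral_cong_right) auto
  also have "\<dots> = (\<Sum>l\<in>F. \<Sum>i\<in>F - {l}. ?x l i * (\<Sum>j\<in>F. cofac F H l j * dH j i))"
    unfolding sum_distrib_left using symd by (intro sum.cong refl) auto
  also have "(\<Sum>i\<in>F. \<Sum>j\<in>F. dH i j * (ldet F H * gauss H F (\<lambda>x. x i * x j))) =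
      ldet F H * (\<Sum>i\<in>F. \<Sum>j\<in>F. dH i j * gauss H F (\<lambda>x. x i * x j))"
    by (simp add: sum_distrib_left mult.left_commute)
  finally have key: "ldet F H * (\<Sum>i\<in>F. \<Sum>j\<in>F. dH i j * gauss H F (\<lambda>x. x i * x j)) =
      (\<Sum>i\<in>F. \<Sum>j\<in>F. dH i j * cofac F H i j) * ?J + (\<Sum>l\<in>F. \<Sum>i\<in>F - {l}. ?x l i * (\<Sum>j\<in>F. cofac F H l j * dH j i))" .
  have arith: "2 * (d * (- G / 2) + A * j / 2) = - B" if "d * G = A * j + B" for d G A j B :: real
    using that by (simp add: field_simps)
  show "2 * (ldet F H * (- (\<Sum>i\<in>F. \<Sum>j\<in>F. dH i j * gauss H F (\<lambda>x. x i * x j)) / 2) +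
       (\<Sum>i\<in>F. \<Sum>j\<in>F. dH i j * cofac F H i j) * ?J / 2) =
    - (\<Sum>l\<in>F. \<Sum>i\<in>F - {l}. ?x l i * (\<Sum>j\<in>F. cofac F H l j * dH j i))"
    by (rule arith[OF key])
qed

section \<open>Rigidity of constrained motions\<close>

lemma mono_on_deriv_nonneg:
  fixes f :: "real \<Rightarrow> real"
  assumes "mono_on {0..<b} f" "(f has_real_derivative D) (at t)" "0 < t" "t < b"
  shows "0 \<le> D"
proof (rule mono_on_imp_deriv_nonneg[OF _ assms(2)])
  show "mono_on {0<..<b} f" using assms(1) by (rule mono_on_subset) auto
  show "t \<in> interior {0<..<b}" using assms by (simp add: interior_open)
qed

lemma signed_mono_deriv:
  fixes f :: "real \<Rightarrow> real"
  assumes "0 < s \<longrightarrow> mono_on {0..<b} f" "s < 0 \<longrightarrow> antimono_on {0..<b} f" "s * p > 0"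
    and "(f has_real_derivative D) (at t)" "0 < t" "t < b"
  shows "0 \<le> p * D"
proof (cases "s > 0")
  case True
  then have "p > 0" using assms(3) by (simp add: zero_less_mult_iff)
  moreover have "0 \<le> D" using mono_on_deriv_nonneg[of b f D t] assms True by simp
  ultimately show ?thesis by simp
next
  case False
  then have s: "s < 0" and p: "p < 0" using assms(3) by (auto simp: zero_less_mult_iff)
  have "mono_on {0..<b} (\<lambda>x. - f x)"
    using assms(2) s by (auto simp: monotone_on_def)
  then have "0 \<le> - D" using mono_on_deriv_nonneg[of b "\<lambda>x. - f x" "- D" t] assms(4-6) by (simp add: DERIV_minus)
  then show ?thesis using p by (simp add: mult_nonpos_nonpos)
qed

lemma prod_sign_eventually:
  fixes a :: "real \<Rightarrow> 'a \<Rightarrow> real"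
  assumes "\<And>i. i \<in> F \<Longrightarrow> ((\<lambda>t. a t i) \<longlongrightarrow> \<alpha> i) (at_right 0)" and "(\<Prod>i\<in>F. \<alpha> i) \<noteq> 0"
  shows "\<forall>\<^sub>F t in at_right 0. (\<Prod>i\<in>F. \<alpha> i) * (\<Prod>i\<in>F. a t i) > 0"
proof (rule order_tendstoD)
  show "((\<lambda>t. (\<Prod>i\<in>F. \<alpha> i) * (\<Prod>i\<in>F. a t i)) \<longlongrightarrow> (\<Prod>i\<in>F. \<alpha> i) * (\<Prod>i\<in>F. \<alpha> i)) (at_right 0)"
    by (intro tendsto_intros assms)
  show "0 < (\<Prod>i\<in>F. \<alpha> i) * (\<Prod>i\<in>F. \<alpha> i)" using assms(2) by (metis not_real_square_gt_zero)
qed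

text \<open>The stress is frozen at \<open>o'\<close>, \<open>s\<close> distinguishes the two kinds
  of constraints, and \<sigma> makes the determinants of the constrained faces positive. These faces
  have k + 2 vertices here and the invariant runs over sets of k vertices. Positivity is asked of
  vectors whose image under \<open>H t\<close> vanishes off \<open>o'\<close>, as that of the
  continued stress does.\<close>

lemma radial_motion_rigid:
  fixes H H' :: "real \<Rightarrow> 'a \<Rightarrow> 'a \<Rightarrow> real" and \<alpha> :: "'a \<Rightarrow> real"
  defines "vol \<equiv> \<lambda>\<sigma> F t. sqrt (\<sigma> * ldet F (H t)) * gauss (H t) F (\<lambda>_. 1)"
  assumes fin: "finite U" and o: "o' \<in> U" and k: "Suc (Suc k) < card U"
    and sym: "\<And>t i j. H t i j = H t j i" and symd: "\<And>t i j. H' t i j = H' t j i"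
    and dH: "\<And>i j t. i \<in> U \<Longrightarrow> j \<in> U \<Longrightarrow> t \<ge> 0 \<Longrightarrow> ((\<lambda>t. H t i j) has_real_derivative H' t i j) (at t within {0..})"
    and H'0: "\<And>i j. i \<in> U \<Longrightarrow> j \<in> U \<Longrightarrow> ((\<lambda>t. H' t i j) \<longlongrightarrow> H' 0 i j) (at_right 0)"
    and nz: "\<And>E. E \<subset> U \<Longrightarrow> ldet E (H 0) \<noteq> 0"
    and co: "\<And>E. E \<subset> U \<Longrightarrow> \<exists>c. coercive c (H 0) E"
    and ker: "\<And>i. i \<in> U \<Longrightarrow> (\<Sum>j\<in>U. H 0 i j * \<alpha> j) = 0" and \<alpha>: "\<And>i. i \<in> U \<Longrightarrow> \<alpha> i \<noteq> 0"
    and \<kappa>: "\<kappa> * \<kappa> = 1"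
    and psd: "\<And>t x. t \<ge> 0 \<Longrightarrow> (\<And>i. i \<in> U - {o'} \<Longrightarrow> (\<Sum>j\<in>U. H t i j * x j) = 0) \<Longrightarrow>
        0 \<le> \<kappa> * (\<Sum>i\<in>U. x i * (\<Sum>j\<in>U. H t i j * x j))"
    and \<sigma>: "\<And>F. F \<subseteq> U \<Longrightarrow> card F = Suc (Suc k) \<Longrightarrow> \<sigma> * ldet F (H 0) > 0"
    and s: "s * \<sigma> * \<kappa> * (\<Sum>E | E \<subseteq> U \<and> card E = k. (\<Prod>i\<in>E. \<alpha> i) * (ldet E (H 0) * gauss (H 0) E (\<lambda>_. 1))) > 0"
    and \<delta>0: "\<delta>0 > 0"
    and mono: "\<And>F. F \<subseteq> U \<Longrightarrow> card F = Suc (Suc k) \<Longrightarrow>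
       (0 < s * (\<Prod>i\<in>F. \<alpha> i) \<longrightarrow> mono_on {0..<\<delta>0} (vol \<sigma> F)) \<and> (s * (\<Prod>i\<in>F. \<alpha> i) < 0 \<longrightarrow> antimono_on {0..<\<delta>0} (vol \<sigma> F))"
  shows "\<exists>\<delta>>0. \<forall>t. 0 < t \<and> t < \<delta> \<longrightarrow>
     (\<forall>F. F \<subseteq> U \<and> card F = Suc (Suc k) \<longrightarrow> vol \<sigma> F t = vol \<sigma> F 0) \<and>
     (\<exists>x. x o' = \<alpha> o' \<and> (\<forall>i\<in>U. (\<Sum>j\<in>U. H t i j * x j) = 0))"
proof -
  define Fs where "Fs = {F. F \<subseteq> U \<and> card F = Suc (Suc k)}"
  have finU: "finite {E. E \<subseteq> U \<and> P E}" for P by (rule finite_subset[of _ "Pow U"]) (use fin in auto)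
  have finFs: "finite Fs" unfolding Fs_def by (rule finU)
  have sub: "E \<subset> U" if "E \<subseteq> U" "card E \<le> Suc (Suc k)" for E using that k by (auto simp: psubset_eq)
  have finE: "finite E" if "E \<subseteq> U" for E using that fin finite_subset by blast
  have Hlim: "((\<lambda>t. H t i j) \<longlongrightarrow> H 0 i j) (at_right 0)" if "i \<in> U" "j \<in> U" for i j
    by (rule tendsto_at_right_of_derivative[OF dH[OF that]]) simp
  have dH1: "((\<lambda>t. H t i j) has_real_derivative H' t i j) (at t)" if "i \<in> U" "j \<in> U" "t > 0" for i j t
    using dH[OF that(1,2), of t] that(3) at_within_nonneg[OF that(3)] by simp
  have \<alpha>o: "\<alpha> o' \<noteq> 0" and s0: "s \<noteq> 0" using \<alpha>[OF o] s by auto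
  have Uo: "U - {o'} \<subset> U" using o by auto
  obtain a \<mu> where a: "\<And>i. i \<in> U \<Longrightarrow> ((\<lambda>t. a t i) \<longlongrightarrow> \<alpha> i) (at_right 0)" and \<mu>: "(\<mu> \<longlongrightarrow> 0) (at_right 0)"
    and ak: "\<forall>\<^sub>F t in at_right 0. a t o' = \<alpha> o' \<and> (\<forall>i\<in>U. (\<Sum>j\<in>U. H t i j * a t j) = (if i = o' then \<mu> t else 0))"
    and dm: "\<forall>\<^sub>F t in at_right 0. ((\<lambda>t. \<alpha> o' * \<mu> t) has_real_derivative (\<Sum>i\<in>U. \<Sum>j\<in>U. a t i * a t j * H' t i j)) (at t)"
    by (rule stress_continuation[OF fin o sym Hlim dH1 H'0 nz[OF Uo] ker]) auto
  define J where "J t E = gauss (H t) E (\<lambda>_. 1)" for t E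
  define dJ where "dJ t E = - (\<Sum>i\<in>E. \<Sum>j\<in>E. H' t i j * gauss (H t) E (\<lambda>x. x i * x j)) / 2" for t E
  define x1 where "x1 t E i = gauss (H t) E (\<lambda>x. x i)" for t E i
  define dL where "dL t E = (\<Sum>i\<in>E. \<Sum>j\<in>E. H' t i j * cofac E (H t) i j)" for t E
  \<comment> \<open>This is sqrt det times the derivative of sqrt det * J, free of square
    roots.\<close>
  define X where "X t F = ldet F (H t) * dJ t F + dL t F * J t F / 2" for t F
  define h where "h t i = (\<Sum>j\<in>U. H' t i j * a t j)" for t i
  \<comment> \<open>\<open>H a\<close> is \<mu> times this unit vector, so \<mu> factors out of all
    terms linear in \<open>g\<close>; \<rho> is what they leave.\<close>
  define \<delta>f where "\<delta>f p = (if p = o' then 1 else 0 :: real)" for p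
  define C0 where "C0 t = (\<Sum>E | E \<subseteq> U \<and> card E = k. (\<Prod>i\<in>E. a t i) * (ldet E (H t) * J t E))" for t
  define \<rho> where "\<rho> t = (\<Sum>E | E \<subseteq> U \<and> card E = Suc k. (\<Prod>i\<in>E. a t i) *
          (\<Sum>i\<in>E. x1 t E i * (\<Sum>j\<in>E. \<Sum>p\<in>E. cofac E (H t) j p * \<delta>f p * H' t j i)))
     + (\<Sum>E | E \<subseteq> U \<and> card E = k. (\<Prod>i\<in>E. a t i) * (J t E * (\<Sum>i\<in>E. \<Sum>p\<in>E. cofac E (H t) i p * \<delta>f p * h t i)))" for t
  have ldet_lim: "((\<lambda>t. ldet E (H t)) \<longlongrightarrow> ldet E (H 0)) (at_right 0)" if "E \<subseteq> U" for E
    using that by (intro tendsto_ldet finE Hlim) auto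
  have cofac_lim: "((\<lambda>t. cofac E (H t) i j) \<longlongrightarrow> cofac E (H 0) i j) (at_right 0)" if "E \<subseteq> U" for E i j
    unfolding cofac_def using that by (intro tendsto_intros Hlim) (auto simp: permutes_in_image)
  have near: "\<exists>c b. c > 0 \<and> b > 0 \<and> (\<forall>t. 0 \<le> t \<and> t < b \<longrightarrow> coercive c (H t) E \<and>
      ((\<lambda>s. J s E) has_real_derivative dJ t E) (at t within {0..}))" if E: "E \<subset> U" for E
  proof -
    have EU: "E \<subseteq> U" using E by auto
    obtain c where c: "coercive c (H 0) E" using co[OF E] by blast
    obtain b where "b > 0" "\<And>t. 0 \<le> t \<Longrightarrow> t < b \<Longrightarrow> coercive (c / 2) (H t) E"
      "\<And>t. 0 \<le> t \<Longrightarrow> t < b \<Longrightarrow> ((\<lambda>s. gauss (H s) E (\<lambda>_. 1)) has_real_derivative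
       - (\<Sum>i\<in>E. \<Sum>j\<in>E. H' t i j * gauss (H t) E (\<lambda>x. x i * x j)) / 2) (at t within {0..})"
      by (rule gauss_derivative_near[of E c H H', OF finE[OF EU] c dH]) (use subsetD[OF EU] in auto)
    then show ?thesis using c unfolding J_def dJ_def
      by (intro exI[of _ "c / 2"] exI[of _ b]) (auto simp: coercive_def)
  qed
  have J_lim: "((\<lambda>t. J t E) \<longlongrightarrow> J 0 E) (at_right 0)" if E: "E \<subset> U" for E
    using near[OF E] by (auto intro: tendsto_at_right_of_derivative)
  have J_der: "\<forall>\<^sub>F t in at_right 0. ((\<lambda>s. J s E) has_real_derivative dJ t E) (at t)" if E: "E \<subset> U" for E
  proof -
    obtain b where b: "b > 0" "\<And>t. 0 \<le> t \<Longrightarrow> t < b \<Longrightarrow> ((\<lambda>s. J s E) has_real_derivative dJ t E) (at t within {0..})"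
      using near[OF E] by blast
    show ?thesis
    proof (rule eventually_at_right_0_withinI[of b])
      fix t assume "0 < t" "t < b"
      then show "((\<lambda>s. J s E) has_real_derivative dJ t E) (at t)" using b(2)[of t] at_within_nonneg[of t] by simp
    qed (rule b(1))
  qed
  have co_ev: "\<forall>\<^sub>F t in at_right 0. \<exists>c. coercive c (H t) E" if E: "E \<subset> U" for E
  proof -
    obtain b c where "b > 0" "\<And>t. 0 \<le> t \<Longrightarrow> t < b \<Longrightarrow> coercive c (H t) E" using near[OF E] by blast
    then show ?thesis by (intro eventually_at_right_0_withinI[of b]) (auto intro: exI[of _ c])
  qed
  have x1_bnd: "bounded_right (\<lambda>t. x1 t E i)" if E: "E \<subset> U" and i: "i \<in> E" for E i
  proof -
    obtain b c where b: "b > 0" and c: "\<And>t. 0 \<le> t \<Longrightarrow> t < b \<Longrightarrow> coercive c (H t) E" using near[OF E] by blast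
    have "\<bar>x1 t E i\<bar> \<le> 1 * (\<integral>x. gauss_dom c E x \<partial>orthant E)" if t: "0 < t" "t < b" for t
      unfolding x1_def
    proof (rule gauss_integrable(2))
      show "finite E" using E finE by auto
      show "coercive c (H t) E" using c t by simp
      show "(\<lambda>x. x i) \<in> borel_measurable (orthant E)" using i by (rule measurable_orthant)
      fix x assume x: "x \<in> space (orthant E)"
      show "\<bar>x i\<bar> \<le> 1 * (\<Prod>i\<in>E. (1 + x i)\<^sup>2)"
        using moment_bounds(2)[of E x i] orthant_nonneg[OF x] i E finE by (auto simp: psubset_eq)
    qed
    then show ?thesis unfolding bounded_right_def using b
      by (intro exI[of _ "1 * (\<integral>x. gauss_dom c E x \<partial>orthant E)"] eventually_at_right_0_withinI[of b])
  qed
  have prod_lim: "((\<lambda>t. \<Prod>i\<in>E. a t i) \<longlongrightarrow> (\<Prod>i\<in>E. \<alpha> i)) (at_right 0)" if "E \<subseteq> U" for E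
    using that by (intro tendsto_intros a) auto
  have "(C0 \<longlongrightarrow> (\<Sum>E | E \<subseteq> U \<and> card E = k. (\<Prod>i\<in>E. \<alpha> i) * (ldet E (H 0) * J 0 E))) (at_right 0)"
    unfolding C0_def by (intro tendsto_intros prod_lim ldet_lim J_lim sub) auto
  then have C_lim: "((\<lambda>t. 1 / 2 * (s * \<sigma> * \<kappa> * C0 t)) \<longlongrightarrow> 1 / 2 * (s * \<sigma> * \<kappa> * (\<Sum>E | E \<subseteq> U \<and> card E = k. (\<Prod>i\<in>E. \<alpha> i) * (ldet E (H 0) * J 0 E)))) (at_right 0)"
    by (intro tendsto_intros)
  obtain c1 where c1: "c1 > 0" "1 / 2 * (s * \<sigma> * \<kappa> * (\<Sum>E | E \<subseteq> U \<and> card E = k. (\<Prod>i\<in>E. \<alpha> i) * (ldet E (H 0) * J 0 E))) > c1"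
    using s dense[of 0 "1 / 2 * (s * \<sigma> * \<kappa> * (\<Sum>E | E \<subseteq> U \<and> card E = k. (\<Prod>i\<in>E. \<alpha> i) * (ldet E (H 0) * J 0 E)))"]
    unfolding J_def by auto
  have C_ev: "\<forall>\<^sub>F t in at_right 0. c1 < 1 / 2 * (s * \<sigma> * \<kappa> * C0 t)"
    by (rule order_tendstoD(1)[OF C_lim c1(2)])
  have \<rho>_bnd: "bounded_right \<rho>"
  proof -
    have h_bnd: "bounded_right (\<lambda>t. h t i)" if "i \<in> U" for i
      unfolding h_def using that by (intro bounded_right_sum bounded_right_mult bounded_right_tendsto[OF H'0] bounded_right_tendsto[OF a]) auto
    show ?thesis unfolding \<rho>_def
      by (intro bounded_right_add bounded_right_sum bounded_right_mult bounded_right_const h_bnd x1_bnd bounded_right_tendsto[OF prod_lim] bounded_right_tendsto[OF cofac_lim]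
          bounded_right_tendsto[OF J_lim] bounded_right_tendsto[OF H'0] sub) auto
  qed
  then obtain K where K: "\<forall>\<^sub>F t in at_right 0. \<bar>\<rho> t\<bar> \<le> K" unfolding bounded_right_def by blast
  have nz_ev: "\<forall>\<^sub>F t in at_right 0. \<forall>E\<in>{E. E \<subseteq> U \<and> E \<noteq> U}. ldet E (H t) \<noteq> 0"
    using finU nz ldet_lim by (intro eventually_ball_finite ballI) (auto intro!: tendsto_imp_eventually_ne)
  have co_all: "\<forall>\<^sub>F t in at_right 0. \<forall>E\<in>{E. E \<subseteq> U \<and> E \<noteq> U}. \<exists>c. coercive c (H t) E"
    using finU co_ev by (intro eventually_ball_finite ballI) auto
  have \<sigma>_ev: "\<forall>\<^sub>F t in at_right 0. \<forall>F\<in>Fs. \<sigma> * ldet F (H t) > 0"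
    using finFs
  proof (rule eventually_ball_finite, intro ballI)
    fix F assume "F \<in> Fs"
    then show "\<forall>\<^sub>F t in at_right 0. \<sigma> * ldet F (H t) > 0"
      using \<sigma>[of F] ldet_lim[of F] unfolding Fs_def
      by (auto intro!: order_tendstoD(1)[of _ "\<sigma> * ldet F (H 0)"] tendsto_intros)
  qed
  have Jd_ev: "\<forall>\<^sub>F t in at_right 0. \<forall>F\<in>Fs. ((\<lambda>s. J s F) has_real_derivative dJ t F) (at t)"
    using finFs by (intro eventually_ball_finite ballI J_der sub) (auto simp: Fs_def)
  have sg_ev: "\<forall>\<^sub>F t in at_right 0. \<forall>F\<in>Fs. (\<Prod>i\<in>F. \<alpha> i) * (\<Prod>i\<in>F. a t i) > 0"
    using finFs finE \<alpha> by (intro eventually_ball_finite ballI prod_sign_eventually a) (auto simp: Fs_def subset_iff)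
  have all_ev: "\<forall>\<^sub>F t in at_right 0.
     (a t o' = \<alpha> o' \<and> (\<forall>i\<in>U. (\<Sum>j\<in>U. H t i j * a t j) = (if i = o' then \<mu> t else 0))) \<and>
     ((\<lambda>t. \<alpha> o' * \<mu> t) has_real_derivative (\<Sum>i\<in>U. \<Sum>j\<in>U. a t i * a t j * H' t i j)) (at t) \<and>
     c1 < 1 / 2 * (s * \<sigma> * \<kappa> * C0 t) \<and> \<bar>\<rho> t\<bar> \<le> K \<and>
     (\<forall>E\<in>{E. E \<subseteq> U \<and> E \<noteq> U}. ldet E (H t) \<noteq> 0) \<and> (\<forall>E\<in>{E. E \<subseteq> U \<and> E \<noteq> U}. \<exists>c. coercive c (H t) E) \<and>
     (\<forall>F\<in>Fs. \<sigma> * ldet F (H t) > 0) \<and> (\<forall>F\<in>Fs. ((\<lambda>s. J s F) has_real_derivative dJ t F) (at t)) \<and>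
     (\<forall>F\<in>Fs. (\<Prod>i\<in>F. \<alpha> i) * (\<Prod>i\<in>F. a t i) > 0)"
    by (intro eventually_conj ak dm C_ev K nz_ev co_all \<sigma>_ev Jd_ev sg_ev)
  then obtain \<delta>1 where \<delta>1: "\<delta>1 > 0" and ev: "\<And>t. 0 < t \<Longrightarrow> t < \<delta>1 \<Longrightarrow>
     (a t o' = \<alpha> o' \<and> (\<forall>i\<in>U. (\<Sum>j\<in>U. H t i j * a t j) = (if i = o' then \<mu> t else 0))) \<and>
     ((\<lambda>t. \<alpha> o' * \<mu> t) has_real_derivative (\<Sum>i\<in>U. \<Sum>j\<in>U. a t i * a t j * H' t i j)) (at t) \<and>
     c1 < 1 / 2 * (s * \<sigma> * \<kappa> * C0 t) \<and> \<bar>\<rho> t\<bar> \<le> K \<and>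
     (\<forall>E\<in>{E. E \<subseteq> U \<and> E \<noteq> U}. ldet E (H t) \<noteq> 0) \<and> (\<forall>E\<in>{E. E \<subseteq> U \<and> E \<noteq> U}. \<exists>c. coercive c (H t) E) \<and>
     (\<forall>F\<in>Fs. \<sigma> * ldet F (H t) > 0) \<and> (\<forall>F\<in>Fs. ((\<lambda>s. J s F) has_real_derivative dJ t F) (at t)) \<and>
     (\<forall>F\<in>Fs. (\<Prod>i\<in>F. \<alpha> i) * (\<Prod>i\<in>F. a t i) > 0)"
    unfolding eventually_at_right_field by auto
  define \<delta> where "\<delta> = min \<delta>0 \<delta>1"
  have \<delta>: "\<delta> > 0" "\<delta> \<le> \<delta>0" "\<delta> \<le> \<delta>1" using \<delta>0 \<delta>1 by (auto simp: \<delta>_def)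
  define dV where "dV F t = \<sigma> * dL t F / (2 * sqrt (\<sigma> * ldet F (H t))) * J t F + sqrt (\<sigma> * ldet F (H t)) * dJ t F" for F t
  \<comment> \<open>The root in the weight cancels the one in the volume derivative, leaving
    \<open>s * \<sigma>\<close> times the weighted \<open>X\<close>.\<close>
  define w where "w F t = s * (\<Prod>i\<in>F. a t i) * sqrt (\<sigma> * ldet F (H t))" for F t
  have dvol: "(vol \<sigma> F has_real_derivative dV F t) (at t)" if F: "F \<in> Fs" and t: "0 < t" "t < \<delta>" for F t
  proof -
    have FU: "F \<subseteq> U" using F by (simp add: Fs_def)
    have pos: "\<sigma> * ldet F (H t) > 0" and Jd: "((\<lambda>s. J s F) has_real_derivative dJ t F) (at t)"
      using ev[of t] t \<delta> F by auto
    have "((\<lambda>t. ldet F (H t)) has_real_derivative dL t F) (at t)"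
      unfolding dL_def using FU t by (intro ldet_has_derivative finE dH1) auto
    then have "((\<lambda>t. \<sigma> * ldet F (H t)) has_real_derivative \<sigma> * dL t F) (at t)" by (rule DERIV_cmult)
    note d = DERIV_mult[OF DERIV_chain2[OF DERIV_real_sqrt[OF pos] this] Jd]
    have arith: "inverse r / 2 * D * j + d * r = D / (2 * r) * j + r * d" if "r > 0" for r D j d :: real
      using that by (simp add: field_simps)
    show ?thesis unfolding vol_def J_def[symmetric] dV_def
      by (rule DERIV_cong[OF d]) (rule arith, use pos in simp)
  qed
  have wX: "w F t * dV F t = s * \<sigma> * ((\<Prod>i\<in>F. a t i) * X t F)" if F: "F \<in> Fs" and t: "0 < t" "t < \<delta>" for F t
  proof -
    have pos: "\<sigma> * ldet F (H t) > 0" using ev[of t] t \<delta> F by auto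
    have arith: "r * (D / (2 * r) * j + r * d) = D * j / 2 + q * d" if "r > 0" "r * r = q" for r D j d q :: real
      using that by (auto simp: field_simps)
    have "sqrt (\<sigma> * ldet F (H t)) * dV F t = \<sigma> * dL t F * J t F / 2 + (\<sigma> * ldet F (H t)) * dJ t F"
      unfolding dV_def by (rule arith) (use pos in \<open>simp_all only: real_sqrt_gt_zero real_sqrt_mult_self abs_of_pos\<close>)
    also have "\<dots> = \<sigma> * X t F" by (simp add: X_def algebra_simps)
    finally show ?thesis by (simp add: w_def mult_ac)
  qed
  have main: "(\<Sum>F\<in>Fs. w F t * dV F t) = - (1 / 2 * (s * \<sigma> * \<kappa> * C0 t)) * (\<kappa> * (\<Sum>i\<in>U. \<Sum>j\<in>U. a t i * a t j * H' t i j)) + s * \<sigma> / 2 * (\<mu> t * \<rho> t)"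
    if t: "0 < t" "t < \<delta>" for t
  proof -
    note e0 = ev[OF t(1) order.strict_trans2[OF t(2) \<delta>(3)]]
    have E: "ldet E (H t) \<noteq> 0" "\<exists>c. coercive c (H t) E" if "E \<subset> U" for E
      using e0[THEN conjunct2, THEN conjunct2, THEN conjunct2, THEN conjunct2, THEN conjunct1]
        e0[THEN conjunct2, THEN conjunct2, THEN conjunct2, THEN conjunct2, THEN conjunct2, THEN conjunct1] that by blast+
    have gk: "(\<Sum>j\<in>U. H t i j * a t j) = (if i = o' then \<mu> t else 0)" if "i \<in> U" for i
      using e0[THEN conjunct1] that by blast
    have "2 * (\<Sum>F\<in>Fs. (\<Prod>i\<in>F. a t i) * X t F) =
     - (\<Sum>i\<in>U. a t i * h t i) * C0 t
     + (\<Sum>E | E \<subseteq> U \<and> card E = Suc k. (\<Prod>i\<in>E. a t i) *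
          (\<Sum>i\<in>E. x1 t E i * (\<Sum>j\<in>E. \<Sum>p\<in>E. cofac E (H t) j p * (\<mu> t * \<delta>f p) * H' t j i)))
     + (\<Sum>E | E \<subseteq> U \<and> card E = k. (\<Prod>i\<in>E. a t i) * (J t E * (\<Sum>i\<in>E. \<Sum>p\<in>E. cofac E (H t) i p * (\<mu> t * \<delta>f p) * h t i)))"
      unfolding Fs_def C0_def
    proof (rule schlaefli_stress_sum[where H="H t" and dH="H' t" and J="J t" and X="X t" and ?x1.0="x1 t"
          and g="\<lambda>p. \<mu> t * \<delta>f p" and h="h t" and \<alpha>="a t" and k=k, OF fin sym symd])
      show "ldet E (H t) \<noteq> 0" if "E \<subseteq> U" "card E \<le> Suc k" for E
        by (rule E(1)[OF sub[OF that(1)]]) (use that(2) in linarith)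
      show "\<mu> t * \<delta>f i = (\<Sum>j\<in>U. H t i j * a t j)" if "i \<in> U" for i
        by (simp add: gk[OF that] \<delta>f_def)
      show "h t i = (\<Sum>j\<in>U. H' t i j * a t j)" for i by (simp add: h_def)
      show "2 * X t F = - (\<Sum>l\<in>F. \<Sum>i\<in>F - {l}. x1 t (F - {l}) i * (\<Sum>j\<in>F. cofac F (H t) l j * H' t j i))"
        if F: "F \<subseteq> U" "card F = Suc (Suc k)" for F
      proof -
        obtain c where "coercive c (H t) F" using E(2)[OF sub[of F]] F by auto
        from schlaefli_gauss(1)[OF finE[OF F(1)] this sym symd, of t] show ?thesis
          unfolding X_def dJ_def dL_def x1_def J_def by simp
      qed
      show "ldet F (H t) * x1 t F i = (\<Sum>m\<in>F. cofac F (H t) i m * J t (F - {m}))"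
        if F: "F \<subseteq> U" "card F = Suc k" "i \<in> F" for F i
      proof -
        obtain c where c: "coercive c (H t) F" using E(2)[OF sub[of F]] F by auto
        show ?thesis unfolding x1_def J_def by (rule schlaefli_gauss(2)[OF finE[OF F(1)] c sym symd F(3)])
      qed
    qed
    also have "(\<Sum>i\<in>U. a t i * h t i) = (\<Sum>i\<in>U. \<Sum>j\<in>U. a t i * a t j * H' t i j)"
      by (simp add: h_def sum_distrib_left mult_ac)
    also have "(\<Sum>E | E \<subseteq> U \<and> card E = Suc k. (\<Prod>i\<in>E. a t i) *
          (\<Sum>i\<in>E. x1 t E i * (\<Sum>j\<in>E. \<Sum>p\<in>E. cofac E (H t) j p * (\<mu> t * \<delta>f p) * H' t j i))) =
        \<mu> t * (\<Sum>E | E \<subseteq> U \<and> card E = Suc k. (\<Prod>i\<in>E. a t i) *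
          (\<Sum>i\<in>E. x1 t E i * (\<Sum>j\<in>E. \<Sum>p\<in>E. cofac E (H t) j p * \<delta>f p * H' t j i)))"
      by (simp add: sum_distrib_left mult_ac)
    also have "(\<Sum>E | E \<subseteq> U \<and> card E = k. (\<Prod>i\<in>E. a t i) * (J t E * (\<Sum>i\<in>E. \<Sum>p\<in>E. cofac E (H t) i p * (\<mu> t * \<delta>f p) * h t i))) =
        \<mu> t * (\<Sum>E | E \<subseteq> U \<and> card E = k. (\<Prod>i\<in>E. a t i) * (J t E * (\<Sum>i\<in>E. \<Sum>p\<in>E. cofac E (H t) i p * \<delta>f p * h t i)))"
      by (simp add: sum_distrib_left mult_ac)
    finally have "2 * (\<Sum>F\<in>Fs. (\<Prod>i\<in>F. a t i) * X t F) = - (\<Sum>i\<in>U. \<Sum>j\<in>U. a t i * a t j * H' t i j) * C0 t + \<mu> t * \<rho> t"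
      unfolding \<rho>_def by (simp only: distrib_left add.assoc)
    then have S: "(\<Sum>F\<in>Fs. (\<Prod>i\<in>F. a t i) * X t F) = (- (\<Sum>i\<in>U. \<Sum>j\<in>U. a t i * a t j * H' t i j) * C0 t + \<mu> t * \<rho> t) / 2" by simp
    have "(\<Sum>F\<in>Fs. w F t * dV F t) = s * \<sigma> * (\<Sum>F\<in>Fs. (\<Prod>i\<in>F. a t i) * X t F)"
      unfolding sum_distrib_left by (intro sum.cong refl wX t)
    also have "\<dots> = - (1 / 2 * (s * \<sigma> * C0 t)) * (\<Sum>i\<in>U. \<Sum>j\<in>U. a t i * a t j * H' t i j) + s * \<sigma> / 2 * (\<mu> t * \<rho> t)"
    proof -
      have "sg * ((- A * c + m) / 2) = - (1 / 2 * (sg * c)) * A + sg / 2 * m" for sg A c m :: real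
        by (simp add: field_simps)
      then show ?thesis unfolding S .
    qed
    \<comment> \<open>\<kappa>^2 = 1 is inserted so that the derivative of \<kappa> \<lambda>, and
      not of \<lambda>, appears.\<close>
    also have "\<dots> = - (1 / 2 * (s * \<sigma> * (\<kappa> * \<kappa>) * C0 t)) * (\<Sum>i\<in>U. \<Sum>j\<in>U. a t i * a t j * H' t i j) + s * \<sigma> / 2 * (\<mu> t * \<rho> t)"
      unfolding \<kappa> by simp
    finally show ?thesis by (simp add: mult_ac)
  qed
  have lam_nn: "0 \<le> \<kappa> * (\<alpha> o' * \<mu> t)" if t: "0 < t" "t < \<delta>" for t
  proof -
    have e: "a t o' = \<alpha> o'" "\<And>i. i \<in> U \<Longrightarrow> (\<Sum>j\<in>U. H t i j * a t j) = (if i = o' then \<mu> t else 0)"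
      using ev[of t] t \<delta> by auto
    have "0 \<le> \<kappa> * (\<Sum>i\<in>U. a t i * (\<Sum>j\<in>U. H t i j * a t j))"
      by (rule psd) (use e(2) t in auto)
    also have "(\<Sum>i\<in>U. a t i * (\<Sum>j\<in>U. H t i j * a t j)) = (\<Sum>i\<in>U. if i = o' then a t i * \<mu> t else 0)"
      using e(2) by (intro sum.cong) auto
    also have "\<dots> = \<alpha> o' * \<mu> t" using fin o e(1) by simp
    finally show ?thesis .
  qed
  have \<kappa>abs: "\<bar>\<kappa>\<bar> = 1" using \<kappa> by (auto simp: square_eq_1_iff)
  define dl where "dl t = \<kappa> * (\<Sum>i\<in>U. \<Sum>j\<in>U. a t i * a t j * H' t i j)" for t
  define C where "C t = 1 / 2 * (s * \<sigma> * \<kappa> * C0 t)" for t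
  define r where "r t = s * \<sigma> / 2 * (\<mu> t * \<rho> t)" for t
  \<comment> \<open>\<open>\<kappa> * (\<alpha> o' * \<mu> t)\<close> is nonnegative and equals
    \<bar>\<alpha> o'\<bar> \<bar>\<mu> t\<bar>, which converts a bound by \<bar>\<mu> t\<bar> into
    one by \<kappa> \<lambda>.\<close>
  define L where "L = \<bar>s * \<sigma> / 2\<bar> * K / \<bar>\<alpha> o'\<bar>"
  have e: "((\<lambda>t. \<alpha> o' * \<mu> t) has_real_derivative (\<Sum>i\<in>U. \<Sum>j\<in>U. a t i * a t j * H' t i j)) (at t)"
     "c1 < C t" "\<bar>\<rho> t\<bar> \<le> K" "F \<in> Fs \<Longrightarrow> \<sigma> * ldet F (H t) > 0"
     "F \<in> Fs \<Longrightarrow> (\<Prod>i\<in>F. \<alpha> i) * (\<Prod>i\<in>F. a t i) > 0"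
    if t: "0 < t" "t < \<delta>" for t F
    using ev[of t, OF t(1) order.strict_trans2[OF t(2) \<delta>(3)]] unfolding C_def by auto
  have d1: "((\<lambda>t. \<kappa> * (\<alpha> o' * \<mu> t)) has_real_derivative dl t) (at t)" if t: "0 < t" "t < \<delta>" for t
    unfolding dl_def using e(1)[OF t] by (rule DERIV_cmult)
  have "((\<lambda>t. \<kappa> * (\<alpha> o' * \<mu> t)) \<longlongrightarrow> \<kappa> * (\<alpha> o' * 0)) (at_right 0)" by (intro tendsto_intros \<mu>)
  then have d2: "((\<lambda>t. \<kappa> * (\<alpha> o' * \<mu> t)) \<longlongrightarrow> 0) (at_right 0)" by simp
  have d3: "(vol \<sigma> F \<longlongrightarrow> vol \<sigma> F 0) (at_right 0)" if "F \<in> Fs" for F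
  proof -
    have F: "F \<subset> U" using sub that by (auto simp: Fs_def)
    show ?thesis unfolding vol_def J_def[symmetric] using F
      by (intro tendsto_mult tendsto_real_sqrt tendsto_const ldet_lim J_lim) auto
  qed
  have d4: "w F t \<noteq> 0" if F: "F \<in> Fs" and t: "0 < t" "t < \<delta>" for F t
    using e(4)[OF t F] e(5)[OF t F] s0 by (auto simp: w_def)
  have d5: "0 \<le> w F t * dV F t" if F: "F \<in> Fs" and t: "0 < t" "t < \<delta>" for F t
  proof -
    have FU: "F \<subseteq> U" "card F = Suc (Suc k)" using F by (auto simp: Fs_def)
    have "0 \<le> (s * (\<Prod>i\<in>F. a t i)) * dV F t"
    proof (rule signed_mono_deriv[where b=\<delta>0, OF _ _ _ dvol[OF F t]])
      have "0 < (s * s) * ((\<Prod>i\<in>F. \<alpha> i) * (\<Prod>i\<in>F. a t i))"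
        using s0 not_real_square_gt_zero[of s] by (intro mult_pos_pos[OF _ e(5)[OF t F]]) blast
      then show "0 < (s * (\<Prod>i\<in>F. \<alpha> i)) * (s * (\<Prod>i\<in>F. a t i))" by (simp add: mult_ac)
    qed (use mono[OF FU] t \<delta> in auto)
    from mult_nonneg_nonneg[OF real_sqrt_ge_zero[OF less_imp_le[OF e(4)[OF t F]]] this]
    show ?thesis by (simp add: w_def mult_ac)
  qed
  have d6: "c1 \<le> C t" if "0 < t" "t < \<delta>" for t using e(2)[OF that] by simp
  have d7: "\<bar>r t\<bar> \<le> L * (\<kappa> * (\<alpha> o' * \<mu> t))" if t: "0 < t" "t < \<delta>" for t
  proof -
    have "\<kappa> * (\<alpha> o' * \<mu> t) = \<bar>\<alpha> o'\<bar> * \<bar>\<mu> t\<bar>"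
      using lam_nn[OF t] \<kappa>abs by (metis abs_mult abs_of_nonneg mult_1)
    then have "L * (\<kappa> * (\<alpha> o' * \<mu> t)) = \<bar>s * \<sigma> / 2\<bar> * (\<bar>\<mu> t\<bar> * K)"
      using \<alpha>o by (simp add: L_def)
    moreover have "\<bar>r t\<bar> = \<bar>s * \<sigma> / 2\<bar> * (\<bar>\<mu> t\<bar> * \<bar>\<rho> t\<bar>)" by (simp add: r_def abs_mult)
    moreover have "\<bar>s * \<sigma> / 2\<bar> * (\<bar>\<mu> t\<bar> * \<bar>\<rho> t\<bar>) \<le> \<bar>s * \<sigma> / 2\<bar> * (\<bar>\<mu> t\<bar> * K)"
      using e(3)[OF t] by (intro mult_left_mono) auto
    ultimately show ?thesis by (simp only:)
  qed
  have d8: "(\<Sum>F\<in>Fs. w F t * dV F t) = - C t * dl t + r t" if "0 < t" "t < \<delta>" for t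
    unfolding C_def dl_def r_def by (rule main[OF that])
  have concl: "\<kappa> * (\<alpha> o' * \<mu> t) = 0 \<and> (\<forall>F\<in>Fs. vol \<sigma> F t = vol \<sigma> F 0)" if t: "0 < t" "t < \<delta>" for t
    by (rule constrained_motion_rigid[where V="vol \<sigma>", OF finFs c1(1) d1 lam_nn d2 dvol d3 d4 d5 d6 d7 d8 t])
  show ?thesis
  proof (intro exI[of _ \<delta>] conjI allI impI \<delta>(1))
    fix t assume "0 < t \<and> t < \<delta>"
    then have t: "0 < t" "t < \<delta>" by auto
    show "vol \<sigma> F t = vol \<sigma> F 0" if "F \<subseteq> U \<and> card F = Suc (Suc k)" for F
      using concl[OF t] that by (simp add: Fs_def)
    have "\<mu> t = 0" using concl[OF t] \<alpha>o \<kappa>abs by auto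
    then show "\<exists>x. x o' = \<alpha> o' \<and> (\<forall>i\<in>U. (\<Sum>j\<in>U. H t i j * x j) = 0)"
      using ev[of t] t \<delta> by (intro exI[of _ "a t"]) auto
  qed
qed

text \<open>Since p a = b \<noteq> z, the row that p sends to \<open>z\<close> is not the deleted
  row \<open>a\<close>, so each product contains exactly one entry of column \<open>z\<close>. This
  extracts the small factor \<mu> from all cofactors with respect to other columns.\<close>

lemma cofac_scale_column:
  assumes fin: "finite I" and z: "z \<in> I" and ab: "a \<in> I" "b \<noteq> z"
  shows "cofac I (\<lambda>i j. M i j * (if j = z then c else 1)) a b = c * cofac I M a b"
  unfolding cofac_def sum_distrib_left
proof (rule sum.cong[OF refl])
  fix p assume "p \<in> {p. p permutes I \<and> p a = b}"
  then have p: "p permutes I" "p a = b" by auto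
  obtain l0 where l0: "l0 \<in> I" "p l0 = z" using permutes_image[OF p(1)] z by (metis imageE)
  have l0a: "l0 \<in> I - {a}" using l0 p(2) ab by auto
  have iff: "p l = z \<longleftrightarrow> l = l0" for l using permutes_inj[OF p(1)] l0(2) by (auto dest: injD)
  have "(\<Prod>l\<in>I - {a}. if p l = z then c else 1) = c"
    unfolding iff using fin l0a by (subst prod.delta) auto
  then show "of_int (sign p) * (\<Prod>l\<in>I - {a}. M l (p l) * (if p l = z then c else 1)) =
     c * (of_int (sign p) * (\<Prod>l\<in>I - {a}. M l (p l)))"
    by (simp add: prod.distrib)
qed

text \<open>Flat counterpart of \<open>radial_motion_rigid\<close>. Positions are taken relative to
  vertex \<open>m\<close>, so row \<open>m\<close> of \<open>G\<close> is zero, and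
  \<open>D z F\<close> is the squared volume up to a factorial. Squared volumes are polynomial in
  \<open>G\<close>, and \<open>stress_second_order\<close> replaces the Schlaefli formula.\<close>

lemma flat_motion_rigid:
  fixes G G' :: "real \<Rightarrow> 'a \<Rightarrow> 'a \<Rightarrow> real" and \<alpha> :: "'a \<Rightarrow> real"
  defines "D \<equiv> \<lambda>z F t. - ldet (insert z F) (bordered z (G t) (\<lambda>_. 1) 0)"
  assumes fin: "finite U" and z: "z \<notin> U" and m: "m \<in> U" and o: "o' \<in> U" "o' \<noteq> m"
    and sym: "\<And>t i j. G t i j = G t j i" and Gm: "\<And>t j. G t m j = 0"
    and symd: "\<And>t i j. G' t i j = G' t j i" and G'm: "\<And>t j. G' t m j = 0"
    and dG: "\<And>i j t. i \<in> U \<Longrightarrow> j \<in> U \<Longrightarrow> t \<ge> 0 \<Longrightarrow> ((\<lambda>t. G t i j) has_real_derivative G' t i j) (at t within {0..})"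
    and G'0: "\<And>i j. i \<in> U \<Longrightarrow> j \<in> U \<Longrightarrow> ((\<lambda>t. G' t i j) \<longlongrightarrow> G' 0 i j) (at_right 0)"
    and nz: "ldet (U - {m} - {o'}) (G 0) \<noteq> 0"
    and ker: "\<And>i. i \<in> U - {m} \<Longrightarrow> (\<Sum>j\<in>U - {m}. G 0 i j * \<alpha> j) = 0" and \<alpha>: "\<And>i. i \<in> U \<Longrightarrow> \<alpha> i \<noteq> 0"
    and \<alpha>0: "(\<Sum>i\<in>U. \<alpha> i) = 0"
    and psd: "\<And>t x. t \<ge> 0 \<Longrightarrow> 0 \<le> (\<Sum>i\<in>U - {m}. x i * (\<Sum>j\<in>U - {m}. G t i j * x j))"
    and s: "s * (\<Sum>E | E \<subseteq> U \<and> card E = k. (\<Prod>i\<in>E. \<alpha> i) * ldet E (G 0)) > 0"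
    and \<delta>0: "\<delta>0 > 0"
    and mono: "\<And>F. F \<subseteq> U \<Longrightarrow> card F = k + 2 \<Longrightarrow>
       (0 < s * (\<Prod>i\<in>F. \<alpha> i) \<longrightarrow> mono_on {0..<\<delta>0} (D z F)) \<and> (s * (\<Prod>i\<in>F. \<alpha> i) < 0 \<longrightarrow> antimono_on {0..<\<delta>0} (D z F))"
  shows "\<exists>\<delta>>0. \<forall>t. 0 < t \<and> t < \<delta> \<longrightarrow>
     (\<forall>F. F \<subseteq> U \<and> card F = k + 2 \<longrightarrow> D z F t = D z F 0) \<and>
     (\<exists>x. x o' = \<alpha> o' \<and> (\<forall>i\<in>U - {m}. (\<Sum>j\<in>U - {m}. G t i j * x j) = 0))"
proof -
  define W where "W = U - {m}"
  define Fs where "Fs = {F. F \<subseteq> U \<and> card F = k + 2}"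
  have finU: "finite {E. E \<subseteq> U \<and> P E}" for P by (rule finite_subset[of _ "Pow U"]) (use fin in auto)
  have finFs: "finite Fs" unfolding Fs_def by (rule finU)
  have finE: "finite E" if "E \<subseteq> U" for E using that fin finite_subset by blast
  have Glim: "((\<lambda>t. G t i j) \<longlongrightarrow> G 0 i j) (at_right 0)" if "i \<in> U" "j \<in> U" for i j
    by (rule tendsto_at_right_of_derivative[OF dG[OF that]]) simp
  have dG1: "((\<lambda>t. G t i j) has_real_derivative G' t i j) (at t)" if "i \<in> U" "j \<in> U" "t > 0" for i j t
    using dG[OF that(1,2), of t] that(3) at_within_nonneg[OF that(3)] by simp
  have \<alpha>o: "\<alpha> o' \<noteq> 0" and s0: "s \<noteq> 0" using \<alpha>[OF o(1)] s by auto
  have W: "finite W" "o' \<in> W" "W \<subseteq> U" "m \<notin> W" "U = insert m W" using fin o m by (auto simp: W_def)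
  have WU: "i \<in> U" if "i \<in> W" for i using that W(3) by blast
  obtain b \<mu> where b: "\<And>i. i \<in> W \<Longrightarrow> ((\<lambda>t. b t i) \<longlongrightarrow> \<alpha> i) (at_right 0)" and \<mu>: "(\<mu> \<longlongrightarrow> 0) (at_right 0)"
    and bk: "\<forall>\<^sub>F t in at_right 0. b t o' = \<alpha> o' \<and> (\<forall>i\<in>W. (\<Sum>j\<in>W. G t i j * b t j) = (if i = o' then \<mu> t else 0))"
    and dm: "\<forall>\<^sub>F t in at_right 0. ((\<lambda>t. \<alpha> o' * \<mu> t) has_real_derivative (\<Sum>i\<in>W. \<Sum>j\<in>W. b t i * b t j * G' t i j)) (at t)"
    by (rule stress_continuation[OF W(1,2) sym Glim[OF WU WU] dG1[OF WU WU] G'0[OF WU WU] nz[folded W_def] ker[folded W_def]]) auto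
  \<comment> \<open>The stress is continued on the vertices other than \<open>m\<close>; its entry
    at \<open>m\<close> is then dictated by the condition that all entries sum to zero.\<close>
  define a where "a t i = (if i = m then - (\<Sum>j\<in>W. b t j) else b t i)" for t i
  have aW: "a t i = b t i" if "i \<in> W" for t i using that W(4) by (auto simp: a_def)
  have a: "((\<lambda>t. a t i) \<longlongrightarrow> \<alpha> i) (at_right 0)" if "i \<in> U" for i
  proof (cases "i = m")
    case True
    have "\<alpha> m = - (\<Sum>j\<in>W. \<alpha> j)" using \<alpha>0 W by simp
    then show ?thesis using True unfolding a_def by (auto intro!: tendsto_intros b)
  qed (use b that in \<open>simp add: a_def W_def\<close>)
  have a0: "(\<Sum>i\<in>U. a t i) = 0" for t
    unfolding W(5) using W(1,4) by (simp add: aW) (simp add: a_def)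
  have sumW: "(\<Sum>j\<in>U. f j * a t j) = (\<Sum>j\<in>W. f j * b t j)" if "f m = 0" for f t
    unfolding W(5) using W(1,4) that by (simp add: aW)
  define g where "g t \<tau> i = (\<Sum>j\<in>U. G \<tau> i j * a t j)" for t \<tau> i
  define l where "l t \<tau> = (\<Sum>i\<in>U. a t i * g t \<tau> i)" for t \<tau>
  define g' where "g' t i = (\<Sum>j\<in>U. G' t i j * a t j)" for t i
  define l' where "l' t = (\<Sum>i\<in>U. a t i * g' t i)" for t
  define \<delta>f where "\<delta>f p = (if p = o' then 1 else 0 :: real)" for p
  define N where "N t i j = bordered z (G t) (\<lambda>p. \<mu> t * \<delta>f p) (\<alpha> o' * \<mu> t) i j" for t i j
  \<comment> \<open>This is \<open>N\<close> with column \<open>z\<close> divided by \<mu>; the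
    entries of row \<open>z\<close> outside that column keep their factor.\<close>
  define N1 where "N1 t i j = (if i = z then if j = z then \<alpha> o' else \<mu> t * \<delta>f j else if j = z then \<delta>f i else G t i j)" for t i j
  define N' where "N' t = bordered z (G' t) (g' t) (l' t)" for t
  define C0 where "C0 t = (\<Sum>E | E \<subseteq> U \<and> card E = k. (\<Prod>i\<in>E. a t i) * ldet E (G t))" for t
  define \<rho> where "\<rho> t = (\<Sum>E | E \<subseteq> U \<and> card E = k. (\<Prod>i\<in>E. a t i) *
     ((\<Sum>j\<in>E. N' t z j * cofac (insert z E) (N1 t) z j) +
      (\<Sum>i\<in>E. N' t i z * cofac (insert z E) (N1 t) z i + (\<Sum>j\<in>E. N' t i j * cofac (insert z E) (N1 t) i j))))" for t
  define dD where "dD F t = - (\<Sum>i\<in>insert z F. \<Sum>j\<in>insert z F. bordered z (G' t) (\<lambda>_. 0) 0 i j * cofac (insert z F) (bordered z (G t) (\<lambda>_. 1) 0) i j)" for F t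
  have NN1: "N t = (\<lambda>i j. N1 t i j * (if j = z then \<mu> t else 1))" for t
    by (auto simp: N_def N1_def bordered_def fun_eq_iff)
  have Nsym: "N t i j = N t j i" for t i j using sym by (auto simp: N_def bordered_def)
  have dD: "(D z F has_real_derivative dD F t) (at t)" if F: "F \<subseteq> U" and t: "t > 0" for F t
    unfolding D_def dD_def
  proof (intro DERIV_minus ldet_has_derivative)
    show "finite (insert z F)" using F finE by simp
    fix i j assume "i \<in> insert z F" "j \<in> insert z F"
    then show "((\<lambda>t. bordered z (G t) (\<lambda>_. 1) 0 i j) has_real_derivative bordered z (G' t) (\<lambda>_. 0) 0 i j) (at t)"
      using t by (auto simp: bordered_def intro!: dG1 subsetD[OF F])
  qed
  have ldet_lim: "((\<lambda>t. ldet E (G t)) \<longlongrightarrow> ldet E (G 0)) (at_right 0)" if "E \<subseteq> U" for E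
    using that by (intro tendsto_ldet finE Glim) auto
  have prod_lim: "((\<lambda>t. \<Prod>i\<in>E. a t i) \<longlongrightarrow> (\<Prod>i\<in>E. \<alpha> i)) (at_right 0)" if "E \<subseteq> U" for E
    using that by (intro tendsto_intros a) auto
  have main: "(\<Sum>F\<in>Fs. (\<Prod>i\<in>F. a t i) * dD F t) = - C0 t * l' t - \<mu> t * \<rho> t"
    if t: "t > 0" and e0: "b t o' = \<alpha> o' \<and> (\<forall>i\<in>W. (\<Sum>j\<in>W. G t i j * b t j) = (if i = o' then \<mu> t else 0))" for t
  proof -
    have gt: "g t t i = \<mu> t * \<delta>f i" if "i \<in> U" for i
    proof (cases "i = m")
      case True then show ?thesis using Gm o by (simp add: g_def \<delta>f_def)
    next
      case False
      then have iW: "i \<in> W" using that by (simp add: W_def)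
      have "g t t i = (\<Sum>j\<in>W. G t i j * b t j)" unfolding g_def by (rule sumW) (use Gm sym in metis)
      then show ?thesis using e0 iW by (simp add: \<delta>f_def)
    qed
    have lt: "l t t = \<alpha> o' * \<mu> t"
    proof -
      have "l t t = (\<Sum>i\<in>U. if i = o' then a t i * \<mu> t else 0)"
        unfolding l_def using gt by (intro sum.cong) (auto simp: \<delta>f_def)
      also have "\<dots> = \<alpha> o' * \<mu> t" using fin o e0 aW[OF W(2)] by simp
      finally show ?thesis .
    qed
    \<comment> \<open>The identity is used for the configuration at time \<tau> but with the stress
      of the fixed time \<open>t\<close>, and is then differentiated at \<tau> = t. No derivative of
      the stress enters.\<close>
    have second: "(\<Sum>F\<in>Fs. (\<Prod>i\<in>F. a t i) * - D z F \<tau>) =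
       (\<Sum>E | E \<subseteq> U \<and> card E = k. (\<Prod>i\<in>E. a t i) * ldet (insert z E) (bordered z (G \<tau>) (g t \<tau>) (l t \<tau>)))" for \<tau>
      unfolding Fs_def D_def minus_minus l_def
      by (rule stress_second_order[OF fin z sym a0]) (simp add: g_def)
    have lhs: "((\<lambda>\<tau>. \<Sum>F\<in>Fs. (\<Prod>i\<in>F. a t i) * - D z F \<tau>) has_real_derivative
        (\<Sum>F\<in>Fs. (\<Prod>i\<in>F. a t i) * - dD F t)) (at t)"
      using t by (intro DERIV_sum DERIV_cmult DERIV_minus dD) (auto simp: Fs_def)
    have rhs: "((\<lambda>\<tau>. \<Sum>E | E \<subseteq> U \<and> card E = k. (\<Prod>i\<in>E. a t i) * ldet (insert z E) (bordered z (G \<tau>) (g t \<tau>) (l t \<tau>))) has_real_derivative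
       (\<Sum>E | E \<subseteq> U \<and> card E = k. (\<Prod>i\<in>E. a t i) *
          (\<Sum>i\<in>insert z E. \<Sum>j\<in>insert z E. N' t i j * cofac (insert z E) (bordered z (G t) (g t t) (l t t)) i j))) (at t)"
    proof (intro DERIV_sum DERIV_cmult ldet_has_derivative)
      fix E assume "E \<in> {E. E \<subseteq> U \<and> card E = k}"
      then have E: "E \<subseteq> U" by simp
      then show "finite (insert z E)" using finE by simp
      have dg: "((\<lambda>\<tau>. g t \<tau> i) has_real_derivative g' t i) (at t)" if "i \<in> U" for i
        unfolding g_def g'_def
        by (rule DERIV_cong, rule DERIV_sum, rule DERIV_cmult_right) (use that t dG1 in \<open>auto simp: mult.commute\<close>)
      have dl: "(l t has_real_derivative l' t) (at t)"
        unfolding l_def l'_def by (intro DERIV_sum DERIV_cmult dg)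
      fix i j assume "i \<in> insert z E" "j \<in> insert z E"
      then show "((\<lambda>\<tau>. bordered z (G \<tau>) (g t \<tau>) (l t \<tau>) i j) has_real_derivative N' t i j) (at t)"
        using t by (auto simp: bordered_def N'_def intro!: dG1 dg dl subsetD[OF E])
    qed
    have "(\<Sum>F\<in>Fs. (\<Prod>i\<in>F. a t i) * - dD F t) = (\<Sum>E | E \<subseteq> U \<and> card E = k. (\<Prod>i\<in>E. a t i) *
          (\<Sum>i\<in>insert z E. \<Sum>j\<in>insert z E. N' t i j * cofac (insert z E) (bordered z (G t) (g t t) (l t t)) i j))"
      using lhs rhs unfolding second by (rule DERIV_unique)
    also have "\<dots> = (\<Sum>E | E \<subseteq> U \<and> card E = k. (\<Prod>i\<in>E. a t i) * (l' t * ldet E (G t) + \<mu> t *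
     ((\<Sum>j\<in>E. N' t z j * cofac (insert z E) (N1 t) z j) +
      (\<Sum>i\<in>E. N' t i z * cofac (insert z E) (N1 t) z i + (\<Sum>j\<in>E. N' t i j * cofac (insert z E) (N1 t) i j)))))"
    proof (rule sum.cong[OF refl], rule arg_cong2[where f="(*)", OF refl])
      fix E assume "E \<in> {E. E \<subseteq> U \<and> card E = k}"
      then have E: "E \<subseteq> U" "finite E" "z \<notin> E" using finE z by auto
      have "(\<Sum>i\<in>insert z E. \<Sum>j\<in>insert z E. N' t i j * cofac (insert z E) (bordered z (G t) (g t t) (l t t)) i j) =
         (\<Sum>i\<in>insert z E. \<Sum>j\<in>insert z E. N' t i j * cofac (insert z E) (N t) i j)"
      proof (intro sum.cong refl arg_cong2[where f="(*)"] cofac_cong)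
        fix i j assume "i \<in> insert z E" "j \<in> insert z E"
        then show "bordered z (G t) (g t t) (l t t) i j = N t i j"
          using E(1) gt lt by (auto simp: N_def bordered_def)
      qed
      also have "\<dots> = N' t z z * cofac (insert z E) (N t) z z + (\<Sum>j\<in>E. N' t z j * cofac (insert z E) (N t) z j) +
          (\<Sum>i\<in>E. N' t i z * cofac (insert z E) (N t) i z + (\<Sum>j\<in>E. N' t i j * cofac (insert z E) (N t) i j))"
        using E by simp
      \<comment> \<open>The corner cofactor supplies the leading term; from all the others a factor
        \<mu> is extracted.\<close>
      also have "cofac (insert z E) (N t) z z = ldet E (G t)"
      proof -
        have "ldet E (N t) = ldet E (G t)" using E by (intro ldet_cong) (auto simp: N_def bordered_def)
        then show ?thesis using cofac_diag[OF E(2,3)] by simp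
      qed
      also have "N' t z z = l' t" by (simp add: N'_def bordered_def)
      also have "(\<Sum>j\<in>E. N' t z j * cofac (insert z E) (N t) z j) = \<mu> t * (\<Sum>j\<in>E. N' t z j * cofac (insert z E) (N1 t) z j)"
        unfolding sum_distrib_left NN1 using E
        by (intro sum.cong refl, subst cofac_scale_column) auto
      also have "(\<Sum>i\<in>E. N' t i z * cofac (insert z E) (N t) i z + (\<Sum>j\<in>E. N' t i j * cofac (insert z E) (N t) i j)) =
         \<mu> t * (\<Sum>i\<in>E. N' t i z * cofac (insert z E) (N1 t) z i + (\<Sum>j\<in>E. N' t i j * cofac (insert z E) (N1 t) i j))"
        unfolding sum_distrib_left
      proof (rule sum.cong[OF refl])
        fix i assume i: "i \<in> E"
        have 1: "cofac (insert z E) (N t) i z = \<mu> t * cofac (insert z E) (N1 t) z i"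
        proof -
          \<comment> \<open>A cofactor at column \<open>z\<close> omits the column that carries
            \<mu>. By symmetry it equals one at row \<open>z\<close>, where that column is
            present.\<close>
          have "cofac (insert z E) (N t) i z = cofac (insert z E) (N t) z i"
            by (rule cofac_sym) (use E i Nsym in auto)
          also have "\<dots> = \<mu> t * cofac (insert z E) (N1 t) z i"
            unfolding NN1 by (rule cofac_scale_column) (use E i in auto)
          finally show ?thesis .
        qed
        have 2: "cofac (insert z E) (N t) i j = \<mu> t * cofac (insert z E) (N1 t) i j" if "j \<in> E" for j
          unfolding NN1 by (rule cofac_scale_column) (use E i that in auto)
        show "N' t i z * cofac (insert z E) (N t) i z + (\<Sum>j\<in>E. N' t i j * cofac (insert z E) (N t) i j) =
          \<mu> t * (N' t i z * cofac (insert z E) (N1 t) z i + (\<Sum>j\<in>E. N' t i j * cofac (insert z E) (N1 t) i j))"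
          by (simp add: 1 2 distrib_left sum_distrib_left mult_ac)
      qed
      finally show "(\<Sum>i\<in>insert z E. \<Sum>j\<in>insert z E. N' t i j * cofac (insert z E) (bordered z (G t) (g t t) (l t t)) i j) =
        l' t * ldet E (G t) + \<mu> t *
     ((\<Sum>j\<in>E. N' t z j * cofac (insert z E) (N1 t) z j) +
      (\<Sum>i\<in>E. N' t i z * cofac (insert z E) (N1 t) z i + (\<Sum>j\<in>E. N' t i j * cofac (insert z E) (N1 t) i j)))"
        by (simp add: distrib_left add.assoc)
    qed
    also have "\<dots> = C0 t * l' t + \<mu> t * \<rho> t"
    proof -
      have split: "(\<Sum>x\<in>A. p x * (c * L x + m * R x)) = (\<Sum>x\<in>A. p x * L x) * c + m * (\<Sum>x\<in>A. p x * R x)"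
        for A :: "'a set set" and p L R :: "'a set \<Rightarrow> real" and c m :: real
        by (simp add: distrib_left sum.distrib sum_distrib_left sum_distrib_right mult_ac)
      show ?thesis unfolding C0_def \<rho>_def by (rule split)
    qed
    finally have "- (\<Sum>F\<in>Fs. (\<Prod>i\<in>F. a t i) * dD F t) = C0 t * l' t + \<mu> t * \<rho> t"
      by (simp add: sum_negf)
    then show ?thesis by simp
  qed
  have \<rho>_bnd: "bounded_right \<rho>"
  proof -
    have G'_bnd: "bounded_right (\<lambda>t. G' t i j)" if "i \<in> U" "j \<in> U" for i j using bounded_right_tendsto[OF G'0[OF that]] .
    have g'_bnd: "bounded_right (\<lambda>t. g' t i)" if "i \<in> U" for i
      unfolding g'_def by (intro bounded_right_sum bounded_right_mult G'_bnd bounded_right_tendsto[OF a] that)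
    have N'_bnd: "bounded_right (\<lambda>t. N' t i j)" if "i \<in> insert z U" "j \<in> insert z U" "i \<noteq> z \<or> j \<noteq> z" for i j
      unfolding N'_def bordered_def using that G'_bnd g'_bnd z by (cases "i = z"; cases "j = z") auto
    have N1_lim: "((\<lambda>t. N1 t i j) \<longlongrightarrow> (if i = z then if j = z then \<alpha> o' else 0 * \<delta>f j else if j = z then \<delta>f i else G 0 i j)) (at_right 0)"
      if "i \<in> insert z U" "j \<in> insert z U" for i j
      unfolding N1_def using that Glim \<mu> by (auto intro!: tendsto_mult_left_zero)
    have cof_bnd: "bounded_right (\<lambda>t. cofac (insert z E) (N1 t) i j)" if "E \<subseteq> U" for E i j
    proof -
      have mem: "x \<in> insert z U" if "x \<in> insert z E" for x using that \<open>E \<subseteq> U\<close> by auto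
      show ?thesis unfolding cofac_def
        by (intro bounded_right_sum bounded_right_mult bounded_right_const bounded_right_prod bounded_right_tendsto[OF N1_lim] mem)
           (auto simp: permutes_in_image simp del: insert_iff)
    qed
    show ?thesis unfolding \<rho>_def
      by (intro bounded_right_sum bounded_right_mult bounded_right_add bounded_right_tendsto[OF prod_lim] cof_bnd N'_bnd) (use z in auto)
  qed
  then obtain K where K: "\<forall>\<^sub>F t in at_right 0. \<bar>\<rho> t\<bar> \<le> K" unfolding bounded_right_def by blast
  have "((\<lambda>t. s * C0 t) \<longlongrightarrow> s * (\<Sum>E | E \<subseteq> U \<and> card E = k. (\<Prod>i\<in>E. \<alpha> i) * ldet E (G 0))) (at_right 0)"
    unfolding C0_def by (intro tendsto_intros prod_lim ldet_lim) auto
  moreover obtain c1 where c1: "c1 > 0" "s * (\<Sum>E | E \<subseteq> U \<and> card E = k. (\<Prod>i\<in>E. \<alpha> i) * ldet E (G 0)) > c1"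
    using s dense by blast
  ultimately have C_ev: "\<forall>\<^sub>F t in at_right 0. c1 < s * C0 t" using order_tendstoD(1) by blast
  have sg_ev: "\<forall>\<^sub>F t in at_right 0. \<forall>F\<in>Fs. (\<Prod>i\<in>F. \<alpha> i) * (\<Prod>i\<in>F. a t i) > 0"
    using finFs finE \<alpha> by (intro eventually_ball_finite ballI prod_sign_eventually a) (auto simp: Fs_def subset_iff)
  obtain \<delta>1 where \<delta>1: "\<delta>1 > 0" and ev: "\<And>t. 0 < t \<Longrightarrow> t < \<delta>1 \<Longrightarrow>
     (b t o' = \<alpha> o' \<and> (\<forall>i\<in>W. (\<Sum>j\<in>W. G t i j * b t j) = (if i = o' then \<mu> t else 0))) \<and>
     ((\<lambda>t. \<alpha> o' * \<mu> t) has_real_derivative (\<Sum>i\<in>W. \<Sum>j\<in>W. b t i * b t j * G' t i j)) (at t) \<and>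
     c1 < s * C0 t \<and> \<bar>\<rho> t\<bar> \<le> K \<and> (\<forall>F\<in>Fs. (\<Prod>i\<in>F. \<alpha> i) * (\<Prod>i\<in>F. a t i) > 0)"
    using eventually_conj[OF bk eventually_conj[OF dm eventually_conj[OF C_ev eventually_conj[OF K sg_ev]]]]
    unfolding eventually_at_right_field by blast
  define \<delta> where "\<delta> = min \<delta>0 \<delta>1"
  have \<delta>: "\<delta> > 0" "\<delta> \<le> \<delta>0" "\<delta> \<le> \<delta>1" using \<delta>0 \<delta>1 by (auto simp: \<delta>_def)
  define w where "w F t = s * (\<Prod>i\<in>F. a t i)" for F t
  define C where "C t = s * C0 t" for t
  define r where "r t = - (s * (\<mu> t * \<rho> t))" for t
  define L where "L = \<bar>s\<bar> * K / \<bar>\<alpha> o'\<bar>"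
  have e: "b t o' = \<alpha> o' \<and> (\<forall>i\<in>W. (\<Sum>j\<in>W. G t i j * b t j) = (if i = o' then \<mu> t else 0))"
     "((\<lambda>t. \<alpha> o' * \<mu> t) has_real_derivative (\<Sum>i\<in>W. \<Sum>j\<in>W. b t i * b t j * G' t i j)) (at t)"
     "c1 < C t" "\<bar>\<rho> t\<bar> \<le> K" "F \<in> Fs \<Longrightarrow> (\<Prod>i\<in>F. \<alpha> i) * (\<Prod>i\<in>F. a t i) > 0"
    if t: "0 < t" "t < \<delta>" for t F
    using ev[of t, OF t(1) order.strict_trans2[OF t(2) \<delta>(3)]] unfolding C_def by blast+
  have l': "l' t = (\<Sum>i\<in>W. \<Sum>j\<in>W. b t i * b t j * G' t i j)" for t
  proof -
    have g'W: "g' t i = (\<Sum>j\<in>W. G' t i j * b t j)" for i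
      unfolding g'_def by (rule sumW) (use G'm symd in metis)
    have "l' t = (\<Sum>i\<in>U. g' t i * a t i)" by (simp add: l'_def mult.commute)
    also have "\<dots> = (\<Sum>i\<in>W. g' t i * b t i)" by (rule sumW) (simp add: g'_def G'm)
    finally show ?thesis unfolding g'W by (simp add: sum_distrib_right sum_distrib_left mult_ac)
  qed
  have d1: "((\<lambda>t. \<alpha> o' * \<mu> t) has_real_derivative l' t) (at t)" if "0 < t" "t < \<delta>" for t
    unfolding l' by (rule e(2)[OF that])
  have nn: "0 \<le> \<alpha> o' * \<mu> t" if t: "0 < t" "t < \<delta>" for t
  proof -
    have "0 \<le> (\<Sum>i\<in>W. b t i * (\<Sum>j\<in>W. G t i j * b t j))" unfolding W_def by (rule psd) (use t in simp)
    also have "\<dots> = (\<Sum>i\<in>W. if i = o' then b t i * \<mu> t else 0)"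
      using e(1)[OF t] by (intro sum.cong) auto
    also have "\<dots> = \<alpha> o' * \<mu> t" using W(1,2) e(1)[OF t] by simp
    finally show ?thesis .
  qed
  have "((\<lambda>t. \<alpha> o' * \<mu> t) \<longlongrightarrow> \<alpha> o' * 0) (at_right 0)" by (intro tendsto_intros \<mu>)
  then have d2: "((\<lambda>t. \<alpha> o' * \<mu> t) \<longlongrightarrow> 0) (at_right 0)" by simp
  have dD': "(D z F has_real_derivative dD F t) (at t)" if "F \<in> Fs" "0 < t" "t < \<delta>" for F t
    using dD that by (simp add: Fs_def)
  have d3: "(D z F \<longlongrightarrow> D z F 0) (at_right 0)" if "F \<in> Fs" for F
  proof -
    have F: "F \<subseteq> U" using that by (simp add: Fs_def)
    have BL: "((\<lambda>t. bordered z (G t) (\<lambda>_. 1) 0 i j) \<longlongrightarrow> bordered z (G 0) (\<lambda>_. 1) 0 i j) (at_right 0)"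
      if "i \<in> insert z F" "j \<in> insert z F" for i j
      unfolding bordered_def using that F Glim by auto
    show ?thesis unfolding D_def ldet_def
      by (intro tendsto_minus tendsto_sum tendsto_mult tendsto_const tendsto_prod BL)
         (auto simp: permutes_in_image simp del: insert_iff)
  qed
  have d4: "w F t \<noteq> 0" if F: "F \<in> Fs" and t: "0 < t" "t < \<delta>" for F t
    using e(5)[OF t F] s0 by (auto simp: w_def)
  have d5: "0 \<le> w F t * dD F t" if F: "F \<in> Fs" and t: "0 < t" "t < \<delta>" for F t
    unfolding w_def
  proof (rule signed_mono_deriv[where b=\<delta>0, OF _ _ _ dD'[OF F t]])
    have FU: "F \<subseteq> U" "card F = k + 2" using F by (auto simp: Fs_def)
    show "0 < s * (\<Prod>i\<in>F. \<alpha> i) \<longrightarrow> mono_on {0..<\<delta>0} (D z F)" "s * (\<Prod>i\<in>F. \<alpha> i) < 0 \<longrightarrow> antimono_on {0..<\<delta>0} (D z F)"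
      using mono[OF FU] by blast+
    have "0 < (s * s) * ((\<Prod>i\<in>F. \<alpha> i) * (\<Prod>i\<in>F. a t i))"
      using s0 not_real_square_gt_zero[of s] by (intro mult_pos_pos[OF _ e(5)[OF t F]]) blast
    then show "0 < (s * (\<Prod>i\<in>F. \<alpha> i)) * (s * (\<Prod>i\<in>F. a t i))" by (simp add: mult_ac)
  qed (use t \<delta> in auto)
  have d6: "c1 \<le> C t" if "0 < t" "t < \<delta>" for t using e(3)[OF that] by simp
  have d7: "\<bar>r t\<bar> \<le> L * (\<alpha> o' * \<mu> t)" if t: "0 < t" "t < \<delta>" for t
  proof -
    have "\<alpha> o' * \<mu> t = \<bar>\<alpha> o'\<bar> * \<bar>\<mu> t\<bar>"
      using nn[OF t] by (metis abs_mult abs_of_nonneg)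
    then have "L * (\<alpha> o' * \<mu> t) = \<bar>s\<bar> * (\<bar>\<mu> t\<bar> * K)"
      using \<alpha>o by (simp add: L_def)
    moreover have "\<bar>r t\<bar> = \<bar>s\<bar> * (\<bar>\<mu> t\<bar> * \<bar>\<rho> t\<bar>)" by (simp add: r_def abs_mult)
    moreover have "\<bar>s\<bar> * (\<bar>\<mu> t\<bar> * \<bar>\<rho> t\<bar>) \<le> \<bar>s\<bar> * (\<bar>\<mu> t\<bar> * K)"
      using e(4)[OF t] by (intro mult_left_mono) auto
    ultimately show ?thesis by (simp only:)
  qed
  have d8: "(\<Sum>F\<in>Fs. w F t * dD F t) = - C t * l' t + r t" if t: "0 < t" "t < \<delta>" for t
  proof -
    have "(\<Sum>F\<in>Fs. w F t * dD F t) = s * (\<Sum>F\<in>Fs. (\<Prod>i\<in>F. a t i) * dD F t)"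
      by (simp add: w_def sum_distrib_left mult.assoc)
    also have "\<dots> = s * (- C0 t * l' t - \<mu> t * \<rho> t)" unfolding main[OF t(1) e(1)[OF t]] ..
    finally show ?thesis by (simp add: C_def r_def algebra_simps)
  qed
  have concl: "\<alpha> o' * \<mu> t = 0 \<and> (\<forall>F\<in>Fs. D z F t = D z F 0)" if t: "0 < t" "t < \<delta>" for t
    by (rule constrained_motion_rigid[where V="D z", OF finFs c1(1) d1 nn d2 dD' d3 d4 d5 d6 d7 d8 t])
  show ?thesis
  proof (intro exI[of _ \<delta>] conjI allI impI \<delta>(1))
    fix t assume "0 < t \<and> t < \<delta>"
    then have t: "0 < t" "t < \<delta>" by auto
    show "D z F t = D z F 0" if "F \<subseteq> U \<and> card F = k + 2" for F
      using concl[OF t] that by (simp add: Fs_def)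
    have "\<mu> t = 0" using concl[OF t] \<alpha>o by auto
    then show "\<exists>x. x o' = \<alpha> o' \<and> (\<forall>i\<in>U - {m}. (\<Sum>j\<in>U - {m}. G t i j * x j) = 0)"
      using e(1)[OF t] unfolding W_def by (intro exI[of _ "b t"]) auto
  qed
qed

section \<open>Gram matrices in the space forms\<close>

definition gram :: "geometry \<Rightarrow> ('i \<Rightarrow> 'v::euclidean_space) \<Rightarrow> 'i \<Rightarrow> 'i \<Rightarrow> real" where
  "gram G v i j = form G (v i) (v j)"

lemma gram_sum:
  "(\<Sum>j\<in>I. gram G v i j * x j) = form G (v i) (\<Sum>j\<in>I. x j *\<^sub>R v j)"
  by (simp add: gram_def form_simps mult.commute)

lemma gram_quad:
  "(\<Sum>i\<in>I. \<Sum>j\<in>I. x i * x j * gram G v i j) = form G (\<Sum>j\<in>I. x j *\<^sub>R v j) (\<Sum>j\<in>I. x j *\<^sub>R v j)"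
proof -
  have "(\<Sum>i\<in>I. \<Sum>j\<in>I. x i * x j * gram G v i j) = (\<Sum>i\<in>I. x i * (\<Sum>j\<in>I. gram G v i j * x j))"
    by (simp add: sum_distrib_left mult_ac)
  also have "\<dots> = (\<Sum>i\<in>I. form G (x i *\<^sub>R v i) (\<Sum>j\<in>I. x j *\<^sub>R v j))"
    unfolding gram_sum by (simp add: form_simps(5))
  also have "\<dots> = form G (\<Sum>j\<in>I. x j *\<^sub>R v j) (\<Sum>j\<in>I. x j *\<^sub>R v j)"
    by (rule bounded_bilinear.sum_left[OF bounded_bilinear_form, symmetric])
  finally show ?thesis .
qed

lemma gram_sym: "gram G v i j = gram G v j i"
  by (simp add: gram_def form_sym)

lemma independent_family:
  fixes v :: "'i \<Rightarrow> 'v::euclidean_space"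
  assumes "finite I" "inj_on v I" "independent (v ` I)" "(\<Sum>i\<in>I. x i *\<^sub>R v i) = 0" "i \<in> I"
  shows "x i = 0"
proof (rule ccontr)
  assume "x i \<noteq> 0"
  define u where "u w = x (the_inv_into I v w)" for w
  have u: "u (v j) = x j" if "j \<in> I" for j using that assms(2) by (simp add: u_def the_inv_into_f_f)
  have "(\<Sum>w\<in>v ` I. u w *\<^sub>R w) = (\<Sum>j\<in>I. x j *\<^sub>R v j)"
    using assms(2) u by (simp add: sum.reindex)
  then have "dependent (v ` I)"
    using assms u \<open>x i \<noteq> 0\<close> unfolding dependent_finite[OF finite_imageI[OF assms(1)]]
    by (intro exI[of _ u]) auto
  then show False using assms(3) by simp
qed

text \<open>A linear relation between the vectors is a kernel vector of their Gram matrix, whatever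
  the signature of the form.\<close>

lemma independent_of_gram:
  fixes v :: "'i \<Rightarrow> 'v::euclidean_space"
  assumes fin: "finite I" and nz: "ldet I (gram G v) \<noteq> 0"
  shows "inj_on v I" "independent (v ` I)"
proof -
  have zero: "x b = 0" if "(\<Sum>i\<in>I. x i *\<^sub>R v i) = 0" "b \<in> I" for x b
  proof -
    have "ldet I (gram G v) * x b = (\<Sum>a\<in>I. cofac I (gram G v) b a * 0)"
    proof (rule cofac_kernel[OF fin _ that(2)])
      show "gram G v i j = gram G v j i" if "i \<in> I" "j \<in> I" for i j by (simp add: gram_def form_sym)
      show "(\<Sum>j\<in>I. gram G v a j * x j) = 0" if "a \<in> I" for a by (simp add: gram_sum \<open>(\<Sum>i\<in>I. x i *\<^sub>R v i) = 0\<close> form_simps)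
    qed
    then show ?thesis using nz by simp
  qed
  show inj: "inj_on v I"
  proof (rule inj_onI, rule ccontr)
    fix i j assume ij: "i \<in> I" "j \<in> I" "v i = v j" "i \<noteq> j"
    define x where "x l = (if l = i then 1 else if l = j then -1 else 0 :: real)" for l
    have "(\<Sum>l\<in>I. x l *\<^sub>R v l) = (\<Sum>l\<in>{i, j}. x l *\<^sub>R v l)"
      using ij fin by (intro sum.mono_neutral_right) (auto simp: x_def)
    also have "\<dots> = 0" using ij by (simp add: x_def)
    finally have "x i = 0" using zero ij(1) by blast
    then show False by (simp add: x_def)
  qed
  show "independent (v ` I)"
    unfolding dependent_finite[OF finite_imageI[OF fin]]
  proof (safe)
    fix u i assume i: "i \<in> I" "u (v i) \<noteq> 0" and s: "(\<Sum>w\<in>v ` I. u w *\<^sub>R w) = 0"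
    have "(\<Sum>l\<in>I. u (v l) *\<^sub>R v l) = 0" using s inj by (simp add: sum.reindex)
    then have "u (v i) = 0" by (rule zero) (fact i(1))
    then show False using i(2) by simp
  qed
qed

lemma gram_pos_def:
  fixes v :: "'i \<Rightarrow> 'v::euclidean_space"
  assumes fin: "finite I" and pos: "\<And>x. \<exists>i\<in>I. x i \<noteq> 0 \<Longrightarrow> 0 < form G (\<Sum>j\<in>I. x j *\<^sub>R v j) (\<Sum>j\<in>I. x j *\<^sub>R v j)"
  shows "ldet I (gram G v) > 0"
proof (rule ldet_pos_def[OF fin])
  show "gram G v i j = gram G v j i" if "i \<in> I" "j \<in> I" for i j by (simp add: gram_def form_sym)
  show "0 < (\<Sum>i\<in>I. \<Sum>j\<in>I. x i * x j * gram G v i j)" if "\<exists>i\<in>I. x i \<noteq> 0" for x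
    unfolding gram_quad using that by (rule pos)
qed

section \<open>Lorentz geometry and the signs of Gram determinants\<close>

lemma e0_inner [simp]: "e0 \<bullet> (e0 :: 'v::euclidean_space) = 1"
  unfolding e0_def using some_in_eq[of "Basis :: 'v set"] by auto

lemma hyperbolic_split:
  fixes x y :: "'v::euclidean_space"
  shows "form Hyperbolic x y = (x - (x \<bullet> e0) *\<^sub>R e0) \<bullet> (y - (y \<bullet> e0) *\<^sub>R e0) - (x \<bullet> e0) * (y \<bullet> e0)"
  by (simp add: form_Hyperbolic inner_diff_left inner_diff_right inner_commute[of e0 y])

text \<open>By orthogonality the spatial parts have inner product a b, where a and b are the time
  coordinates. Cauchy-Schwarz then bounds the squared spatial norm of \<open>y\<close> by a^2 times
  \<open>form Hyperbolic y y\<close>.\<close>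

lemma hyperbolic_orthogonal:
  fixes x y :: "'v::euclidean_space"
  assumes x: "x \<in> space_form Hyperbolic" and o: "form Hyperbolic x y = 0"
  shows "0 \<le> form Hyperbolic y y" "form Hyperbolic y y = 0 \<Longrightarrow> y = 0"
proof -
  let ?x = "x - (x \<bullet> e0) *\<^sub>R e0" and ?y = "y - (y \<bullet> e0) *\<^sub>R e0"
  let ?a = "x \<bullet> e0" and ?b = "y \<bullet> e0"
  have x1: "(norm ?x)\<^sup>2 = ?a\<^sup>2 - 1" and a: "?a > 0"
    using x hyperbolic_split[of x x] unfolding power2_norm_eq_inner by (simp_all add: power2_eq_square)
  have "?x \<bullet> ?y = ?a * ?b" using o hyperbolic_split[of x y] by simp
  then have "(?a * ?b)\<^sup>2 \<le> (?a\<^sup>2 - 1) * (norm ?y)\<^sup>2"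
    using Cauchy_Schwarz_ineq[of ?x ?y] x1 by (simp add: power2_norm_eq_inner)
  then have key: "(norm ?y)\<^sup>2 \<le> ?a\<^sup>2 * ((norm ?y)\<^sup>2 - ?b\<^sup>2)" by (simp add: algebra_simps power_mult_distrib)
  have f: "form Hyperbolic y y = (norm ?y)\<^sup>2 - ?b\<^sup>2"
    using hyperbolic_split[of y y] unfolding power2_norm_eq_inner by (simp add: power2_eq_square)
  have "0 \<le> ?a\<^sup>2 * ((norm ?y)\<^sup>2 - ?b\<^sup>2)" using key zero_le_power2 order_trans by blast
  then show "0 \<le> form Hyperbolic y y" unfolding f using a by (simp add: zero_le_mult_iff)
  assume "form Hyperbolic y y = 0"
  then have z: "(norm ?y)\<^sup>2 - ?b\<^sup>2 = 0" unfolding f .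
  then have "norm ?y = 0" using key by simp
  then have "?b = 0" "?y = 0" using z by auto
  then show "y = 0" by simp
qed

text \<open>In terms of the time coordinates the squared product of the spatial norms is (a b - 1)^2
  - (a - b)^2, and a b \<ge> 1. Geometrically the form is minus the hyperbolic cosine of the
  distance.\<close>

lemma hyperbolic_form_le:
  fixes x y :: "'v::euclidean_space"
  assumes x: "x \<in> space_form Hyperbolic" and y: "y \<in> space_form Hyperbolic"
  shows "form Hyperbolic x y \<le> - 1"
proof -
  let ?x = "x - (x \<bullet> e0) *\<^sub>R e0" and ?y = "y - (y \<bullet> e0) *\<^sub>R e0"
  let ?a = "x \<bullet> e0" and ?b = "y \<bullet> e0"
  have x1: "(norm ?x)\<^sup>2 = ?a\<^sup>2 - 1" and a: "?a > 0"
    using x hyperbolic_split[of x x] unfolding power2_norm_eq_inner by (simp_all add: power2_eq_square)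
  have y1: "(norm ?y)\<^sup>2 = ?b\<^sup>2 - 1" and b: "?b > 0"
    using y hyperbolic_split[of y y] unfolding power2_norm_eq_inner by (simp_all add: power2_eq_square)
  have "1 \<le> ?a\<^sup>2" "1 \<le> ?b\<^sup>2" using x1 y1 zero_le_power2[of "norm ?x"] zero_le_power2[of "norm ?y"] by linarith+
  then have "1 \<le> ?a" "1 \<le> ?b" using a b power2_le_imp_le[of 1 ?a] power2_le_imp_le[of 1 ?b] by simp_all
  then have ab: "0 \<le> ?a * ?b - 1" using mult_mono[of 1 ?a 1 ?b] by simp
  have "(norm ?x * norm ?y)\<^sup>2 \<le> (?a * ?b - 1)\<^sup>2"
  proof -
    have "(norm ?x * norm ?y)\<^sup>2 = (?a\<^sup>2 - 1) * (?b\<^sup>2 - 1)" by (simp add: power_mult_distrib x1 y1)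
    also have "\<dots> = (?a * ?b - 1)\<^sup>2 - (?a - ?b)\<^sup>2" by (simp add: power2_eq_square algebra_simps)
    finally show ?thesis by simp
  qed
  then have "norm ?x * norm ?y \<le> ?a * ?b - 1" using ab by (rule power2_le_imp_le)
  then show ?thesis using hyperbolic_split[of x y] norm_cauchy_schwarz[of ?x ?y] by linarith
qed

lemma space_form_orthogonal:
  fixes x y :: "'v::euclidean_space"
  assumes "G \<noteq> Euclidean" "x \<in> space_form G" "form G x y = 0"
  shows "0 \<le> form G y y" "form G y y = 0 \<Longrightarrow> y = 0"
proof -
  show "0 \<le> form G y y" using assms hyperbolic_orthogonal(1)[of x y] by (cases G) simp_all
  show "y = 0" if "form G y y = 0" using assms that hyperbolic_orthogonal(2)[of x y] by (cases G) simp_all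
qed

text \<open>On the sphere the form is positive definite. In the hyperbolic case a Schur complement
  splits off one vertex of square -1, and the projections of the others to its orthogonal complement
  have a positive definite Gram matrix; so exactly one negative sign occurs.\<close>

lemma gram_det_sign:
  fixes v :: "'i \<Rightarrow> 'v::euclidean_space"
  assumes G: "G \<noteq> Euclidean" and fin: "finite I" and ne: "I \<noteq> {}"
    and v: "\<And>i. i \<in> I \<Longrightarrow> v i \<in> space_form G" and inj: "inj_on v I" and ind: "independent (v ` I)"
  shows "curvature G * ldet I (gram G v) > 0"
proof (cases "G = Spherical")
  case True
  have "0 < ldet I (gram G v)"
  proof (rule gram_pos_def[OF fin])
    fix x :: "'i \<Rightarrow> real" assume "\<exists>i\<in>I. x i \<noteq> 0"
    then have "(\<Sum>j\<in>I. x j *\<^sub>R v j) \<noteq> 0" using independent_family[OF fin inj ind] by blast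
    then show "0 < form G (\<Sum>j\<in>I. x j *\<^sub>R v j) (\<Sum>j\<in>I. x j *\<^sub>R v j)" using True by simp
  qed
  then show ?thesis using True by simp
next
  case False
  then have H: "G = Hyperbolic" using G by (cases G) auto
  obtain o' where o: "o' \<in> I" using ne by blast
  define I' where "I' = I - {o'}"
  have I': "I = insert o' I'" "o' \<notin> I'" "finite I'" using o fin by (auto simp: I'_def)
  have voo: "form G (v o') (v o') = -1" using v[OF o] H by simp
  define w where "w i = v i + form G (v i) (v o') *\<^sub>R v o'" for i
  have wo: "form G (v o') (w i) = 0" for i by (simp add: w_def form_simps voo form_sym[of G "v o'" "v i"])
  have ww: "form G (w i) (w j) = form G (v i) (v j) - form G (v i) (v o') * form G (v o') (v j) / form G (v o') (v o')" for i j
    using wo[of j] by (simp add: w_def form_simps voo)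
  have "ldet I (gram G v) = - ldet I' (gram G w)"
  proof -
    have "ldet I (gram G v) = form G (v o') (v o') * ldet I' (\<lambda>i j. gram G v i j - gram G v i o' * gram G v o' j / gram G v o' o')"
      unfolding I'(1) using ldet_schur[of I' o' "gram G v"] I' voo by (simp add: gram_def)
    then show ?thesis unfolding gram_def ww voo by simp
  qed
  moreover have "0 < ldet I' (gram G w)"
  proof (rule gram_pos_def[OF I'(3)])
    fix x :: "'i \<Rightarrow> real" assume ex: "\<exists>i\<in>I'. x i \<noteq> 0"
    let ?y = "\<Sum>j\<in>I'. x j *\<^sub>R w j"
    have orth: "form G (v o') ?y = 0" by (simp add: form_simps wo)
    have "?y \<noteq> 0"
    proof
      assume y0: "?y = 0"
      \<comment> \<open>A relation among the projections becomes one among the vertices once the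
        contributions of \<open>v o'\<close> are collected.\<close>
      define u where "u i = (if i = o' then (\<Sum>j\<in>I'. x j * form G (v j) (v o')) else x i)" for i
      have "(\<Sum>j\<in>I. u j *\<^sub>R v j) = u o' *\<^sub>R v o' + (\<Sum>j\<in>I'. x j *\<^sub>R v j)"
        unfolding I'(1) using I' by (simp add: u_def) (intro sum.cong, auto)
      also have "\<dots> = ?y" by (simp add: u_def w_def scaleR_add_right sum.distrib scaleR_sum_left add.commute)
      finally have "\<forall>i\<in>I. u i = 0" using y0 independent_family[OF fin inj ind, of u] by simp
      then have "\<forall>i\<in>I'. x i = 0" using I' by (auto simp: u_def split: if_splits)
      then show False using ex by blast
    qed
    then show "0 < form G ?y ?y"
      using space_form_orthogonal[OF G v[OF o] orth] by linarith
  qed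
  ultimately show ?thesis using H by simp
qed

text \<open>On the sphere Cramer's rule bounds each coordinate by the norm of the combination. In
  the hyperbolic case all entries of \<kappa> times the Gram matrix are at least 1, so on the
  orthant the form dominates the square of the coordinate sum, and the constant 1 works.\<close>

lemma coercive_gram:
  fixes v :: "'i \<Rightarrow> 'v::euclidean_space"
  assumes G: "G \<noteq> Euclidean" and fin: "finite I"
    and v: "\<And>i. i \<in> I \<Longrightarrow> v i \<in> space_form G" and nz: "ldet I (gram G v) \<noteq> 0"
  shows "\<exists>c. coercive c (\<lambda>i j. curvature G * gram G v i j) I"
proof (cases "G = Spherical")
  case True
  define d where "d = ldet I (gram G v)"
  define K where "K i = (\<Sum>a\<in>I. \<bar>cofac I (gram G v) i a\<bar>) / \<bar>d\<bar>" for i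
  define c where "c = 1 / ((\<Sum>i\<in>I. (K i)\<^sup>2) + 1)"
  have K0: "0 \<le> (\<Sum>i\<in>I. (K i)\<^sup>2)" by (intro sum_nonneg) auto
  have q: "quad (\<lambda>i j. curvature G * gram G v i j) I x = (norm (\<Sum>j\<in>I. x j *\<^sub>R v j))\<^sup>2" for x
    using gram_quad[where G=G and v=v and I=I and x=x] True by (simp add: quad_def power2_norm_eq_inner mult_ac)
  have "coercive c (\<lambda>i j. curvature G * gram G v i j) I"
    unfolding coercive_def q
  proof (intro conjI allI impI)
    show "c > 0" using K0 by (simp add: c_def)
    fix x :: "'i \<Rightarrow> real"
    let ?y = "\<Sum>j\<in>I. x j *\<^sub>R v j"
    have "(x i)\<^sup>2 \<le> (K i)\<^sup>2 * (norm ?y)\<^sup>2" if i: "i \<in> I" for i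
    proof -
      have "d * x i = (\<Sum>a\<in>I. cofac I (gram G v) i a * form G (v a) ?y)"
        unfolding d_def by (rule cofac_kernel[OF fin _ i]) (rule gram_sym gram_sum)+
      also have "\<bar>\<dots>\<bar> \<le> (\<Sum>a\<in>I. \<bar>cofac I (gram G v) i a\<bar> * norm ?y)"
      proof (intro order_trans[OF sum_abs] sum_mono)
        fix a assume "a \<in> I"
        then have "norm (v a) = 1" using v True by simp
        then have "\<bar>form G (v a) ?y\<bar> \<le> norm ?y" using Cauchy_Schwarz_ineq2[of "v a" ?y] True by simp
        then show "\<bar>cofac I (gram G v) i a * form G (v a) ?y\<bar> \<le> \<bar>cofac I (gram G v) i a\<bar> * norm ?y"
          by (simp add: abs_mult mult_left_mono)
      qed
      finally have "\<bar>d\<bar> * \<bar>x i\<bar> \<le> (\<Sum>a\<in>I. \<bar>cofac I (gram G v) i a\<bar>) * norm ?y" by (simp add: abs_mult sum_distrib_right)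
      then have "\<bar>x i\<bar> \<le> K i * norm ?y" using nz by (simp add: K_def d_def field_simps)
      then have "\<bar>x i\<bar>\<^sup>2 \<le> (K i * norm ?y)\<^sup>2" by (intro power_mono) auto
      then show ?thesis by (simp add: power_mult_distrib)
    qed
    then have "(\<Sum>i\<in>I. (x i)\<^sup>2) \<le> (\<Sum>i\<in>I. (K i)\<^sup>2) * (norm ?y)\<^sup>2"
      unfolding sum_distrib_right by (rule sum_mono)
    also have "\<dots> \<le> ((\<Sum>i\<in>I. (K i)\<^sup>2) + 1) * (norm ?y)\<^sup>2" by (intro mult_right_mono) auto
    finally show "c * (\<Sum>i\<in>I. (x i)\<^sup>2) \<le> (norm ?y)\<^sup>2"
      using K0 by (simp add: c_def divide_le_eq mult.commute add_nonneg_pos)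
  qed
  then show ?thesis ..
next
  case False
  then have H: "G = Hyperbolic" using G by (cases G) auto
  have "coercive 1 (\<lambda>i j. curvature G * gram G v i j) I"
    unfolding coercive_def
  proof (intro conjI allI impI)
    fix x :: "'i \<Rightarrow> real" assume x: "\<forall>i\<in>I. 0 \<le> x i"
    have "1 * (\<Sum>i\<in>I. (x i)\<^sup>2) \<le> (\<Sum>i\<in>I. x i * (\<Sum>j\<in>I. x j))"
      unfolding mult_1 power2_eq_square using x fin
      by (intro sum_mono mult_left_mono member_le_sum) auto
    also have "\<dots> \<le> quad (\<lambda>i j. curvature G * gram G v i j) I x"
      unfolding quad_def sum_distrib_left
    proof (intro sum_mono)
      fix i j assume ij: "i \<in> I" "j \<in> I"
      have "1 * (x i * x j) \<le> (curvature G * gram G v i j) * (x i * x j)"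
        using hyperbolic_form_le[of "v i" "v j"] v ij x H by (intro mult_right_mono) (auto simp: gram_def)
      then show "x i * x j \<le> curvature G * gram G v i j * x i * x j" by (simp add: mult.assoc)
    qed
    finally show "1 * (\<Sum>i\<in>I. (x i)\<^sup>2) \<le> quad (\<lambda>i j. curvature G * gram G v i j) I x" .
  qed simp
  then show ?thesis ..
qed

section \<open>Faces and motions through Gram matrices\<close>

lemma verts_nth:
  assumes "finite I" "p < card I"
  shows "verts A I ! p = A (sorted_list_of_set I ! p)"
  using assms by (simp add: verts_def)

lemma length_verts [simp]: "finite I \<Longrightarrow> length (verts A I) = card I"
  by (simp add: verts_def)

lemma bij_betw_sorted: "finite I \<Longrightarrow> bij_betw ((!) (sorted_list_of_set I)) {..<card I} I"
  by (rule bij_betw_nth) auto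

lemma gram_det_verts:
  assumes "finite I"
  shows "gram_det G (verts A I) = ldet I (gram G A)"
proof -
  have "gram_det G (verts A I) = ldet {..<card I} (\<lambda>p q. gram G A (sorted_list_of_set I ! p) (sorted_list_of_set I ! q))"
    unfolding gram_det_eq_ldet length_verts[OF assms] by (rule ldet_cong) (simp add: gram_def verts_nth assms)
  then show ?thesis using ldet_reindex[OF bij_betw_sorted[OF assms], of "gram G A"] by simp
qed

lemma simplex_volume_verts:
  fixes A :: "nat \<Rightarrow> 'v::euclidean_space"
  assumes G: "G \<noteq> Euclidean" and card: "card I = Suc k"
    and det: "curvature G * ldet I (gram G A) > 0"
    and co: "coercive c (\<lambda>i j. curvature G * gram G A i j) I"
  shows "simplex_volume G (verts A I) * enn2real (radial_moment k) =
     sqrt (curvature G * ldet I (gram G A)) * gauss (\<lambda>i j. curvature G * gram G A i j) I (\<lambda>_. 1)"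
proof -
  have fin: "finite I" by (rule card_ge_0_finite) (simp add: card)
  let ?L = "sorted_list_of_set I"
  let ?H = "\<lambda>i j. curvature G * gram G A i j"
  have bij: "bij_betw ((!) ?L) {..k} I" using bij_betw_sorted[OF fin] card by (simp add: lessThan_Suc_atMost)
  have co': "coercive c (\<lambda>i j. ?H (?L ! i) (?L ! j)) {..k}" by (rule coercive_reindex[OF bij co])
  have same: "?H (?L ! i) (?L ! j) = curvature G * form G (verts A I ! i) (verts A I ! j)"
    if "i \<in> {..k}" "j \<in> {..k}" for i j using that fin card by (simp add: gram_def verts_nth)
  have quad_eq: "quad (\<lambda>i j. ?H (?L ! i) (?L ! j)) {..k} = quad (\<lambda>i j. curvature G * form G (verts A I ! i) (verts A I ! j)) {..k}"
  proof
    show "quad (\<lambda>i j. ?H (?L ! i) (?L ! j)) {..k} x = quad (\<lambda>i j. curvature G * form G (verts A I ! i) (verts A I ! j)) {..k} x" for x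
      unfolding quad_def by (intro sum.cong[OF refl]) (simp only: same)
  qed
  have "simplex_volume G (verts A I) * enn2real (radial_moment k) =
    simplex_norm G (verts A I) * gauss (\<lambda>i j. curvature G * form G (verts A I ! i) (verts A I ! j)) {..k} (\<lambda>_. 1)"
    by (rule simplex_volume_gauss[OF G _ _, where c=c])
       (use fin card det co' gram_det_verts[OF fin, of G A] in \<open>auto simp: coercive_def quad_eq\<close>)
  also have "gauss (\<lambda>i j. curvature G * form G (verts A I ! i) (verts A I ! j)) {..k} (\<lambda>_. 1) = gauss (\<lambda>i j. ?H (?L ! i) (?L ! j)) {..k} (\<lambda>_. 1)"
    unfolding gauss_def quad_eq ..
  also have "\<dots> = gauss ?H I (\<lambda>_. 1)" by (rule gauss_reindex[OF _ bij]) simp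
  also have "simplex_norm G (verts A I) = sqrt (curvature G * ldet I (gram G A))"
    using det G unfolding simplex_norm_def gram_det_verts[OF fin] by (cases G) auto
  finally show ?thesis .
qed

lemma smooth_on_nonneg_C1:
  fixes f :: "real \<Rightarrow> 'v::real_normed_vector"
  assumes "smooth_on_nonneg f"
  obtains f' where "\<And>t. t \<ge> 0 \<Longrightarrow> (f has_vector_derivative f' t) (at t within {0..})" "(f' \<longlongrightarrow> f' 0) (at_right 0)"
proof -
  obtain D :: "nat \<Rightarrow> real \<Rightarrow> 'v" where D: "D 0 = f"
    "\<And>m t. t \<ge> 0 \<Longrightarrow> (D m has_vector_derivative D (Suc m) t) (at t within {0..})"
    using assms unfolding smooth_on_nonneg_def by blast
  have "continuous (at 0 within {0..}) (D 1)"
    by (rule has_vector_derivative_continuous[OF D(2)]) simp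
  then have "(D 1 \<longlongrightarrow> D 1 0) (at 0 within {0..})" by (simp add: continuous_within)
  then have "(D 1 \<longlongrightarrow> D 1 0) (at_right 0)" by (rule tendsto_within_subset) auto
  with D(2)[of _ 0] show ?thesis using that[of "D 1"] unfolding D(1) by simp
qed

lemma smooth_motion_C1:
  fixes At :: "real \<Rightarrow> nat \<Rightarrow> 'v::euclidean_space"
  assumes "smooth_motion G n A At"
  obtains V where
    "\<And>i t. i \<in> {1..n + 2} \<Longrightarrow> t \<ge> 0 \<Longrightarrow> ((\<lambda>t. At t i) has_vector_derivative V t i) (at t within {0..})"
    "\<And>i. i \<in> {1..n + 2} \<Longrightarrow> ((\<lambda>t. V t i) \<longlongrightarrow> V 0 i) (at_right 0)"
    "\<And>i. i \<in> {1..n + 2} \<Longrightarrow> ((\<lambda>t. At t i) \<longlongrightarrow> At 0 i) (at_right 0)"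
proof -
  have "\<forall>i. \<exists>f'. i \<in> {1..n + 2} \<longrightarrow>
      (\<forall>t\<ge>0. ((\<lambda>t. At t i) has_vector_derivative f' t) (at t within {0..})) \<and> (f' \<longlongrightarrow> f' 0) (at_right 0)"
  proof
    fix i
    show "\<exists>f'. i \<in> {1..n + 2} \<longrightarrow>
      (\<forall>t\<ge>0. ((\<lambda>t. At t i) has_vector_derivative f' t) (at t within {0..})) \<and> (f' \<longlongrightarrow> f' 0) (at_right 0)"
    proof (cases "i \<in> {1..n + 2}")
      case True
      then have "smooth_on_nonneg (\<lambda>t. At t i)" using assms unfolding smooth_motion_def by blast
      then show ?thesis by (rule smooth_on_nonneg_C1) blast
    qed blast
  qed
  then obtain f' where f': "\<And>i. i \<in> {1..n + 2} \<longrightarrow>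
      (\<forall>t\<ge>0. ((\<lambda>t. At t i) has_vector_derivative f' i t) (at t within {0..})) \<and> (f' i \<longlongrightarrow> f' i 0) (at_right 0)"
    by metis
  have "((\<lambda>t. At t i) \<longlongrightarrow> At 0 i) (at_right 0)" if "i \<in> {1..n + 2}" for i
  proof -
    have "continuous (at 0 within {0..}) (\<lambda>t. At t i)"
      using f' that by (intro has_vector_derivative_continuous[where D="f' i 0"]) auto
    then have "((\<lambda>t. At t i) \<longlongrightarrow> At 0 i) (at 0 within {0..})" by (simp add: continuous_within)
    then show ?thesis by (rule tendsto_within_subset) auto
  qed
  then show ?thesis using that[of "\<lambda>t i. f' i t"] f' by blast
qed

lemma form_has_real_derivative:
  assumes "(f has_vector_derivative f') (at t within S)" "(g has_vector_derivative g') (at t within S)"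
  shows "((\<lambda>t. form G (f t) (g t)) has_real_derivative form G (f t) g' + form G f' (g t)) (at t within S)"
  unfolding has_real_derivative_iff_has_vector_derivative
  by (rule bounded_bilinear.has_vector_derivative[OF bounded_bilinear_form assms])

text \<open>A proper set of vertices misses some vertex and therefore lies in an n-face.\<close>

lemma nondegenerate_subset:
  assumes nd: "\<forall>I\<in>faces n n. nondegenerate G A I" and E: "E \<subset> {1..n + 2}"
  shows "nondegenerate G A E"
proof -
  obtain x where x: "x \<in> {1..n + 2}" "x \<notin> E" using E by blast
  then have "card ({1..n + 2} - {x}) = n + 1" by (simp add: card_Diff_singleton)
  then have "{1..n + 2} - {x} \<in> faces n n" unfolding faces_def by blast
  then have nd': "nondegenerate G A ({1..n + 2} - {x})" using nd by blast
  have sub: "E \<subseteq> {1..n + 2} - {x}" using E x by blast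
  show ?thesis
    using nd' inj_on_subset[OF _ sub, of A] independent_mono[OF _ image_mono[OF sub, of A]]
      affine_independent_subset[OF _ image_mono[OF sub, of A]]
    by (cases G) (simp_all only: nondegenerate.simps simp_thms)
qed

lemma nondegenerate_nonEuclidean:
  "G \<noteq> Euclidean \<Longrightarrow> nondegenerate G A I \<longleftrightarrow> inj_on A I \<and> independent (A ` I)"
  by (cases G) (simp_all only: nondegenerate.simps simp_thms)

lemma ldet_curvature_gram:
  "ldet F (\<lambda>i j. curvature G * gram G v i j) = curvature G ^ card F * ldet F (gram G v)"
  using ldet_scale[of F "\<lambda>_. curvature G" "\<lambda>_. 1" "gram G v"] by simp

lemma curvature_power_sq: "G \<noteq> Euclidean \<Longrightarrow> curvature G ^ m * curvature G ^ m = 1"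
  by (simp add: power_mult_distrib[symmetric] curvature_sq)

lemma simplex_norm_verts:
  assumes "finite I" "curvature G * ldet I (gram G A) > 0"
  shows "simplex_norm G (verts A I) = sqrt (curvature G * ldet I (gram G A))"
  using assms(2) unfolding simplex_norm_def gram_det_verts[OF assms(1)] by (cases G) auto

section \<open>The spherical and hyperbolic cases\<close>

lemma totally_geodesic_span:
  fixes v :: "nat \<Rightarrow> 'v::euclidean_space"
  assumes G: "G \<noteq> Euclidean" and I: "finite I" "card I = n + 1" "inj_on v I" "independent (v ` I)"
    and v: "\<And>i. i \<in> I \<Longrightarrow> v i \<in> space_form G"
  shows "totally_geodesic G n (space_form G \<inter> span (v ` I))"
proof -
  have d: "dim (span (v ` I)) = n + 1" using dim_span_eq_card_independent[OF I(4)] card_image[OF I(3)] I(2) by simp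
  obtain i where "i \<in> I" using I(2) by fastforce
  then have "v i \<in> space_form G \<inter> span (v ` I)" using v by (simp add: span_base)
  then have ne: "space_form G \<inter> span (v ` I) \<noteq> {}" by blast
  have "\<exists>L. subspace L \<and> dim L = n + 1 \<and> space_form G \<inter> span (v ` I) = space_form G \<inter> L"
    using d subspace_span by blast
  then show ?thesis using G ne by (cases G) (simp_all only: totally_geodesic.simps simp_thms)
qed

lemma span_of_relation:
  fixes v :: "'i \<Rightarrow> 'v::euclidean_space"
  assumes "finite U" "o' \<in> U" "(\<Sum>j\<in>U. x j *\<^sub>R v j) = 0" "x o' \<noteq> 0"
  shows "v o' \<in> span (v ` (U - {o'}))"
proof -
  have "x o' *\<^sub>R v o' + (\<Sum>j\<in>U - {o'}. x j *\<^sub>R v j) = 0"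
    using assms(3) sum.remove[OF assms(1,2), of "\<lambda>j. x j *\<^sub>R v j"] by simp
  then have "x o' *\<^sub>R v o' = - (\<Sum>j\<in>U - {o'}. x j *\<^sub>R v j)" by (simp add: add_eq_0_iff)
  also have "\<dots> \<in> span (v ` (U - {o'}))"
    by (intro span_neg span_sum span_scale span_base) auto
  finally have "(1 / x o') *\<^sub>R (x o' *\<^sub>R v o') \<in> span (v ` (U - {o'}))" by (rule span_scale)
  then show ?thesis using assms(4) by simp
qed

text \<open>Each product of norm and volume is a Gaussian term divided by the radial moment. That
  moment and the factor \<open>real (k + 1) * fact l\<close> are positive, so the sign of the
  invariant is that of the sum used in \<open>radial_motion_rigid\<close> up to the displayed powers
  of \<kappa>.\<close>

lemma stress_invariant_radial:
  fixes A :: "nat \<Rightarrow> 'v::euclidean_space"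
  assumes G: "G \<noteq> Euclidean" and nd: "\<forall>I\<in>faces n n. nondegenerate G A I"
    and A: "\<And>i. i \<in> {1..n + 2} \<Longrightarrow> A i \<in> space_form G" and k: "k \<le> n"
    and s: "s * stress_invariant G n A \<alpha> P Q k > 0"
  shows "s * curvature G ^ (k + 1) * curvature G *
    (\<Sum>E | E \<subseteq> {1..n + 2} \<and> card E = k. (\<Prod>i\<in>E. \<alpha> i) *
      (ldet E (\<lambda>i j. curvature G * gram G A i j) * gauss (\<lambda>i j. curvature G * gram G A i j) E (\<lambda>_. 1))) > 0"
    (is "s * _ * _ * ?S > 0")
proof (cases k)
  case 0
  have "{E. E \<subseteq> {1..n + 2} \<and> card E = 0} = {{}}" using finite_subset[of _ "{1..n + 2}"] by auto
  then have "?S = gauss (\<lambda>i j. curvature G * gram G A i j) {} (\<lambda>_. 1)" unfolding 0 by (simp add: ldet_def)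
  also have "\<dots> = 1"
    by (simp add: gauss_def quad_def orthant_def PiM_empty measure_def emeasure_count_space)
  finally have "s * curvature G ^ (k + 1) * curvature G * ?S = s"
    using curvature_sq[OF G] 0 by simp
  moreover have "s > 0" using s 0 by (simp add: stress_invariant_def)
  ultimately show ?thesis by (simp only:)
next
  case (Suc l)
  let ?\<kappa> = "curvature G"
  let ?H = "\<lambda>i j. ?\<kappa> * gram G A i j"
  let ?C = "enn2real (radial_moment l)"
  have C: "?C > 0" using radial_moment_pos[of l] radial_moment_finite[of l] by (simp add: enn2real_positive_iff)
  have faces: "faces n l = {E. E \<subseteq> {1..n + 2} \<and> card E = k}" by (simp add: faces_def Suc)
  have *: "simplex_norm G (verts A I) * simplex_volume G (verts A I) * ?C = ?\<kappa> ^ (k + 1) * (ldet I ?H * gauss ?H I (\<lambda>_. 1))"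
    if I: "I \<in> faces n l" for I
  proof -
    have cI: "I \<subseteq> {1..n + 2}" "card I = Suc l" using I Suc by (auto simp: faces)
    then have proper: "I \<subset> {1..n + 2}" using k Suc by (auto simp: psubset_eq)
    have fin: "finite I" using cI finite_subset by blast
    have ne: "I \<noteq> {}" using cI by auto
    have AI: "A i \<in> space_form G" if "i \<in> I" for i using A cI that by blast
    have ndI: "inj_on A I \<and> independent (A ` I)"
      using nondegenerate_subset[OF nd proper] nondegenerate_nonEuclidean[OF G] by blast
    have pos: "?\<kappa> * ldet I (gram G A) > 0"
      by (rule gram_det_sign[OF G fin ne AI ndI[THEN conjunct1] ndI[THEN conjunct2]])
    then obtain c where co: "coercive c ?H I" using coercive_gram[OF G fin AI] by fastforce
    have "simplex_norm G (verts A I) * simplex_volume G (verts A I) * ?C =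
       simplex_norm G (verts A I) * (sqrt (?\<kappa> * ldet I (gram G A)) * gauss ?H I (\<lambda>_. 1))"
      using simplex_volume_verts[OF G cI(2) pos co] by simp
    also have "\<dots> = ?\<kappa> * ldet I (gram G A) * gauss ?H I (\<lambda>_. 1)"
      using pos by (simp add: simplex_norm_verts[OF fin pos])
    \<comment> \<open>One copy of \<kappa>^k turns the Gram determinant into that of
      \<open>?H\<close>; the other stays in front.\<close>
    also have "\<dots> = ?\<kappa> * (?\<kappa> ^ k * ?\<kappa> ^ k) * ldet I (gram G A) * gauss ?H I (\<lambda>_. 1)"
      by (simp add: curvature_power_sq[OF G])
    also have "\<dots> = ?\<kappa> ^ (k + 1) * (ldet I ?H * gauss ?H I (\<lambda>_. 1))"
      unfolding ldet_curvature_gram cI(2) Suc by (simp add: mult_ac)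
    finally show ?thesis .
  qed
  have "(\<Sum>I\<in>faces n l. (\<Prod>i\<in>I. \<alpha> i) * simplex_norm G (verts A I) * simplex_volume G (verts A I)) * ?C =
     (\<Sum>I\<in>faces n l. (\<Prod>i\<in>I. \<alpha> i) * (?\<kappa> ^ (k + 1) * (ldet I ?H * gauss ?H I (\<lambda>_. 1))))"
    unfolding sum_distrib_right
  proof (rule sum.cong[OF refl])
    fix I assume "I \<in> faces n l"
    from *[OF this] show "(\<Prod>i\<in>I. \<alpha> i) * simplex_norm G (verts A I) * simplex_volume G (verts A I) * ?C =
      (\<Prod>i\<in>I. \<alpha> i) * (?\<kappa> ^ (k + 1) * (ldet I ?H * gauss ?H I (\<lambda>_. 1)))" by (simp only: mult.assoc)
  qed
  also have "\<dots> = ?\<kappa> ^ (k + 1) * ?S"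
    unfolding faces sum_distrib_left by (rule sum.cong[OF refl]) (simp only: mult_ac)
  finally have sum: "(\<Sum>I\<in>faces n l. (\<Prod>i\<in>I. \<alpha> i) * simplex_norm G (verts A I) * simplex_volume G (verts A I)) * ?C = ?\<kappa> ^ (k + 1) * ?S" .
  have eq: "s * stress_invariant G n A \<alpha> P Q k * ?C = (real (k + 1) * fact l) * (s * ?\<kappa> ^ (k + 1) * ?\<kappa> * ?S)"
  proof -
    have "stress_invariant G n A \<alpha> P Q k = ?\<kappa> * real (k + 1) * fact l *
        (\<Sum>I\<in>faces n l. (\<Prod>i\<in>I. \<alpha> i) * simplex_norm G (verts A I) * simplex_volume G (verts A I))"
      using G Suc by (simp add: stress_invariant_def)
    then have "s * stress_invariant G n A \<alpha> P Q k * ?C = s * ?\<kappa> * real (k + 1) * fact l *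
        ((\<Sum>I\<in>faces n l. (\<Prod>i\<in>I. \<alpha> i) * simplex_norm G (verts A I) * simplex_volume G (verts A I)) * ?C)" by (simp only: mult_ac)
    then show ?thesis unfolding sum by (simp only: mult_ac)
  qed
  have "0 < (real (k + 1) * fact l) * (s * ?\<kappa> ^ (k + 1) * ?\<kappa> * ?S)"
    using mult_pos_pos[OF s C] unfolding eq .
  moreover have "0 < real (k + 1) * fact l" by simp
  ultimately show ?thesis using zero_less_mult_pos by blast
qed

lemma nonEuclidean_motion_rigid:
  fixes A :: "nat \<Rightarrow> 'v::euclidean_space"
  assumes G: "G \<noteq> Euclidean" and nd: "\<forall>I\<in>faces n n. nondegenerate G A I"
    and st: "is_1_stress G n A \<alpha>" and k: "1 \<le> k" "k \<le> n" and mot: "smooth_motion G n A At"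
    and s: "s * stress_invariant G n A \<alpha> P Q (k - 1) > 0"
    and mono: "\<And>I. I \<in> faces n k \<Longrightarrow>
       (0 < s * (\<Prod>i\<in>I. \<alpha> i) \<longrightarrow> mono_on {0..} (\<lambda>t. simplex_volume G (verts (At t) I))) \<and>
       (s * (\<Prod>i\<in>I. \<alpha> i) < 0 \<longrightarrow> antimono_on {0..} (\<lambda>t. simplex_volume G (verts (At t) I)))"
  shows "\<exists>\<delta>>0. \<forall>t. 0 < t \<and> t < \<delta> \<longrightarrow>
           (\<forall>I\<in>faces n k. simplex_volume G (verts (At t) I) = simplex_volume G (verts (At 0) I)) \<and>
           (\<exists>S. totally_geodesic G n S \<and> (\<forall>i\<in>{1..n + 2}. At t i \<in> S))"
proof -
  define U where "U = {1..n + 2}"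
  define \<kappa> where "\<kappa> = curvature G"
  have \<kappa>2: "\<kappa> * \<kappa> = 1" using curvature_sq[OF G] by (simp add: \<kappa>_def)
  have \<kappa>0: "\<kappa> \<noteq> 0" using \<kappa>2 by auto
  have \<kappa>p: "\<kappa> ^ m * \<kappa> ^ m = 1" for m using curvature_power_sq[OF G] by (simp add: \<kappa>_def)
  obtain l where l: "k = Suc l" using k(1) by (cases k) auto
  have finU: "finite U" and cU: "card U = n + 2" and oU: "1 \<in> U" and tU: "2 \<in> U - {1}" by (auto simp: U_def)
  have finE: "finite E" if "E \<subseteq> U" for E using that finU finite_subset by blast
  obtain V where V: "\<And>i t. i \<in> U \<Longrightarrow> t \<ge> 0 \<Longrightarrow> ((\<lambda>t. At t i) has_vector_derivative V t i) (at t within {0..})"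
    and V0: "\<And>i. i \<in> U \<Longrightarrow> ((\<lambda>t. V t i) \<longlongrightarrow> V 0 i) (at_right 0)"
    and At0: "\<And>i. i \<in> U \<Longrightarrow> ((\<lambda>t. At t i) \<longlongrightarrow> At 0 i) (at_right 0)"
    unfolding U_def using smooth_motion_C1[OF mot] by blast
  have AtA: "At 0 i = A i" if "i \<in> U" for i using mot that unfolding smooth_motion_def U_def by blast
  have Atsf: "At t i \<in> space_form G" if "i \<in> U" "t \<ge> 0" for i t using mot that unfolding smooth_motion_def U_def by blast
  have Asf: "A i \<in> space_form G" if "i \<in> U" for i using Atsf[OF that, of 0] AtA[OF that] by simp
  define H where "H t i j = \<kappa> * gram G (At t) i j" for t i j
  define H' where "H' t i j = \<kappa> * (form G (At t i) (V t j) + form G (V t i) (At t j))" for t i j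
  have ldH: "ldet F (H t) = \<kappa> ^ card F * ldet F (gram G (At t))" for F t
    unfolding H_def \<kappa>_def ldet_curvature_gram ..
  have gramlim: "((\<lambda>t. gram G (At t) i j) \<longlongrightarrow> gram G (At 0) i j) (at_right 0)" if "i \<in> U" "j \<in> U" for i j
    unfolding gram_def by (rule bounded_bilinear.tendsto[OF bounded_bilinear_form At0[OF that(1)] At0[OF that(2)]])
  have detpos0: "\<kappa> * ldet F (gram G (At 0)) > 0" if "F \<subset> U" "F \<noteq> {}" for F
  proof -
    have FU: "i \<in> U" if "i \<in> F" for i using that \<open>F \<subset> U\<close> by blast
    have "ldet F (gram G (At 0)) = ldet F (gram G A)" by (rule ldet_cong) (simp add: gram_def AtA FU)
    moreover have "inj_on A F \<and> independent (A ` F)"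
      using nondegenerate_subset[OF nd that(1)[unfolded U_def]] nondegenerate_nonEuclidean[OF G] by blast
    then have "\<kappa> * ldet F (gram G A) > 0" unfolding \<kappa>_def
      by (intro gram_det_sign[OF G finE[OF psubset_imp_subset[OF that(1)]] that(2) Asf[OF FU]]) blast+
    ultimately show ?thesis by simp
  qed
  have "\<forall>\<^sub>F t in at_right 0. \<forall>F\<in>{F. F \<subset> U \<and> F \<noteq> {}}. \<kappa> * ldet F (gram G (At t)) > 0"
  proof (rule eventually_ball_finite)
    show "finite {F. F \<subset> U \<and> F \<noteq> {}}" by (rule finite_subset[of _ "Pow U"]) (use finU in auto)
    show "\<forall>F\<in>{F. F \<subset> U \<and> F \<noteq> {}}. \<forall>\<^sub>F t in at_right 0. \<kappa> * ldet F (gram G (At t)) > 0"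
    proof
      fix F assume "F \<in> {F. F \<subset> U \<and> F \<noteq> {}}"
      then have F: "F \<subset> U" "F \<noteq> {}" by blast+
      have "((\<lambda>t. \<kappa> * ldet F (gram G (At t))) \<longlongrightarrow> \<kappa> * ldet F (gram G (At 0))) (at_right 0)"
        using F by (intro tendsto_mult_left tendsto_ldet gramlim finE) auto
      then show "\<forall>\<^sub>F t in at_right 0. \<kappa> * ldet F (gram G (At t)) > 0" by (rule order_tendstoD) (rule detpos0[OF F])
    qed
  qed
  \<comment> \<open>Before \<delta>0 all proper faces stay nondegenerate, as the Gaussian formula
    for their volumes requires.\<close>
  then obtain \<delta>0 where \<delta>0: "\<delta>0 > 0" and dp: "\<And>t F. 0 < t \<Longrightarrow> t < \<delta>0 \<Longrightarrow> F \<subset> U \<Longrightarrow> F \<noteq> {} \<Longrightarrow> \<kappa> * ldet F (gram G (At t)) > 0"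
    unfolding eventually_at_right_field by blast
  have detpos: "\<kappa> * ldet F (gram G (At t)) > 0" if "0 \<le> t" "t < \<delta>0" "F \<subset> U" "F \<noteq> {}" for t F
    using dp detpos0 that by (cases "t = 0") auto
  have faces: "F \<in> faces n k \<longleftrightarrow> F \<subseteq> U \<and> card F = Suc (Suc l)" for F by (simp add: faces_def U_def l)
  have proper: "F \<subset> U" "F \<noteq> {}" if "F \<subseteq> U" "card F = Suc (Suc l)" for F
    using that cU k l by (auto simp: psubset_eq)
  define C where "C = enn2real (radial_moment k)"
  have C: "C > 0" using radial_moment_pos[of k] radial_moment_finite[of k] by (simp add: C_def enn2real_positive_iff)
  \<comment> \<open>For k + 1 vertices the determinant of \<open>H\<close> is \<kappa>^(k+1) times
    the Gram determinant, whose sign is that of \<kappa>; multiplying by \<kappa>^k makes it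
    positive.\<close>
  define \<sigma> where "\<sigma> = \<kappa> ^ k"
  have \<sigma>det: "\<sigma> * ldet F (H t) = \<kappa> * ldet F (gram G (At t))" if "card F = Suc (Suc l)" for F t
  proof -
    have "\<sigma> * ldet F (H t) = \<kappa> * (\<kappa> ^ k * \<kappa> ^ k) * ldet F (gram G (At t))"
      unfolding ldH \<sigma>_def that l by (simp add: mult_ac)
    then show ?thesis by (simp add: \<kappa>p)
  qed
  let ?vol = "\<lambda>F t. sqrt (\<sigma> * ldet F (H t)) * gauss (H t) F (\<lambda>_. 1)"
  have vol: "?vol F t = C * simplex_volume G (verts (At t) F)"
    if "0 \<le> t" "t < \<delta>0" "F \<subseteq> U" "card F = Suc (Suc l)" for t F
  proof -
    note t = that
    have FU: "i \<in> U" if "i \<in> F" for i using that \<open>F \<subseteq> U\<close> by blast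
    have pos: "curvature G * ldet F (gram G (At t)) > 0"
      using detpos[OF that(1,2) proper[OF that(3,4)]] by (simp add: \<kappa>_def)
    then obtain c where co: "coercive c (\<lambda>i j. curvature G * gram G (At t) i j) F"
      using coercive_gram[OF G finE[OF t(3)] Atsf[OF FU t(1)]] by fastforce
    have H: "H t = (\<lambda>i j. curvature G * gram G (At t) i j)" by (intro ext) (simp add: H_def \<kappa>_def)
    have "card F = Suc k" using that(4) l by simp
    note sv = simplex_volume_verts[OF G this pos co]
    show ?thesis
      unfolding \<sigma>det[OF that(4)] C_def mult.commute[of "enn2real _"] sv unfolding H \<kappa>_def ..
  qed
  have stU: "(\<Sum>j\<in>U. \<alpha> j *\<^sub>R A j) = 0" and \<alpha>U: "\<And>i. i \<in> U \<Longrightarrow> \<alpha> i \<noteq> 0"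
    using st unfolding is_1_stress_def U_def by blast+
  have Hsum: "(\<Sum>j\<in>U. H t i j * x j) = \<kappa> * form G (At t i) (\<Sum>j\<in>U. x j *\<^sub>R At t j)" for t i x
    unfolding H_def gram_sum[symmetric] sum_distrib_left by (simp only: mult.assoc)
  have Hquad: "(\<Sum>i\<in>U. x i * (\<Sum>j\<in>U. H t i j * x j)) = \<kappa> * form G (\<Sum>j\<in>U. x j *\<^sub>R At t j) (\<Sum>j\<in>U. x j *\<^sub>R At t j)" for t x
    unfolding gram_quad[symmetric] H_def sum_distrib_left by (simp only: mult_ac)
  have "\<exists>\<delta>>0. \<forall>t. 0 < t \<and> t < \<delta> \<longrightarrow>
     (\<forall>F. F \<subseteq> U \<and> card F = Suc (Suc l) \<longrightarrow> ?vol F t = ?vol F 0) \<and>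
     (\<exists>x. x 1 = \<alpha> 1 \<and> (\<forall>i\<in>U. (\<Sum>j\<in>U. H t i j * x j) = 0))"
  proof (rule radial_motion_rigid[where H = H and H' = H' and \<kappa> = \<kappa> and s = s and \<sigma> = \<sigma> and k = l and U = U and \<alpha> = \<alpha>])
    show "finite U" "1 \<in> U" by fact+
    show "Suc (Suc l) < card U" using cU k l by simp
    show "H t i j = H t j i" for t i j by (simp add: H_def gram_sym)
    show "H' t i j = H' t j i" for t i j by (simp add: H'_def form_sym[of G "At t i"] form_sym[of G "V t i"])
    show "((\<lambda>t. H t i j) has_real_derivative H' t i j) (at t within {0..})" if "i \<in> U" "j \<in> U" "t \<ge> 0" for i j t
      unfolding H_def H'_def gram_def
      by (intro DERIV_cmult form_has_real_derivative V that)
    show "((\<lambda>t. H' t i j) \<longlongrightarrow> H' 0 i j) (at_right 0)" if "i \<in> U" "j \<in> U" for i j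
      unfolding H'_def
      by (intro tendsto_mult_left tendsto_add bounded_bilinear.tendsto[OF bounded_bilinear_form] At0 V0 that)
    show "ldet E (H 0) \<noteq> 0" if "E \<subset> U" for E
    proof (cases "E = {}")
      case True then show ?thesis by (simp add: ldet_def)
    next
      case False
      then have "\<kappa> * ldet E (gram G (At 0)) > 0" by (rule detpos0[OF that])
      then have "ldet E (gram G (At 0)) \<noteq> 0" by auto
      then show ?thesis using \<kappa>0 unfolding ldH by simp
    qed
    show "\<exists>c. coercive c (H 0) E" if "E \<subset> U" for E
    proof -
      have EU: "i \<in> U" if "i \<in> E" for i using that \<open>E \<subset> U\<close> by blast
      have "ldet E (gram G (At 0)) \<noteq> 0"
        using detpos0[OF that] by (cases "E = {}") (auto simp: ldet_def)
      then have "\<exists>c. coercive c (\<lambda>i j. curvature G * gram G (At 0) i j) E"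
        using that by (intro coercive_gram[OF G finE Atsf] EU) auto
      moreover have "H 0 = (\<lambda>i j. curvature G * gram G (At 0) i j)" by (intro ext) (simp add: H_def \<kappa>_def)
      ultimately show ?thesis by simp
    qed
    have "(\<Sum>j\<in>U. \<alpha> j *\<^sub>R At 0 j) = 0" using stU by (simp add: AtA)
    then show "(\<Sum>j\<in>U. H 0 i j * \<alpha> j) = 0" if "i \<in> U" for i unfolding Hsum by (simp add: form_simps)
    show "\<alpha> i \<noteq> 0" if "i \<in> U" for i using \<alpha>U[OF that] .
    show "\<kappa> * \<kappa> = 1" by fact
    show "0 \<le> \<kappa> * (\<Sum>i\<in>U. x i * (\<Sum>j\<in>U. H t i j * x j))"
      if t: "t \<ge> 0" and z: "\<And>i. i \<in> U - {1} \<Longrightarrow> (\<Sum>j\<in>U. H t i j * x j) = 0" for t x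
    proof -
      \<comment> \<open>The stress is frozen at vertex 1; vertex 2 is one of the points of the space
        form to which the combination is orthogonal.\<close>
      have "form G (At t 2) (\<Sum>j\<in>U. x j *\<^sub>R At t j) = 0"
        using z[OF tU] \<kappa>0 unfolding Hsum by simp
      then have "0 \<le> form G (\<Sum>j\<in>U. x j *\<^sub>R At t j) (\<Sum>j\<in>U. x j *\<^sub>R At t j)"
        using space_form_orthogonal(1)[OF G Atsf[OF _ t]] tU by blast
      then show ?thesis unfolding Hquad mult.assoc[symmetric] \<kappa>2 by simp
    qed
    show "\<sigma> * ldet F (H 0) > 0" if "F \<subseteq> U" "card F = Suc (Suc l)" for F
      unfolding \<sigma>det[OF that(2)] by (rule detpos0[OF proper[OF that]])
    show "s * \<sigma> * \<kappa> * (\<Sum>E | E \<subseteq> U \<and> card E = l. (\<Prod>i\<in>E. \<alpha> i) * (ldet E (H 0) * gauss (H 0) E (\<lambda>_. 1))) > 0"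
    proof -
      have eq: "ldet E (\<lambda>i j. curvature G * gram G A i j) * gauss (\<lambda>i j. curvature G * gram G A i j) E (\<lambda>_. 1)
          = ldet E (H 0) * gauss (H 0) E (\<lambda>_. 1)" if "E \<subseteq> U" for E
      proof -
        have e: "curvature G * gram G A i j = H 0 i j" if "i \<in> E" "j \<in> E" for i j
        proof -
          have "i \<in> U" "j \<in> U" using that \<open>E \<subseteq> U\<close> by blast+
          then show ?thesis by (simp add: H_def \<kappa>_def gram_def AtA)
        qed
        have "ldet E (\<lambda>i j. curvature G * gram G A i j) = ldet E (H 0)" by (rule ldet_cong) (rule e)
        moreover have "quad (\<lambda>i j. curvature G * gram G A i j) E x = quad (H 0) E x" for x
          unfolding quad_def by (intro sum.cong[OF refl]) (simp only: e)
        ultimately show ?thesis by (simp add: gauss_def)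
      qed
      have "(\<Sum>E | E \<subseteq> U \<and> card E = l. (\<Prod>i\<in>E. \<alpha> i) *
          (ldet E (\<lambda>i j. curvature G * gram G A i j) * gauss (\<lambda>i j. curvature G * gram G A i j) E (\<lambda>_. 1)))
        = (\<Sum>E | E \<subseteq> U \<and> card E = l. (\<Prod>i\<in>E. \<alpha> i) * (ldet E (H 0) * gauss (H 0) E (\<lambda>_. 1)))"
        by (rule sum.cong[OF refl]) (simp only: eq mem_Collect_eq)
      moreover have "s * curvature G ^ (l + 1) * curvature G * (\<Sum>E | E \<subseteq> U \<and> card E = l. (\<Prod>i\<in>E. \<alpha> i) *
          (ldet E (\<lambda>i j. curvature G * gram G A i j) * gauss (\<lambda>i j. curvature G * gram G A i j) E (\<lambda>_. 1))) > 0"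
        unfolding U_def
      proof (rule stress_invariant_radial[OF G nd])
        show "A i \<in> space_form G" if "i \<in> {1..n + 2}" for i using Asf that unfolding U_def by blast
        show "l \<le> n" using k l by simp
        show "s * stress_invariant G n A \<alpha> P Q l > 0" using s l by simp
      qed
      ultimately show ?thesis by (simp only: \<sigma>_def \<kappa>_def l Suc_eq_plus1)
    qed
    show "\<delta>0 > 0" by fact
    show "(0 < s * (\<Prod>i\<in>F. \<alpha> i) \<longrightarrow> mono_on {0..<\<delta>0} (?vol F)) \<and> (s * (\<Prod>i\<in>F. \<alpha> i) < 0 \<longrightarrow> antimono_on {0..<\<delta>0} (?vol F))"
      if F: "F \<subseteq> U" "card F = Suc (Suc l)" for F
    proof (intro conjI impI)
      have m: "(0 < s * (\<Prod>i\<in>F. \<alpha> i) \<longrightarrow> mono_on {0..} (\<lambda>t. simplex_volume G (verts (At t) F))) \<and>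
         (s * (\<Prod>i\<in>F. \<alpha> i) < 0 \<longrightarrow> antimono_on {0..} (\<lambda>t. simplex_volume G (verts (At t) F)))"
        using F by (intro mono) (simp add: faces)
      { assume "0 < s * (\<Prod>i\<in>F. \<alpha> i)"
        then have "mono_on {0..} (\<lambda>t. simplex_volume G (verts (At t) F))" using m by blast
        then show "mono_on {0..<\<delta>0} (?vol F)" using C
          by (auto simp: monotone_on_def vol F intro!: mult_left_mono) }
      { assume "s * (\<Prod>i\<in>F. \<alpha> i) < 0"
        then have "antimono_on {0..} (\<lambda>t. simplex_volume G (verts (At t) F))" using m by blast
        then show "antimono_on {0..<\<delta>0} (?vol F)" using C
          by (auto simp: monotone_on_def vol F intro!: mult_left_mono) }
    qed
  qed
  then obtain \<delta>1 where \<delta>1: "\<delta>1 > 0"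
    and r: "\<And>t. 0 < t \<Longrightarrow> t < \<delta>1 \<Longrightarrow> (\<forall>F. F \<subseteq> U \<and> card F = Suc (Suc l) \<longrightarrow> ?vol F t = ?vol F 0) \<and>
     (\<exists>x. x 1 = \<alpha> 1 \<and> (\<forall>i\<in>U. (\<Sum>j\<in>U. H t i j * x j) = 0))" by blast
  show ?thesis
  proof (intro exI[of _ "min \<delta>0 \<delta>1"] conjI allI impI ballI)
    show "min \<delta>0 \<delta>1 > 0" using \<delta>0 \<delta>1 by simp
    fix t assume "0 < t \<and> t < min \<delta>0 \<delta>1"
    then have t: "0 < t" "t < \<delta>0" "t < \<delta>1" "0 \<le> t" by auto
    show "simplex_volume G (verts (At t) I) = simplex_volume G (verts (At 0) I)" if "I \<in> faces n k" for I
    proof -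
      have I: "I \<subseteq> U" "card I = Suc (Suc l)" using that by (auto simp: faces)
      have "?vol I t = ?vol I 0" using r[OF t(1,3), THEN conjunct1] I by blast
      then show ?thesis using C by (simp only: vol[OF t(4,2) I] vol[OF order_refl \<delta>0 I] mult_cancel_left) simp
    qed
    obtain x where x: "x 1 = \<alpha> 1" "\<forall>i\<in>U. (\<Sum>j\<in>U. H t i j * x j) = 0" using r[OF t(1,3), THEN conjunct2] by blast
    let ?y = "\<Sum>j\<in>U. x j *\<^sub>R At t j"
    \<comment> \<open>A kernel vector makes the combination orthogonal to every vertex and hence to
      itself. Being orthogonal to a point of the space form and of square zero, it is zero.\<close>
    have yi: "form G (At t i) ?y = 0" if "i \<in> U" for i using x(2) that \<kappa>0 unfolding Hsum by simp
    have "\<kappa> * form G ?y ?y = 0" unfolding Hquad[symmetric] using x(2) by simp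
    then have "form G ?y ?y = 0" using \<kappa>0 by simp
    then have y0: "?y = 0" using space_form_orthogonal(2)[OF G Atsf[OF oU t(4)] yi[OF oU]] by blast
    have sp: "At t 1 \<in> span (At t ` (U - {1}))"
      by (rule span_of_relation[OF finU oU y0]) (use x(1) \<alpha>U[OF oU] in simp)
    have W: "U - {1} \<subset> U" "U - {1} \<noteq> {}" using oU tU by blast+
    \<comment> \<open>The other n + 1 vertices are still independent, so their span has dimension
      exactly n + 1.\<close>
    have nzW: "ldet (U - {1}) (gram G (At t)) \<noteq> 0" using detpos[OF t(4,2) W] by auto
    have "totally_geodesic G n (space_form G \<inter> span (At t ` (U - {1})))"
    proof (rule totally_geodesic_span[OF G])
      show "finite (U - {1})" using finU by simp
      then show "inj_on (At t) (U - {1})" "independent (At t ` (U - {1}))"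
        using independent_of_gram[OF _ nzW] by blast+
      show "card (U - {1}) = n + 1" using cU oU by (simp add: card_Diff_singleton)
      show "At t i \<in> space_form G" if "i \<in> U - {1}" for i using Atsf[of i t] that t(4) by blast
    qed
    moreover have "\<forall>i\<in>{1..n + 2}. At t i \<in> space_form G \<inter> span (At t ` (U - {1}))"
    proof
      fix i assume "i \<in> {1..n + 2}"
      then have i: "i \<in> U" by (simp add: U_def)
      have "At t i \<in> span (At t ` (U - {1}))"
      proof (cases "i = 1")
        case True then show ?thesis using sp by (simp only:)
      next
        case False then show ?thesis using i by (intro span_base imageI) blast
      qed
      then show "At t i \<in> space_form G \<inter> span (At t ` (U - {1}))" using Atsf[OF i t(4)] by blast
    qed
    ultimately show "\<exists>S. totally_geodesic G n S \<and> (\<forall>i\<in>{1..n + 2}. At t i \<in> S)" by blast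
  qed
qed

section \<open>The Euclidean case\<close>

text \<open>Subtracting row and column \<open>f\<close> moves the base point from \<open>b\<close>
  to the vertex \<open>A f\<close> and leaves \<open>z\<close> and \<open>f\<close> as a hook. In
  particular neither the base point nor the choice of \<open>f\<close> matters.\<close>

lemma ldet_bordered_gram:
  fixes A :: "'i \<Rightarrow> 'v::euclidean_space"
  assumes fin: "finite F" and f: "f \<in> F" and z: "z \<notin> F"
  shows "ldet (insert z F) (bordered z (gram Euclidean (\<lambda>i. A i - b)) (\<lambda>_. 1) 0) =
    - ldet (F - {f}) (gram Euclidean (\<lambda>i. A i - A f))"
proof -
  define S where "S = F - {f}"
  have S: "finite S" "f \<notin> S" "z \<notin> S" "z \<noteq> f" and F: "insert z F = insert z (insert f S)"
    using fin f z by (auto simp: S_def)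
  define M where "M = bordered z (gram Euclidean (\<lambda>i. A i - b)) (\<lambda>_. 1) 0"
  define M1 where "M1 i j = M i j + (if i \<in> S then (-1) * M f j else 0)" for i j
  define N where "N i j = M1 j i + (if i \<in> S then (-1) * M1 j f else 0)" for i j
  have M_eq: "M z z = 0" "\<And>i. i \<noteq> z \<Longrightarrow> M z i = 1" "\<And>i. i \<noteq> z \<Longrightarrow> M i z = 1"
    "\<And>i j. i \<noteq> z \<Longrightarrow> j \<noteq> z \<Longrightarrow> M i j = (A i - b) \<bullet> (A j - b)"
    by (simp_all add: M_def bordered_def gram_def)
  have Sz: "i \<noteq> z" if "i \<in> S" for i using that S(3) by blast
  have "ldet (insert z F) M = ldet (insert z F) M1"
    unfolding M1_def by (rule ldet_rows_add[symmetric]) (use S F in auto)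
  also have "\<dots> = ldet (insert z F) (\<lambda>i j. M1 j i)" by (rule ldet_transpose[symmetric]) (use fin in simp)
  also have "\<dots> = ldet (insert z F) N"
    unfolding N_def by (rule ldet_rows_add[symmetric, where M = "\<lambda>i j. M1 j i"]) (use S F in auto)
  also have "\<dots> = - ldet S N" unfolding F
  proof (rule ldet_hook)
    show "finite S" "z \<notin> S" "f \<notin> S" "z \<noteq> f" by fact+
    show "N z j = 0" if "j \<in> insert z S" for j
      using that S Sz by (cases "j = z") (simp_all add: N_def M1_def M_eq)
    show "N z f = 1" "N f z = 1" using S by (simp_all add: N_def M1_def M_eq)
    show "N j z = 0" if "j \<in> S" for j using that S Sz[OF that] by (simp add: N_def M1_def M_eq)
  qed
  also have "ldet S N = ldet S (gram Euclidean (\<lambda>i. A i - A f))"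
  proof (rule ldet_cong)
    fix i j assume ij: "i \<in> S" "j \<in> S"
    then have "N i j = (A j - b) \<bullet> (A i - b) - (A f - b) \<bullet> (A i - b) - ((A j - b) \<bullet> (A f - b) - (A f - b) \<bullet> (A f - b))"
      using S Sz by (simp add: N_def M1_def M_eq)
    also have "\<dots> = gram Euclidean (\<lambda>i. A i - A f) i j"
      by (simp add: gram_def inner_diff_left inner_diff_right inner_commute)
    finally show "N i j = gram Euclidean (\<lambda>i. A i - A f) i j" .
  qed
  finally show ?thesis by (simp add: M_def S_def)
qed

lemma measure_std_simplex:
  "measure (PiM {..<k} (\<lambda>_. lborel :: real measure)) (std_simplex k) = 1 / fact k"
proof -
  let ?L = "PiM {..<k} (\<lambda>_. lborel :: real measure)"
  have "std_simplex k = {x. (\<forall>i\<in>{..<k}. 0 \<le> x i) \<and> sum x {..<k} \<le> 1} \<inter> space ?L"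
    by (auto simp: std_simplex_def space_PiM PiE_def)
  then have "emeasure ?L (std_simplex k) = ennreal (1 / fact k)"
    using emeasure_std_simplex_aux[of "{..<k}" 1] by simp
  then show ?thesis by (simp add: measure_def)
qed

text \<open>The partial derivatives are the edges at the first vertex, so the density is constant
  and gets multiplied by the volume 1 / k! of the parameter simplex. The bordered determinant
  permits any vertex \<open>f\<close> in place of the first.\<close>

lemma simplex_volume_Euclidean:
  fixes A :: "nat \<Rightarrow> 'v::euclidean_space"
  assumes card: "card I = Suc k" and f: "f \<in> I"
  shows "simplex_volume Euclidean (verts A I) = sqrt (ldet (I - {f}) (gram Euclidean (\<lambda>i. A i - A f))) / fact k"
proof -
  have fin: "finite I" by (rule card_ge_0_finite) (simp add: card)
  let ?L = "sorted_list_of_set I" and ?Bs = "verts A I"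
  have len: "length ?Bs = Suc k" using fin card by simp
  define g where "g = ?L ! 0"
  have gI: "g \<in> I" using nth_mem[of 0 ?L] fin card by (simp add: g_def)
  have "bij_betw ((!) ?L) {..<Suc k} I" using bij_betw_sorted[OF fin] card by simp
  then have b0: "bij_betw ((!) ?L) ({..<Suc k} - {0}) (I - {g})"
  proof (rule bij_betw_DiffI)
    show "bij_betw ((!) ?L) {0} {g}" by (simp add: bij_betw_def g_def)
    show "{0} \<subseteq> {..<Suc k}" by simp
    show "{g} \<subseteq> I" using gI by simp
  qed
  have "bij_betw Suc {..<k} ({..<Suc k} - {0})"
    by (rule bij_betwI[where g = "\<lambda>i. i - 1"]) auto
  from bij_betw_trans[OF this b0] have bij: "bij_betw (\<lambda>p. ?L ! Suc p) {..<k} (I - {g})" by (simp add: o_def)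
  have det: "gram_det Euclidean (map (simplex_partial Euclidean ?Bs s) [0..<k]) = ldet (I - {g}) (gram Euclidean (\<lambda>i. A i - A g))" for s
  proof -
    have "gram_det Euclidean (map (simplex_partial Euclidean ?Bs s) [0..<k]) =
       ldet {..<k} (\<lambda>p q. gram Euclidean (\<lambda>i. A i - A g) (?L ! Suc p) (?L ! Suc q))"
      unfolding gram_det_eq_ldet length_map length_upt diff_zero
    proof (rule ldet_cong)
      fix p q assume pq: "p \<in> {..<k}" "q \<in> {..<k}"
      have "simplex_partial Euclidean ?Bs s p = A (?L ! Suc p) - A g" if "p < k" for p
      proof -
        have "p < length ?Bs - 1" "Suc p < card I" "0 < card I" using that len card by simp_all
        then show ?thesis by (simp only: simplex_partial_Euclidean verts_nth[OF fin] g_def)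
      qed
      then show "form Euclidean (map (simplex_partial Euclidean ?Bs s) [0..<k] ! p) (map (simplex_partial Euclidean ?Bs s) [0..<k] ! q) =
        gram Euclidean (\<lambda>i. A i - A g) (?L ! Suc p) (?L ! Suc q)"
        using pq by (simp add: gram_def)
    qed
    also have "\<dots> = ldet (I - {g}) (gram Euclidean (\<lambda>i. A i - A g))" by (rule ldet_reindex[OF bij]) simp
    finally show ?thesis .
  qed
  obtain z where z: "z \<notin> I" using ex_new_if_finite[OF infinite_UNIV_nat fin] by blast
  have same: "ldet (I - {g}) (gram Euclidean (\<lambda>i. A i - A g)) = ldet (I - {f}) (gram Euclidean (\<lambda>i. A i - A f))"
    using ldet_bordered_gram[OF fin gI z, of A 0] ldet_bordered_gram[OF fin f z, of A 0] by simp
  have "simplex_volume Euclidean ?Bs =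
     (LINT s : std_simplex k | PiM {..<k} (\<lambda>_. lborel). sqrt (ldet (I - {f}) (gram Euclidean (\<lambda>i. A i - A f))))"
    unfolding simplex_volume_def Let_def len diff_Suc_1 det same ..
  also have "\<dots> = sqrt (ldet (I - {f}) (gram Euclidean (\<lambda>i. A i - A f))) * measure (PiM {..<k} (\<lambda>_. lborel :: real measure)) (std_simplex k)"
    unfolding set_lebesgue_integral_def using std_simplex_subset_space[of k] by (simp add: Int_absorb2)
  finally show ?thesis unfolding measure_std_simplex by simp
qed

lemma nondegenerate_gram_pos:
  fixes A :: "nat \<Rightarrow> 'v::euclidean_space"
  assumes nd: "nondegenerate Euclidean A I" and fin: "finite I" and f: "f \<in> I"
  shows "ldet (I - {f}) (gram Euclidean (\<lambda>i. A i - A f)) > 0"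
proof (rule gram_pos_def)
  have inj: "inj_on A I" and ind: "\<not> affine_dependent (A ` I)" using nd by simp_all
  show fin': "finite (I - {f})" using fin by simp
  have "A ` I - {A f} = A ` (I - {f})" using inj f by (auto simp: inj_on_def)
  then have ind': "independent ((\<lambda>i. A i - A f) ` (I - {f}))"
    using ind affine_dependent_iff_dependent2[of "A f" "A ` I"] f by (simp add: image_image)
  have inj': "inj_on (\<lambda>i. A i - A f) (I - {f})" using inj by (auto simp: inj_on_def)
  fix x :: "nat \<Rightarrow> real" assume "\<exists>i\<in>I - {f}. x i \<noteq> 0"
  then have "(\<Sum>j\<in>I - {f}. x j *\<^sub>R (A j - A f)) \<noteq> 0" using independent_family[OF fin' inj' ind'] by blast
  then show "0 < form Euclidean (\<Sum>j\<in>I - {f}. x j *\<^sub>R (A j - A f)) (\<Sum>j\<in>I - {f}. x j *\<^sub>R (A j - A f))" by simp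
qed

text \<open>With a point of the affine hull, its reflection in the closest point lies in the hull
  too, so the variational inequality for the closest point holds with both signs.\<close>

lemma altitude_orthogonal:
  fixes Bs :: "'v::euclidean_space list"
  assumes x: "x \<in> affine hull set Bs" and y: "y \<in> affine hull set Bs"
  shows "altitude Bs P \<bullet> (x - y) = 0"
proof -
  let ?S = "affine hull set Bs"
  let ?c = "closest_point ?S P"
  have c: "?c \<in> ?S" using x by (intro closest_point_in_set) auto
  have orth: "(P - ?c) \<bullet> (x - ?c) = 0" if "x \<in> ?S" for x
  proof (rule antisym)
    show "(P - ?c) \<bullet> (x - ?c) \<le> 0" using that by (intro closest_point_dot) (auto simp: affine_imp_convex)
    have "2 *\<^sub>R ?c + (- 1) *\<^sub>R x \<in> ?S" using c that affine_affine_hull[of "set Bs"] by (intro mem_affine) auto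
    then have "(P - ?c) \<bullet> ((2 *\<^sub>R ?c + (- 1) *\<^sub>R x) - ?c) \<le> 0" by (intro closest_point_dot) (auto simp: affine_imp_convex)
    then show "0 \<le> (P - ?c) \<bullet> (x - ?c)" by (simp add: inner_diff_right inner_add_right)
  qed
  show ?thesis using orth[OF x] orth[OF y] by (simp add: altitude_def inner_diff_right)
qed

text \<open>From row \<open>e\<close> subtract the affine combination of vertex rows that represents
  the foot of the altitude from \<open>P\<close>, and correct by a multiple of the row of ones. Only
  the entry at \<open>e\<close> remains, and it is the inner product of the two altitude
  vectors.\<close>

lemma ldet_altitude:
  fixes A :: "nat \<Rightarrow> 'v::euclidean_space"
  assumes fin: "finite I" and ne: "I \<noteq> {}" and inj: "inj_on A I" and ze: "z \<notin> I" "e \<notin> I" "z \<noteq> e"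
    and R: "\<And>i j. R i j = (if i = z then if j = z then 0 else 1 else if j = z then 1
        else if i = e then if j = e then (P - b) \<bullet> (Q - b) else (P - b) \<bullet> (A j - b)
        else if j = e then (Q - b) \<bullet> (A i - b) else gram Euclidean (\<lambda>i. A i - b) i j)"
  shows "ldet (insert z (insert e I)) R =
    (altitude (verts A I) P \<bullet> altitude (verts A I) Q) * ldet (insert z I) (bordered z (gram Euclidean (\<lambda>i. A i - b)) (\<lambda>_. 1) 0)"
proof -
  have set: "set (verts A I) = A ` I" using fin by (simp add: verts_def)
  let ?S = "affine hull set (verts A I)"
  let ?w = "altitude (verts A I) P" and ?v = "altitude (verts A I) Q"
  obtain f where f: "f \<in> I" using ne by blast
  have neS: "?S \<noteq> {}" using ne by (simp add: set)
  have AS: "A i \<in> ?S" if "i \<in> I" for i using that by (simp add: set hull_inc)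
  have cS: "closest_point ?S X \<in> ?S" for X using neS by (intro closest_point_in_set) auto
  obtain u where u: "sum u (A ` I) = 1" "(\<Sum>v\<in>A ` I. u v *\<^sub>R v) = closest_point ?S P"
    using cS[of P] affine_hull_finite[of "A ` I"] fin unfolding set by auto
  define l where "l i = u (A i)" for i
  have l: "(\<Sum>i\<in>I. l i) = 1" "(\<Sum>i\<in>I. l i *\<^sub>R A i) = P - ?w"
    using u inj by (simp_all add: l_def sum.reindex altitude_def)
  have lb: "(\<Sum>i\<in>I. l i * ((A i - b) \<bullet> x)) = (P - ?w - b) \<bullet> x" for x
  proof -
    have "(\<Sum>i\<in>I. l i * ((A i - b) \<bullet> x)) = (\<Sum>i\<in>I. l i *\<^sub>R A i) \<bullet> x - (\<Sum>i\<in>I. l i) * (b \<bullet> x)"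
      by (simp add: inner_sum_left inner_diff_left right_diff_distrib sum_subtractf sum_distrib_right)
    then show ?thesis unfolding l by (simp add: inner_diff_left)
  qed
  \<comment> \<open>The inner product of the altitude vector with X - b is constant for X in the
    hull; \<open>c\<close> cancels this constant.\<close>
  define c where "c = - (?w \<bullet> (A f - b))"
  let ?I = "insert z (insert e I)"
  let ?c = "\<lambda>a. if a = z then c else - l a"
  define R' where "R' = R(e := (\<lambda>j. R e j + (\<Sum>a\<in>?I - {e}. ?c a * R a j)))"
  have sum: "(\<Sum>a\<in>?I - {e}. ?c a * R a j) = c * R z j - (\<Sum>a\<in>I. l a * R a j)" for j
  proof -
    have "?I - {e} = insert z I" using ze by auto
    then have "(\<Sum>a\<in>?I - {e}. ?c a * R a j) = c * R z j + (\<Sum>a\<in>I. ?c a * R a j)" using fin ze by simp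
    also have "(\<Sum>a\<in>I. ?c a * R a j) = (\<Sum>a\<in>I. - (l a * R a j))" by (rule sum.cong[OF refl]) (use ze in auto)
    finally show ?thesis by (simp add: sum_negf)
  qed
  have Rz: "(\<Sum>a\<in>I. l a * R a z) = 1"
  proof -
    have "(\<Sum>a\<in>I. l a * R a z) = (\<Sum>a\<in>I. l a)" by (rule sum.cong[OF refl]) (use ze in \<open>auto simp: R\<close>)
    then show ?thesis using l(1) by simp
  qed
  have Re: "(\<Sum>a\<in>I. l a * R a e) = (P - ?w - b) \<bullet> (Q - b)"
  proof -
    have "(\<Sum>a\<in>I. l a * R a e) = (\<Sum>a\<in>I. l a * ((A a - b) \<bullet> (Q - b)))"
      by (rule sum.cong[OF refl]) (use ze in \<open>auto simp: R inner_commute\<close>)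
    then show ?thesis using lb by simp
  qed
  have Rj: "(\<Sum>a\<in>I. l a * R a j) = (P - ?w - b) \<bullet> (A j - b)" if "j \<in> I" for j
  proof -
    have "(\<Sum>a\<in>I. l a * R a j) = (\<Sum>a\<in>I. l a * ((A a - b) \<bullet> (A j - b)))"
      by (rule sum.cong[OF refl]) (use ze that in \<open>auto simp: R gram_def\<close>)
    then show ?thesis using lb by simp
  qed
  have fe: "f \<noteq> e" "f \<noteq> z" using f ze by auto
  have row: "R' e j = 0" if "j \<in> insert z I" for j
  proof (cases "j = z")
    case True
    then show ?thesis unfolding R'_def fun_upd_same sum using ze Rz by (simp add: R)
  next
    case False
    then have j: "j \<in> I" "j \<noteq> e" using that ze by auto
    have "?w \<bullet> (A j - A f) = 0" by (rule altitude_orthogonal[OF AS[OF j(1)] AS[OF f]])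
    then show ?thesis unfolding R'_def fun_upd_same sum Rj[OF j(1)] using ze False j
      by (simp add: R c_def inner_diff_left inner_diff_right)
  qed
  have wv: "R' e e = ?w \<bullet> ?v"
  proof -
    have "?w \<bullet> (closest_point ?S Q - A f) = 0" by (rule altitude_orthogonal[OF cS AS[OF f]])
    then have "?w \<bullet> ?v = ?w \<bullet> (Q - A f)" by (simp add: altitude_def[of _ Q] inner_diff_right)
    also have "\<dots> = R' e e" unfolding R'_def fun_upd_same sum Re using ze
      by (simp add: R c_def inner_diff_left inner_diff_right)
    finally show ?thesis by simp
  qed
  have "ldet ?I R = ldet ?I R'" unfolding R'_def by (rule ldet_row_add[symmetric]) (use fin in auto)
  also have "?I = insert e (insert z I)" by blast
  also have "ldet (insert e (insert z I)) R' = R' e e * ldet (insert z I) R'"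
    by (rule ldet_unit_row) (use fin ze row in auto)
  also have "ldet (insert z I) R' = ldet (insert z I) (bordered z (gram Euclidean (\<lambda>i. A i - b)) (\<lambda>_. 1) 0)"
    by (rule ldet_cong) (use ze in \<open>auto simp: R'_def R bordered_def\<close>)
  finally show ?thesis unfolding wv by (subst insert_commute)
qed

text \<open>The altitudes of each face are absorbed into a determinant with two borders, one of ones
  and one from \<open>P\<close> and \<open>Q\<close>. By \<open>stress_invariant_gram\<close> both
  borders disappear from the weighted sum, hence its independence of \<open>P\<close> and
  \<open>Q\<close>; the base point \<open>b\<close> is free.\<close>

lemma stress_invariant_Euclidean:
  fixes A :: "nat \<Rightarrow> 'v::euclidean_space"
  assumes nd: "\<forall>I\<in>faces n n. nondegenerate Euclidean A I" and st: "is_1_stress Euclidean n A \<alpha>" and k: "k \<le> n"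
  shows "stress_invariant Euclidean n A \<alpha> P Q k =
    (\<Sum>E | E \<subseteq> {1..n + 2} \<and> card E = k. (\<Prod>i\<in>E. \<alpha> i) * ldet E (gram Euclidean (\<lambda>i. A i - b)))"
proof (cases k)
  case 0
  have "{E. E \<subseteq> {1..n + 2} \<and> card E = 0} = {{}}" using finite_subset[of _ "{1..n + 2}"] by auto
  then show ?thesis unfolding 0 by (simp add: ldet_def stress_invariant_def)
next
  case (Suc l)
  define U where "U = {1..n + 2}"
  \<comment> \<open>Two indices outside the vertex set, for the two borders.\<close>
  define z e where "z = (0::nat)" and "e = n + 3"
  have finU: "finite U" and ze: "z \<notin> U" "e \<notin> U" "z \<noteq> e" by (auto simp: U_def z_def e_def)
  let ?G = "gram Euclidean (\<lambda>i. A i - b)"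
  define R where "R i j = (if i = z then if j = z then 0 else 1 else if j = z then 1
        else if i = e then if j = e then (P - b) \<bullet> (Q - b) else (P - b) \<bullet> (A j - b)
        else if j = e then (Q - b) \<bullet> (A i - b) else ?G i j)" for i j
  have rel: "(\<Sum>i\<in>U. \<alpha> i *\<^sub>R (A i - b)) = 0" and \<sigma>: "(\<Sum>i\<in>U. \<alpha> i) = 0"
  proof -
    show \<sigma>: "(\<Sum>i\<in>U. \<alpha> i) = 0" using st unfolding is_1_stress_def U_def by blast
    have "(\<Sum>i\<in>U. \<alpha> i *\<^sub>R A i) = 0" using st unfolding is_1_stress_def U_def by blast
    then show "(\<Sum>i\<in>U. \<alpha> i *\<^sub>R (A i - b)) = 0"
      by (simp add: scaleR_diff_right sum_subtractf scaleR_sum_left[symmetric] \<sigma>)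
  qed
  have relx: "(\<Sum>i\<in>U. \<alpha> i * (x \<bullet> (A i - b))) = 0" for x
  proof -
    have "(\<Sum>i\<in>U. \<alpha> i * (x \<bullet> (A i - b))) = x \<bullet> (\<Sum>i\<in>U. \<alpha> i *\<^sub>R (A i - b))"
      by (simp only: inner_sum_right inner_scaleR_right)
    then show ?thesis by (simp add: rel)
  qed
  have summand: "(\<Prod>i\<in>I. \<alpha> i) * (fact l * simplex_volume Euclidean (verts A I))\<^sup>2 * (altitude (verts A I) P \<bullet> altitude (verts A I) Q)
      = - ((\<Prod>i\<in>I. \<alpha> i) * ldet (insert z (insert e I)) R)" if I: "I \<subseteq> U" "card I = Suc l" for I
  proof -
    have fin: "finite I" using I(1) finU finite_subset by blast
    obtain f where f: "f \<in> I" using I(2) by fastforce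
    have "card I < card U" using I(2) k Suc by (simp add: U_def)
    then have "I \<subset> {1..n + 2}" using I(1) unfolding U_def by auto
    then have ndI: "nondegenerate Euclidean A I" by (rule nondegenerate_subset[OF nd])
    let ?D = "ldet (I - {f}) (gram Euclidean (\<lambda>i. A i - A f))"
    have D: "0 < ?D" by (rule nondegenerate_gram_pos[OF ndI fin f])
    have vol: "(fact l * simplex_volume Euclidean (verts A I))\<^sup>2 = ?D"
      unfolding simplex_volume_Euclidean[OF I(2) f] using D by simp
    have zI: "z \<notin> I" "e \<notin> I" using ze I(1) by blast+
    have "ldet (insert z (insert e I)) R = (altitude (verts A I) P \<bullet> altitude (verts A I) Q) * - ?D"
      unfolding ldet_bordered_gram[OF fin f zI(1), of A b, symmetric]
    proof (rule ldet_altitude[OF fin _ _ zI ze(3) R_def])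
      show "I \<noteq> {}" using f by blast
      show "inj_on A I" using ndI by simp
    qed
    then show ?thesis unfolding vol by simp
  qed
  have "stress_invariant Euclidean n A \<alpha> P Q k = (\<Sum>I | I \<subseteq> U \<and> card I = Suc l.
     (\<Prod>i\<in>I. \<alpha> i) * (fact l * simplex_volume Euclidean (verts A I))\<^sup>2 * (altitude (verts A I) P \<bullet> altitude (verts A I) Q))"
    unfolding stress_invariant_def faces_def U_def Suc by simp
  also have "\<dots> = (\<Sum>I | I \<subseteq> U \<and> card I = Suc l. - ((\<Prod>i\<in>I. \<alpha> i) * ldet (insert z (insert e I)) R))"
    by (rule sum.cong[OF refl]) (simp only: mem_Collect_eq summand)
  also have "\<dots> = - (\<Sum>I | I \<subseteq> U \<and> card I = Suc l. (\<Prod>i\<in>I. \<alpha> i) * ldet (insert z (insert e I)) R)"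
    by (rule sum_negf)
  also have "(\<Sum>I | I \<subseteq> U \<and> card I = Suc l. (\<Prod>i\<in>I. \<alpha> i) * ldet (insert z (insert e I)) R) =
     - (\<Sum>I | I \<subseteq> U \<and> card I = Suc l. (\<Prod>i\<in>I. \<alpha> i) * ldet I ?G)"
  proof (rule stress_invariant_gram[OF finU ze _ \<sigma> _ _ _ R_def])
    show "?G i j = ?G j i" for i j by (rule gram_sym)
    show "(\<Sum>i\<in>U. ?G a i * \<alpha> i) = 0" for a unfolding gram_sum rel by simp
    show "(\<Sum>i\<in>U. \<alpha> i * ((P - b) \<bullet> (A i - b))) = 0" "(\<Sum>i\<in>U. \<alpha> i * ((Q - b) \<bullet> (A i - b))) = 0" by (rule relx)+
  qed
  finally show ?thesis by (simp add: U_def Suc)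
qed

lemma Euclidean_motion_rigid:
  fixes A :: "nat \<Rightarrow> 'v::euclidean_space"
  assumes n: "n \<ge> 1" and nd: "\<forall>I\<in>faces n n. nondegenerate Euclidean A I"
    and st: "is_1_stress Euclidean n A \<alpha>" and k: "1 \<le> k" "k \<le> n" and mot: "smooth_motion Euclidean n A At"
    and s: "s * stress_invariant Euclidean n A \<alpha> P Q (k - 1) > 0"
    and mono: "\<And>I. I \<in> faces n k \<Longrightarrow>
       (0 < s * (\<Prod>i\<in>I. \<alpha> i) \<longrightarrow> mono_on {0..} (\<lambda>t. simplex_volume Euclidean (verts (At t) I))) \<and>
       (s * (\<Prod>i\<in>I. \<alpha> i) < 0 \<longrightarrow> antimono_on {0..} (\<lambda>t. simplex_volume Euclidean (verts (At t) I)))"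
  shows "\<exists>\<delta>>0. \<forall>t. 0 < t \<and> t < \<delta> \<longrightarrow>
           (\<forall>I\<in>faces n k. simplex_volume Euclidean (verts (At t) I) = simplex_volume Euclidean (verts (At 0) I)) \<and>
           (\<exists>S. totally_geodesic Euclidean n S \<and> (\<forall>i\<in>{1..n + 2}. At t i \<in> S))"
proof -
  define U where "U = {1..n + 2}"
  \<comment> \<open>The last vertex is the base point of the difference vectors, and vertex 1 is
    where the stress is frozen. They differ because n is positive.\<close>
  define m where "m = n + 2"
  define W where "W = U - {m}"
  obtain l where l: "k = Suc l" using k(1) by (cases k) auto
  have finU: "finite U" and cU: "card U = n + 2" and zU: "0 \<notin> U" and mU: "m \<in> U" and oU: "1 \<in> U" and om: "1 \<noteq> m"
    using n by (auto simp: U_def m_def)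
  have finW: "finite W" and oW: "1 \<in> W" using finU oU om by (auto simp: W_def)
  have WU: "i \<in> U" if "i \<in> W" for i using that by (simp add: W_def)
  obtain V where V: "\<And>i t. i \<in> U \<Longrightarrow> t \<ge> 0 \<Longrightarrow> ((\<lambda>t. At t i) has_vector_derivative V t i) (at t within {0..})"
    and V0: "\<And>i. i \<in> U \<Longrightarrow> ((\<lambda>t. V t i) \<longlongrightarrow> V 0 i) (at_right 0)"
    and At0: "\<And>i. i \<in> U \<Longrightarrow> ((\<lambda>t. At t i) \<longlongrightarrow> At 0 i) (at_right 0)"
    unfolding U_def using smooth_motion_C1[OF mot] by blast
  have AtA: "At 0 i = A i" if "i \<in> U" for i using mot that unfolding smooth_motion_def U_def by blast
  define a where "a t i = At t i - At t m" for t i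
  define v where "v t i = V t i - V t m" for t i
  have da: "((\<lambda>t. a t i) has_vector_derivative v t i) (at t within {0..})" if "i \<in> U" "t \<ge> 0" for i t
    unfolding a_def v_def by (intro has_vector_derivative_diff V that mU)
  have v0: "((\<lambda>t. v t i) \<longlongrightarrow> v 0 i) (at_right 0)" if "i \<in> U" for i unfolding v_def by (intro tendsto_diff V0 that mU)
  have a0: "((\<lambda>t. a t i) \<longlongrightarrow> a 0 i) (at_right 0)" if "i \<in> U" for i unfolding a_def by (intro tendsto_diff At0 that mU)
  have aA: "a 0 i = A i - A m" if "i \<in> U" for i using that mU by (simp add: a_def AtA)
  define H where "H t = gram Euclidean (a t)" for t
  define H' where "H' t i j = form Euclidean (a t i) (v t j) + form Euclidean (v t i) (a t j)" for t i j
  have gramlim: "((\<lambda>t. H t i j) \<longlongrightarrow> H 0 i j) (at_right 0)" if "i \<in> U" "j \<in> U" for i j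
    unfolding gram_def H_def by (rule bounded_bilinear.tendsto[OF bounded_bilinear_form a0[OF that(1)] a0[OF that(2)]])
  have faces: "F \<in> faces n k \<longleftrightarrow> F \<subseteq> U \<and> card F = l + 2" for F by (simp add: faces_def U_def l)
  let ?D = "\<lambda>F t. - ldet (insert 0 F) (bordered 0 (H t) (\<lambda>_. 1) 0)"
  have vol: "simplex_volume Euclidean (verts (At t) F) = sqrt (?D F t) / fact k" if F: "F \<subseteq> U" "card F = l + 2" for t F
  proof -
    obtain f where f: "f \<in> F" using F(2) by fastforce
    have "finite F" "0 \<notin> F" using F(1) finU zU finite_subset by blast+
    from ldet_bordered_gram[OF this(1) f this(2), of "At t" "At t m"]
    have "?D F t = ldet (F - {f}) (gram Euclidean (\<lambda>i. At t i - At t f))" by (simp add: H_def a_def[abs_def])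
    then show ?thesis using simplex_volume_Euclidean[OF _ f, of k "At t"] F(2) l by simp
  qed
  have \<alpha>U: "\<alpha> i \<noteq> 0" if "i \<in> U" for i using st that unfolding is_1_stress_def U_def by blast
  have \<sigma>: "(\<Sum>i\<in>U. \<alpha> i) = 0" using st unfolding is_1_stress_def U_def by blast
  have Hsum: "(\<Sum>j\<in>W. H t i j * x j) = a t i \<bullet> (\<Sum>j\<in>W. x j *\<^sub>R a t j)" for t i x
    unfolding H_def gram_sum by simp
  have Hquad: "(\<Sum>i\<in>W. x i * (\<Sum>j\<in>W. H t i j * x j)) = (\<Sum>j\<in>W. x j *\<^sub>R a t j) \<bullet> (\<Sum>j\<in>W. x j *\<^sub>R a t j)" for t x
    unfolding Hsum by (simp only: inner_sum_left inner_scaleR_left)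
  have rel: "(\<Sum>j\<in>W. \<alpha> j *\<^sub>R a 0 j) = 0"
  proof -
    have "(\<Sum>j\<in>U. \<alpha> j *\<^sub>R A j) = 0" using st unfolding is_1_stress_def U_def by blast
    then have "(\<Sum>j\<in>U. \<alpha> j *\<^sub>R (A j - A m)) = 0"
      by (simp add: scaleR_diff_right sum_subtractf scaleR_sum_left[symmetric] \<sigma>)
    then have "(\<Sum>j\<in>W. \<alpha> j *\<^sub>R (A j - A m)) = 0"
      unfolding W_def using sum.remove[OF finU mU, of "\<lambda>j. \<alpha> j *\<^sub>R (A j - A m)"] by simp
    then show ?thesis by (simp add: aA WU)
  qed
  have nz: "ldet (U - {m} - {1}) (H 0) \<noteq> 0"
  proof -
    have "U - {1} \<subset> {1..n + 2}" using oU unfolding U_def by blast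
    then have "nondegenerate Euclidean A (U - {1})" by (rule nondegenerate_subset[OF nd])
    then have "ldet (U - {1} - {m}) (gram Euclidean (\<lambda>i. A i - A m)) > 0"
      by (rule nondegenerate_gram_pos) (use finU mU om in auto)
    moreover have "ldet (U - {m} - {1}) (H 0) = ldet (U - {m} - {1}) (gram Euclidean (\<lambda>i. A i - A m))"
      by (rule ldet_cong) (simp add: H_def gram_def aA)
    moreover have "U - {m} - {1} = U - {1} - {m}" by blast
    ultimately show ?thesis by simp
  qed
  have "((\<lambda>t. ldet (W - {1}) (H t)) \<longlongrightarrow> ldet (W - {1}) (H 0)) (at_right 0)"
    by (rule tendsto_ldet) (use finW WU gramlim in auto)
  then have "\<forall>\<^sub>F t in at_right 0. ldet (W - {1}) (H t) \<noteq> 0"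
    using nz unfolding W_def by (rule tendsto_imp_eventually_ne)
  then obtain \<delta>0 where \<delta>0: "\<delta>0 > 0" and nzt: "\<And>t. 0 < t \<Longrightarrow> t < \<delta>0 \<Longrightarrow> ldet (W - {1}) (H t) \<noteq> 0"
    unfolding eventually_at_right_field by blast
  have "\<exists>\<delta>>0. \<forall>t. 0 < t \<and> t < \<delta> \<longrightarrow>
     (\<forall>F. F \<subseteq> U \<and> card F = l + 2 \<longrightarrow> ?D F t = ?D F 0) \<and>
     (\<exists>x. x 1 = \<alpha> 1 \<and> (\<forall>i\<in>U - {m}. (\<Sum>j\<in>U - {m}. H t i j * x j) = 0))"
  proof (rule flat_motion_rigid[where G = H and G' = H' and s = s and k = l and U = U and \<alpha> = \<alpha>])
    show "finite U" "0 \<notin> U" "m \<in> U" "1 \<in> U" "1 \<noteq> m" by fact+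
    show "H t i j = H t j i" for t i j by (simp add: H_def gram_sym)
    show "H t m j = 0" "H' t m j = 0" for t j by (simp_all add: H_def H'_def gram_def a_def v_def)
    show "H' t i j = H' t j i" for t i j by (simp add: H'_def inner_commute)
    show "((\<lambda>t. H t i j) has_real_derivative H' t i j) (at t within {0..})" if "i \<in> U" "j \<in> U" "t \<ge> 0" for i j t
      unfolding H_def H'_def gram_def by (intro form_has_real_derivative da that)
    show "((\<lambda>t. H' t i j) \<longlongrightarrow> H' 0 i j) (at_right 0)" if "i \<in> U" "j \<in> U" for i j
      unfolding H'_def
      by (intro tendsto_add bounded_bilinear.tendsto[OF bounded_bilinear_form] a0 v0 that)
    show "ldet (U - {m} - {1}) (H 0) \<noteq> 0" by fact
    show "(\<Sum>j\<in>U - {m}. H 0 i j * \<alpha> j) = 0" for i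
      unfolding Hsum[unfolded W_def] rel[unfolded W_def] by simp
    show "\<alpha> i \<noteq> 0" if "i \<in> U" for i using \<alpha>U[OF that] .
    show "(\<Sum>i\<in>U. \<alpha> i) = 0" by fact
    show "0 \<le> (\<Sum>i\<in>U - {m}. x i * (\<Sum>j\<in>U - {m}. H t i j * x j))" for t x
      unfolding Hquad[unfolded W_def] by simp
    have "(\<Sum>E | E \<subseteq> U \<and> card E = l. (\<Prod>i\<in>E. \<alpha> i) * ldet E (H 0)) =
      (\<Sum>E | E \<subseteq> U \<and> card E = l. (\<Prod>i\<in>E. \<alpha> i) * ldet E (gram Euclidean (\<lambda>i. A i - A m)))"
    proof (rule sum.cong[OF refl])
      fix E assume "E \<in> {E. E \<subseteq> U \<and> card E = l}"
      then have EU: "i \<in> U" if "i \<in> E" for i using that by blast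
      have "ldet E (H 0) = ldet E (gram Euclidean (\<lambda>i. A i - A m))"
        by (rule ldet_cong) (simp add: H_def gram_def aA EU)
      then show "(\<Prod>i\<in>E. \<alpha> i) * ldet E (H 0) = (\<Prod>i\<in>E. \<alpha> i) * ldet E (gram Euclidean (\<lambda>i. A i - A m))" by simp
    qed
    also have "\<dots> = stress_invariant Euclidean n A \<alpha> P Q l"
      unfolding U_def by (rule stress_invariant_Euclidean[OF nd st, symmetric]) (use k l in simp)
    finally show "s * (\<Sum>E | E \<subseteq> U \<and> card E = l. (\<Prod>i\<in>E. \<alpha> i) * ldet E (H 0)) > 0" using s l by simp
    \<comment> \<open>The volume formula holds at all times, so the constraints are available on any
      interval and its length 1 is arbitrary.\<close>
    show "(1::real) > 0" by simp
    show "(0 < s * (\<Prod>i\<in>F. \<alpha> i) \<longrightarrow> mono_on {0..<1} (?D F)) \<and> (s * (\<Prod>i\<in>F. \<alpha> i) < 0 \<longrightarrow> antimono_on {0..<1} (?D F))"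
      if F: "F \<subseteq> U" "card F = l + 2" for F
    proof -
      have m: "(0 < s * (\<Prod>i\<in>F. \<alpha> i) \<longrightarrow> mono_on {0..} (\<lambda>t. simplex_volume Euclidean (verts (At t) F))) \<and>
         (s * (\<Prod>i\<in>F. \<alpha> i) < 0 \<longrightarrow> antimono_on {0..} (\<lambda>t. simplex_volume Euclidean (verts (At t) F)))"
        using F by (intro mono) (simp add: faces)
      \<comment> \<open>The real square root is extended increasingly to negative arguments, so
        volumes and determinants are ordered alike.\<close>
      have le: "simplex_volume Euclidean (verts (At t) F) \<le> simplex_volume Euclidean (verts (At u) F) \<longleftrightarrow> ?D F t \<le> ?D F u" for t u
        unfolding vol[OF F] by (simp add: divide_le_cancel)
      show ?thesis using m unfolding monotone_on_def le by (meson atLeast_iff atLeastLessThan_iff)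
    qed
  qed
  then obtain \<delta>1 where \<delta>1: "\<delta>1 > 0"
    and r: "\<And>t. 0 < t \<Longrightarrow> t < \<delta>1 \<Longrightarrow> (\<forall>F. F \<subseteq> U \<and> card F = l + 2 \<longrightarrow> ?D F t = ?D F 0) \<and>
     (\<exists>x. x 1 = \<alpha> 1 \<and> (\<forall>i\<in>W. (\<Sum>j\<in>W. H t i j * x j) = 0))" unfolding W_def by blast
  show ?thesis
  proof (intro exI[of _ "min \<delta>0 \<delta>1"] conjI allI impI ballI)
    show "min \<delta>0 \<delta>1 > 0" using \<delta>0 \<delta>1 by simp
    fix t assume "0 < t \<and> t < min \<delta>0 \<delta>1"
    then have t: "0 < t" "t < \<delta>0" "t < \<delta>1" by auto
    show "simplex_volume Euclidean (verts (At t) I) = simplex_volume Euclidean (verts (At 0) I)" if "I \<in> faces n k" for I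
    proof -
      have I: "I \<subseteq> U" "card I = l + 2" using that by (auto simp: faces)
      have "?D I t = ?D I 0" using r[OF t(1,3), THEN conjunct1] I by blast
      then show ?thesis unfolding vol[OF I] by (simp only:)
    qed
    obtain x where x: "x 1 = \<alpha> 1" "\<forall>i\<in>W. (\<Sum>j\<in>W. H t i j * x j) = 0" using r[OF t(1,3), THEN conjunct2] by blast
    let ?y = "\<Sum>j\<in>W. x j *\<^sub>R a t j"
    let ?L = "span (a t ` (W - {1}))"
    have "?y \<bullet> ?y = 0" unfolding Hquad[symmetric] using x(2) by simp
    then have y0: "?y = 0" by simp
    have sp: "a t 1 \<in> ?L"
      by (rule span_of_relation[OF finW oW y0]) (use x(1) \<alpha>U[OF oU] in simp)
    have finW': "finite (W - {1})" using finW by simp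
    note ind = independent_of_gram[OF finW' nzt[OF t(1,2), unfolded H_def]]
    have "card (W - {1}) = n" using cU oU mU om by (simp add: W_def card_Diff_singleton)
    then have dL: "dim ?L = n" using dim_span_eq_card_independent[OF ind(2)] card_image[OF ind(1)] by simp
    have "affine ((+) (At t m) ` ?L)"
      using affine_translation[of ?L] subspace_imp_affine[OF subspace_span] by blast
    moreover have "aff_dim ((+) (At t m) ` ?L) = int n"
      unfolding aff_dim_translation_eq aff_dim_subspace[OF subspace_span] dL ..
    moreover have "\<forall>i\<in>{1..n + 2}. At t i \<in> (+) (At t m) ` ?L"
    proof
      fix i assume "i \<in> {1..n + 2}"
      then have i: "i \<in> U" by (simp add: U_def)
      have "a t i \<in> ?L"
      proof (cases "i = 1 \<or> i = m")
        case True then show ?thesis using sp by (auto simp: a_def span_zero)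
      next
        case False
        then have "i \<in> W - {1}" using i by (simp add: W_def)
        then show ?thesis by (intro span_base imageI)
      qed
      then show "At t i \<in> (+) (At t m) ` ?L" by (intro image_eqI[where x = "a t i"]) (simp_all add: a_def)
    qed
    ultimately show "\<exists>S. totally_geodesic Euclidean n S \<and> (\<forall>i\<in>{1..n + 2}. At t i \<in> S)"
      unfolding totally_geodesic.simps by blast
  qed
qed

theorem theorem1p4:
  fixes G :: geometry
    and n d k :: nat
    and A :: "nat \<Rightarrow> 'v::euclidean_space"
    and \<alpha> :: "nat \<Rightarrow> real"
    and At :: "real \<Rightarrow> nat \<Rightarrow> 'v"
    and P Q :: 'v
  assumes "n \<ge> 1" and "d \<ge> n + 1"
    and "DIM('v) = ambient_dim G d"
    and "\<exists>S. totally_geodesic G n S \<and> (\<forall>i\<in>{1..n + 2}. A i \<in> S)"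
    and "\<forall>I\<in>faces n n. nondegenerate G A I"
    and "is_1_stress G n A \<alpha>"
    and "1 \<le> k" and "k \<le> n"
    and "smooth_motion G n A At"
    and "P \<in> space_form G" and "Q \<in> space_form G"
    and "(stress_invariant G n A \<alpha> P Q (k - 1) > 0 \<and> volume_constraints G n k \<alpha> At) \<or>
         (stress_invariant G n A \<alpha> P Q (k - 1) < 0 \<and> volume_constraints' G n k \<alpha> At)"
  shows "\<exists>\<epsilon>>0. \<forall>t\<in>{0..<\<epsilon>}.
           (\<forall>I\<in>faces n k. simplex_volume G (verts (At t) I) = simplex_volume G (verts A I)) \<and>
           (\<exists>S. totally_geodesic G n S \<and> (\<forall>i\<in>{1..n + 2}. At t i \<in> S))"
proof -
  \<comment> \<open>s = 1 encodes the original constraints and s = -1 the interchanged ones, so that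
    both alternatives take the same form.\<close>
  obtain s :: real where s: "s * stress_invariant G n A \<alpha> P Q (k - 1) > 0"
    and mono: "\<And>I. I \<in> faces n k \<Longrightarrow>
       (0 < s * (\<Prod>i\<in>I. \<alpha> i) \<longrightarrow> mono_on {0..} (\<lambda>t. simplex_volume G (verts (At t) I))) \<and>
       (s * (\<Prod>i\<in>I. \<alpha> i) < 0 \<longrightarrow> antimono_on {0..} (\<lambda>t. simplex_volume G (verts (At t) I)))"
    using assms(12)
  proof (elim disjE conjE)
    assume "stress_invariant G n A \<alpha> P Q (k - 1) > 0" "volume_constraints G n k \<alpha> At"
    then show thesis by (intro that[of 1]) (simp_all add: volume_constraints_def)
  next
    assume "stress_invariant G n A \<alpha> P Q (k - 1) < 0" "volume_constraints' G n k \<alpha> At"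
    then show thesis by (intro that[of "-1"]) (simp_all add: volume_constraints'_def)
  qed
  have "\<exists>\<delta>>0. \<forall>t. 0 < t \<and> t < \<delta> \<longrightarrow>
           (\<forall>I\<in>faces n k. simplex_volume G (verts (At t) I) = simplex_volume G (verts (At 0) I)) \<and>
           (\<exists>S. totally_geodesic G n S \<and> (\<forall>i\<in>{1..n + 2}. At t i \<in> S))"
  proof (cases "G = Euclidean")
    case True
    show ?thesis unfolding True
      by (rule Euclidean_motion_rigid[OF assms(1) assms(5,6)[unfolded True] assms(7,8) assms(9)[unfolded True] s[unfolded True] mono[unfolded True]])
  next
    case False
    then show ?thesis by (rule nonEuclidean_motion_rigid[OF _ assms(5-9) s mono])
  qed
  then obtain \<delta> where \<delta>: "\<delta> > 0" "\<And>t. 0 < t \<Longrightarrow> t < \<delta> \<Longrightarrow>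
           (\<forall>I\<in>faces n k. simplex_volume G (verts (At t) I) = simplex_volume G (verts (At 0) I)) \<and>
           (\<exists>S. totally_geodesic G n S \<and> (\<forall>i\<in>{1..n + 2}. At t i \<in> S))" by blast
  have At0: "At 0 i = A i" if "i \<in> {1..n + 2}" for i using assms(9) that unfolding smooth_motion_def by blast
  have verts: "verts (At 0) I = verts A I" if "I \<in> faces n k" for I
  proof -
    have I: "I \<subseteq> {1..n + 2}" using that by (simp add: faces_def)
    then have "set (sorted_list_of_set I) \<subseteq> {1..n + 2}" using finite_subset[OF I] by simp
    then show ?thesis unfolding verts_def by (intro map_cong refl At0) blast
  qed
  show ?thesis
  proof (intro exI[of _ \<delta>] conjI ballI)
    show "\<delta> > 0" by fact
    fix t assume t: "t \<in> {0..<\<delta>}"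
    show "simplex_volume G (verts (At t) I) = simplex_volume G (verts A I)" if "I \<in> faces n k" for I
      using \<delta>(2)[of t] t that by (cases "t = 0") (simp_all add: verts)
    show "\<exists>S. totally_geodesic G n S \<and> (\<forall>i\<in>{1..n + 2}. At t i \<in> S)"
    proof (cases "t = 0")
      case True then show ?thesis using assms(4) At0 by simp
    next
      case False then show ?thesis using \<delta>(2)[of t] t by simp
    qed
  qed
qed

end
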